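(* If $f$ and $g$ are analytic in $\mathcal{R}_1$, then $f*g$ extends analytically in $\mathcal{R}_1$ and furthermore $$(f*g)^{ba}=f^{ba}*g^{ba}.$$
   Context: Let $\lambda_1=1,\lambda_2,\dots,\lambda_n$ be nonzero complex numbers with $\arg\lambda_j>\arg\lambda_i$ for $j>i$ (in the paper, the eigenvalues of the linear part of a differential system), and put $\phi_+=\arg\lambda_2$, $\phi_-=2\pi-\arg\lambda_n$. Let $\mathcal{W}_1:=\{p\in\mathbb{C}:\ p\notin\mathbb{N}\cup\{0\},\ \arg p\in(-\phi_-,\phi_+)\}$ (if $n=1$ the condition on the argument is dropped). $\mathcal{R}_1$ is the surface over $\mathcal{W}_1$ consisting of the curves $\gamma:(0,1)\to\mathcal{W}_1$ with $\gamma(0_+)=0$, $\Re\gamma(t)$ increasing in $t$, and crossing the real axis at most once (that is, $0=\Im\gamma(t_1)=\Im\gamma(t_2)\Rightarrow t_1=t_2$), modulo homotopies. Convolution: $(f*g)(p)=\int_0^pf(s)g(p-s)\,ds$ (for small $p$, then analytically continued; for functions on $\mathbb{R}^+$ it is the integral along $[0,p]$). For $f$ analytic in $\mathcal{R}_1$, $f^{+}$ and $f^{-}$ denote the analytic continuations of $f$ along paths confined to the upper, respectively lower, half-plane, and also their boundary values on $\mathbb{R}^+\setminus\mathbb{N}$. $f^{-^m+}$ is the analytic continuation along a path that goes below $\mathbb{R}^+$, crosses it from below through the interval $(m,m+1)$, and then goes only through the upper half-plane. Thus $f^{-^0+}=f^+$, and at non-integer points $p<m+1$ of $\mathbb{R}^+$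 one has $f^{-^m+}=f^-$. With $\mathcal{H}$ the Heaviside function and $\tau_k(p)=p-k$, the balanced average of $f$ is, on $\mathbb{R}^+\setminus\mathbb{N}$, $$f^{ba}:=f^++\sum_{k=1}^\infty2^{-k}\big(f^{-^k+}-f^{-^{k-1}+}\big)\,(\mathcal{H}\circ\tau_k),$$ where for each $p$ only finitely many terms are nonzero.
   Formalization: f, g are assumed integrable at 0 with local uniform domination (else f*g is undefined); the balanced identity assumes dominated integrability at integers; if phi_+ or phi_- < pi/2, f*g extends only to the part of R_1 where, after crossing, gamma-k stays in W_1 (on all of R_1 the claim is false). *)

theory Defs
  imports "HOL-Complex_Analysis.Complex_Analysis"
begin

definition phi_plus :: "(nat \<Rightarrow> complex) \<Rightarrow> real" where
  "phi_plus lam = Arg2pi (lam 2)"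

definition phi_minus :: "nat \<Rightarrow> (nat \<Rightarrow> complex) \<Rightarrow> real" where
  "phi_minus n lam = 2 * pi - Arg2pi (lam n)"

text \<open>The condition on the argument is a condition modulo \<open>2\<pi>\<close>. Note that \<open>0 \<in> \<nat>\<close>.\<close>

definition W1 :: "nat \<Rightarrow> (nat \<Rightarrow> complex) \<Rightarrow> complex set" where
  "W1 n lam = {p. p \<notin> \<nat> \<and>
     (n \<noteq> 1 \<longrightarrow> (\<exists>\<theta>. - phi_minus n lam < \<theta> \<and> \<theta> < phi_plus lam
                       \<and> p = complex_of_real (norm p) * cis \<theta>))}"

text \<open>
  A point of the surface is a class of curves together with their common endpoint \<open>\<gamma> 1\<close>. The
  restriction on zeros of \<open>Im \<gamma>\<close> concerns the open interval only: a curve that has crossed the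
  real axis may still end on it. Hence the surface contains, over \<open>\<real>\<^sup>+ - \<nat>\<close>, the points
  carrying the boundary values of the branches below; and over \<open>{0<..<1}\<close> the
  endpoints reached from above and from below are the same point.
\<close>

definition R1_curve :: "complex set \<Rightarrow> (real \<Rightarrow> complex) \<Rightarrow> bool" where
  "R1_curve W \<gamma> \<longleftrightarrow> path \<gamma> \<and> \<gamma> 0 = 0 \<and> (\<forall>t\<in>{0<..1}. \<gamma> t \<in> W)
     \<and> strict_mono_on {0..1} (\<lambda>t. Re (\<gamma> t))
     \<and> (\<forall>t1\<in>{0<..<1}. \<forall>t2\<in>{0<..<1}. Im (\<gamma> t1) = 0 \<and> Im (\<gamma> t2) = 0 \<longrightarrow> t1 = t2)"

definition R1_class :: "complex set \<Rightarrow> (real \<Rightarrow> complex) \<Rightarrow> (real \<Rightarrow> complex) set" where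
  "R1_class W \<gamma> =
     {\<gamma>'. homotopic_with_canon (\<lambda>\<sigma>. R1_curve W \<sigma> \<and> \<sigma> 1 = \<gamma> 1) {0..1} UNIV \<gamma> \<gamma>'}"

definition R1 :: "complex set \<Rightarrow> (real \<Rightarrow> complex) set set" where
  "R1 W = {R1_class W \<gamma> | \<gamma>. R1_curve W \<gamma>}"

text \<open>
  Functions on the surface are functions of the class; only their values on \<open>R1 W\<close> matter.
  Neighbourhoods of a point are given by the curves uniformly close to one representing it, and
  the endpoint serves as local coordinate. At a point over the real axis reached after a crossing,
  analyticity means that the function is locally the restriction of a holomorphic function of
  the endpoint.
\<close>

type_synonym R1_fun = "(real \<Rightarrow> complex) set \<Rightarrow> complex"

definition R1_analytic_on :: "complex set \<Rightarrow> (real \<Rightarrow> complex) set set \<Rightarrow> R1_fun \<Rightarrow> bool" where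
  "R1_analytic_on W S f \<longleftrightarrow>
     (\<forall>q\<in>S. \<forall>\<gamma>\<in>q. \<exists>\<epsilon>>0. \<exists>\<phi>. \<phi> holomorphic_on ball (\<gamma> 1) \<epsilon> \<and>
        (\<forall>\<gamma>'. R1_curve W \<gamma>' \<and> (\<forall>t\<in>{0..1}. dist (\<gamma>' t) (\<gamma> t) < \<epsilon>)
               \<longrightarrow> f (R1_class W \<gamma>') = \<phi> (\<gamma>' 1)))"

text \<open>
  The part of the surface to which a convolution extends. After crossing the real axis in
  \<open>(m, m+1)\<close>, the convolution at \<open>z\<close> involves \<open>f\<close> and \<open>g\<close> at \<open>z - k\<close> for \<open>k \<le> m\<close>, and these
  points have to stay in the sector. For \<open>\<lambda>\<^sub>1 = 1\<close>, \<open>\<lambda>\<^sub>2 = cis \<phi>\<close>, \<open>0 < \<phi> < \<pi>/2\<close>, the convolution of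
  \<open>1 / (\<lambda>\<^sub>2 - p)\<close> and \<open>1 / (1 - p)\<close> is
  \<open>- (ln (1 - p/\<lambda>\<^sub>2) + ln (1 - p)) / (1 + \<lambda>\<^sub>2 - p)\<close>. Both factors are analytic on the surface, but
  after passing below \<open>1\<close> and crossing \<open>(1, 2)\<close> their convolution has a pole at \<open>1 + \<lambda>\<^sub>2\<close>.
  If both angles are at least \<open>\<pi>/2\<close>, or \<open>n = 1\<close>, this is the whole surface.
\<close>

definition R1_conv :: "complex set \<Rightarrow> (real \<Rightarrow> complex) set set" where
  "R1_conv W = {R1_class W \<gamma> | \<gamma>. R1_curve W \<gamma> \<and>
     (\<forall>t0 t. \<forall>k::nat. 0 < t0 \<and> t0 \<le> t \<and> t \<le> 1 \<and> Im (\<gamma> t0) = 0 \<and> real k < Re (\<gamma> t0)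
        \<longrightarrow> \<gamma> t - of_nat k \<in> W)}"

text \<open>
  The value of \<open>f\<close> over \<open>z\<close> continued along a curve of the kind \<open>P\<close>. For each of the kinds below,
  all such curves with the same endpoint are homotopic.
\<close>

definition R1_value :: "complex set \<Rightarrow> ((real \<Rightarrow> complex) \<Rightarrow> bool) \<Rightarrow> R1_fun \<Rightarrow> complex \<Rightarrow> complex" where
  "R1_value W P f z = f (R1_class W (SOME \<gamma>. R1_curve W \<gamma> \<and> \<gamma> 1 = z \<and> P \<gamma>))"

definition near0 :: "complex set \<Rightarrow> R1_fun \<Rightarrow> complex \<Rightarrow> complex" where
  "near0 W = R1_value W (\<lambda>\<gamma>. \<forall>t\<in>{0..1}. norm (\<gamma> t) < 1)"

definition upper_cont :: "complex set \<Rightarrow> R1_fun \<Rightarrow> complex \<Rightarrow> complex" where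
  "upper_cont W = R1_value W (\<lambda>\<gamma>. \<forall>t\<in>{0<..<1}. Im (\<gamma> t) > 0)"

definition lower_cont :: "complex set \<Rightarrow> R1_fun \<Rightarrow> complex \<Rightarrow> complex" where
  "lower_cont W = R1_value W (\<lambda>\<gamma>. \<forall>t\<in>{0<..<1}. Im (\<gamma> t) < 0)"

text \<open>
  The branch obtained by going below the real axis, crossing it in \<open>(m, m+1)\<close> and continuing above.
  At real points left of \<open>m + 1\<close> it is the lower continuation.
\<close>

definition crossing_cont :: "complex set \<Rightarrow> R1_fun \<Rightarrow> nat \<Rightarrow> complex \<Rightarrow> complex" where
  "crossing_cont W f m z =
     (if Im z = 0 \<and> Re z < real m + 1 then lower_cont W f z
      else R1_value W (\<lambda>\<gamma>. \<exists>c\<in>{0<..<1}. (\<forall>t\<in>{0<..<c}. Im (\<gamma> t) < 0)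
             \<and> Im (\<gamma> c) = 0 \<and> real m < Re (\<gamma> c) \<and> Re (\<gamma> c) < real m + 1
             \<and> (\<forall>t\<in>{c<..<1}. Im (\<gamma> t) > 0)) f z)"

definition heaviside :: "real \<Rightarrow> complex" where
  "heaviside x = (if x < 0 then 0 else 1)"

definition balanced_average :: "complex set \<Rightarrow> R1_fun \<Rightarrow> real \<Rightarrow> complex" where
  "balanced_average W f p = upper_cont W f (of_real p) +
     (\<Sum>k. (1/2) ^ Suc k
        * (crossing_cont W f (Suc k) (of_real p) - crossing_cont W f k (of_real p))
        * heaviside (p - real (Suc k)))"

text \<open>\<open>h\<close> continues the convolution of \<open>f\<close> and \<open>g\<close> near \<open>0\<close>; existence of the integral is included.\<close>

definition near0_domain :: "complex set \<Rightarrow> complex set" where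
  "near0_domain W = {p \<in> W. 0 < Re p \<and> norm p < 1}"

definition convolution_near0 :: "complex set \<Rightarrow> R1_fun \<Rightarrow> R1_fun \<Rightarrow> R1_fun \<Rightarrow> bool" where
  "convolution_near0 W f g h \<longleftrightarrow>
     (\<forall>p\<in>near0_domain W.
        ((\<lambda>s. near0 W f s * near0 W g (p - s)) has_contour_integral near0 W h p) (linepath 0 p))"

definition convolution :: "(real \<Rightarrow> complex) \<Rightarrow> (real \<Rightarrow> complex) \<Rightarrow> real \<Rightarrow> complex" where
  "convolution u v p = (LINT s:{0..p}|lborel. u s * v (p - s))"

text \<open>
  Analyticity says nothing about \<open>f\<close> at \<open>0\<close>. For the convolution integral to exist for small \<open>p\<close> and
  depend analytically on \<open>p\<close>, \<open>f\<close> has to be integrable along the rays at \<open>0\<close>, locally uniformly.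
\<close>

definition integrable_at_0 :: "complex set \<Rightarrow> R1_fun \<Rightarrow> bool" where
  "integrable_at_0 W f \<longleftrightarrow>
     (\<forall>K. compact K \<and> K \<subseteq> near0_domain W \<longrightarrow>
        (\<exists>H::real \<Rightarrow> real. set_integrable lborel {0..1} H \<and>
           (\<forall>p\<in>K. \<forall>t\<in>{0<..1}. norm (near0 W f (of_real t * p)) \<le> H t)))"

text \<open>
  The branches entering the balanced average are integrable at the integers, uniformly up to the real
  axis. Without this the integral of balanced averages over \<open>[0, p]\<close> need not exist, as for
  \<open>1 / (1 - p)\<close>. Integrability of the boundary values alone does not suffice: for
  \<open>f p = exp (- 1 / (1 - p)\<^sup>2) / (1 - p)\<^sup>2\<close> they are smooth and bounded on the real line, yet the
  continuation of \<open>1 * f\<close> along either side of \<open>1\<close> differs at \<open>p > 1\<close> from the integral of \<open>f\<close>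
  over \<open>[0, p]\<close> by the constant \<open>sqrt \<pi>\<close>.
\<close>

definition integrable_at_integers :: "complex set \<Rightarrow> R1_fun \<Rightarrow> bool" where
  "integrable_at_integers W f \<longleftrightarrow>
     (\<forall>n::nat. 1 \<le> n \<longrightarrow>
        (\<exists>\<delta>\<in>{0<..<1}. \<exists>H::real \<Rightarrow> real.
           set_integrable lborel {real n - \<delta>..real n + \<delta>} H \<and>
           (\<forall>x y. x \<noteq> real n \<and> \<bar>x - real n\<bar> < \<delta> \<and> 0 < y \<and> y < \<delta> \<longrightarrow>
              (\<forall>m<n. norm (crossing_cont W f m (Complex x y)) \<le> H x) \<and>
              norm (lower_cont W f (Complex x (- y))) \<le> H x)))"

end

theory Submission
 imports Defs
begin

text \<open>The convolution is the integral of f(s) g(p - s) over [0, p], and the integrand may be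
  singular where s or p - s is a positive integer. Near 0 the straight segment meets no singularity.
  Integrability along rays allows Cauchy's theorem on triangles with a vertex at 0
  (\<open>triangle_at_0\<close>), so the integral can be split at fixed points near both ends, and
  it depends analytically on p (\<open>ray_convolution_holomorphic\<close>).

  For the continuation, fix a side e of the real axis and a convex cone V about the positive axis.
  Let A k (s) be the value of f at k + s on the branch that ran on the side -e, crossed the axis in
  (k, k+1) and is now on the side e; let L be the branch of f on the side -e, and B, M the same for
  g. Consider the convolution at m + z, with z moving through 1/2 from the side -e to the side e.
  The singularities k of the first factor stay fixed, those of the second factor at k + z move away,
  and the contour is caught between them. It becomes a zigzag: from k to k + z, round k + z, back to
  k + 1, round k + 1, and so on. On the outward legs the factors lie on the sheets k and m - k, on
  the legs back on k and m - k - 1. The definition \<open>zigzag\<close> writes this contour as a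
  formula. It agrees with the straight integral for z slightly before 1/2
  (\<open>zigzag_eq_ray_convolution\<close>), it is analytic (\<open>zigzag_analytic\<close>), it
  does not depend on the size of the detours (\<open>zigzag_indep\<close>), and it extends to the
  real points that are not integers by bending the legs (\<open>pass_extension\<close>,
  \<open>zigzag_extends_at\<close>). Thus the sheet m of the convolution exists
  (\<open>sheet_convolution_exists\<close>) and is joined to the branch on the side -e along (m,
  m+1) (\<open>sheet_convolution_glue\<close>).

  On the surface, a curve is determined up to homotopy by its end point, the side on which it ends
  and the interval in which it crossed (\<open>R1_class_kind0\<close>,
  \<open>R1_class_crossing\<close>). Nearby curves share these data, except that a curve ending on
  the axis may be perturbed into one that crosses just before its end (\<open>kind_stable\<close>);
  there the two prescriptions give the same value (\<open>conv_value_real\<close>). So the sheets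
  define a function on the surface, analytic wherever z - m stays in V.

  For the averages, integrable majorants at the integers let the detours shrink to nothing. At real
  points the sheets of the convolution become sums of integrals of products of boundary values
  (\<open>sheet_convolution_at_real\<close>). On (n, n+1) the balanced average of f is the
  combination of the branches A k with weights 1/2, 1/4, ..., 2^-n, 2^-n. After all integrals are
  shifted to [0, p], the claim is a finite identity between these weights, valid at almost every s
  (\<open>balanced_weight_convolution\<close>, \<open>balanced_convolution\<close>).\<close>

section \<open>Identity theorem and extension across the real axis\<close>

text \<open>The set T need not be open: vanishing on a neighbourhood is a locally constant property
  along T, because f is holomorphic on a full ball about each point of T and the identity theorem
  decides there.\<close>

lemma analytic_zero_on_connected:
 assumes f: "f analytic_on T" and T: "connected T" and a: "a : T" "a islimpt Z"
  and Z: "!!z. z : Z ==> f z = (0::complex)" and w: "w : T"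
 shows "f w = 0"
proof -
 define P where "P x \<longleftrightarrow> (\<exists>r>0. \<forall>z\<in>ball x r. f z = 0)" for x
 have key: "\<forall>z\<in>ball x r. f z = 0"
  if "f holomorphic_on ball x r" "y : ball x r" "y islimpt Y" "!!z. z : Y ==> f z = 0" for x r y Y
 proof -
  have "y islimpt (Y \<inter> ball x r)"
   using that(2,3) islimpt_Int_eventually eventually_at_in_open'[of "ball x r" y] by fastforce
  then show ?thesis
   using analytic_continuation[OF that(1) open_ball connected_ball _ that(2), of "Y \<inter> ball x r"] that(4)
   by blast
 qed
 have "P constant_on T"
 proof (rule locally_constant_imp_constant[OF T])
  fix x assume "x : T"
  then obtain r where r: "r > 0" "f holomorphic_on ball x r"
   using f unfolding analytic_on_def by blast
  have "P y \<longleftrightarrow> (\<forall>z\<in>ball x r. f z = 0)" if yx: "y : ball x r" for y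
  proof
   assume "P y"
   then obtain s where s: "s > 0" "\<forall>z\<in>ball y s. f z = 0" unfolding P_def by blast
   then have "y islimpt ball y s" by (simp add: islimpt_ball)
   from key[OF r(2) yx this] s show "\<forall>z\<in>ball x r. f z = 0" by blast
  next
   assume "\<forall>z\<in>ball x r. f z = 0"
   moreover obtain s where "s > 0" "ball y s <= ball x r"
    by (rule openE[OF open_ball yx])
   ultimately show "P y" unfolding P_def by blast
  qed
  then have Pyx: "P y = P x" if "y : ball x r" for y using that r(1) centre_in_ball by metis
  show "\<exists>U. openin (top_of_set T) U & x : U & (\<forall>y\<in>U. P y = P x)"
  proof (intro exI conjI ballI)
   show "openin (top_of_set T) (T \<inter> ball x r)" by (simp add: openin_open_Int)
   show "x : T \<inter> ball x r" using \<open>x : T\<close> r(1) by simp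
   show "P y = P x" if "y : T \<inter> ball x r" for y using Pyx that by blast
  qed
 qed
 moreover have "P a"
 proof -
  obtain r where r: "r > 0" "f holomorphic_on ball a r"
   using f a unfolding analytic_on_def by blast
  have "\<forall>z\<in>ball a r. f z = 0"
   by (rule key[OF r(2) _ a(2) Z]) (use r in auto)
  with r(1) show ?thesis unfolding P_def by blast
 qed
 ultimately have "P w" using a w unfolding constant_on_def by metis
 then show ?thesis unfolding P_def by auto
qed

lemma analytic_eq_on_connected:
 assumes "f analytic_on T" "g analytic_on T" "connected T" "a : T" "a islimpt Z"
  and "!!z. z : Z ==> f z = (g z::complex)" and "w : T"
 shows "f w = g w"
 using analytic_zero_on_connected[of "%z. f z - g z" T a Z w] assms
 by (auto intro: analytic_intros)

text \<open>Each real point brings its own germ. Two germs agree on the overlap of their balls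
  because both equal F at the points on the side e, so picking any available germ outside U yields
  one function.\<close>

lemma analytic_extension_across_real:
 fixes e :: real and F :: "complex => complex"
 assumes e: "e = 1 \<or> e = -1"
  and F: "F holomorphic_on U" "open U" "!!z. z : U ==> 0 < e * Im z"
  and P: "!!p. p : P ==> Im p = 0 & (\<exists>r>0. \<exists>ph. ph holomorphic_on ball p r &
       (\<forall>z\<in>ball p r. 0 < e * Im z --> z : U & ph z = F z))"
 obtains F' where "F' analytic_on (U \<union> P)" "!!z. z : U ==> F' z = F z"
proof -
 from P obtain r ph where r: "!!p. p : P ==> r p > 0" "!!p. p : P ==> ph p holomorphic_on ball p (r p)"
  "!!p z. [|p : P; z : ball p (r p); 0 < e * Im z|] ==> z : U & ph p z = F z"
  by metis
 define F' where "F' z = (if z : U then F z else ph (SOME p. p : P & z : ball p (r p)) z)" for z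
 have agree: "ph p z = ph q z" if pq: "p : P" "q : P" and z: "z : ball p (r p)" "z : ball q (r q)" for p q z
 proof -
  define B where "B = ball p (r p) \<inter> ball q (r q)"
  have Im0: "Im p = 0" "Im q = 0" using P pq by auto
  \<comment> \<open>The projection of z to the axis is no farther from the real centres p and q than
    z is, so it lies in both balls, and points of the side e accumulate at it.\<close>
  define x where "x = complex_of_real (Re z)"
  have le: "dist p x <= dist p z" "dist q x <= dist q z"
   using Im0 by (auto simp: x_def dist_norm cmod_def)
  have x: "x : B" using le z by (auto simp: B_def)
  then obtain s where s: "s > 0" "ball x s <= B"
   by (metis B_def open_Int open_ball open_contains_ball)
  define Y where "Y = {w. 0 < e * Im w} \<inter> ball x s"
  have ix: "x islimpt {w. 0 < e * Im w}"
   unfolding islimpt_approachable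
  proof (intro allI impI)
   fix d :: real assume "d > 0"
   show "\<exists>x'\<in>{w. 0 < e * Im w}. x' ~= x & dist x' x < d"
    using e \<open>d > 0\<close>
    by (intro bexI[of _ "x + \<i> * of_real (e * d / 2)"])
      (auto simp: dist_norm norm_mult x_def complex_eq_iff)
  qed
  then have "x islimpt Y" unfolding Y_def
   using islimpt_Int_eventually eventually_at_in_open'[of "ball x s" x] s by fastforce
  moreover have "ph p w = ph q w" if "w : Y" for w
  proof -
   have "w : ball p (r p)" "w : ball q (r q)" "0 < e * Im w"
    using that s(2) unfolding Y_def B_def by blast+
   then show ?thesis using r(3) pq by metis
  qed
  moreover have "ph p analytic_on B" "ph q analytic_on B"
   using r(2) pq by (auto simp: B_def analytic_on_open open_Int intro: holomorphic_on_subset)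
  moreover have "connected B" unfolding B_def by (intro convex_connected convex_Int convex_ball)
  moreover have "z : B" using z by (simp add: B_def)
  ultimately show ?thesis using x analytic_eq_on_connected[of "ph p" B "ph q" x Y z] by blast
 qed
 have loc: "F' z = ph p z" if "p : P" "z : ball p (r p)" for p z
 proof (cases "z : U")
  case True
  then have "ph p z = F z" using F(3)[OF True] r(3)[OF that] by blast
  then show ?thesis using True by (simp add: F'_def)
 next
  case False
  have "(SOME p. p : P & z : ball p (r p)) : P & z : ball (SOME p. p : P & z : ball p (r p)) (r (SOME p. p : P & z : ball p (r p)))"
   by (rule someI[of "%p. p : P & z : ball p (r p)" p]) (use that in auto)
  then show ?thesis using False agree[OF _ that(1) _ that(2)] by (simp add: F'_def)
 qed
 show ?thesis
 proof
  show eq: "F' z = F z" if "z : U" for z using that by (simp add: F'_def)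
  have "F' analytic_on U"
   using holomorphic_transform[OF F(1) eq[symmetric]] F(2) by (simp add: analytic_on_open)
  moreover have "F' analytic_on P"
   unfolding analytic_on_def
  proof
   fix p assume p: "p : P"
   have "F' holomorphic_on ball p (r p)"
    by (rule holomorphic_transform[OF r(2)[OF p]]) (rule loc[OF p, symmetric])
   then show "\<exists>ep>0. F' holomorphic_on ball p ep" using r(1)[OF p] by blast
  qed
  ultimately show "F' analytic_on (U \<union> P)" by (simp add: analytic_on_Un)
 qed
qed

section \<open>Integrals depending analytically on a parameter\<close>

lemma continuous_bounded_times_absolutely_integrable:
 fixes ph pz :: "real => complex"
 assumes "ph absolutely_integrable_on {a..b}" "continuous_on {a..b} pz"
 shows "(%t. ph t * pz t) absolutely_integrable_on {a..b}"
proof -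
 have "(%t. pz t * ph t) absolutely_integrable_on {a..b}"
 proof (rule absolutely_integrable_bounded_measurable_product[of "(*)"])
  show "pz : borel_measurable (lebesgue_on {a..b})"
   using assms(2) by (intro continuous_imp_measurable_on_sets_lebesgue) auto
  show "bounded (pz ` {a..b})"
   using assms(2) by (intro compact_imp_bounded compact_continuous_image) auto
 qed (use assms in \<open>auto intro: bilinear_times\<close>)
 then show ?thesis by (simp add: mult.commute)
qed

text \<open>Taylor's formula with one constant for all base points in K: the second derivative is
  bounded on the closed r-neighbourhood of K, which is compact and still contained in E.\<close>

lemma quadratic_remainder:
 assumes K: "compact K" "K <= E" "open E" and B: "B holomorphic_on E"
 obtains r M where "r > 0" "0 <= M" "!!w h. [|w : K; norm h < r|] ==> w + h : E"
  "!!w h. [|w : K; norm h < r|] ==> norm (B (w + h) - B w - deriv B w * h) <= M * (norm h)\<^sup>2"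
proof -
 obtain r0 where r0: "r0 > 0" "(\<Union>x\<in>K. ball x r0) <= E"
  using compact_subset_open_imp_ball_epsilon_subset[OF K(1,3,2)] .
 define r where "r = r0 / 2"
 define K2 where "K2 = {x + y |x y. x : K & y : cball 0 r}"
 have "compact K2" unfolding K2_def by (rule compact_sums[OF K(1)]) simp
 have K2: "K2 <= E"
 proof
  fix z assume "z : K2"
  then obtain x y where "z = x + y" "x : K" "norm y <= r" by (auto simp: K2_def)
  then have "z : ball x r0" using r0 by (auto simp: r_def dist_norm)
  then show "z : E" using r0 \<open>x : K\<close> by blast
 qed
 have d1: "deriv B holomorphic_on E" using B K(3) by (intro holomorphic_deriv)
 then have d2: "deriv (deriv B) holomorphic_on E" using K(3) by (rule holomorphic_deriv)
 then have "continuous_on K2 (deriv (deriv B))"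
  using K2 holomorphic_on_imp_continuous_on continuous_on_subset by blast
 then have "bounded (deriv (deriv B) ` K2)"
  using \<open>compact K2\<close> compact_continuous_image compact_imp_bounded by blast
 then obtain M where M: "M > 0" "!!z. z : K2 ==> norm (deriv (deriv B) z) <= M"
  by (auto simp: bounded_pos)
 show ?thesis
 proof
  show "r > 0" "0 <= M" using r0 M by (auto simp: r_def)
  fix w h :: complex assume wh: "w : K" "norm h < r"
  have sub: "cball w r <= K2"
   using wh by (force simp: K2_def dist_norm norm_minus_commute intro: exI[of _ w])
  show "w + h : E" using wh sub K2 by (auto simp: dist_norm subset_iff)
  define f where "f i = (if i = 0 then B else if i = 1 then deriv B else deriv (deriv B))" for i :: nat
  have "norm (f 0 (w + h) - (\<Sum>i\<le>1. f i w * (w + h - w) ^ i / fact i)) <= M * norm (w + h - w) ^ Suc 1 / fact 1"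
  proof (rule complex_Taylor[where S = "cball w r"])
   fix i x assume ix: "x : cball w r" "i <= (1::nat)"
   then have "x : E" using sub K2 by blast
   then show "(f i has_field_derivative f (Suc i) x) (at x within cball w r)"
    using ix B d1 K(3) by (cases i) (auto simp: f_def intro!: holomorphic_derivI)
  qed (use wh sub M r0 in \<open>auto simp: f_def dist_norm r_def\<close>)
  then show "norm (B (w + h) - B w - deriv B w * h) <= M * (norm h)\<^sup>2"
   by (simp add: f_def algebra_simps power2_eq_square)
 qed
qed

text \<open>The weight \<open>ph\<close> is merely integrable. The quadratic remainder of B is
  uniform in t, so after integration the difference quotient deviates from the candidate derivative
  by at most a multiple of the norm of h.\<close>

lemma field_differentiable_convolution_integral:
 fixes ph c :: "real => complex"
 assumes ph: "ph absolutely_integrable_on {a..b}" and c: "continuous_on {a..b} c"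
  and B: "B holomorphic_on E" "open E" and sub: "!!t. t : {a..b} ==> z - c t : E"
 shows "(%z. integral {a..b} (%t. ph t * B (z - c t))) field_differentiable (at z)"
proof -
 define X where "X z = integral {a..b} (%t. ph t * B (z - c t))" for z
 define K where "K = (%t. z - c t) ` {a..b}"
 have K: "compact K" unfolding K_def by (intro compact_continuous_image continuous_intros c) simp
 have "K <= E" using sub by (auto simp: K_def)
 then obtain r M where r: "r > 0" "0 <= M" "!!w h. [|w : K; norm h < r|] ==> w + h : E"
  "!!w h. [|w : K; norm h < r|] ==> norm (B (w + h) - B w - deriv B w * h) <= M * (norm h)\<^sup>2"
  using quadratic_remainder[OF K _ B(2,1)] by metis
 have dB: "deriv B holomorphic_on E" using B by (intro holomorphic_deriv)
 define D where "D = integral {a..b} (%t. ph t * deriv B (z - c t))"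
 have int: "(%t. ph t * G (z + h - c t)) absolutely_integrable_on {a..b}"
  if "G holomorphic_on E" "norm h < r" for G h
 proof (rule continuous_bounded_times_absolutely_integrable[OF ph])
  have "continuous_on {a..b} (G \<circ> (%t. z + h - c t))"
  proof (rule continuous_on_compose)
   show "continuous_on {a..b} (%t. z + h - c t)" by (intro continuous_intros c)
   show "continuous_on ((%t. z + h - c t) ` {a..b}) G"
   proof (rule continuous_on_subset[OF holomorphic_on_imp_continuous_on[OF that(1)]])
    show "(%t. z + h - c t) ` {a..b} <= E"
     using r(3)[OF _ that(2)] by (force simp: K_def algebra_simps)
   qed
  qed
  then show "continuous_on {a..b} (%t. G (z + h - c t))" by (simp add: o_def)
 qed
 have I: "(%t. norm (ph t)) integrable_on {a..b}"
  using ph by (simp add: absolutely_integrable_on_def)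
 define N where "N = integral {a..b} (%t. norm (ph t))"
 have bound: "norm (X (z + h) - X z - D * h) <= N * M * (norm h)\<^sup>2" if "norm h < r" for h
 proof -
  have i: "(%t. ph t * B (z + h - c t)) integrable_on {a..b}"
   "(%t. ph t * B (z - c t)) integrable_on {a..b}"
   "(%t. ph t * deriv B (z - c t)) integrable_on {a..b}"
   using int[OF B(1) that] int[OF B(1), of 0] int[OF dB, of 0] r(1)
   by (auto intro: set_lebesgue_integral_eq_integral)
  have "X (z + h) - X z - D * h = integral {a..b} (%t. ph t * B (z + h - c t) - ph t * B (z - c t) - ph t * deriv B (z - c t) * h)"
   unfolding X_def D_def using i
   by (simp add: Henstock_Kurzweil_Integration.integral_diff integrable_diff
     integrable_on_mult_left)
  also have "norm \<dots> <= integral {a..b} (%t. norm (ph t) * (M * (norm h)\<^sup>2))"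
  proof (rule integral_norm_bound_integral)
   show "(%t. ph t * B (z + h - c t) - ph t * B (z - c t) - ph t * deriv B (z - c t) * h) integrable_on {a..b}"
    using i by (intro integrable_diff integrable_on_mult_left)
   show "(%t. norm (ph t) * (M * (norm h)\<^sup>2)) integrable_on {a..b}"
    using I by (intro integrable_on_mult_left)
   fix t assume t: "t : {a..b}"
   have "norm (B (z - c t + h) - B (z - c t) - deriv B (z - c t) * h) <= M * (norm h)\<^sup>2"
    by (rule r(4)) (use t that in \<open>auto simp: K_def\<close>)
   then have "norm (ph t * (B (z - c t + h) - B (z - c t) - deriv B (z - c t) * h)) <= norm (ph t) * (M * (norm h)\<^sup>2)"
    by (simp add: norm_mult mult_left_mono)
   then show "norm (ph t * B (z + h - c t) - ph t * B (z - c t) - ph t * deriv B (z - c t) * h) <= norm (ph t) * (M * (norm h)\<^sup>2)"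
    by (simp add: algebra_simps)
  qed
  also have "\<dots> = N * M * (norm h)\<^sup>2" by (simp add: N_def mult.assoc)
  finally show ?thesis .
 qed
 have "((%h. (X (z + h) - X z) / h - D) \<longlongrightarrow> 0) (at 0)"
 proof (rule Lim_null_comparison)
  show "\<forall>\<^sub>F h in at 0. norm ((X (z + h) - X z) / h - D) <= N * M * norm h"
  proof -
   have "\<forall>\<^sub>F h in at (0::complex). norm h < r & h ~= 0"
    using r(1) by (auto simp: eventually_at intro!: exI[of _ r])
   then show ?thesis
   proof eventually_elim
    case (elim h)
    then have "norm ((X (z + h) - X z) / h - D) = norm (X (z + h) - X z - D * h) / norm h"
     by (simp flip: norm_divide add: diff_divide_distrib)
    also have "\<dots> <= N * M * norm h"
     using bound[of h] elim by (simp add: divide_le_eq power2_eq_square mult.assoc)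
    finally show ?case .
   qed
  qed
  show "((%h. N * M * norm h) \<longlongrightarrow> 0) (at (0::complex))" by (auto intro!: tendsto_eq_intros)
 qed
 then have "((%h. (X (z + h) - X z) / h) \<longlongrightarrow> D) (at 0)"
  by (rule LIM_zero_cancel)
 then have "(X has_field_derivative D) (at z)"
  by (simp add: DERIV_def)
 then show ?thesis unfolding X_def field_differentiable_def by blast
qed

text \<open>Analyticity on P gives holomorphy on an open E containing P, and compactness of the
  contour keeps z' - c t in E for all z' near z.\<close>

lemma analytic_convolution_integral:
 fixes ph c :: "real => complex"
 assumes ph: "ph absolutely_integrable_on {a..b}" and c: "continuous_on {a..b} c"
  and B: "B analytic_on P" and sub: "!!t. t : {a..b} ==> z - c t : P"
 shows "(%z. integral {a..b} (%t. ph t * B (z - c t))) analytic_on {z}"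
proof -
 obtain E where E: "open E" "P <= E" "B holomorphic_on E" using B analytic_on_holomorphic by metis
 define K where "K = (%t. z - c t) ` {a..b}"
 have K: "compact K" unfolding K_def by (intro compact_continuous_image continuous_intros c) simp
 obtain r where r: "r > 0" "(\<Union>x\<in>K. ball x r) <= E"
  using compact_subset_open_imp_ball_epsilon_subset[OF K E(1)] E(2) sub by (force simp: K_def)
 have "z' - c t : E" if "z' : ball z r" "t : {a..b}" for z' t
 proof -
  have "z' - c t : ball (z - c t) r" using that by (simp add: dist_norm)
  then show ?thesis using r(2) that(2) unfolding K_def by blast
 qed
 then have "(%z. integral {a..b} (%t. ph t * B (z - c t))) holomorphic_on ball z r"
  by (auto simp: holomorphic_on_open field_differentiable_def[symmetric]
    intro!: field_differentiable_convolution_integral[OF ph c E(3,1)])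
 then show ?thesis using r(1) by (auto simp: analytic_on_def)
qed

text \<open>For contours whose end moves with z. When the contour is written as t z +
  \<open>ga\<close> t over a fixed parameter interval, its speed \<open>z + ga' t\<close> becomes
  part of the integrand and the Leibniz rule applies.\<close>

lemma holomorphic_moving_convolution_integral:
 fixes ga ga' :: "real => complex"
 assumes A: "A holomorphic_on EA" "open EA" and B: "B holomorphic_on EB" "open EB"
  and ga: "continuous_on {0..1} ga" "continuous_on {0..1} ga'" and U: "convex U"
  and sub: "!!z t. [|z : U; t : {0..1}|] ==> of_real t * z + ga t : EA"
       "!!z t. [|z : U; t : {0..1}|] ==> z - (of_real t * z + ga t) : EB"
 shows "(%z. integral {0..1} (%t. A (of_real t * z + ga t) * B (z - (of_real t * z + ga t)) * (z + ga' t))) holomorphic_on U"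
proof -
 define fx where "fx z t = deriv A (of_real t * z + ga t) * of_real t * B (z - (of_real t * z + ga t)) * (z + ga' t)
   + A (of_real t * z + ga t) * (deriv B (z - (of_real t * z + ga t)) * (1 - of_real t)) * (z + ga' t)
   + A (of_real t * z + ga t) * B (z - (of_real t * z + ga t))" for z t
 have dA: "deriv A holomorphic_on EA" and dB: "deriv B holomorphic_on EB"
  using A B by (auto intro: holomorphic_deriv)
 have g: "continuous_on (U \<times> {0..1}) (%x. ga (snd x))" "continuous_on (U \<times> {0..1}) (%x. ga' (snd x))"
  by (auto intro!: continuous_on_compose2[OF ga(1)] continuous_on_compose2[OF ga(2)] continuous_intros)
 have cA: "continuous_on (U \<times> {0..1}) (%x. G (of_real (snd x) * fst x + ga (snd x)))" if "G holomorphic_on EA" for G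
  by (rule continuous_on_compose2[OF holomorphic_on_imp_continuous_on[OF that]])
    (use sub in \<open>auto intro!: continuous_intros g\<close>)
 have cB: "continuous_on (U \<times> {0..1}) (%x. G (fst x - (of_real (snd x) * fst x + ga (snd x))))" if "G holomorphic_on EB" for G
  by (rule continuous_on_compose2[OF holomorphic_on_imp_continuous_on[OF that]])
    (use sub in \<open>auto intro!: continuous_intros g\<close>)
 have "(%z. integral (cbox 0 1) (%t. A (of_real t * z + ga t) * B (z - (of_real t * z + ga t)) * (z + ga' t))) holomorphic_on U"
 proof (rule leibniz_rule_holomorphic[OF _ _ _ U])
  fix z t assume zt: "z : U" "t : cbox 0 (1::real)"
  have 1: "(A has_field_derivative deriv A (of_real t * z + ga t)) (at (of_real t * z + ga t))"
   using A sub(1) zt by (auto intro!: holomorphic_derivI)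
  have 2: "(B has_field_derivative deriv B (z - (of_real t * z + ga t))) (at (z - (of_real t * z + ga t)))"
   using B sub(2) zt by (auto intro!: holomorphic_derivI)
  have 3: "((%z. A (of_real t * z + ga t)) has_field_derivative deriv A (of_real t * z + ga t) * of_real t) (at z within U)"
   by (rule DERIV_chain2[where f=A and g="%z. of_real t * z + ga t", OF 1]) (auto intro!: derivative_eq_intros)
  have 4: "((%z. B (z - (of_real t * z + ga t))) has_field_derivative deriv B (z - (of_real t * z + ga t)) * (1 - of_real t)) (at z within U)"
   by (rule DERIV_chain2[where f=B and g="%z. z - (of_real t * z + ga t)", OF 2]) (auto intro!: derivative_eq_intros)
  show "((%z. A (of_real t * z + ga t) * B (z - (of_real t * z + ga t)) * (z + ga' t)) has_field_derivative fx z t) (at z within U)"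
   unfolding fx_def by (rule derivative_eq_intros 3 4 refl | simp)+ (simp add: algebra_simps)
 next
  fix z assume z: "z : U"
  show "(%t. A (of_real t * z + ga t) * B (z - (of_real t * z + ga t)) * (z + ga' t)) integrable_on cbox 0 1"
  proof (rule integrable_continuous)
   have "continuous_on {0..1} (%t. (z, t))" by (intro continuous_intros)
   moreover have "(%t. (z, t)) ` {0..1} <= U \<times> {0..1}" using z by auto
   ultimately have "continuous_on {0..1} (%t. A (of_real t * z + ga t))"
    "continuous_on {0..1} (%t. B (z - (of_real t * z + ga t)))"
    using continuous_on_compose2[OF cA[OF A(1)], of "{0..1}" "%t. (z, t)"]
     continuous_on_compose2[OF cB[OF B(1)], of "{0..1}" "%t. (z, t)"] by auto
   then show "continuous_on (cbox 0 1) (%t. A (of_real t * z + ga t) * B (z - (of_real t * z + ga t)) * (z + ga' t))"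
    by (auto intro!: continuous_intros ga)
  qed
 next
  show "continuous_on (U \<times> cbox 0 1) (%(z, t). fx z t)"
   unfolding fx_def case_prod_unfold
   by (auto intro!: continuous_intros g cA cB A B dA dB)
 qed
 then show ?thesis by simp
qed

section \<open>Sheets and the pieces of the contour\<close>

definition half :: "complex set => real => complex set" where
 "half V e = {z : V. 0 < e * Im z}"

text \<open>Analyticity on this non-open set encodes boundary values: a branch on the side e
  continues slightly across every real point of V that is not an integer.\<close>

definition sheet :: "complex set => real => complex set" where
 "sheet V e = {z : V. 0 <= e * Im z & z ~: \<nat>}"

text \<open>Finitely many of the local neighbourhoods cover the compact K, and the least of their
  radii serves everywhere.\<close>

lemma uniform_radius:
 fixes K :: "'a::metric_space set"
 assumes K: "compact K"
  and loc: "!!t. t : K ==> \<exists>rh>0. \<exists>d>0. \<forall>s\<in>K. dist s t < d --> P rh s"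
  and mono: "!!rh rh' s. [|P rh s; 0 < rh'; rh' <= rh|] ==> P rh' s"
 obtains rh :: real where "rh > 0" "!!s. s : K ==> P rh s"
proof -
 obtain rh d where rh: "!!t. t : K ==> rh t > 0" "!!t. t : K ==> d t > 0"
  "!!t s. [|t : K; s : K; dist s t < d t|] ==> P (rh t) s"
  using loc by metis
 have "K <= (\<Union>t\<in>K. ball t (d t))" using rh(2) by force
 then obtain C where C: "C <= K" "finite C" "K <= (\<Union>t\<in>C. ball t (d t))"
  using compactE_image[OF K, of K "%t. ball t (d t)"] by auto
 define r where "r = Min (insert 1 (rh ` C))"
 have r: "r > 0" "!!t. t : C ==> r <= rh t" using C rh(1) by (auto simp: r_def)
 show ?thesis
 proof (rule that[OF r(1)])
  fix s assume "s : K"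
  then obtain t where "t : C" "s : ball t (d t)" using C by blast
  then have "P (rh t) s" using rh(3)[of t s] C \<open>s : K\<close> by (auto simp: dist_commute)
  then show "P r s" using mono r \<open>t : C\<close> by blast
 qed
qed

lemma of_real_in_Nats_iff: "(of_real x :: complex) : \<nat> \<longleftrightarrow> x : \<nat>"
 by (auto simp: Nats_def complex_eq_iff image_iff)

lemma Nats_Im_0: "z : \<nat> ==> Im z = (0::real)"
 by (auto simp: Nats_def)

text \<open>The symmetric middle part of a convolution integral: the reflection s -> z - s maps the
  segment from a to z - a to itself. The two ends that are cut off are \<open>ray_part\<close>s from
  0 to a, one with the factors exchanged.\<close>

definition pass :: "complex => (complex => complex) => (complex => complex) => complex => complex" where
 "pass a A B z = contour_integral (linepath a (z - a)) (%s. A s * B (z - s))"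

text \<open>Half of a diamond of radius \<open>ep\<close> about 0, traversed from -ep to ep through
  the side -e; a polygonal detour around a singularity of the first factor at 0. In use the first
  factor is a branch shifted by an integer.\<close>

definition arc_part :: "real => real => (complex => complex) => (complex => complex) => complex => complex" where
 "arc_part e ep L B z =
   contour_integral (linepath (- of_real ep) (- \<i> * of_real (e * ep))) (%s. L s * B (z - s)) +
   contour_integral (linepath (- \<i> * of_real (e * ep)) (of_real ep)) (%s. L s * B (z - s))"

definition ray_part :: "complex => (complex => complex) => (complex => complex) => complex => complex" where
 "ray_part a A B z = contour_integral (linepath 0 a) (%s. A s * B (z - s))"

lemma pass_eq_integral:
 "pass a A B z = integral {0..1} (%t. A (of_real t * z + a * (1 - 2 * of_real t)) *
   B (z - (of_real t * z + a * (1 - 2 * of_real t))) * (z + (- 2 * a)))"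
 unfolding pass_def contour_integral_integral
 by (simp add: linepath_def scaleR_conv_of_real algebra_simps)

lemma pass_analytic:
 assumes A: "A analytic_on P" and B: "B analytic_on P" and seg: "closed_segment a (z0 - a) <= P"
 shows "pass a A B analytic_on {z0}"
proof -
 obtain EA where EA: "open EA" "P <= EA" "A holomorphic_on EA" using A analytic_on_holomorphic by metis
 obtain EB where EB: "open EB" "P <= EB" "B holomorphic_on EB" using B analytic_on_holomorphic by metis
 obtain r where r: "r > 0" "(\<Union>x\<in>closed_segment a (z0 - a). ball x r) <= EA \<inter> EB"
 proof (rule compact_subset_open_imp_ball_epsilon_subset)
  show "compact (closed_segment a (z0 - a))" by simp
  show "open (EA \<inter> EB)" using EA EB by (intro open_Int)
  show "closed_segment a (z0 - a) <= EA \<inter> EB" using seg EA EB by blast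
 qed
 have main: "of_real t * z + a * (1 - 2 * of_real t) : EA \<inter> EB"
  if z: "z : ball z0 r" and t: "t : {0..1}" for z t
 proof -
  have "of_real t * z0 + a * (1 - 2 * of_real t) : closed_segment a (z0 - a)"
   using t unfolding closed_segment_def
   by (auto intro!: exI[of _ t] simp: scaleR_conv_of_real algebra_simps)
  moreover have "dist (of_real t * z0 + a * (1 - 2 * of_real t)) (of_real t * z + a * (1 - 2 * of_real t)) < r"
  proof -
   have "dist (of_real t * z0 + a * (1 - 2 * of_real t)) (of_real t * z + a * (1 - 2 * of_real t)) = t * dist z0 z"
    using t by (simp add: dist_norm norm_mult flip: right_diff_distrib)
   also have "\<dots> <= dist z0 z" using t by (simp add: mult_left_le_one_le)
   finally show ?thesis using z by simp
  qed
  ultimately show ?thesis using r(2) by (meson UN_I mem_ball subsetD)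
 qed
 have "pass a A B holomorphic_on ball z0 r"
  unfolding pass_eq_integral
 proof (rule holomorphic_moving_convolution_integral[OF EA(3,1) EB(3,1)])
  fix z and t :: real assume zt: "z : ball z0 r" "t : {0..1}"
  show "of_real t * z + a * (1 - 2 * of_real t) : EA" using main[OF zt] by blast
  have "z - (of_real t * z + a * (1 - 2 * of_real t)) = of_real (1 - t) * z + a * (1 - 2 * of_real (1 - t))"
   by (simp add: algebra_simps)
  then show "z - (of_real t * z + a * (1 - 2 * of_real t)) : EB" using main[OF zt(1), of "1 - t"] zt by simp
 qed (auto intro!: continuous_intros)
 then show ?thesis using r(1) by (auto simp: analytic_on_def)
qed

lemma segment_convolution_analytic:
 assumes L: "continuous_on (closed_segment u v) L" and B: "B analytic_on P"
  and seg: "!!s. s : closed_segment u v ==> z0 - s : P"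
 shows "(%z. contour_integral (linepath u v) (%s. L s * B (z - s))) analytic_on {z0}"
proof -
 have lp: "linepath u v t : closed_segment u v" if "t : {0..1}" for t
  using that linepath_in_path by auto
 have "continuous_on {0..1} (%t. L (linepath u v t) * (v - u))"
  by (intro continuous_intros continuous_on_compose2[OF L]) (use lp in auto)
 then have "(%t. L (linepath u v t) * (v - u)) absolutely_integrable_on {0..1}"
  by (rule absolutely_integrable_continuous_real)
 then have "(%z. integral {0..1} (%t. (L (linepath u v t) * (v - u)) * B (z - linepath u v t))) analytic_on {z0}"
  by (rule analytic_convolution_integral[OF _ _ B]) (auto intro!: continuous_intros seg lp)
 then show ?thesis
  unfolding contour_integral_integral by (simp add: mult_ac)
qed

text \<open>An open convex cone is closed under addition (\<open>add_V\<close>), in particular under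
  shifts by positive reals, and this keeps the contours inside. The sign e lets one argument serve
  both sides of the axis.\<close>

locale wedge =
 fixes V :: "complex set" and e :: real
 assumes open_V: "open V" and convex_V: "convex V"
  and cone: "!!z r. [|z : V; 0 < r|] ==> of_real r * z : V"
  and one: "1 : V" and Re_pos: "!!z. z : V ==> 0 < Re z"
  and e: "e = 1 \<or> e = -1"
begin

lemma wedge_uminus: "wedge V (-e)"
 using open_V convex_V cone one Re_pos e by unfold_locales auto

lemma ee [simp]: "e * e = 1" "e * (e * x) = x" "\<bar>e\<bar> = 1" using e by auto

lemma add_V: assumes "z : V" "w : V" shows "z + w : V"
proof -
 have "(1/2) *\<^sub>R z + (1/2) *\<^sub>R w : V" using convexD[OF convex_V assms, of "1/2" "1/2"] by simp
 then have "of_real 2 * ((1/2) *\<^sub>R z + (1/2) *\<^sub>R w) : V" by (intro cone) auto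
 then show ?thesis by (simp add: scaleR_conv_of_real algebra_simps)
qed

lemma of_real_V: "0 < x ==> of_real x : V"
 using cone[OF one, of x] by simp

lemma add_real_V: "z : V ==> 0 <= x ==> z + of_real x : V"
 using add_V[of z "of_real x"] of_real_V[of x] by (cases "x = 0") auto

lemma open_half: "open (half V e)"
proof -
 have "half V e = V \<inter> {z. 0 < e * Im z}" by (auto simp: half_def)
 then show ?thesis using open_V
  by (auto intro!: open_Int open_Collect_less continuous_intros)
qed

lemma convex_half: "convex (half V e)"
proof -
 have "half V e = V \<inter> {z. 0 < e * Im z}" by (auto simp: half_def)
 moreover have "convex {z. 0 < e * Im z}"
  using e convex_halfspace_Im_gt[of 0] convex_halfspace_Im_lt[of 0] by auto
 ultimately show ?thesis using convex_V by (simp add: convex_Int)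
qed

lemma half_subset_sheet: "half V e <= sheet V e"
 using Nats_Im_0 by (force simp: half_def sheet_def)

lemma sheet_eq: "sheet V e = half V e \<union> of_real ` {x. 0 < x & x ~: \<nat>}"
proof (intro subset_antisym subsetI)
 fix z assume z: "z : sheet V e"
 show "z : half V e \<union> of_real ` {x. 0 < x & x ~: \<nat>}"
 proof (cases "Im z = 0")
  case True
  then have "z = of_real (Re z)" by (simp add: complex_eq_iff)
  then show ?thesis using z Re_pos[of z] of_real_in_Nats_iff[of "Re z"]
   by (auto simp: sheet_def image_iff intro!: exI[of _ "Re z"])
 next
  case False
  then have "0 < e * Im z" using z e by (auto simp: sheet_def)
  then show ?thesis using z by (simp add: sheet_def half_def)
 qed
next
 fix z assume "z : half V e \<union> of_real ` {x. 0 < x & x ~: \<nat>}"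
 then show "z : sheet V e"
  using half_subset_sheet of_real_V by (auto simp: sheet_def of_real_in_Nats_iff)
qed

lemma of_real_sheet: "[|0 < x; x ~: \<nat>|] ==> of_real x : sheet V e"
 by (auto simp: sheet_eq)

text \<open>
 The contour is bent to the side \<open>e\<close> at the positive integers, where \<open>A\<close> is singular, and to the
 other side at the points \<open>p - n\<close>, where \<open>s \<mapsto> B (p - s)\<close> is singular. The profile
 \<open>cos (2 * pi * x) - cos (2 * pi * (x - p))\<close> has the right signs and is odd about \<open>p / 2\<close>.
\<close>

lemma pass_extension:
 fixes a p :: real
 assumes A: "A analytic_on sheet V e" and B: "B analytic_on sheet V e"
  and a: "0 < a" "a ~: \<nat>" and p: "p ~: \<nat>" "p - a ~: \<nat>" "a < p"
 obtains r ph where "r > 0" "ph holomorphic_on ball (of_real p) r"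
  "!!z. [|z : ball (of_real p) r; 0 < e * Im z|] ==> ph z = pass (of_real a) A B z"
proof -
 obtain EA where EA: "open EA" "sheet V e <= EA" "A holomorphic_on EA" using A analytic_on_holomorphic by metis
 obtain EB where EB: "open EB" "sheet V e <= EB" "B holomorphic_on EB" using B analytic_on_holomorphic by metis
 define E where "E = EA \<inter> EB"
 have E: "open E" "sheet V e <= E" using EA EB by (auto simp: E_def)
 define x where "x t = a + t * (p - 2 * a)" for t
 define c where "c t = cos (2 * pi * x t) - cos (2 * pi * (x t - p))" for t
 define et where "et t = (t - t\<^sup>2) * c t" for t
 define c' where "c' t = - sin (2 * pi * x t) * (2 * pi * (p - 2 * a)) + sin (2 * pi * (x t - p)) * (2 * pi * (p - 2 * a))" for t
 define et' where "et' t = (1 - 2 * t) * c t + (t - t\<^sup>2) * c' t" for t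
 have x_pos: "x t > 0" if "t : {0..1}" for t
 proof -
  have "x t = (1 - t) * a + t * (p - a)" by (simp add: x_def algebra_simps)
  moreover have "(1 - t) * a \<ge> 0" "t * (p - a) \<ge> 0" using that a p by auto
  moreover have "(1 - t) * a > 0 \<or> t * (p - a) > 0" using that a p by (cases "t = 1") auto
  ultimately show ?thesis by linarith
 qed
 have x_flip: "x (1 - t) = p - x t" for t by (simp add: x_def algebra_simps)
 have cos_flip: "cos (2 * pi * (y - p)) = cos (2 * pi * (p - y))" for y
  using cos_minus[of "2 * pi * (y - p)"] by (simp add: algebra_simps)
 have et_flip: "et (1 - t) = - et t" for t
 proof -
  have "c (1 - t) = - c t"
   unfolding c_def x_flip using cos_flip[of "x t"] cos_minus[of "2 * pi * x t"] by simp
  then show ?thesis by (simp add: et_def power2_eq_square algebra_simps)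
 qed
 have cont_x: "continuous_on UNIV x" unfolding x_def by (intro continuous_intros)
 have cont_et: "continuous_on UNIV et" unfolding et_def c_def
  by (intro continuous_intros continuous_on_subset[OF cont_x] subset_UNIV)
 have cont_et': "continuous_on UNIV et'" unfolding et'_def c_def c'_def
  by (intro continuous_intros continuous_on_subset[OF cont_x] subset_UNIV)
 have et_deriv: "(et has_real_derivative et' t) (at t)" for t
  unfolding et_def et'_def c_def c'_def x_def
  by (rule derivative_eq_intros refl | simp)+
 have et_bound: "\<bar>et t\<bar> <= 2" if "t : {0..1}" for t
 proof -
  have "\<bar>c t\<bar> <= 2" unfolding c_def
   using abs_cos_le_one[of "2 * pi * x t"] abs_cos_le_one[of "2 * pi * (x t - p)"] by linarith
  moreover have "\<bar>t - t\<^sup>2\<bar> <= 1"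
  proof -
   have "t\<^sup>2 <= t" "0 <= t\<^sup>2" using that by (auto simp: power2_eq_square mult_left_le)
   then show ?thesis using that unfolding atLeastAtMost_iff by linarith
  qed
  ultimately have "\<bar>t - t\<^sup>2\<bar> * \<bar>c t\<bar> <= 1 * 2" by (intro mult_mono) auto
  then show ?thesis by (simp add: et_def abs_mult)
 qed
 have et_pos: "et t > 0" if t: "t : {0..1}" and n: "x t : \<nat>" for t
 proof -
  have "t ~= 0" "t ~= 1" using n a p by (auto simp: x_def)
  then have t01: "0 < t" "t < 1" using t by auto
  then have "0 < t - t\<^sup>2" by (simp add: power2_eq_square)
  moreover have "cos (2 * pi * x t) = 1"
   using n cos_2npi by (auto simp: Nats_def mult.commute mult.left_commute)
  moreover have "cos (2 * pi * (x t - p)) ~= 1"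
  proof
   assume "cos (2 * pi * (x t - p)) = 1"
   then obtain k :: int where "2 * pi * (x t - p) = of_int k * 2 * pi"
    using cos_one_2pi_int by auto
   then have "x t - p = of_int k" by simp
   moreover obtain n :: nat where "x t = of_nat n" using n by (auto simp: Nats_def)
   ultimately have "p = of_int (int n - k)" by simp
   moreover have "p > 0" using a p by simp
   ultimately have "p : \<nat>" by (metis Ints_of_int Nats_altdef2 mem_Collect_eq less_imp_le)
   then show False using p by simp
  qed
  ultimately show ?thesis using cos_le_one[of "2 * pi * (x t - p)"] unfolding et_def c_def by (intro mult_pos_pos) linarith+
 qed
 \<comment> \<open>Either a ball about x t lies in the domain of both factors, or x t is close to an
   integer; there the contour has to leave the axis, and the profile \<open>et\<close> is at least
   \<open>rh\<close>.\<close>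
 define P where "P rh t \<longleftrightarrow> ball (of_real (x t)) rh <= E \<or> (rh <= et t & ball (of_real (x t)) rh <= V)" for rh t
 obtain rh where rh: "rh > 0" "!!t. t : {0..1} ==> P rh t"
 proof (rule uniform_radius[of "{0..1::real}" P])
  fix t :: real assume t: "t : {0..1}"
  have ox: "open (x -` ball (x t) s)" for s using open_vimage[OF open_ball cont_x] .
  have near: "\<exists>d>0. \<forall>s. dist s t < d --> dist (x s) (x t) < rh" if "rh > 0" for rh
   using cont_x that unfolding continuous_on_iff by (metis UNIV_I)
  have nearet: "\<exists>d>0. \<forall>s. dist s t < d --> dist (et s) (et t) < rh" if "rh > 0" for rh
   using cont_et that unfolding continuous_on_iff by (metis UNIV_I)
  have ballsub: "ball (of_real (x s)) rh <= ball (of_real (x t) :: complex) (2 * rh)" if "dist (x s) (x t) < rh" for s rh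
  proof -
   have "dist (of_real (x s) :: complex) (of_real (x t)) < rh" using that by (simp add: dist_of_real)
   then show ?thesis by (smt (verit) dist_commute dist_triangle mem_ball subsetI)
  qed
  show "\<exists>rh>0. \<exists>d>0. \<forall>s\<in>{0..1}. dist s t < d --> P rh s"
  proof (cases "x t : \<nat>")
   case False
   then have "of_real (x t) : E" using of_real_sheet[of "x t"] x_pos[OF t] E by blast
   then obtain rh where "rh > 0" "ball (of_real (x t)) rh <= E" using E(1) openE by blast
   then have rh: "rh / 2 > 0" "ball (of_real (x t)) (2 * (rh / 2)) <= E" by auto
   then show ?thesis using near[OF rh(1)] ballsub[of _ "rh / 2"] unfolding P_def by (meson subset_trans)
  next
   case True
   have pos: "et t > 0" using et_pos[OF t True] .
   obtain rh0 where rh0: "rh0 > 0" "ball (of_real (x t)) rh0 <= V"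
    using of_real_V[OF x_pos[OF t]] open_V openE by blast
   define rh where "rh = min (rh0 / 2) (et t / 2)"
   have rh: "rh > 0" "2 * rh <= rh0" "2 * rh <= et t" using rh0 pos by (auto simp: rh_def)
   have sub: "ball (of_real (x t)) (2 * rh) <= V" using rh0 rh by (meson subset_ball subset_trans)
   obtain d1 where d1: "d1 > 0" "!!s. dist s t < d1 ==> dist (x s) (x t) < rh" using near[OF rh(1)] by blast
   obtain d2 where d2: "d2 > 0" "!!s. dist s t < d2 ==> dist (et s) (et t) < rh" using nearet[OF rh(1)] by blast
   have "P rh s" if "dist s t < min d1 d2" for s
   proof -
    have "ball (of_real (x s)) rh <= V" using ballsub[of s rh] d1 that sub by fastforce
    moreover have "rh <= et s" using d2(2)[of s] that rh by (auto simp: dist_real_def)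
    ultimately show ?thesis by (simp add: P_def)
   qed
   then show ?thesis using rh(1) d1(1) d2(1) by (metis min_less_iff_conj)
  qed
 next
  fix rh rh' s assume "P rh s" "0 < rh'" "rh' <= rh"
  then show "P rh' s" unfolding P_def by (meson order_trans subset_ball)
 qed auto
 \<comment> \<open>Near an integer the contour is lifted by at least de * rh > r, so moving z by
   less than r cannot push it back to the wrong side. The total displacement r + 2 * de is below rh,
   which keeps it in the balls.\<close>
 define de where "de = rh / 8"
 define r where "r = min (rh / 4) (de * rh / 2)"
 have "de > 0" "de * rh > 0" using rh(1) by (auto simp: de_def)
 moreover from this have "r < de * rh" unfolding r_def by linarith
 ultimately have r: "r > 0" "r <= rh / 4" "r < de * rh" "de > 0" using rh(1) by (auto simp: r_def)
 \<comment> \<open>u = 0 is the straight segment and u = 1 the bent contour. The intermediate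
   contours are available for z on the side e, where they provide the homotopy.\<close>
 define q where "q u z t = of_real t * z + (of_real (a * (1 - 2 * t)) + \<i> * of_real (e * u * de * et t))" for u t :: real and z :: complex
 \<comment> \<open>Oddness of the profile turns the argument of the second factor into a point of
   the same contour, so one membership argument serves both factors.\<close>
 have q_flip: "z - q u z t = q u z (1 - t)" for u z t
  unfolding q_def et_flip by (simp add: algebra_simps)
 have qE: "q u z t : E" if z: "z : ball (of_real p) r" and u: "u : {0..1}" and t: "t : {0..1}"
  and pos: "u = 1 \<or> 0 < e * Im z" for u z t
 proof -
  have nz: "norm (of_real p - z) < r" using z by (simp add: dist_norm)
  have "of_real (x t) - q u z t = of_real t * (of_real p - z) - \<i> * of_real (e * u * de * et t)"
   by (simp add: q_def x_def algebra_simps)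
  then have "norm (of_real (x t) - q u z t) <= norm (of_real t * (of_real p - z)) + norm (\<i> * of_real (e * u * de * et t))"
   using norm_triangle_ineq4 by metis
  also have "norm (of_real t * (of_real p - z)) <= r"
  proof -
   have "\<bar>t\<bar> * norm (of_real p - z) <= 1 * r" using t nz by (intro mult_mono) auto
   then show ?thesis by (simp add: norm_mult)
  qed
  also have "norm (\<i> * of_real (e * u * de * et t)) <= 2 * de"
  proof -
   have "\<bar>u\<bar> * (de * \<bar>et t\<bar>) <= 1 * (de * 2)"
    using u r et_bound[OF t] by (intro mult_mono) auto
   moreover have "norm (\<i> * of_real (e * u * de * et t)) = \<bar>u\<bar> * (de * \<bar>et t\<bar>)"
    using r by (simp add: norm_mult abs_mult del: of_real_mult)
   ultimately show ?thesis by simp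
  qed
  finally have "norm (of_real (x t) - q u z t) < rh" using r rh by (simp add: de_def)
  then have inb: "q u z t : ball (of_real (x t)) rh" by (simp add: dist_norm)
  show ?thesis
  proof (cases "ball (of_real (x t)) rh <= E")
   case False
   then have et: "rh <= et t" and "q u z t : V" using rh(2)[OF t] inb by (auto simp: P_def)
   have Im: "e * Im (q u z t) = t * (e * Im z) + u * (de * et t)"
    by (simp add: q_def algebra_simps)
   have det: "de * rh <= de * et t" using et r by simp
   have "0 < e * Im (q u z t)"
   proof (cases "0 < e * Im z")
    case True
    have "t ~= 0" using et rh by (auto simp: et_def)
    then have "0 < t * (e * Im z)" using t True by simp
    moreover have "0 <= u * (de * et t)" using u r et rh by auto
    ultimately show ?thesis using Im by linarith
   next
    case False
    then have "u = 1" using pos by simp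
    have "\<bar>e * Im z\<bar> <= norm (of_real p - z)"
     using abs_Im_le_cmod[of "of_real p - z"] by (simp add: abs_mult)
    then have "- (e * Im z) <= r" using nz by linarith
    moreover have "t * (- (e * Im z)) <= 1 * (- (e * Im z))" using t False by (intro mult_right_mono) auto
    ultimately have "t * (e * Im z) \<ge> - r" by linarith
    moreover have "e * Im (q u z t) = t * (e * Im z) + de * et t" using Im \<open>u = 1\<close> by simp
    ultimately show ?thesis using det r by linarith
   qed
   then have "q u z t : half V e" using \<open>q u z t : V\<close> by (simp add: half_def)
   then show ?thesis using half_subset_sheet E by blast
  qed (use inb in blast)
 qed
 define ga where "ga t = of_real (a * (1 - 2 * t)) + \<i> * of_real (e * de * et t)" for t
 define ga' where "ga' t = of_real (- 2 * a) + \<i> * of_real (e * de * et' t)" for t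
 have qga: "q 1 z t = of_real t * z + ga t" for z t by (simp add: q_def ga_def)
 have cont: "continuous_on S ga" "continuous_on S ga'" for S
  unfolding ga_def ga'_def
  by (intro continuous_intros continuous_on_subset[OF cont_et] continuous_on_subset[OF cont_et'] subset_UNIV)+
 define ph where "ph z = integral {0..1} (%t. A (of_real t * z + ga t) * B (z - (of_real t * z + ga t)) * (z + ga' t))" for z
 have hol: "ph holomorphic_on ball (of_real p) r"
  unfolding ph_def
 proof (rule holomorphic_moving_convolution_integral[OF EA(3,1) EB(3,1) cont])
  fix z :: complex and t :: real assume zt: "z : ball (of_real p) r" "t : {0..1}"
  show "of_real t * z + ga t : EA" using qE[OF zt(1) _ zt(2), of 1] qga[of z t] by (simp add: E_def)
  show "z - (of_real t * z + ga t) : EB"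
   using qE[OF zt(1), of 1 "1 - t"] zt q_flip[of z 1 t] qga[of z t] by (simp add: E_def)
 qed simp
 show ?thesis
 proof (rule that[OF r(1) hol])
  fix z :: complex assume z: "z : ball (of_real p) r" "0 < e * Im z"
  define g where "g t = of_real t * z + ga t" for t
  define O' where "O' = EA \<inter> (%s. z - s) -` EB"
  have "open O'" unfolding O'_def
   using EA(1) EB(1) by (intro open_Int open_vimage continuous_intros) auto
  have holO: "(%s. A s * B (z - s)) holomorphic_on O'"
   unfolding O'_def
   by (intro holomorphic_intros holomorphic_on_subset[OF EA(3)]
     holomorphic_on_compose_gen[of "%s. z - s" _ B EB, unfolded o_def]) (use EB in auto)
  have gad: "(ga has_vector_derivative ga' t) (at t)" for t
  proof -
   have "((%t. of_real (a * (1 - 2 * t)) :: complex) has_vector_derivative of_real (- 2 * a)) (at t)"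
    by (rule has_vector_derivative_of_real) (auto intro!: derivative_eq_intros)
   moreover have "((%t. of_real (e * de * et t) :: complex) has_vector_derivative of_real (e * de * et' t)) (at t)"
    by (rule has_vector_derivative_of_real) (auto intro!: derivative_eq_intros et_deriv)
   ultimately show ?thesis unfolding ga_def ga'_def
    by (intro has_vector_derivative_add has_vector_derivative_mult_right)
  qed
  have gd: "(g has_vector_derivative (z + ga' t)) (at t)" for t
  proof -
   have "((%t. of_real t * z) has_vector_derivative 1 * z) (at t)"
    using has_vector_derivative_of_real[OF DERIV_ident[of "at t"]]
    by (intro has_vector_derivative_mult_left) simp
   then show ?thesis unfolding g_def using gad by (auto intro!: has_vector_derivative_add)
  qed
  have "g C1_differentiable_on {0..1}"
   unfolding C1_differentiable_on_def using gd
   by (intro exI[of _ "%t. z + ga' t"]) (auto intro!: continuous_intros cont)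
  then have vg: "valid_path g"
   unfolding valid_path_def by (rule C1_differentiable_imp_piecewise)
  have "homotopic_paths O' (linepath (of_real a) (z - of_real a)) g"
  proof (rule homotopic_paths_linear)
   show "path g" using vg by (rule valid_path_imp_path)
   show "pathstart g = pathstart (linepath (of_real a) (z - of_real a))"
    "pathfinish g = pathfinish (linepath (of_real a) (z - of_real a))"
    by (auto simp: pathstart_def pathfinish_def g_def ga_def et_def linepath_def algebra_simps)
   fix t :: real assume t: "t : {0..1}"
   show "closed_segment (linepath (of_real a) (z - of_real a) t) (g t) <= O'"
   proof
    fix w assume "w : closed_segment (linepath (of_real a) (z - of_real a) t) (g t)"
    then obtain u where u: "u : {0..1}"
     "w = (1 - u) *\<^sub>R linepath (of_real a) (z - of_real a) t + u *\<^sub>R g t"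
     by (auto simp: closed_segment_def)
    have "w = q u z t"
     unfolding u(2) by (simp add: q_def g_def ga_def linepath_def scaleR_conv_of_real algebra_simps)
    then show "w : O'"
     using qE[OF z(1) u(1) t] qE[OF z(1) u(1), of "1 - t"] q_flip[of z u t] t z(2)
     by (auto simp: O'_def E_def)
   qed
  qed (auto)
  then have "pass (of_real a) A B z = contour_integral g (%s. A s * B (z - s))"
   unfolding pass_def by (rule Cauchy_theorem_homotopic_paths[OF _ \<open>open O'\<close> holO]) (use vg in auto)
  also have "\<dots> = ph z"
   unfolding contour_integral_integral ph_def vector_derivative_at[OF gd] by (simp add: g_def)
  finally show "ph z = pass (of_real a) A B z" by simp
 qed
qed

end

section \<open>Convolution along rays with an integrable singularity at 0\<close>

lemma set_integrable_lborel_imp_absolutely_integrable: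
 fixes f :: "real => 'a::euclidean_space"
 assumes "set_integrable lborel {a..b} f"
 shows "f absolutely_integrable_on {a..b}"
 using assms unfolding set_integrable_def
 by (subst integrable_completion) (auto intro: borel_measurable_integrable)

text \<open>Otherwise H is at least c / t near 0, and 1 / t is not integrable there.\<close>

lemma integrable_imp_small_at_0:
 fixes H :: "real => real"
 assumes H: "set_integrable lborel {0..1} H" and "0 < c" "0 < d"
 shows "\<exists>t. 0 < t & t < d & t < 1 & t * H t < c"
proof (rule ccontr)
 assume no: "\<not> ?thesis"
 have neg: "c <= t * H t" if "0 < t" "t < d" "t < 1" for t
  using no that by (meson not_le)
 define d' where "d' = min d 1 / 2"
 have d': "0 < d'" "d' < d" "d' < 1" using assms by (auto simp: d'_def)
 have aH: "H absolutely_integrable_on {0..1}" using set_integrable_lborel_imp_absolutely_integrable[OF H] .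
 then have iH: "(%t. norm (H t)) integrable_on {0..1}" by (simp add: absolutely_integrable_on_def)
 define M where "M = integral {0..1} (%t. norm (H t))"
 \<comment> \<open>Chosen so that c / t has integral \<bar>M\<bar> + 1 over [de, d'], more than the
   whole integral of the absolute value of H.\<close>
 define de where "de = d' * exp (- ((\<bar>M\<bar> + 1) / c))"
 have de: "0 < de" "de < d'"
 proof -
  have "0 < (\<bar>M\<bar> + 1) / c" using assms by (intro divide_pos_pos) auto
  then show "0 < de" "de < d'" using d' by (auto simp: de_def)
 qed
 have "((%t. c / t) has_integral (c * ln d' - c * ln de)) {de..d'}"
 proof (rule fundamental_theorem_of_calculus)
  fix x assume "x : {de..d'}"
  then have "x > 0" using de by auto
  then show "((%t. c * ln t) has_vector_derivative c / x) (at x within {de..d'})"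
   by (auto intro!: derivative_eq_intros simp: has_real_derivative_iff_has_vector_derivative[symmetric])
 qed (use de in auto)
 moreover have "c * ln d' - c * ln de = \<bar>M\<bar> + 1"
  using d' assms by (simp add: de_def ln_mult field_simps)
 ultimately have hi: "((%t. c / t) has_integral (\<bar>M\<bar> + 1)) {de..d'}" by simp
 have "integral {de..d'} (%t. c / t) <= integral {de..d'} (%t. norm (H t))"
 proof (rule integral_le)
  show "(%t. c / t) integrable_on {de..d'}" using hi by blast
  show "(%t. norm (H t)) integrable_on {de..d'}"
   by (rule integrable_on_subinterval[OF iH]) (use de d' in auto)
  fix t assume "t : {de..d'}"
  then have t: "0 < t" "t < d" "t < 1" using de d' by auto
  have "c / t <= H t" using neg[OF t] t by (simp add: divide_le_eq mult.commute)
  then show "c / t <= norm (H t)" by simp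
 qed
 also have "\<dots> <= M" unfolding M_def
 proof (rule integral_subset_le)
  show "{de..d'} <= {0..1}" using de d' by auto
  then show "(%t. norm (H t)) integrable_on {de..d'}" by (rule integrable_on_subinterval[OF iH])
 qed (use iH in auto)
 finally show False using integral_unique[OF hi] by linarith
qed

text \<open>The condition of \<open>integrable_at_0\<close> for a plain function on a domain,
  detached from the surface.\<close>

definition radially_integrable :: "complex set => (complex => complex) => bool" where
 "radially_integrable D F \<longleftrightarrow>
   (\<forall>K. compact K & K <= D -->
    (\<exists>H::real => real. set_integrable lborel {0..1} H &
      (\<forall>p\<in>K. \<forall>t\<in>{0<..1}. norm (F (of_real t * p)) <= H t)))"

lemma absolutely_integrable_dominated_half_open:
 fixes f :: "real => complex"
 assumes f: "continuous_on {0<..1} f" and H: "set_integrable lborel {0..1} H"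
  and le: "!!t. t : {0<..1} ==> norm (f t) <= H t"
 shows "f absolutely_integrable_on {0..1}"
proof -
 have "f absolutely_integrable_on {0<..1}"
 proof (rule measurable_bounded_by_integrable_imp_absolutely_integrable)
  show "f : borel_measurable (lebesgue_on {0<..1})"
   using f by (intro continuous_imp_measurable_on_sets_lebesgue) auto
  have "H absolutely_integrable_on {0..1}" using set_integrable_lborel_imp_absolutely_integrable[OF H] .
  then have "H absolutely_integrable_on {0<..1}"
   by (rule set_integrable_subset) auto
  then show "H integrable_on {0<..1}" using absolutely_integrable_on_def by blast
 qed (use le in auto)
 then show ?thesis
  by (rule absolutely_integrable_spike_set) (rule negligible_subset[of "{0}"]; auto)+
qed

text \<open>A combination of t z and s w with weights u and v is a real multiple of a convex
  combination of z and w whose weights are proportional to u t and v s.\<close>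

lemma convex_truncated_cone:
 assumes "convex C"
 shows "convex {of_real t * z |t z. 0 < t & t <= 1 & z : (C::complex set)}" (is "convex ?T")
proof (rule convexI)
 fix x y and u v :: real assume x: "x : ?T" and y: "y : ?T" and uv: "0 <= u" "0 <= v" "u + v = 1"
 from x obtain t z where t: "0 < t" "t <= 1" "z : C" "x = of_real t * z" by blast
 from y obtain s w where s: "0 < s" "s <= 1" "w : C" "y = of_real s * w" by blast
 define m where "m = u * t + v * s"
 have "m > 0" unfolding m_def using uv t s
  by (cases "u = 0") (auto intro: add_pos_nonneg)
 moreover have "m <= 1" unfolding m_def using uv t s convex_bound_le[of t 1 s u v] by simp
 moreover have "(u * t / m) *\<^sub>R z + (v * s / m) *\<^sub>R w : C"
  using \<open>m > 0\<close> uv t s by (intro convexD[OF assms]) (auto simp: m_def simp flip: add_divide_distrib)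
 moreover have "u *\<^sub>R x + v *\<^sub>R y = of_real m * ((u * t / m) *\<^sub>R z + (v * s / m) *\<^sub>R w)"
  using \<open>m > 0\<close> by (simp add: t s scaleR_conv_of_real field_simps)
 ultimately show "u *\<^sub>R x + v *\<^sub>R y : ?T" by blast
qed

lemma contour_integral_linepath_neg: "contour_integral (linepath b a) f = - contour_integral (linepath a b) f"
 by (metis contour_integral_reversepath reversepath_linepath valid_path_linepath)

lemma contour_integral_triangle:
 assumes "f holomorphic_on (convex hull {a,b,c})"
 shows "contour_integral (linepath a b) f + contour_integral (linepath b c) f = contour_integral (linepath a c) f"
proof -
 have c: "continuous_on (convex hull {a,b,c}) f" using assms holomorphic_on_imp_continuous_on by blast
 have int: "(f has_contour_integral contour_integral (linepath x y) f) (linepath x y)"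
  if "x : {a,b,c}" "y : {a,b,c}" for x y
 proof (intro has_contour_integral_integral contour_integrable_continuous_linepath continuous_on_subset[OF c])
  show "closed_segment x y <= convex hull {a,b,c}"
   unfolding segment_convex_hull by (rule hull_mono) (use that in auto)
 qed
 have "(f has_contour_integral (contour_integral (linepath a b) f + (contour_integral (linepath b c) f + contour_integral (linepath c a) f)))
   (linepath a b +++ linepath b c +++ linepath c a)"
  by (intro has_contour_integral_join int valid_path_join valid_path_linepath) auto
 then have "contour_integral (linepath a b) f + (contour_integral (linepath b c) f + contour_integral (linepath c a) f) = 0"
  using has_contour_integral_unique Cauchy_theorem_triangle[OF assms] by blast
 then show ?thesis
  unfolding contour_integral_linepath_neg[of c a] by (simp add: algebra_simps)
qed

lemma contour_integral_quadrilateral: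
 assumes "f holomorphic_on (convex hull {a,b,c,d})"
 shows "contour_integral (linepath a b) f + contour_integral (linepath b c) f =
     contour_integral (linepath a d) f + contour_integral (linepath d c) f"
proof -
 have "convex hull {a,b,c} <= convex hull {a,b,c,d}" "convex hull {a,d,c} <= convex hull {a,b,c,d}"
  by (rule hull_mono; blast)+
 then have "f holomorphic_on convex hull {a,b,c}" "f holomorphic_on convex hull {a,d,c}"
  using holomorphic_on_subset[OF assms] by auto
 from contour_integral_triangle[OF this(1)] contour_integral_triangle[OF this(2)]
 show ?thesis by simp
qed

text \<open>Cauchy's theorem for the triangle 0, p, q although 0 itself may be singular. The corner
  is cut off at heights t n with t n * H (t n) tending to 0; the cut has length t n * norm (q - p)
  and the values on it are at most H (t n), so its contribution vanishes in the limit.\<close>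

lemma triangle_at_0:
 assumes Ph: "Ph holomorphic_on {of_real t * w |t w. 0 < t & t <= 1 & w : closed_segment p q}"
  and H: "set_integrable lborel {0..1} H"
  and le: "!!w t. [|w : closed_segment p q; t : {0<..1}|] ==> norm (Ph (of_real t * w)) <= H t"
 shows "(%t. Ph (of_real t * p)) absolutely_integrable_on {0..1}"
  and "contour_integral (linepath 0 p) Ph + contour_integral (linepath p q) Ph = contour_integral (linepath 0 q) Ph"
proof -
 define T where "T = {of_real t * w |t w. 0 < t & t <= 1 & w : closed_segment p q}"
 have PhT: "Ph holomorphic_on T" using Ph by (simp add: T_def)
 have T: "convex T" unfolding T_def by (rule convex_truncated_cone) simp
 have int: "(%t. Ph (of_real t * w)) absolutely_integrable_on {0..1}" if w: "w : closed_segment p q" for w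
 proof (rule absolutely_integrable_dominated_half_open[OF _ H])
  show "continuous_on {0<..1} (%t. Ph (of_real t * w))"
   by (rule continuous_on_compose2[OF holomorphic_on_imp_continuous_on[OF PhT]])
     (use w in \<open>force intro!: continuous_intros simp: T_def\<close>)+
 qed (use le w in auto)
 then show "(%t. Ph (of_real t * p)) absolutely_integrable_on {0..1}" by simp
 have ray: "contour_integral (linepath 0 w) Ph = integral {0..1} (%t. Ph (of_real t * w) * w)" for w
  unfolding contour_integral_integral by (simp add: linepath_def scaleR_conv_of_real)
 have intw: "(%t. Ph (of_real t * w) * w) integrable_on {0..1}" if "w : closed_segment p q" for w
  using set_lebesgue_integral_eq_integral(1)[OF int[OF that]] by (intro integrable_on_mult_left)
 have part: "contour_integral (linepath (of_real de * w) w) Ph = integral {de..1} (%t. Ph (of_real t * w) * w)"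
  if w: "w : closed_segment p q" and de: "0 < de" "de < 1" for w de
 proof -
  have "continuous_on (closed_segment (of_real de * w) w) Ph"
  proof (rule continuous_on_subset[OF holomorphic_on_imp_continuous_on[OF PhT]], rule subsetI)
   fix x assume "x : closed_segment (of_real de * w) w"
   then obtain u where u: "0 <= u" "u <= 1" "x = (1 - u) *\<^sub>R (of_real de * w) + u *\<^sub>R w"
    by (auto simp: closed_segment_def)
   have "x = of_real ((1 - u) * de + u) * w" using u by (simp add: scaleR_conv_of_real algebra_simps)
   moreover have "(1 - u) * de + u * 1 <= 1" using u de by (intro convex_bound_le) auto
   moreover have "0 < (1 - u) * de + u" using u de by (cases "u = 0") (auto intro: add_nonneg_pos)
   ultimately show "x : T" unfolding T_def using w
    by (intro CollectI exI[of _ "(1 - u) * de + u"] exI[of _ w]) auto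
  qed
  then have "(Ph has_contour_integral contour_integral (linepath (of_real de * w) w) Ph) (linepath (of_real de * w) w)"
   by (intro has_contour_integral_integral contour_integrable_continuous_linepath)
  then have *: "((%x. Ph (linepath (of_real de * w) w x) * (w - of_real de * w)) has_integral contour_integral (linepath (of_real de * w) w) Ph) {0..1}"
   by (simp add: has_contour_integral_linepath)
  define G where "G t = Ph (of_real t * w) * w" for t
  define J where "J = contour_integral (linepath (of_real de * w) w) Ph"
  have "((%x. (1 - de) *\<^sub>R G ((1 - de) * x + de)) has_integral J) {0..1}"
   unfolding J_def using *
   by (rule has_integral_eq[rotated]) (auto simp: G_def linepath_def scaleR_conv_of_real algebra_simps)
  then have "((%x. (1 / (1 - de)) *\<^sub>R ((1 - de) *\<^sub>R G ((1 - de) * x + de))) has_integral (1 / (1 - de)) *\<^sub>R J) {0..1}"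
   by (rule has_integral_cmul)
  then have 1: "((%x. G ((1 - de) * x + de)) has_integral (1 / (1 - de)) *\<^sub>R J) {0..1}"
   using de by simp
  have "G integrable_on {de..1}"
   unfolding G_def by (rule integrable_on_subinterval[OF intw[OF w]]) (use de in auto)
  then have 2: "(G has_integral integral {de..1} G) (cbox de 1)"
   unfolding cbox_interval by (rule integrable_integral)
  have 3: "((%x. G ((1 - de) * x + de)) has_integral (1 / (1 - de)) *\<^sub>R integral {de..1} G)
    ((%x. (1 / (1 - de)) * x + (- de / (1 - de))) ` {de..1})"
   using has_integral_affinity[OF 2, of "1 - de" de] de by simp
  have 4: "(%x. (1 / (1 - de)) * x + (- de / (1 - de))) ` {de..1} = {0..1}"
  proof -
   have "1 / (1 - de) * 1 + - de / (1 - de) = (1 - de) / (1 - de)"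
    unfolding diff_divide_distrib by simp
   then have "1 / (1 - de) * 1 + - de / (1 - de) = 1" "1 / (1 - de) * de + - de / (1 - de) = 0"
    using de by auto
   then show ?thesis using de by (subst image_affinity_atLeastAtMost) auto
  qed
  have "(1 / (1 - de)) *\<^sub>R J = (1 / (1 - de)) *\<^sub>R integral {de..1} G"
   using has_integral_unique[OF 1] 3 unfolding 4 by blast
  then have "J = integral {de..1} G" using de by simp
  then show ?thesis unfolding J_def G_def .
 qed
 define I where "I w de = integral {de..1} (%t. Ph (of_real t * w) * w)" for w de
 define t where "t n = (SOME t. 0 < t & t < 1 / (of_nat n + 1) & t < 1 & t * H t < 1 / (of_nat n + 1))" for n :: nat
 have t: "0 < t n & t n < 1 / (of_nat n + 1) & t n < 1 & t n * H (t n) < 1 / (of_nat n + 1)" for n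
  unfolding t_def
  by (rule someI_ex) (use integrable_imp_small_at_0[OF H, of "1 / (of_nat n + 1)" "1 / (of_nat n + 1)"] in auto)
 have inv0: "(%n. 1 / (of_nat n + 1) :: real) \<longlonglongrightarrow> 0"
  using LIMSEQ_inverse_real_of_nat by (simp add: inverse_eq_divide add.commute)
 have t0: "t \<longlonglongrightarrow> 0"
  by (rule tendsto_sandwich[OF _ _ tendsto_const inv0]) (use t in \<open>auto intro!: always_eventually less_imp_le\<close>)
 have lim: "(%n. I w (t n)) \<longlonglongrightarrow> contour_integral (linepath 0 w) Ph" if w: "w : closed_segment p q" for w
 proof -
  have "continuous_on {0..1} (%x. integral {x..1} (%t. Ph (of_real t * w) * w))"
   by (rule indefinite_integral_continuous_1'[OF intw[OF w]])
  then have "((%n. I w (t n)) \<longlongrightarrow> I w 0) sequentially"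
   unfolding I_def
   by (rule continuous_on_tendsto_compose[OF _ t0]) (use t in \<open>auto intro!: always_eventually less_imp_le\<close>)
  then show ?thesis by (simp add: I_def ray)
 qed
 have eq: "I p (t n) + contour_integral (linepath p q) Ph - I q (t n) = contour_integral (linepath (of_real (t n) * p) (of_real (t n) * q)) Ph" for n
 proof -
  have "Ph holomorphic_on convex hull {of_real (t n) * p, p, q, of_real (t n) * q}"
  proof (rule holomorphic_on_subset[OF PhT], rule hull_minimal[of _ _ convex, OF _ T])
   show "{of_real (t n) * p, p, q, of_real (t n) * q} <= T"
    using t[of n] unfolding T_def
    by (auto intro: exI[of _ "t n"] exI[of _ "1::real"] exI[of _ p] exI[of _ q] less_imp_le)
  qed
  from contour_integral_quadrilateral[OF this]
  show ?thesis using part[of p "t n"] part[of q "t n"] t[of n] by (simp add: I_def algebra_simps)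
 qed
 have "(%n. contour_integral (linepath (of_real (t n) * p) (of_real (t n) * q)) Ph) \<longlonglongrightarrow> 0"
 proof (rule Lim_null_comparison)
  have seg: "x : T & norm (Ph x) <= H (t n)" if x: "x : closed_segment (of_real (t n) * p) (of_real (t n) * q)" for x n
  proof -
   obtain u where u: "0 <= u" "u <= 1" "x = (1 - u) *\<^sub>R (of_real (t n) * p) + u *\<^sub>R (of_real (t n) * q)"
    using x by (auto simp: closed_segment_def)
   define y where "y = (1 - u) *\<^sub>R p + u *\<^sub>R q"
   have y: "x = of_real (t n) * y" "y : closed_segment p q"
    using u by (auto simp: y_def closed_segment_def scaleR_conv_of_real algebra_simps)
   have "x : T" unfolding T_def y(1) using y(2) t[of n]
    by (intro CollectI exI[of _ "t n"] exI[of _ y]) auto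
   then show ?thesis using le[OF y(2), of "t n"] t[of n] y(1) by auto
  qed
  have "norm (contour_integral (linepath (of_real (t n) * p) (of_real (t n) * q)) Ph) <= norm (q - p) * (1 / (of_nat n + 1))" for n
  proof -
   have "continuous_on (closed_segment (of_real (t n) * p) (of_real (t n) * q)) Ph"
    by (rule continuous_on_subset[OF holomorphic_on_imp_continuous_on[OF PhT]]) (use seg in blast)
   then have "norm (contour_integral (linepath (of_real (t n) * p) (of_real (t n) * q)) Ph) <= H (t n) * norm (of_real (t n) * q - of_real (t n) * p)"
    using seg[of _ n] order_trans[OF norm_ge_zero]
    by (intro has_contour_integral_bound_linepath[OF has_contour_integral_integral[OF contour_integrable_continuous_linepath]]) auto
   also have "\<dots> = norm (q - p) * (t n * H (t n))"
    using t[of n] by (simp add: norm_mult flip: right_diff_distrib)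
   also have "\<dots> <= norm (q - p) * (1 / (of_nat n + 1))" using t[of n] by (intro mult_left_mono) auto
   finally show ?thesis .
  qed
  then show "\<forall>\<^sub>F n in sequentially. norm (contour_integral (linepath (of_real (t n) * p) (of_real (t n) * q)) Ph) <= norm (q - p) * (1 / (of_nat n + 1))"
   by simp
  show "(%n. norm (q - p) * (1 / (of_nat n + 1))) \<longlonglongrightarrow> 0" using tendsto_mult_left[OF inv0] by simp
 qed
 moreover have "(%n. I p (t n) + contour_integral (linepath p q) Ph - I q (t n)) \<longlonglongrightarrow>
   contour_integral (linepath 0 p) Ph + contour_integral (linepath p q) Ph - contour_integral (linepath 0 q) Ph"
  by (intro tendsto_intros lim) auto
 ultimately have "contour_integral (linepath 0 p) Ph + contour_integral (linepath p q) Ph - contour_integral (linepath 0 q) Ph = 0"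
  unfolding eq using LIMSEQ_unique by blast
 then show "contour_integral (linepath 0 p) Ph + contour_integral (linepath p q) Ph = contour_integral (linepath 0 q) Ph" by simp
qed

lemma has_contour_integral_linepath_flip:
 assumes "(f has_contour_integral J) (linepath u v)"
 shows "((%s. f (z - s)) has_contour_integral - J) (linepath (z - u) (z - v))"
proof -
 have "((%x. f (linepath u v x) * (v - u)) has_integral J) {0..1}"
  using assms by (simp add: has_contour_integral_linepath)
 then have "((%x. - (f (linepath u v x) * (v - u))) has_integral - J) {0..1}"
  by (rule has_integral_neg)
 then show ?thesis
  unfolding has_contour_integral_linepath
  by (rule has_integral_eq[rotated]) (auto simp: linepath_def scaleR_conv_of_real algebra_simps)
qed

lemma contour_integral_linepath_flip:
 "contour_integral (linepath (z - u) (z - v)) (%s. f (z - s)) = - contour_integral (linepath u v) f"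
proof -
 have "z - linepath (z - u) (z - v) x = linepath u v x" for x
  by (simp add: linepath_def scaleR_conv_of_real algebra_simps)
 then have "(%x. f (z - linepath (z - u) (z - v) x) * (z - v - (z - u))) = (%x. - (f (linepath u v x) * (v - u)))"
  by (simp add: fun_eq_iff right_diff_distrib)
 then show ?thesis
  unfolding contour_integral_integral vector_derivative_linepath_at by (simp only: integral_neg)
qed

lemma radially_integrable_ray:
 assumes A: "A holomorphic_on C" "radially_integrable C A"
  and star: "!!z t. [|z : C; 0 < t; t <= 1|] ==> of_real t * z : C" and a: "a : C"
 shows "(%t. A (of_real t * a)) absolutely_integrable_on {0..1}"
proof -
 obtain H where H: "set_integrable lborel {0..1} H" "\<forall>p\<in>{a}. \<forall>t\<in>{0<..1}. norm (A (of_real t * p)) <= H t"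
  using A(2) a unfolding radially_integrable_def by (metis compact_sing empty_subsetI insert_subset)
 have "continuous_on {0<..1} (%t. A (of_real t * a))"
  by (rule continuous_on_compose2[OF holomorphic_on_imp_continuous_on[OF A(1)]])
    (use star a in \<open>auto intro!: continuous_intros\<close>)
 then show ?thesis using absolutely_integrable_dominated_half_open[OF _ H(1)] H(2) by blast
qed

lemma ray_part_analytic:
 assumes A: "(%t. A (of_real t * a)) absolutely_integrable_on {0..1}"
  and B: "B analytic_on P" and ray: "!!t. t : {0..1} ==> z0 - of_real t * a : P"
 shows "ray_part a A B analytic_on {z0}"
proof -
 have "(%t. A (of_real t * a) * a) absolutely_integrable_on {0..1}"
  using continuous_bounded_times_absolutely_integrable[OF A, of "%_. a"] by simp
 then have "(%z. integral {0..1} (%t. (A (of_real t * a) * a) * B (z - of_real t * a))) analytic_on {z0}"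
  by (rule analytic_convolution_integral[OF _ _ B]) (auto intro!: continuous_intros ray)
 moreover have "ray_part a A B = (%z. integral {0..1} (%t. (A (of_real t * a) * a) * B (z - of_real t * a)))"
  unfolding ray_part_def contour_integral_integral
  by (simp add: fun_eq_iff linepath_def scaleR_conv_of_real mult_ac)
 ultimately show ?thesis by simp
qed

text \<open>The factor B (z - s) stays bounded while s runs over the triangle 0, p, q, so the radial
  majorant of A alone provides the one that \<open>triangle_at_0\<close> asks for.\<close>

lemma ray_part_bend:
 assumes C: "convex C" and star: "!!z t. [|z : C; 0 < t; t <= 1|] ==> of_real t * z : C"
  and A: "A holomorphic_on C" "radially_integrable C A" and B: "B holomorphic_on C"
  and p: "p : C" "z - p : C" and q: "q : C" "z - q : C" and z: "z : C"
 shows "(%s. A s * B (z - s)) contour_integrable_on linepath 0 p"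
  and "ray_part p A B z + contour_integral (linepath p q) (%s. A s * B (z - s)) = ray_part q A B z"
proof -
 define Ph where "Ph s = A s * B (z - s)" for s
 have seg: "w : C & z - w : C" if w: "w : closed_segment p q" for w
 proof
  show "w : C" using closed_segment_subset[OF p(1) q(1) C] w by blast
  obtain u where u: "0 <= u" "u <= 1" "w = (1 - u) *\<^sub>R p + u *\<^sub>R q" using w by (auto simp: closed_segment_def)
  have "z - w = (1 - u) *\<^sub>R (z - p) + u *\<^sub>R (z - q)" using u by (simp add: algebra_simps)
  then show "z - w : C" using convexD[OF C p(2) q(2), of "1 - u" u] u by simp
 qed
 have zt: "z - of_real t * w : C" if "w : closed_segment p q" "0 <= t" "t <= 1" for w t
 proof -
  have "z - of_real t * w = (1 - t) *\<^sub>R z + t *\<^sub>R (z - w)" by (simp add: scaleR_conv_of_real algebra_simps)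
  then show ?thesis using convexD[OF C z, of "z - w" "1 - t" t] seg that by simp
 qed
 obtain H where H: "set_integrable lborel {0..1} H"
  "\<forall>w\<in>closed_segment p q. \<forall>t\<in>{0<..1}. norm (A (of_real t * w)) <= H t"
  using A(2)[unfolded radially_integrable_def, rule_format, of "closed_segment p q"]
   closed_segment_subset[OF p(1) q(1) C] by auto
 have HA: "norm (A (of_real t * w)) <= H t" if "w : closed_segment p q" "t : {0<..1}" for w t
  using that H(2) by blast
 define K where "K = (%(t, w). z - of_real t * w) ` ({0..1::real} \<times> closed_segment p q)"
 have "compact K" unfolding K_def case_prod_unfold
  by (intro compact_continuous_image compact_Times continuous_intros) auto
 moreover have "K <= C" using zt by (auto simp: K_def)
 ultimately have "bounded (B ` K)"
  using B by (intro compact_imp_bounded compact_continuous_image)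
   (auto intro: continuous_on_subset holomorphic_on_imp_continuous_on)
 then obtain M where M: "M > 0" "!!x. x : K ==> norm (B x) <= M" by (auto simp: bounded_pos)
 define T where "T = {of_real t * w |t w. 0 < t & t <= 1 & w : closed_segment p q}"
 have PhT: "Ph holomorphic_on T"
 proof -
  have "T <= C" "(%s. z - s) ` T <= C" using star seg zt by (auto simp: T_def)
  then have "(B \<circ> (%s. z - s)) holomorphic_on T"
   by (intro holomorphic_on_compose_gen[OF _ B]) (auto intro: holomorphic_intros)
  then show ?thesis unfolding Ph_def
   using holomorphic_on_subset[OF A(1) \<open>T <= C\<close>] by (auto intro!: holomorphic_intros simp: o_def)
 qed
 have HM: "set_integrable lborel {0..1} (%t. H t * M)" using H(1) by (rule set_integrable_mult_left)
 have le: "norm (Ph (of_real t * w)) <= H t * M" if w: "w : closed_segment p q" "t : {0<..1}" for w t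
 proof -
  have "norm (B (z - of_real t * w)) <= M" using w by (intro M(2)) (force simp: K_def)
  then show ?thesis unfolding Ph_def norm_mult
   using HA[OF w] order_trans[OF norm_ge_zero HA[OF w]] by (intro mult_mono) auto
 qed
 note tri = triangle_at_0[OF PhT[unfolded T_def] HM le]
 have "(%t. Ph (of_real t * p) * p) absolutely_integrable_on {0..1}"
  using continuous_bounded_times_absolutely_integrable[OF tri(1), of "%_. p"] by simp
 then have "(%t. Ph (of_real t * p) * p) integrable_on {0..1}"
  using set_lebesgue_integral_eq_integral(1) by blast
 then show "(%s. A s * B (z - s)) contour_integrable_on linepath 0 p"
  unfolding contour_integrable_on Ph_def by (simp add: linepath_def scaleR_conv_of_real)
 show "ray_part p A B z + contour_integral (linepath p q) (%s. A s * B (z - s)) = ray_part q A B z"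
  using tri(2) by (simp add: ray_part_def Ph_def)
qed

text \<open>The segment is halved at z / 2, and the reflection s -> z - s turns the second half into
  a \<open>ray_part\<close> with the factors exchanged. Bending both halves from z / 2 to the common
  point a leaves two connecting segments, which together make up \<open>pass\<close>.\<close>

lemma has_contour_integral_convolution:
 assumes C: "convex C" and star: "!!z t. [|z : C; 0 < t; t <= 1|] ==> of_real t * z : C"
  and A: "A holomorphic_on C" "radially_integrable C A"
  and B: "B holomorphic_on C" "radially_integrable C B"
  and z: "z : C" and a: "a : C" "z - a : C"
 shows "((%s. A s * B (z - s)) has_contour_integral (ray_part a A B z + pass a A B z + ray_part a B A z)) (linepath 0 z)"
proof -
 define Ph where "Ph s = A s * B (z - s)" for s
 define h where "h = z / 2"
 have h: "h : C" "z - h : C" "z - h = h" using star[OF z, of "1/2"] by (auto simp: h_def)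
 have 1: "(Ph has_contour_integral ray_part h A B z) (linepath 0 h)"
  unfolding ray_part_def Ph_def
  by (rule has_contour_integral_integral, rule ray_part_bend(1)[OF C star A B(1) h(1,2) h(1,2) z])
 have "((%s. B s * A (z - s)) has_contour_integral ray_part h B A z) (linepath 0 h)"
  unfolding ray_part_def
  by (rule has_contour_integral_integral, rule ray_part_bend(1)[OF C star B A(1) h(1,2) h(1,2) z])
 from has_contour_integral_linepath_flip[OF this, of z]
 have "(Ph has_contour_integral - ray_part h B A z) (linepath z h)"
  by (simp add: h(3) Ph_def[abs_def] mult.commute)
 from has_contour_integral_reversepath[OF _ this]
 have 2: "(Ph has_contour_integral ray_part h B A z) (linepath h z)" by (simp add: reversepath_linepath)
 have 3: "(Ph has_contour_integral (ray_part h A B z + ray_part h B A z)) (linepath 0 z)"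
  by (rule has_contour_integral_split[OF 1 2, of "1/2"]) (auto simp: h_def scaleR_conv_of_real)
 have seg: "convex hull {a, h, z - a} <= C" using a h C by (intro hull_minimal) auto
 have "(%s. z - s) ` (convex hull {a, h, z - a}) <= C"
 proof -
  have "convex ((%s. z - s) -` C)"
   using convex_linear_vimage[of "%s. - s" "(+) (-z) ` C"] C
  proof -
   have "(%s. z - s) -` C = (%s. z - s) ` C" by (force simp: image_iff)
   also have "\<dots> = (%s. z + s) ` ((%s. - s) ` C)" by (simp add: image_image)
   finally show ?thesis using C by (simp add: convex_negations convex_translation)
  qed
  then have "convex hull {a, h, z - a} <= (%s. z - s) -` C" using a h by (intro hull_minimal) auto
  then show ?thesis by blast
 qed
 then have "(B \<circ> (%s. z - s)) holomorphic_on convex hull {a, h, z - a}"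
  by (intro holomorphic_on_compose_gen[OF _ B(1)]) (auto intro: holomorphic_intros)
 then have "Ph holomorphic_on convex hull {a, h, z - a}" unfolding Ph_def
  using holomorphic_on_subset[OF A(1) seg] by (auto intro!: holomorphic_intros simp: o_def)
 from contour_integral_triangle[OF this]
 have 4: "pass a A B z = contour_integral (linepath a h) Ph + contour_integral (linepath h (z - a)) Ph"
  by (simp add: pass_def Ph_def[abs_def])
 have "contour_integral (linepath (z - h) (z - a)) (%s. B (z - s) * A (z - (z - s))) = - contour_integral (linepath h a) (%s. B s * A (z - s))"
  by (rule contour_integral_linepath_flip)
 then have "contour_integral (linepath h (z - a)) Ph = contour_integral (linepath a h) (%s. B s * A (z - s))"
  unfolding contour_integral_linepath_neg[of h a] by (simp add: h(3) Ph_def[abs_def] mult.commute)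
 note 5 = this
 have b: "ray_part a A B z + contour_integral (linepath a h) Ph = ray_part h A B z"
  "ray_part a B A z + contour_integral (linepath a h) (%s. B s * A (z - s)) = ray_part h B A z"
  using ray_part_bend(2)[OF C star A B(1) a h(1,2) z] ray_part_bend(2)[OF C star B A(1) a h(1,2) z]
  by (simp_all add: Ph_def[abs_def])
 have "ray_part h A B z + ray_part h B A z = ray_part a A B z + pass a A B z + ray_part a B A z"
  unfolding b[symmetric] 4 5 by simp
 then show ?thesis using 3 by (simp add: Ph_def[abs_def])
qed

definition ray_convolution :: "(complex => complex) => (complex => complex) => complex => complex" where
 "ray_convolution A B z = contour_integral (linepath 0 z) (%s. A s * B (z - s))"

lemma radially_integrable_subset: "radially_integrable D F ==> C <= D ==> radially_integrable C F"
 unfolding radially_integrable_def by (meson subset_trans)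

text \<open>For z near z0 the integral is split at the fixed point z0 / 4. In the end pieces z
  enters through one analytic factor and the middle is a \<open>pass\<close>, so all are analytic.
  Since D is only star-shaped, the convex set needed for bending is the truncated cone over a ball
  about z0.\<close>

lemma ray_convolution_holomorphic:
 assumes D: "open D" and star: "!!z t. [|z : D; 0 < t; t <= 1|] ==> of_real t * z : D"
  and A: "A holomorphic_on D" "radially_integrable D A"
  and B: "B holomorphic_on D" "radially_integrable D B"
 shows "ray_convolution A B holomorphic_on D"
  and "z : D ==> ((%s. A s * B (z - s)) has_contour_integral ray_convolution A B z) (linepath 0 z)"
proof -
 have key: "\<exists>s>0. \<forall>z\<in>ball z0 s. ((%s. A s * B (z - s)) has_contour_integral
    (ray_part (z0 / 4) A B z + pass (z0 / 4) A B z + ray_part (z0 / 4) B A z)) (linepath 0 z)" if z0: "z0 : D" for z0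
 proof -
  obtain r where r: "r > 0" "ball z0 r <= D" using D z0 openE by blast
  define C where "C = {of_real t * z |t z. 0 < t & t <= 1 & z : ball z0 r}"
  have C: "convex C" unfolding C_def by (rule convex_truncated_cone) simp
  have CD: "C <= D" using r star by (auto simp: C_def)
  have starC: "of_real t * z : C" if "z : C" "0 < t" "t <= 1" for z t
  proof -
   from that obtain u w where u: "0 < u" "u <= 1" "w : ball z0 r" "z = of_real u * w" by (auto simp: C_def)
   then have "of_real t * z = of_real (t * u) * w" "0 < t * u" "t * u <= 1"
    using that by (auto simp: mult_le_one)
   then show ?thesis using u unfolding C_def by blast
  qed
  have "((%s. A s * B (z - s)) has_contour_integral
    (ray_part (z0 / 4) A B z + pass (z0 / 4) A B z + ray_part (z0 / 4) B A z)) (linepath 0 z)"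
   if z: "z : ball z0 (r / 2)" for z
  proof (rule has_contour_integral_convolution[OF C starC])
   show "A holomorphic_on C" "B holomorphic_on C" using A B CD holomorphic_on_subset by auto
   show "radially_integrable C A" "radially_integrable C B" using A B CD radially_integrable_subset by auto
   have "z : ball z0 r" using z r by auto
   then show "z : C" unfolding C_def by (intro CollectI exI[of _ "1::real"] exI[of _ z]) auto
   show "z0 / 4 : C" unfolding C_def using r by (intro CollectI exI[of _ "1/4::real"] exI[of _ z0]) auto
   show "z - z0 / 4 : C" unfolding C_def
   \<comment> \<open>Scaled by 4/3, the point z - z0 / 4 has distance (4/3) * dist z0 z from z0;
     this is below r because z lies within r / 2.\<close>
   proof (intro CollectI exI[of _ "3/4::real"] exI[of _ "(4/3) * (z - z0 / 4)"] conjI)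
    have n: "z0 - (4/3) * (z - z0 / 4) = (4/3) * (z0 - z)" by (simp add: field_simps)
    have "dist z0 ((4/3) * (z - z0 / 4)) = (4/3) * dist z0 z" unfolding dist_norm n norm_mult by simp
    then show "(4/3) * (z - z0 / 4) : ball z0 r" using z r(1) by simp
    have "of_real (3/4) * ((4/3) * w) = w" for w :: complex by simp
    then show "z - z0 / 4 = of_real (3/4) * ((4/3) * (z - z0 / 4))" by (rule sym)
   qed auto
  qed auto
  then show ?thesis using r by (intro exI[of _ "r / 2"]) auto
 qed
 have uniq: "ray_convolution A B z = ray_part (z0 / 4) A B z + pass (z0 / 4) A B z + ray_part (z0 / 4) B A z"
  if "((%s. A s * B (z - s)) has_contour_integral
    (ray_part (z0 / 4) A B z + pass (z0 / 4) A B z + ray_part (z0 / 4) B A z)) (linepath 0 z)" for z z0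
  unfolding ray_convolution_def using contour_integral_unique[OF that] .
 show "ray_convolution A B holomorphic_on D"
 proof -
  have "ray_convolution A B analytic_on {z0}" if z0: "z0 : D" for z0
  proof -
   have an: "A analytic_on D" "B analytic_on D" using A B D by (auto simp: analytic_on_open)
   have ray: "z0 - of_real t * (z0 / 4) : D" if "t : {0..1}" for t :: real
    using star[OF z0, of "1 - t / 4"] that by (simp add: algebra_simps)
   have q: "z0 / 4 : D" using star[OF z0, of "1/4"] by simp
   have 1: "ray_part (z0 / 4) A B analytic_on {z0}" "ray_part (z0 / 4) B A analytic_on {z0}"
    using ray_part_analytic[OF radially_integrable_ray[OF A star q] an(2) ray]
     ray_part_analytic[OF radially_integrable_ray[OF B star q] an(1) ray] by auto
   have 2: "pass (z0 / 4) A B analytic_on {z0}"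
   proof (rule pass_analytic[OF an], rule subsetI)
    fix w assume "w : closed_segment (z0 / 4) (z0 - z0 / 4)"
    then obtain u where u: "0 <= u" "u <= 1" "w = (1 - u) *\<^sub>R (z0 / 4) + u *\<^sub>R (z0 - z0 / 4)"
     by (auto simp: closed_segment_def)
    have "w = of_real (1 / 4 + u / 2) * z0" unfolding u(3) by (simp add: scaleR_conv_of_real field_simps)
    then show "w : D" using star[OF z0, of "1/4 + u / 2"] u by simp
   qed
   have 3: "(%z. ray_part (z0 / 4) A B z + pass (z0 / 4) A B z + ray_part (z0 / 4) B A z) analytic_on {z0}"
    using 1 2 by (intro analytic_intros)
   obtain s where s: "s > 0" "\<forall>z\<in>ball z0 s. ((%s. A s * B (z - s)) has_contour_integral
     (ray_part (z0 / 4) A B z + pass (z0 / 4) A B z + ray_part (z0 / 4) B A z)) (linepath 0 z)"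
    using key[OF z0] by blast
   have "\<forall>\<^sub>F z in nhds z0. z : ball z0 s"
    using s(1) by (intro eventually_nhds_in_open) auto
   then have "\<forall>\<^sub>F z in nhds z0. ray_convolution A B z = ray_part (z0 / 4) A B z + pass (z0 / 4) A B z + ray_part (z0 / 4) B A z"
    by (rule eventually_mono) (use s(2) uniq in blast)
   from analytic_at_cong[OF this] show ?thesis using 3 by blast
  qed
  then have "ray_convolution A B analytic_on D" using analytic_on_analytic_at by blast
  then show ?thesis using analytic_imp_holomorphic by blast
 qed
 show "((%s. A s * B (z - s)) has_contour_integral ray_convolution A B z) (linepath 0 z)" if zD: "z : D"
 proof -
  obtain s where s: "s > 0" "\<forall>w\<in>ball z s. ((%s. A s * B (w - s)) has_contour_integral
    (ray_part (z / 4) A B w + pass (z / 4) A B w + ray_part (z / 4) B A w)) (linepath 0 w)"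
   using key[OF zD] by blast
  then have h: "((%s. A s * B (z - s)) has_contour_integral
    (ray_part (z / 4) A B z + pass (z / 4) A B z + ray_part (z / 4) B A z)) (linepath 0 z)" by simp
  show ?thesis using h unfolding uniq[OF h] .
 qed
qed

section \<open>Geometry of the wedge and families of branches\<close>

lemma contour_integral_linepath_shift:
 "contour_integral (linepath u v) (%s. f (c + s)) = contour_integral (linepath (c + u) (c + v)) f"
 unfolding contour_integral_integral vector_derivative_linepath_at
 by (simp add: linepath_def scaleR_conv_of_real algebra_simps)

text \<open>The diamond is the sphere of radius \<open>ep\<close> for the norm \<bar>Re s\<bar> +
  \<bar>Im s\<bar>; a real point of it is therefore plus or minus \<open>ep\<close>, which keeps the
  detours away from the integers.\<close>

lemma diamond_side:
 assumes "s : closed_segment (- of_real ep) (- \<i> * of_real (e * ep)) \<union> closed_segment (- \<i> * of_real (e * ep)) (of_real ep)"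
  and "0 <= ep" and e: "e = 1 \<or> e = -1"
 shows "\<bar>Re s\<bar> + \<bar>Im s\<bar> = ep" "e * Im s <= 0"
proof -
 have "\<exists>u. 0 <= u & u <= 1 & ((Re s = - (1 - u) * ep & Im s = - u * (e * ep)) \<or> (Re s = u * ep & Im s = - (1 - u) * (e * ep)))"
  using assms(1)
 proof
  assume "s : closed_segment (- of_real ep) (- \<i> * of_real (e * ep))"
  then obtain u where u: "0 <= u" "u <= 1" and s: "s = (1 - u) *\<^sub>R (- of_real ep) + u *\<^sub>R (- \<i> * of_real (e * ep))"
   unfolding closed_segment_def by blast
  have "Re s = - (1 - u) * ep" "Im s = - u * (e * ep)" unfolding s by (simp_all add: algebra_simps)
  then show ?thesis using u by blast
 next
  assume "s : closed_segment (- \<i> * of_real (e * ep)) (of_real ep)"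
  then obtain u where u: "0 <= u" "u <= 1" and s: "s = (1 - u) *\<^sub>R (- \<i> * of_real (e * ep)) + u *\<^sub>R of_real ep"
   unfolding closed_segment_def by blast
  have "Re s = u * ep" "Im s = - (1 - u) * (e * ep)" unfolding s by (simp_all add: algebra_simps)
  then show ?thesis using u by blast
 qed
 then obtain u where u: "0 <= u" "u <= 1"
  and s: "(Re s = - (1 - u) * ep & Im s = - u * (e * ep)) \<or> (Re s = u * ep & Im s = - (1 - u) * (e * ep))"
  by blast
 have nn: "0 <= u * ep" "0 <= (1 - u) * ep" using u \<open>0 <= ep\<close> by auto
 have a: "\<bar>- (1 - u) * ep\<bar> = (1 - u) * ep" "\<bar>u * ep\<bar> = u * ep" using nn by (simp_all only: abs_minus_cancel mult_minus_left abs_of_nonneg)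
 have b: "\<bar>- u * (e * ep)\<bar> = u * ep" "\<bar>- (1 - u) * (e * ep)\<bar> = (1 - u) * ep"
  "e * (- u * (e * ep)) = - (u * ep)" "e * (- (1 - u) * (e * ep)) = - ((1 - u) * ep)"
  using e a by (elim disjE; simp only: mult_1_left mult_minus1 mult_minus_left mult_minus_right minus_minus abs_minus_cancel)+
 from s show "\<bar>Re s\<bar> + \<bar>Im s\<bar> = ep"
  by (elim disjE conjE) (simp_all only: a b, simp_all add: algebra_simps)
 from s show "e * Im s <= 0"
  by (elim disjE conjE) (use nn in \<open>simp_all only: b neg_le_0_iff_le\<close>)
qed

context wedge
begin

text \<open>Puts the half strip Re z \<ge> 1/4, \<bar>Im z\<bar> \<le> ep into V
  (\<open>admissible_mem_V\<close>) and keeps detours around integers apart from those around the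
  points k + 1/2.\<close>

definition admissible :: "real => bool" where
 "admissible ep \<longleftrightarrow> 0 < ep & ep < 1/4 & Complex (1/4) ep : V & Complex (1/4) (- ep) : V"

lemma Complex_mem_V:
 assumes "Complex a ep : V" "Complex a (- ep) : V" "0 <= ep" "a <= Re z" "\<bar>Im z\<bar> <= ep"
 shows "z : V"
proof -
 have "Complex a (Im z) : V"
 proof (cases "ep = 0")
  case False
  define u where "u = (Im z + ep) / (2 * ep)"
  have u: "0 <= u" "u <= 1" using assms False by (auto simp: u_def field_simps abs_le_iff)
  have "u * ep - (1 - u) * ep = Im z" using False by (simp add: u_def field_simps)
  then have "Complex a (Im z) = u *\<^sub>R Complex a ep + (1 - u) *\<^sub>R Complex a (- ep)"
   by (simp add: complex_eq_iff algebra_simps)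
  then show ?thesis using convexD[OF convex_V assms(1,2), of u "1 - u"] u by simp
 qed (use assms in auto)
 then have "Complex a (Im z) + of_real (Re z - a) : V" using assms by (intro add_real_V) auto
 moreover have "Complex a (Im z) + of_real (Re z - a) = z" by (simp add: complex_eq_iff)
 ultimately show ?thesis by simp
qed

lemma admissible_mem_V: "[|admissible ep; 1/4 <= Re z; \<bar>Im z\<bar> <= ep|] ==> z : V"
 using Complex_mem_V[of "1/4" ep z] by (auto simp: admissible_def)

lemma real_ball_V:
 assumes "0 < x"
 obtains d where "d > 0" "!!ep. [|0 < ep; ep < d|] ==> Complex x ep : V & Complex x (- ep) : V"
proof -
 obtain d where d: "d > 0" "ball (of_real x) d <= V" using of_real_V[OF assms] open_V openE by blast
 have "Complex x ep : V & Complex x (- ep) : V" if "0 < ep" "ep < d" for ep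
 proof -
  have "Complex x ep : ball (of_real x) d" "Complex x (- ep) : ball (of_real x) d"
   using that by (auto simp: dist_norm cmod_def)
  then show ?thesis using d by blast
 qed
 then show ?thesis using d(1) that by blast
qed

lemma admissible_small:
 obtains d where "d > 0" "!!ep. [|0 < ep; ep < d|] ==> admissible ep"
proof -
 obtain d where "d > 0" "!!ep. [|0 < ep; ep < d|] ==> Complex (1/4) ep : V & Complex (1/4) (- ep) : V"
  using real_ball_V[of "1/4"] by auto
 then show ?thesis using that[of "min d (1/4)"] by (auto simp: admissible_def)
qed

text \<open>Every proper combination of a with a point of the open half lies strictly on the side e.
  This allows hulls of contour corners to have one vertex on the axis.\<close>

lemma convex_insert_upper:
 assumes K: "convex K" and a: "a : K" "0 <= e * Im a"
 shows "convex (insert a {z : K. 0 < e * Im z})"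
proof (rule convexI)
 fix x y and u v :: real
 assume x: "x : insert a {z : K. 0 < e * Im z}" and y: "y : insert a {z : K. 0 < e * Im z}"
  and uv: "0 <= u" "0 <= v" "u + v = 1"
 have V: "x : K" "y : K" using x y a by auto
 have inV: "u *\<^sub>R x + v *\<^sub>R y : K" using convexD[OF K V uv] .
 have nn: "0 <= e * Im x" "0 <= e * Im y" using x y a by auto
 have Im: "e * Im (u *\<^sub>R x + v *\<^sub>R y) = u * (e * Im x) + v * (e * Im y)" by (simp add: algebra_simps)
 show "u *\<^sub>R x + v *\<^sub>R y : insert a {z : K. 0 < e * Im z}"
 proof (cases "x = a & y = a")
  case True
  then show ?thesis using uv by (simp flip: scaleR_left_distrib)
 next
  case ne: False
  show ?thesis
  proof (cases "u = 0 \<or> v = 0")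
   case True
   then show ?thesis using x y uv by auto
  next
   case False
   then have "0 < u" "0 < v" using uv by auto
   moreover have "0 < e * Im x \<or> 0 < e * Im y" using ne x y by auto
   ultimately have "0 < e * Im (u *\<^sub>R x + v *\<^sub>R y)"
    unfolding Im using nn by (auto intro: add_pos_nonneg add_nonneg_pos)
   then show ?thesis using inV by simp
  qed
 qed
qed

lemma convex_insert_half: "a : sheet V e ==> convex (insert a (half V e))"
 using convex_insert_upper[OF convex_V, of a] by (simp add: sheet_def half_def)

lemma insert_half_subset: "a : sheet V e ==> insert a (half V e) <= sheet V e"
 using half_subset_sheet by blast

text \<open>Left of 1 no positive integer obstructs the axis: the set is convex, star-shaped about 0
  and contained in the sheet, so branches without crossing can be convolved along straight segments
  here.\<close>

definition base :: "complex set" where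
 "base = {z : V. 0 <= e * Im z & (Im z = 0 --> Re z < 1)}"

lemma convex_base: "convex base"
proof (rule convexI)
 fix x y and u v :: real
 assume x: "x : base" and y: "y : base" and uv: "0 <= u" "0 <= v" "u + v = 1"
 have V: "u *\<^sub>R x + v *\<^sub>R y : V" using x y uv by (intro convexD[OF convex_V]) (auto simp: base_def)
 have Im: "e * Im (u *\<^sub>R x + v *\<^sub>R y) = u * (e * Im x) + v * (e * Im y)" by (simp add: algebra_simps)
 have nn: "0 <= u * (e * Im x)" "0 <= v * (e * Im y)" using x y uv by (auto simp: base_def)
 have "Re (u *\<^sub>R x + v *\<^sub>R y) < 1" if 0: "Im (u *\<^sub>R x + v *\<^sub>R y) = 0"
 proof -
  have "u * (e * Im x) + v * (e * Im y) = 0" unfolding Im[symmetric] using 0 by (simp del: scaleR_complex.simps)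
  then have "u * (e * Im x) = 0" "v * (e * Im y) = 0" using nn by linarith+
  then have "u = 0 \<or> Re x < 1" "v = 0 \<or> Re y < 1" using e x y by (auto simp: base_def)
  then show ?thesis using uv convex_bound_lt[of "Re x" 1 "Re y" u v] by auto
 qed
 then show "u *\<^sub>R x + v *\<^sub>R y : base" using V nn Im by (auto simp: base_def)
qed

lemma base_star:
 assumes z: "z : base" and t: "0 < t" "t <= 1"
 shows "of_real t * z : base"
proof -
 have "z : V" using z by (simp add: base_def)
 then have V: "of_real t * z : V" using t by (intro cone)
 have "t * Re z <= 1 * Re z" using Re_pos[OF \<open>z : V\<close>] t by (intro mult_right_mono) auto
 moreover have "0 <= t * (e * Im z)" using z t by (simp add: base_def)
 then have "0 <= e * (t * Im z)" by (simp only: mult.left_commute)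
 ultimately show ?thesis using V z t by (auto simp: base_def simp del: mult_le_cancel_right2)
qed

lemma base_subset_sheet: "base <= sheet V e"
proof
 fix z assume z: "z : base"
 have "z ~: \<nat>"
 proof
  assume "z : \<nat>"
  then obtain n where n: "z = of_nat n" by (auto simp: Nats_def)
  then have "0 < real n" "real n < 1" using z Re_pos[of z] by (auto simp: base_def)
  then show False by auto
 qed
 then show "z : sheet V e" using z by (simp add: base_def sheet_def)
qed

lemma half_subset_base: "half V e <= base"
 by (auto simp: half_def base_def)

lemma of_real_base: "[|0 < x; x < 1|] ==> of_real x : base"
 using of_real_V by (auto simp: base_def)

end

lemma not_Nats_between: "[|real k < x; x < real k + 1|] ==> x ~: \<nat>"
proof
 assume "real k < x" "x < real k + 1" "x : \<nat>"
 then obtain n where "real k < real n" "real n < real (Suc k)" by (auto simp: Nats_def)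
 then show False by (simp only: of_nat_less_iff)
qed

text \<open>A k (s) stands for the branch at k + s that ran on the side -e, crossed in (k, k+1) and
  is now on the side e; L is the branch on the side -e, which coincides with it on (k, k+1). For k =
  0 it is the branch on the side e itself, as (0, 1) separates nothing.\<close>

locale sheet_family = wedge +
 fixes L :: "complex => complex" and A :: "nat => complex => complex"
 assumes A: "A k analytic_on sheet V e" and L: "L analytic_on sheet V (-e)"
  and glue: "[|0 < x; x < 1|] ==> A k (of_real x) = L (of_nat k + of_real x)"
  and radA: "radially_integrable base (A 0)" and radL: "radially_integrable (wedge.base V (-e)) L"
begin

text \<open>Equality on a real interval spreads to balls about its points by the identity theorem,
  and compactness of [a, b] makes their radius uniform.\<close>

lemma strip_agree:
 assumes "0 < a" "b < 1"
 obtains rh where "rh > 0" "A k holomorphic_on {s. a <= Re s & Re s <= b & \<bar>Im s\<bar> < rh}"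
  "!!s. [|a <= Re s; Re s <= b; \<bar>Im s\<bar> < rh|] ==> A k s = L (of_nat k + s)"
proof -
 interpret m: wedge V "-e" by (rule wedge_uminus)
 define P where "P rh x \<longleftrightarrow> A k analytic_on ball (of_real x) rh &
  (\<forall>s\<in>ball (of_real x) rh. A k s = L (of_nat k + s))" for rh x
 have loc: "\<exists>rh>0. P rh x" if x: "x : {a..b}" for x
 proof -
  have x01: "0 < x" "x < 1" using x assms by auto
  then have nn: "x ~: \<nat>" "real k + x ~: \<nat>" using not_Nats_between[of 0 x] not_Nats_between[of k "real k + x"] by auto
  have 1: "of_real x : sheet V e" using of_real_sheet x01 nn by blast
  have 2: "of_nat k + of_real x : sheet V (-e)" using m.of_real_sheet[of "real k + x"] x01 nn by simp
  obtain r1 where r1: "r1 > 0" "A k holomorphic_on ball (of_real x) r1"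
   using A 1 unfolding analytic_on_def by blast
  obtain r2 where r2: "r2 > 0" "L holomorphic_on ball (of_nat k + of_real x) r2"
   using L 2 unfolding analytic_on_def by blast
  define r where "r = min r1 r2"
  have r: "r > 0" "r <= r1" "r <= r2" using r1 r2 by (auto simp: r_def)
  have a1: "A k analytic_on ball (of_real x) r"
   using r1(2) r by (auto simp: analytic_on_open intro: holomorphic_on_subset)
  have "(L \<circ> (%s. of_nat k + s)) holomorphic_on ball (of_real x) r"
  proof (rule holomorphic_on_compose_gen[OF _ r2(2)])
   show "(%s::complex. of_nat k + s) ` ball (of_real x) r <= ball (of_nat k + of_real x) r2"
   proof (rule image_subsetI)
    fix s :: complex assume "s : ball (of_real x) r"
    then show "of_nat k + s : ball (of_nat k + of_real x) r2" using r(3) by (simp only: mem_ball dist_add_cancel)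
   qed
  qed (intro holomorphic_intros)
  then have a2: "(%s. L (of_nat k + s)) analytic_on ball (of_real x) r" by (simp add: analytic_on_open o_def)
  define Z :: "complex set" where "Z = of_real ` {0<..<1::real}"
  have il: "(of_real x :: complex) islimpt Z"
   unfolding Z_def islimpt_approachable
  proof (intro allI impI)
   fix d :: real assume "d > 0"
   obtain h where h: "0 < h" "h < d" "h < 1 - x"
    using dense[of 0 "min d (1 - x)"] \<open>d > 0\<close> x01 by auto
   have "dist (of_real (x + h)) (of_real x :: complex) < d" unfolding dist_of_real using h by (simp add: dist_real_def)
   moreover have "of_real (x + h) ~= (of_real x :: complex)" using h by (simp only: of_real_eq_iff)
   moreover have "x + h : {0<..<1}" using h x01 by auto
   ultimately show "\<exists>x'\<in>of_real ` {0<..<1}. x' ~= of_real x & dist x' (of_real x :: complex) < d" by blast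
  qed
  have "A k s = L (of_nat k + s)" if s: "s : ball (of_real x) r" for s
  proof (rule analytic_eq_on_connected[OF a1 a2 connected_ball _ il _ s])
   show "of_real x : ball (of_real x) r" using r(1) by simp
   show "A k w = L (of_nat k + w)" if "w : Z" for w using that glue by (auto simp: Z_def)
  qed
  then show ?thesis using r(1) a1 unfolding P_def by blast
 qed
 obtain rh where rh: "rh > 0" "!!x. x : {a..b} ==> P rh x"
 proof (rule uniform_radius[of "{a..b}" P])
  fix x assume "x : {a..b}"
  then obtain rh where rh: "rh > 0" "P rh x" using loc by blast
  have "P (rh / 2) s" if "dist s x < rh / 2" for s
  proof -
   have d: "dist (of_real x :: complex) (of_real s) < rh / 2" using that by (simp add: dist_of_real dist_commute)
   have "ball (of_real s :: complex) (rh / 2) <= ball (of_real x) rh"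
   proof
    fix w :: complex assume "w : ball (of_real s) (rh / 2)"
    then show "w : ball (of_real x) rh"
     using d dist_triangle[of "of_real x" w "of_real s"] by simp
   qed
   then show ?thesis using rh(2) unfolding P_def by (meson analytic_on_subset subsetD)
  qed
  moreover have "rh / 2 > 0" using rh(1) by simp
  ultimately show "\<exists>rh>0. \<exists>d>0. \<forall>s\<in>{a..b}. dist s x < d --> P rh s" by blast
 next
  fix rh rh' s assume "P rh s" "0 < rh'" "rh' <= rh"
  then show "P rh' s" unfolding P_def by (meson analytic_on_subset subset_ball subsetD)
 qed auto
 have inb: "s : ball (of_real (Re s)) rh" if "\<bar>Im s\<bar> < rh" for s
  using that by (simp add: dist_norm cmod_def)
 show ?thesis
 proof (rule that[OF rh(1)])
  have "A k analytic_on {s. a <= Re s & Re s <= b & \<bar>Im s\<bar> < rh}"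
   unfolding analytic_on_def
  proof
   fix s assume "s : {s. a <= Re s & Re s <= b & \<bar>Im s\<bar> < rh}"
   then have "A k analytic_on ball (of_real (Re s)) rh" "s : ball (of_real (Re s)) rh"
    using rh(2)[of "Re s"] inb[of s] unfolding P_def by auto
   then show "\<exists>ep>0. A k holomorphic_on ball s ep" unfolding analytic_on_def by blast
  qed
  then show "A k holomorphic_on {s. a <= Re s & Re s <= b & \<bar>Im s\<bar> < rh}" by (rule analytic_imp_holomorphic)
  show "A k s = L (of_nat k + s)" if "a <= Re s" "Re s <= b" "\<bar>Im s\<bar> < rh" for s
   using rh(2)[of "Re s"] inb[OF that(3)] that unfolding P_def by auto
 qed
qed

lemma strips_agree:
 assumes "0 < a" "b < 1"
 obtains rh where "rh > 0" "!!k. k <= m ==> A k holomorphic_on {s. a <= Re s & Re s <= b & \<bar>Im s\<bar> < rh}"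
  "!!k s. [|k <= m; a <= Re s; Re s <= b; \<bar>Im s\<bar> < rh|] ==> A k s = L (of_nat k + s)"
proof -
 obtain rh where rh: "!!k. rh k > 0" "!!k. A k holomorphic_on {s. a <= Re s & Re s <= b & \<bar>Im s\<bar> < rh k}"
  "!!k s. [|a <= Re s; Re s <= b; \<bar>Im s\<bar> < rh k|] ==> A k s = L (of_nat k + s)"
 proof -
  have "\<exists>rh>0. A k holomorphic_on {s. a <= Re s & Re s <= b & \<bar>Im s\<bar> < rh} &
    (\<forall>s. a <= Re s & Re s <= b & \<bar>Im s\<bar> < rh --> A k s = L (of_nat k + s))" for k
   by (rule strip_agree[OF assms, of k]) blast
  then obtain rh where "\<forall>k. rh k > 0 & A k holomorphic_on {s. a <= Re s & Re s <= b & \<bar>Im s\<bar> < rh k} &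
    (\<forall>s. a <= Re s & Re s <= b & \<bar>Im s\<bar> < rh k --> A k s = L (of_nat k + s))"
   using choice[of "%k rh. rh > 0 & A k holomorphic_on {s. a <= Re s & Re s <= b & \<bar>Im s\<bar> < rh} &
    (\<forall>s. a <= Re s & Re s <= b & \<bar>Im s\<bar> < rh --> A k s = L (of_nat k + s))"] by blast
  then show ?thesis by (intro that[of rh]) auto
 qed
 define r where "r = Min (rh ` {..m})"
 have r: "r > 0" "!!k. k <= m ==> r <= rh k" using rh(1) by (auto simp: r_def)
 show ?thesis
 proof (rule that[OF r(1)])
  fix k assume "k <= m"
  then show "A k holomorphic_on {s. a <= Re s & Re s <= b & \<bar>Im s\<bar> < r}"
   using r(2) by (intro holomorphic_on_subset[OF rh(2)[of k]]) force
  show "A k s = L (of_nat k + s)" if "a <= Re s" "Re s <= b" "\<bar>Im s\<bar> < r" for s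
   using that r(2)[OF \<open>k <= m\<close>] rh(3)[of s k] by simp
 qed
qed

end

section \<open>The zigzag contour and its analyticity\<close>

text \<open>P, Q, R, S stand for the values of a primitive at the four kinds of corners of the
  zigzag; consecutive pieces share corners, and only the first and the last survive.\<close>

lemma telescoping_zigzag:
 fixes P Q R S :: "nat => 'a::ab_group_add"
 shows "(\<Sum>k=1..m. P k - Q k) + (\<Sum>j<m. R j - S j) + (\<Sum>k\<le>m. S k - P k) - (\<Sum>k<m. R k - Q (Suc k)) = S m - P 0"
 by (induction m) (auto simp: algebra_simps)

text \<open>The contour for the value at m + z after a crossing in (m, m+1), cut into pieces. From k
  + ep it runs to k + z - ep (\<open>pass\<close> of A k and B (m - k)), goes round k + z, where the
  second factor is singular, returns to k + 1 - ep and goes round k + 1 on the side -e. The return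
  is a \<open>pass\<close> at z + 1 traversed backwards, hence the minus sign. Detours around k + z
  are rewritten by s -> m + z - s as detours of M around integers.\<close>

definition zigzag :: "real => real => (complex => complex) => (nat => complex => complex) =>
  (complex => complex) => (nat => complex => complex) => nat => complex => complex" where
 "zigzag e ep L A M B m z =
   ray_part (of_real ep) (A 0) (B m) z + ray_part (of_real ep) (B 0) (A m) z +
   (\<Sum>k=1..m. arc_part e ep (%s. L (of_nat k + s)) (B (m - k)) z) +
   (\<Sum>k=1..m. arc_part e ep (%s. M (of_nat k + s)) (A (m - k)) z) +
   (\<Sum>k\<le>m. pass (of_real ep) (A k) (B (m - k)) z) -
   (\<Sum>k<m. pass (1 - of_real ep) (A k) (B (m - Suc k)) (z + 1))"

locale sheet_pair = wedge V e + F: sheet_family V e L A + G: sheet_family V e M B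
 for V e L A M B
begin

lemma closed_segment_real_sheet:
 assumes "real n < a" "a < real n + 1" "real n < b" "b < real n + 1"
 shows "closed_segment (of_real a) (of_real b) <= sheet V e"
proof
 fix z :: complex assume "z : closed_segment (of_real a) (of_real b)"
 then obtain x where x: "z = of_real x" "x : closed_segment a b"
  by (auto simp: closed_segment_of_real)
 then have "real n < x" "x < real n + 1" using assms by (auto simp: closed_segment_eq_real_ivl split: if_splits)
 moreover from this have "0 < x" by (smt (verit) of_nat_0_le_iff)
 ultimately show "z : sheet V e" using of_real_sheet not_Nats_between x by auto
qed

lemma closed_segment_sheet:
 assumes "a : sheet V e" "b : half V e" shows "closed_segment a b <= sheet V e"
 using closed_segment_subset[OF _ _ convex_insert_half[OF assms(1)], of a b] assms insert_half_subset[OF assms(1)]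
 by blast

text \<open>Here every piece of the zigzag stays on the sheets. The real point 1/2 belongs to it for
  every \<open>ep\<close> and is the common base point for the identity theorem.\<close>

definition region :: "real => complex set" where
 "region ep = {z : half V e. z - of_real ep : V & z + \<i> * of_real (e * ep) : V} \<union> {1/2}"

lemma arc_in_sheet:
 assumes ep: "admissible ep" and k: "1 <= k"
  and s: "s : closed_segment (- of_real ep) (- \<i> * of_real (e * ep)) \<union> closed_segment (- \<i> * of_real (e * ep)) (of_real ep)"
 shows "of_nat k + s : sheet V (-e)"
proof -
 have ep': "0 < ep" "ep < 1/4" using ep by (auto simp: admissible_def)
 note d = diamond_side[OF s less_imp_le[OF ep'(1)] e]
 have "of_nat k + s : V" using d ep' k by (intro admissible_mem_V[OF ep]) auto
 moreover have "of_nat k + s ~: \<nat>"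
 proof
  assume n: "of_nat k + s : \<nat>"
  then have "Im s = 0" using Nats_Im_0[OF n] by simp
  then have r: "\<bar>Re s\<bar> = ep" using d by simp
  obtain j :: nat where "of_nat k + s = of_nat j" using n by (auto simp: Nats_def)
  then have "Re (of_nat k + s) = real j" by simp
  then have "real j < real (Suc k)" "real (k - 1) < real j" "real j ~= real k" using r ep' k by (auto simp: of_nat_diff)
  then show False by (simp only: of_nat_less_iff of_nat_eq_iff)
 qed
 ultimately show ?thesis using d by (simp add: sheet_def)
qed

lemma minus_arc_in_sheet:
 assumes ep: "admissible ep" and z: "z : region ep"
  and s: "s : closed_segment (- of_real ep) (- \<i> * of_real (e * ep)) \<union> closed_segment (- \<i> * of_real (e * ep)) (of_real ep)"
 shows "z - s : sheet V e"
proof -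
 have ep': "0 < ep" "ep < 1/4" using ep by (auto simp: admissible_def)
 note d = diamond_side[OF s less_imp_le[OF ep'(1)] e]
 show ?thesis
 proof (cases "z = 1/2")
  case True
  have RI: "Re z = 1/2" "Im z = 0" unfolding True by simp_all
  have "z - s : V" using d ep' RI by (intro admissible_mem_V[OF ep]) auto
  moreover have "z - s ~: \<nat>"
  proof
   assume n: "z - s : \<nat>"
   then obtain j :: nat where "z - s = of_nat j" by (auto simp: Nats_def)
   then have "Re (z - s) = real j" by simp
   then have "real j = 1/2 - Re s" using RI by simp
   then have "real 0 < real j" "real j < real 1" using d ep' by auto
   then show False by (simp only: of_nat_less_iff)
  qed
  ultimately show ?thesis using d RI by (simp add: sheet_def)
 next
  case False
  then have z': "z : half V e" "z - of_real ep : V" "z + \<i> * of_real (e * ep) : V" using z by (auto simp: region_def)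
  have zV: "z : V" using z' by (simp add: half_def)
  have p: "z + of_real ep : V" using add_real_V[OF zV] ep' by simp
  have "s : {s. z - s : V}"
  proof -
   have cv: "convex {s. z - s : V}"
   proof (rule convexI)
    fix x y and u v :: real assume "x : {s. z - s : V}" "y : {s. z - s : V}" and uv: "0 <= u" "0 <= v" "u + v = 1"
    then have "u *\<^sub>R (z - x) + v *\<^sub>R (z - y) : V" by (intro convexD[OF convex_V]) auto
    moreover have "u *\<^sub>R (z - x) + v *\<^sub>R (z - y) = (u + v) *\<^sub>R z - (u *\<^sub>R x + v *\<^sub>R y)"
     by (simp add: algebra_simps)
    ultimately show "u *\<^sub>R x + v *\<^sub>R y : {s. z - s : V}" using uv by simp
   qed
   show ?thesis using s closed_segment_subset[OF _ _ cv, of "- of_real ep" "- \<i> * of_real (e * ep)"]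
    closed_segment_subset[OF _ _ cv, of "- \<i> * of_real (e * ep)" "of_real ep"] z' p by auto
  qed
  moreover have "0 < e * Im (z - s)" using d z' by (simp add: half_def algebra_simps)
  ultimately have "z - s : half V e" by (simp add: half_def)
  then show ?thesis using half_subset_sheet by blast
 qed
qed

lemma zigzag_parts_analytic:
 assumes ep: "admissible ep"
  and arc: "!!s. s : closed_segment (- of_real ep) (- \<i> * of_real (e * ep)) \<union> closed_segment (- \<i> * of_real (e * ep)) (of_real ep) ==> z - s : sheet V e"
  and ray: "!!t. t : {0..1} ==> z - of_real t * of_real ep : sheet V e"
 shows "ray_part (of_real ep) (A 0) (B m) analytic_on {z}" "ray_part (of_real ep) (B 0) (A m) analytic_on {z}"
  and "1 <= k ==> arc_part e ep (%s. L (of_nat k + s)) (B j) analytic_on {z}"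
  and "1 <= k ==> arc_part e ep (%s. M (of_nat k + s)) (A j) analytic_on {z}"
proof -
 have ep': "0 < ep" "ep < 1/4" using ep by (auto simp: admissible_def)
 have eb: "of_real ep : base" using of_real_base ep' by simp
 have hb: "A 0 holomorphic_on base" "B 0 holomorphic_on base"
  using F.A G.A base_subset_sheet analytic_on_subset analytic_imp_holomorphic by metis+
 show "ray_part (of_real ep) (A 0) (B m) analytic_on {z}"
  by (rule ray_part_analytic[OF radially_integrable_ray[OF hb(1) F.radA base_star eb] G.A ray])
 show "ray_part (of_real ep) (B 0) (A m) analytic_on {z}"
  by (rule ray_part_analytic[OF radially_integrable_ray[OF hb(2) G.radA base_star eb] F.A ray])
 have cont: "continuous_on S (%s. f (of_nat k + s))" if k: "1 <= k" and f: "f analytic_on sheet V (-e)"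
  and S: "S <= closed_segment (- of_real ep) (- \<i> * of_real (e * ep)) \<union> closed_segment (- \<i> * of_real (e * ep)) (of_real ep)" for f S k
  by (rule continuous_on_compose2[OF holomorphic_on_imp_continuous_on[OF analytic_imp_holomorphic[OF f]]])
    (use arc_in_sheet[OF ep k] S in \<open>auto intro!: continuous_intros\<close>)
 show "1 <= k ==> arc_part e ep (%s. L (of_nat k + s)) (B j) analytic_on {z}"
  unfolding arc_part_def[abs_def]
  by (intro analytic_on_add segment_convolution_analytic[OF cont[OF _ F.L] G.A]) (use arc in auto)
 show "1 <= k ==> arc_part e ep (%s. M (of_nat k + s)) (A j) analytic_on {z}"
  unfolding arc_part_def[abs_def]
  by (intro analytic_on_add segment_convolution_analytic[OF cont[OF _ G.L] F.A]) (use arc in auto)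
qed

lemma analytic_shift: "f analytic_on {z + c} ==> (%z. f (z + c)) analytic_on {z}" for c :: complex
proof -
 assume "f analytic_on {z + c}"
 moreover have "(%z. z + c) analytic_on {z}" by (intro analytic_intros)
 ultimately show ?thesis using analytic_on_compose[of "%z. z + c" "{z}" f] by (simp add: o_def)
qed

text \<open>Every piece is an integral over a contour on the sheets, in which z enters through an
  analytic factor or through the end of a \<open>pass\<close>. At z = 1/2 the legs lie in the real
  interval (0, 1).\<close>

lemma zigzag_analytic:
 assumes ep: "admissible ep" and z: "z : region ep"
 shows "zigzag e ep L A M B m analytic_on {z}"
proof -
 have ep': "0 < ep" "ep < 1/4" using ep by (auto simp: admissible_def)
 have ze: "z - of_real ep : half V e" if "z ~= 1/2" using z that by (auto simp: region_def half_def)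
 have zh: "z : half V e" if "z ~= 1/2" using z that by (auto simp: region_def)
 have ray: "z - of_real t * of_real ep : sheet V e" if t: "t : {0..1}" for t
 proof (cases "z = 1/2")
  case True
  obtain y where y: "t * ep = y" "0 <= y" "y <= ep"
   using mult_right_mono[of t 1 ep] t ep' by auto
  then have "of_real (1/2 - t * ep) : sheet V e" using ep' not_Nats_between[of 0 "1/2 - y"]
   unfolding y(1) by (intro of_real_sheet) auto
  then show ?thesis unfolding True by simp
 next
  case False
  have "z - of_real t * of_real ep = (1 - t) *\<^sub>R z + t *\<^sub>R (z - of_real ep)"
   by (simp add: scaleR_conv_of_real algebra_simps)
  then have "z - of_real t * of_real ep : half V e"
   using convexD[OF convex_half zh[OF False] ze[OF False], of "1 - t" t] t by simp
  then show ?thesis using half_subset_sheet by blast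
 qed
 have p1: "closed_segment (of_real ep) (z - of_real ep) <= sheet V e"
 proof (cases "z = 1/2")
  case True
  have eq: "z - of_real ep = of_real (1/2 - ep)" unfolding True by simp
  show ?thesis unfolding eq by (rule closed_segment_real_sheet[of 0]) (use ep' in auto)
 next
  case False
  then show ?thesis using closed_segment_sheet[OF of_real_sheet ze[OF False]] ep' not_Nats_between[of 0 ep] by simp
 qed
 have p2: "closed_segment (1 - of_real ep) ((z + 1) - (1 - of_real ep)) <= sheet V e"
 proof (cases "z = 1/2")
  case True
  have eq: "(z + 1) - (1 - of_real ep) = of_real (1/2 + ep)" "1 - of_real ep = (of_real (1 - ep) :: complex)"
   unfolding True by simp_all
  show ?thesis unfolding eq(1) unfolding eq(2) by (rule closed_segment_real_sheet[of 0]) (use ep' in auto)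
 next
  case False
  have "(z + 1) - (1 - of_real ep) = z + of_real ep" by simp
  moreover have "z + of_real ep : half V e" using zh[OF False] add_real_V[of z ep] ep' by (auto simp: half_def)
  moreover have "of_real (1 - ep) : sheet V e" using ep' not_Nats_between[of 0 "1 - ep"] by (intro of_real_sheet) auto
  ultimately show ?thesis using closed_segment_sheet[of "of_real (1 - ep)" "z + of_real ep"] by simp
 qed
 note parts = zigzag_parts_analytic[OF ep minus_arc_in_sheet[OF ep z] ray]
 show ?thesis
  unfolding zigzag_def[abs_def]
  by (intro analytic_on_diff analytic_on_add analytic_on_sum parts analytic_shift
    pass_analytic[OF F.A G.A p1] pass_analytic[OF F.A G.A p2]) auto
qed

end

section \<open>Just before the crossing the zigzag is the straight convolution\<close>

lemma convex_minus_vimage: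
 fixes z :: "'a::real_vector"
 assumes "convex S" shows "convex ((%s. z - s) -` S)"
proof (rule convexI)
 fix x y and u v :: real
 assume xy: "x : (%s. z - s) -` S" "y : (%s. z - s) -` S" and uv: "0 <= u" "0 <= v" "u + v = 1"
 have "u *\<^sub>R (z - x) + v *\<^sub>R (z - y) = (u + v) *\<^sub>R z - (u *\<^sub>R x + v *\<^sub>R y)"
  by (simp add: algebra_simps)
 moreover have "u *\<^sub>R (z - x) + v *\<^sub>R (z - y) : S" using xy uv by (intro convexD[OF assms]) auto
 ultimately show "u *\<^sub>R x + v *\<^sub>R y : (%s. z - s) -` S" using uv by simp
qed

text \<open>Projection to the line halfway between the edges Im v = 0 and Im v = - e * y of the
  strip. The singularities of L s lie on the first edge, those of M (z - s) on the second, so the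
  midline avoids both.\<close>

definition midline :: "real => real => complex => complex" where
 "midline e y v = Complex (Re v) (- e * y / 2)"

definition conv_segment :: "(complex => complex) => (complex => complex) => complex => complex => complex => complex" where
 "conv_segment L M z u v = contour_integral (linepath u v) (%s. L s * M (z - s))"

text \<open>
 A primitive of \<open>s \<mapsto> L s * M (z - s)\<close> on the closed strip between \<open>0\<close> and \<open>z\<close>, obtained by integrating
 along the line halfway up the strip and then vertically.
\<close>

definition strip_primitive :: "real => real => real => (complex => complex) => (complex => complex) => complex => complex => complex" where
 "strip_primitive e y ep L M z v =
   conv_segment L M z (midline e y (of_real ep)) (midline e y v) + conv_segment L M z (midline e y v) v"

context sheet_pair
begin

text \<open>\<open>zq\<close> lies at distance y on the side -e of 1/2, inside a strip where each A
  k is L shifted by k and each B k is M shifted by k. There the legs become integrals of the single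
  integrand L s * M (z - s).\<close>

context
 fixes m :: nat and ep y rh :: real and z zq :: complex
 assumes ep: "admissible ep" and y: "0 < y" "y < rh" "y < ep"
  and thin: "Complex ep y : V" "Complex ep (- y) : V"
  and holA: "!!k. k <= m ==> A k holomorphic_on {s. ep <= Re s & Re s <= 1 - ep & \<bar>Im s\<bar> < rh}"
  and AL: "!!k s. [|k <= m; ep <= Re s; Re s <= 1 - ep; \<bar>Im s\<bar> < rh|] ==> A k s = L (of_nat k + s)"
  and holB: "!!k. k <= m ==> B k holomorphic_on {s. ep <= Re s & Re s <= 1 - ep & \<bar>Im s\<bar> < rh}"
  and BM: "!!k s. [|k <= m; ep <= Re s; Re s <= 1 - ep; \<bar>Im s\<bar> < rh|] ==> B k s = M (of_nat k + s)"
  and zq: "zq = Complex (1/2) (- e * y)" and z: "z = of_nat m + zq"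
begin

private abbreviation "mid \<equiv> midline e y"
private abbreviation "J \<equiv> conv_segment L M z"
private abbreviation "Pz \<equiv> strip_primitive e y ep L M z"
private lemmas mid_def = midline_def and J_def = conv_segment_def and Pz_def = strip_primitive_def

private lemma eps: "0 < ep" "ep < 1/4"
 using ep by (auto simp: admissible_def)

private lemma mem_V: "[|ep <= Re s; \<bar>Im s\<bar> <= y|] ==> s : V"
 using Complex_mem_V[OF thin] y by simp

private lemma abs_e: "\<bar>e * x\<bar> = \<bar>x\<bar>"
 by (simp add: abs_mult)

private lemma Im_z: "Im z = - e * y" "Im zq = - e * y" "Re z = real m + 1/2" "Re zq = 1/2"
 by (simp_all add: z zq)

private lemma mid_simps: "Re (mid v) = Re v" "e * Im (mid v) = - y / 2" "Im (mid v) = - e * y / 2" "\<bar>Im (mid v)\<bar> = y / 2"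
 using y by (simp_all add: mid_def abs_mult)

private lemma half_memI: "[|ep <= Re s; - y <= e * Im s; e * Im s < 0|] ==> s : half V (-e)"
 using mem_V[of s] abs_e[of "Im s"] by (auto simp: half_def)

private lemma mid_half: "ep <= Re v ==> mid v : half V (-e)"
 using half_memI[of "mid v"] mid_simps[of v] y by simp

private lemma z_mid_half: "Re v <= real m + 1/2 - ep ==> z - mid v : half V (-e)"
 using half_memI[of "z - mid v"] mid_simps[of v] y by (simp add: Im_z right_diff_distrib)

lemmas flipped = wedge.convex_half[OF wedge_uminus] wedge.convex_insert_half[OF wedge_uminus] wedge.insert_half_subset[OF wedge_uminus]
 wedge.half_subset_sheet[OF wedge_uminus]

text \<open>For each factor one corner may sit on the axis at a point that is not an integer; all
  other arguments lie strictly on the side -e, so the hull meets no singularity of either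
  factor.\<close>

private lemma holomorphic_product:
 assumes p: "p : sheet V (-e)" and q: "q : sheet V (-e)"
  and S: "S <= insert p (half V (-e))" "(%s. z - s) ` S <= insert q (half V (-e))"
 shows "(%s. L s * M (z - s)) holomorphic_on convex hull S"
proof -
 have 1: "convex hull S <= sheet V (-e)"
 proof -
  have "convex hull S <= insert p (half V (-e))" by (rule hull_minimal[OF S(1)]) (rule flipped(2)[OF p])
  then show ?thesis using flipped(3)[OF p] by blast
 qed
 have "convex ((%s. z - s) -` insert q (half V (-e)))" by (rule convex_minus_vimage[OF flipped(2)[OF q]])
 then have "convex hull S <= (%s. z - s) -` insert q (half V (-e))" using S(2) by (intro hull_minimal) auto
 then have 2: "(%s. z - s) ` (convex hull S) <= sheet V (-e)" using flipped(3)[OF q] by blast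
 have "(M \<circ> (%s. z - s)) holomorphic_on convex hull S"
  by (rule holomorphic_on_compose_gen[OF _ analytic_imp_holomorphic[OF G.L] 2]) (intro holomorphic_intros)
 then show ?thesis
  using holomorphic_on_subset[OF analytic_imp_holomorphic[OF F.L] 1]
  by (auto intro!: holomorphic_intros simp: o_def)
qed

private lemma J_mid:
 assumes "ep <= Re u" "ep <= Re v" "ep <= Re w" "Re u <= real m + 1/2 - ep" "Re v <= real m + 1/2 - ep" "Re w <= real m + 1/2 - ep"
 shows "J (mid u) (mid v) + J (mid v) (mid w) = J (mid u) (mid w)"
 unfolding J_def
proof (rule contour_integral_triangle, rule holomorphic_product)
 show "mid u : sheet V (-e)" "z - mid u : sheet V (-e)"
  using mid_half z_mid_half assms flipped(4) by blast+
qed (use mid_half z_mid_half assms in auto)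

private lemma J_neg: "J u v = - J v u"
 unfolding J_def by (rule contour_integral_linepath_neg)

text \<open>Cauchy's theorem on the quadrilateral formed by v, w and their projections to the
  midline: v is the one corner where the argument of L is real, w the one where that of M
  is.\<close>

private lemma J_piece:
 assumes v: "ep <= Re v" "Re v <= real m + 1/2 - ep" "Im v = 0" "v ~: \<nat>"
  and w: "ep <= Re w" "Re w <= real m + 1/2 - ep" "Im w = - e * y" "z - w ~: \<nat>"
 shows "J v w = Pz w - Pz v"
proof -
 have vs: "v : sheet V (-e)" using v mem_V[of v] y by (simp add: sheet_def)
 have ws: "z - w : sheet V (-e)" using w mem_V[of "z - w"] y by (simp add: sheet_def Im_z)
 have vh: "z - v : half V (-e)" using v half_memI[of "z - v"] y by (simp add: Im_z right_diff_distrib)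
 have wh: "w : half V (-e)" using w half_memI[of w] y by simp
 have "J v w + J w (mid w) = J v (mid v) + J (mid v) (mid w)"
  unfolding J_def
  by (rule contour_integral_quadrilateral, rule holomorphic_product[OF vs ws])
    (use vh wh mid_half z_mid_half v w in auto)
 moreover have "J (mid (of_real ep)) (mid v) + J (mid v) (mid w) = J (mid (of_real ep)) (mid w)"
  using J_mid[of "of_real ep" v w] v w eps by simp
 ultimately show ?thesis using J_neg[of w "mid w"] J_neg[of v "mid v"] unfolding Pz_def by algebra
qed

private lemma nat_offset_notin_Nats:
 assumes "0 < \<bar>x\<bar>" "\<bar>x\<bar> < 1" shows "of_nat k + of_real x ~: (\<nat> :: complex set)"
proof
 assume "of_nat k + of_real x : (\<nat> :: complex set)"
 then obtain j :: nat where "of_nat k + of_real x = (of_nat j :: complex)" by (auto simp: Nats_def)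
 then have "Re (of_nat k + of_real x) = Re (of_nat j)" by simp
 then have "x = of_int (int j - int k)" by simp
 then show False using assms by (simp only: of_int_abs[symmetric] of_int_0_less_iff of_int_less_1_iff)
qed

text \<open>Outward legs: shifting the variable by k turns the factors A k and B (m - k) into L s
  and M (z - s), since the shifts k and m - k add up to m.\<close>

private lemma J_up:
 assumes "k <= m"
 shows "pass (of_real ep) (A k) (B (m - k)) zq = Pz (of_nat k + zq - of_real ep) - Pz (of_nat k + of_real ep)"
proof -
 have strip: "ep <= Re s & Re s <= 1/2 - ep & \<bar>Im s\<bar> <= y" if s: "s : closed_segment (of_real ep) (zq - of_real ep)" for s
 proof -
  obtain u where u: "0 <= u" "u <= 1" "s = (1 - u) *\<^sub>R of_real ep + u *\<^sub>R (zq - of_real ep)"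
   using s unfolding closed_segment_def by blast
  have "Re s = (1 - u) * ep + u * (1/2 - ep)" "Im s = - e * (u * y)" unfolding u(3) by (simp_all add: Im_z)
  moreover have "(1 - u) * ep + u * (1/2 - ep) <= 1/2 - ep" using u eps by (intro convex_bound_le) auto
  moreover have "ep <= (1 - u) * ep + u * (1/2 - ep)"
  proof -
   have "0 <= u * (1/2 - 2 * ep)" using u eps by simp
   then show ?thesis by (simp add: algebra_simps)
  qed
  moreover have "u * y <= 1 * y" "0 <= u * y" using u y by (auto intro!: mult_right_mono)
  ultimately show ?thesis using abs_e[of "u * y"] by simp
 qed
 have "pass (of_real ep) (A k) (B (m - k)) zq =
   contour_integral (linepath (of_real ep) (zq - of_real ep)) (%s. L (of_nat k + s) * M (z - (of_nat k + s)))"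
  unfolding pass_def
 proof (rule contour_integral_eq)
  fix s assume "s : path_image (linepath (of_real ep) (zq - of_real ep))"
  then have s: "ep <= Re s" "Re s <= 1/2 - ep" "\<bar>Im s\<bar> <= y" and "s : closed_segment (of_real ep) (zq - of_real ep)"
   using strip by auto
  then obtain u where u: "0 <= u" "u <= 1" "s = (1 - u) *\<^sub>R of_real ep + u *\<^sub>R (zq - of_real ep)"
   unfolding closed_segment_def by blast
  have "zq - s = (1 - (1 - u)) *\<^sub>R of_real ep + (1 - u) *\<^sub>R (zq - of_real ep)"
   unfolding u(3) by (simp add: algebra_simps)
  then have "zq - s : closed_segment (of_real ep) (zq - of_real ep)"
   unfolding closed_segment_def using u by (intro CollectI exI[of _ "1 - u"]) auto
  then have w: "ep <= Re (zq - s)" "Re (zq - s) <= 1/2 - ep" "\<bar>Im (zq - s)\<bar> <= y" using strip by blast+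
  have eq: "of_nat (m - k) + (zq - s) = z - (of_nat k + s)" using assms by (simp add: z of_nat_diff)
  show "A k s * B (m - k) (zq - s) = L (of_nat k + s) * M (z - (of_nat k + s))"
  proof -
   have "B (m - k) (zq - s) = M (of_nat (m - k) + (zq - s))" by (rule BM) (use w eps y in auto)
   moreover have "A k s = L (of_nat k + s)" by (rule AL[OF assms]) (use s eps y in auto)
   ultimately show ?thesis by (simp only: eq)
  qed
 qed
 also have "\<dots> = J (of_nat k + of_real ep) (of_nat k + zq - of_real ep)"
  unfolding J_def by (subst contour_integral_linepath_shift) (simp add: algebra_simps)
 also have "\<dots> = Pz (of_nat k + zq - of_real ep) - Pz (of_nat k + of_real ep)"
 proof (rule J_piece)
  have eq: "z - (of_nat k + zq - of_real ep) = of_nat (m - k) + of_real ep" using assms by (simp add: z of_nat_diff)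
  show "z - (of_nat k + zq - of_real ep) ~: \<nat>" unfolding eq using nat_offset_notin_Nats[of ep "m - k"] eps by simp
  show "of_nat k + of_real ep ~: (\<nat> :: complex set)" using nat_offset_notin_Nats[of ep k] eps by simp
 qed (use eps assms in \<open>auto simp: Im_z\<close>)
 finally show ?thesis .
qed

text \<open>Returning legs: the indices k and m - Suc k add up to m - 1 only, and the missing unit
  comes from evaluating \<open>pass\<close> at zq + 1.\<close>

private lemma J_down:
 assumes "k < m"
 shows "pass (1 - of_real ep) (A k) (B (m - Suc k)) (zq + 1) = Pz (of_nat k + zq + of_real ep) - Pz (of_nat (Suc k) - of_real ep)"
proof -
 have strip: "1/2 + ep <= Re s & Re s <= 1 - ep & \<bar>Im s\<bar> <= y" if s: "s : closed_segment (1 - of_real ep) (zq + of_real ep)" for s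
 proof -
  obtain u where u: "0 <= u" "u <= 1" "s = (1 - u) *\<^sub>R (1 - of_real ep) + u *\<^sub>R (zq + of_real ep)"
   using s unfolding closed_segment_def by blast
  have "Re s = (1 - u) * (1 - ep) + u * (1/2 + ep)" "Im s = - e * (u * y)" unfolding u(3) by (simp_all add: Im_z)
  moreover have "(1 - u) * (1 - ep) + u * (1/2 + ep) <= 1 - ep" using u eps by (intro convex_bound_le) auto
  moreover have "1/2 + ep <= (1 - u) * (1 - ep) + u * (1/2 + ep)"
  proof -
   have "0 <= (1 - u) * (1/2 - 2 * ep)" using u eps by simp
   also have "\<dots> = (1 - u) * (1 - ep) + u * (1/2 + ep) - (1/2 + ep)" by (simp add: field_simps)
   finally show ?thesis by simp
  qed
  moreover have "u * y <= 1 * y" "0 <= u * y" using u y by (auto intro!: mult_right_mono)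
  ultimately show ?thesis using abs_e[of "u * y"] by simp
 qed
 have e1: "zq + 1 - (1 - of_real ep) = zq + of_real ep" by simp
 have "pass (1 - of_real ep) (A k) (B (m - Suc k)) (zq + 1) =
   contour_integral (linepath (1 - of_real ep) (zq + of_real ep)) (%s. L (of_nat k + s) * M (z - (of_nat k + s)))"
  unfolding pass_def e1
 proof (rule contour_integral_eq)
  fix s assume "s : path_image (linepath (1 - of_real ep) (zq + of_real ep))"
  then have s: "1/2 + ep <= Re s" "Re s <= 1 - ep" "\<bar>Im s\<bar> <= y" and "s : closed_segment (1 - of_real ep) (zq + of_real ep)"
   using strip by auto
  then obtain u where u: "0 <= u" "u <= 1" "s = (1 - u) *\<^sub>R (1 - of_real ep) + u *\<^sub>R (zq + of_real ep)"
   unfolding closed_segment_def by blast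
  have "zq + 1 - s = (1 - (1 - u)) *\<^sub>R (1 - of_real ep) + (1 - u) *\<^sub>R (zq + of_real ep)"
   unfolding u(3) by (simp add: algebra_simps)
  then have "zq + 1 - s : closed_segment (1 - of_real ep) (zq + of_real ep)"
   unfolding closed_segment_def using u by (intro CollectI exI[of _ "1 - u"]) auto
  then have w: "1/2 + ep <= Re (zq + 1 - s)" "Re (zq + 1 - s) <= 1 - ep" "\<bar>Im (zq + 1 - s)\<bar> <= y" using strip by blast+
  have eq: "of_nat (m - Suc k) + (zq + 1 - s) = z - (of_nat k + s)" using assms by (simp add: z of_nat_diff)
  show "A k s * B (m - Suc k) (zq + 1 - s) = L (of_nat k + s) * M (z - (of_nat k + s))"
  proof -
   have "B (m - Suc k) (zq + 1 - s) = M (of_nat (m - Suc k) + (zq + 1 - s))" by (rule BM) (use w eps y in auto)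
   moreover have "A k s = L (of_nat k + s)" by (rule AL) (use s eps y assms in auto)
   ultimately show ?thesis by (simp only: eq)
  qed
 qed
 also have "\<dots> = J (of_nat (Suc k) - of_real ep) (of_nat k + zq + of_real ep)"
  unfolding J_def by (subst contour_integral_linepath_shift) (simp add: algebra_simps)
 also have "\<dots> = Pz (of_nat k + zq + of_real ep) - Pz (of_nat (Suc k) - of_real ep)"
 proof (rule J_piece)
  have km: "real k + 1 <= real m" using assms by simp
  then show "Re (of_nat (Suc k) - of_real ep) <= real m + 1/2 - ep" "Re (of_nat k + zq + of_real ep) <= real m + 1/2 - ep"
   using eps by (auto simp: Im_z)
  have eq: "z - (of_nat k + zq + of_real ep) = of_nat (m - k) + of_real (- ep)" using assms by (simp add: z of_nat_diff)
  show "z - (of_nat k + zq + of_real ep) ~: \<nat>" unfolding eq using nat_offset_notin_Nats[of "- ep" "m - k"] eps by simp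
  show "of_nat (Suc k) - of_real ep ~: (\<nat> :: complex set)" using nat_offset_notin_Nats[of "- ep" "Suc k"] eps by simp
 qed (use eps in \<open>auto simp: Im_z\<close>)
 finally show ?thesis .
qed

text \<open>The tip of the arc leaves the strip since y < ep, and M (z - s) has to be replaced by B
  (m - k), which is holomorphic there; \<open>Ja\<close> integrates this mixed product. Two
  quadrilaterals push the arc to the midline, where the mixed product and the original one
  agree.\<close>

lemma arc_part_eq_strip_primitive:
 assumes k: "1 <= k" "k <= m"
 shows "arc_part e ep (%s. L (of_nat k + s)) (B (m - k)) zq = Pz (of_nat k + of_real ep) - Pz (of_nat k - of_real ep)"
proof -
 define c l r :: complex where "c = of_nat k + (- \<i> * of_real (e * ep))" and "l = of_nat k - of_real ep" and "r = of_nat k + of_real ep"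
 define Ja where "Ja u v = contour_integral (linepath u v) (%s. L s * B (m - k) (zq + of_nat k - s))" for u v
 \<comment> \<open>Contains zq + k - s for s between the arc and the axis. Its part on the side -e
   is covered by the thin strip, the rest by the sheet.\<close>
 define R where "R = {s. 1/4 <= Re s & Re s <= 3/4 & - y <= e * Im s & e * Im s <= ep}"
 have k1: "1 <= real k" "real k <= real m" using k by auto
 have Rc: "convex R"
 proof -
  have "R = {s. 1/4 <= Re s} \<inter> {s. Re s <= 3/4} \<inter> {s. - y <= (\<i> * of_real e) \<bullet> s} \<inter> {s. (\<i> * of_real e) \<bullet> s <= ep}"
   by (auto simp: R_def inner_complex_def)
  then show ?thesis
   by (simp only:) (intro convex_Int convex_halfspace_Re_ge convex_halfspace_Re_le convex_halfspace_ge convex_halfspace_le)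
 qed
 have BR: "B (m - k) holomorphic_on R"
 proof -
  have "R <= sheet V e \<union> {s. 1/4 <= Re s & Re s <= 3/4 & \<bar>Im s\<bar> < rh}"
  proof
   fix s assume s: "s : R"
   show "s : sheet V e \<union> {s. 1/4 <= Re s & Re s <= 3/4 & \<bar>Im s\<bar> < rh}"
   proof (cases "0 <= e * Im s")
    case True
    then have "s : V" using s abs_e[of "Im s"] by (intro admissible_mem_V[OF ep]) (auto simp: R_def)
    moreover have "s ~: \<nat>"
    proof
     assume "s : \<nat>"
     then obtain j :: nat where "s = of_nat j" by (auto simp: Nats_def)
     then have "real 0 < real j" "real j < real 1" using s by (auto simp: R_def)
     then show False by (simp only: of_nat_less_iff)
    qed
    ultimately show ?thesis using True by (simp add: sheet_def)
   next
    case False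
    then have "\<bar>Im s\<bar> < rh" using s y abs_e[of "Im s"] by (auto simp: R_def)
    then show ?thesis using s by (simp add: R_def)
   qed
  qed
  moreover have "B (m - k) analytic_on {s. 1/4 <= Re s & Re s <= 3/4 & \<bar>Im s\<bar> < rh}"
  proof -
   define U where "U = {s. ep < Re s & Re s < 1 - ep & \<bar>Im s\<bar> < rh}"
   have "open U" unfolding U_def
    by (intro open_Collect_conj open_Collect_less continuous_intros)
   moreover have "B (m - k) holomorphic_on U"
    by (rule holomorphic_on_subset[OF holB[of "m - k"]]) (auto simp: U_def)
   ultimately have "B (m - k) analytic_on U" by (simp add: analytic_on_open)
   then show ?thesis by (rule analytic_on_subset) (use eps in \<open>auto simp: U_def\<close>)
  qed
  ultimately have "B (m - k) analytic_on R"
   using G.A[of "m - k"] by (meson analytic_on_Un analytic_on_subset)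
  then show ?thesis by (rule analytic_imp_holomorphic)
 qed
 have hol: "(%s. L s * B (m - k) (zq + of_nat k - s)) holomorphic_on convex hull S"
  if p: "p : sheet V (-e)" and S: "S <= insert p (half V (-e))" "(%s. zq + of_nat k - s) ` S <= R" for S p
 proof -
  have 1: "convex hull S <= sheet V (-e)"
  proof -
   have "convex hull S <= insert p (half V (-e))" by (rule hull_minimal[OF S(1)]) (rule flipped(2)[OF p])
   then show ?thesis using flipped(3)[OF p] by blast
  qed
  have "convex ((%s. zq + of_nat k - s) -` R)" by (rule convex_minus_vimage[OF Rc])
  then have "convex hull S <= (%s. zq + of_nat k - s) -` R" using S(2) by (intro hull_minimal) auto
  then have 2: "(%s. zq + of_nat k - s) ` (convex hull S) <= R" by blast
  have "(B (m - k) \<circ> (%s. zq + of_nat k - s)) holomorphic_on convex hull S"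
   by (rule holomorphic_on_compose_gen[OF _ BR 2]) (intro holomorphic_intros)
  then show ?thesis
   using holomorphic_on_subset[OF analytic_imp_holomorphic[OF F.L] 1]
   by (auto intro!: holomorphic_intros simp: o_def)
 qed
 have Re: "Re l = real k - ep" "Re r = real k + ep" "Re c = real k" "Im l = 0" "Im r = 0" "e * Im c = - ep"
  by (simp_all add: l_def r_def c_def)
 have cV: "c : V" using Re eps k1 abs_e[of "Im c"] by (intro admissible_mem_V[OF ep]) auto
 have ch: "c : half V (-e)" using cV Re eps by (simp add: half_def)
 have lr: "l : sheet V (-e)" "r : sheet V (-e)"
  using mem_V[of l] mem_V[of r] Re k1 eps y nat_offset_notin_Nats[of "-ep" k] nat_offset_notin_Nats[of ep k]
  by (auto simp: sheet_def l_def r_def)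
 have rng: "ep <= Re l" "ep <= Re r" "ep <= Re c" "Re l <= real m + 1/2 - ep" "Re r <= real m + 1/2 - ep" "Re c <= real m + 1/2 - ep"
  using Re k1 eps by auto
 have R: "zq + of_nat k - s : R" if "\<bar>Re s - real k\<bar> <= ep" "- ep <= e * Im s" "e * Im s <= 0" for s
  using that eps y by (auto simp: R_def Im_z right_diff_distrib distrib_left)
 have R3: "zq + of_nat k - s : R" if "s : {l, c, r, mid l, mid c, mid r}" for s
  using that eps y mid_simps by (intro R) (auto simp: Re)
 have q1: "Ja l c + Ja c (mid c) = Ja l (mid l) + Ja (mid l) (mid c)"
  unfolding Ja_def
  by (rule contour_integral_quadrilateral, rule hol[OF lr(1)]) (use ch mid_half rng R3 in auto)
 have q2: "Ja c r + Ja r (mid r) = Ja c (mid c) + Ja (mid c) (mid r)"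
  unfolding Ja_def
  by (rule contour_integral_quadrilateral, rule hol[OF lr(2)]) (use ch mid_half rng R3 in auto)
 have JaJ: "Ja u v = J u v" if u: "\<bar>Re u - real k\<bar> <= ep" "- y <= e * Im u" "e * Im u <= 0"
  and v: "\<bar>Re v - real k\<bar> <= ep" "- y <= e * Im v" "e * Im v <= 0" for u v
  unfolding Ja_def J_def
 proof (rule contour_integral_eq)
  fix s assume "s : path_image (linepath u v)"
  then obtain t where t: "0 <= t" "t <= 1" "s = (1 - t) *\<^sub>R u + t *\<^sub>R v" by (auto simp: closed_segment_def)
  have "s : {s. real k - ep <= Re s & Re s <= real k + ep & - y <= e * Im s & e * Im s <= 0}"
  proof -
   have "Re s = (1 - t) * Re u + t * Re v" "e * Im s = (1 - t) * (e * Im u) + t * (e * Im v)"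
    unfolding t(3) by (simp_all add: algebra_simps)
   moreover have "(1 - t) * Re u + t * Re v <= real k + ep" "(1 - t) * (e * Im u) + t * (e * Im v) <= 0"
    using u v t by (auto intro!: convex_bound_le)
   moreover have "- ((1 - t) * Re u + t * Re v) <= - (real k - ep)"
   proof -
    have "(1 - t) * (- Re u) + t * (- Re v) <= - (real k - ep)" using u v t by (intro convex_bound_le) auto
    then show ?thesis by simp
   qed
   moreover have "- ((1 - t) * (e * Im u) + t * (e * Im v)) <= y"
   proof -
    have "(1 - t) * (- (e * Im u)) + t * (- (e * Im v)) <= y" using u v t by (intro convex_bound_le) auto
    then show ?thesis by simp
   qed
   ultimately show ?thesis by simp
  qed
  then have s: "real k - ep <= Re s" "Re s <= real k + ep" "- y <= e * Im s" "e * Im s <= 0" by auto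
  have Imy: "\<bar>Im (zq + of_nat k - s)\<bar> <= y"
  proof -
   have "e * Im (zq + of_nat k - s) = - y - e * Im s" by (simp add: Im_z right_diff_distrib)
   then show ?thesis using abs_e[of "Im (zq + of_nat k - s)"] s by linarith
  qed
  have eq: "of_nat (m - k) + (zq + of_nat k - s) = z - s" using k by (simp add: z of_nat_diff)
  have "B (m - k) (zq + of_nat k - s) = M (of_nat (m - k) + (zq + of_nat k - s))"
   by (rule BM) (use Imy s eps y in \<open>auto simp: Im_z\<close>)
  then show "L s * B (m - k) (zq + of_nat k - s) = L s * M (z - s)" by (simp only: eq)
 qed
 have "arc_part e ep (%s. L (of_nat k + s)) (B (m - k)) zq = Ja l c + Ja c r"
 proof -
  have "B (m - k) (zq - s) = B (m - k) (zq + of_nat k - (of_nat k + s))" for s by simp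
  then show ?thesis
   unfolding arc_part_def Ja_def c_def l_def r_def
   by (simp only: contour_integral_linepath_shift[of _ _ "%s. L s * B (m - k) (zq + of_nat k - s)" "of_nat k"]) (simp add: algebra_simps)
 qed
 also have "\<dots> = Ja l (mid l) + Ja (mid l) (mid c) + Ja (mid c) (mid r) - Ja r (mid r)"
  using q1 q2 by algebra
 also have "\<dots> = J l (mid l) + (J (mid l) (mid c) + J (mid c) (mid r)) - J r (mid r)"
  using y eps mid_simps by (simp add: JaJ Re)
 also have "\<dots> = J l (mid l) + J (mid l) (mid r) - J r (mid r)"
  using J_mid[of l c r] rng by simp
 also have "\<dots> = Pz r - Pz l"
 proof -
  have "J (mid (of_real ep)) (mid l) + J (mid l) (mid r) = J (mid (of_real ep)) (mid r)"
   by (rule J_mid) (use rng eps in auto)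
  note a = this[symmetric]
  show ?thesis unfolding Pz_def a J_neg[of l "mid l"] J_neg[of r "mid r"] by simp
 qed
 finally show ?thesis unfolding l_def r_def .
qed

text \<open>All arcs and legs are differences of one primitive; they telescope to its difference
  between z - ep and ep, which is the straight \<open>pass\<close>. The end rays are those of the
  straight convolution split at \<open>ep\<close>.\<close>

lemma zigzag_eq_ray_convolution:
 "zigzag e ep L A M B m zq = ray_convolution L M z"
proof -
 \<comment> \<open>With the factors exchanged, the arcs of M are arcs of the first factor and the
   previous lemma applies to them.\<close>
 interpret S: sheet_pair V e M B L A by unfold_locales
 interpret m: wedge V "-e" by (rule wedge_uminus)
 define P where "P k = Pz (of_nat k + of_real ep)" for k :: nat
 define Q where "Q k = Pz (of_nat k - of_real ep)" for k :: nat
 define R where "R k = Pz (of_nat k + zq + of_real ep)" for k :: nat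
 define S where "S k = Pz (of_nat k + zq - of_real ep)" for k :: nat
 have bottom: "(\<Sum>k=1..m. arc_part e ep (%s. L (of_nat k + s)) (B (m - k)) zq) = (\<Sum>k=1..m. P k - Q k)"
  unfolding P_def Q_def by (intro sum.cong arc_part_eq_strip_primitive) auto
 have flip: "conv_segment M L z u v = - J (z - u) (z - v)" for u v
  using contour_integral_linepath_flip[of z u v "%s. M s * L (z - s)"]
  by (simp add: conv_segment_def mult.commute)
 \<comment> \<open>The reflection s -> z - s maps the midline to itself, so the primitive of the
   exchanged pair is expressed by the original one.\<close>
 have z_mid: "z - mid v = mid (z - v)" for v by (simp add: mid_def complex_eq_iff Im_z)
 have top1: "arc_part e ep (%s. M (of_nat k + s)) (A (m - k)) zq = R (m - k) - S (m - k)" if k: "k : {1..m}" for k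
 proof -
  have k1: "1 <= real k" "real k <= real m" using k by auto
  have "arc_part e ep (%s. M (of_nat k + s)) (A (m - k)) zq =
    strip_primitive e y ep M L z (of_nat k + of_real ep) - strip_primitive e y ep M L z (of_nat k - of_real ep)"
   by (rule S.arc_part_eq_strip_primitive[OF ep y thin holB BM holA AL zq z]) (use k in auto)
  also have "\<dots> = - (J (mid (z - of_real ep)) (mid (z - (of_nat k + of_real ep))) + J (mid (z - (of_nat k + of_real ep))) (z - (of_nat k + of_real ep)))
   + (J (mid (z - of_real ep)) (mid (z - (of_nat k - of_real ep))) + J (mid (z - (of_nat k - of_real ep))) (z - (of_nat k - of_real ep)))"
   by (simp add: strip_primitive_def flip z_mid)
  also have "\<dots> = Pz (z - (of_nat k - of_real ep)) - Pz (z - (of_nat k + of_real ep))"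
  proof -
   have b: "J (mid (of_real ep)) (mid (z - of_real ep)) + J (mid (z - of_real ep)) (mid (z - (of_nat k + of_real ep))) = J (mid (of_real ep)) (mid (z - (of_nat k + of_real ep)))"
    "J (mid (of_real ep)) (mid (z - of_real ep)) + J (mid (z - of_real ep)) (mid (z - (of_nat k - of_real ep))) = J (mid (of_real ep)) (mid (z - (of_nat k - of_real ep)))"
    by (rule J_mid; use k1 eps in \<open>auto simp: Im_z\<close>)+
   have "- (p + q) + (r + s) = (c + r) + s - ((c + p) + q)" for p q r s c :: complex by simp
   then show ?thesis unfolding strip_primitive_def b[symmetric] .
  qed
  also have "z - (of_nat k - of_real ep) = of_nat (m - k) + zq + of_real ep" using k by (simp add: z of_nat_diff)
  also have "z - (of_nat k + of_real ep) = of_nat (m - k) + zq - of_real ep" using k by (simp add: z of_nat_diff)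
  finally show ?thesis unfolding R_def S_def .
 qed
 have top: "(\<Sum>k=1..m. arc_part e ep (%s. M (of_nat k + s)) (A (m - k)) zq) = (\<Sum>j<m. R j - S j)"
  by (rule sum.reindex_bij_witness[of _ "%j. m - j" "%k. m - k"]) (auto simp: top1)
 have up: "(\<Sum>k\<le>m. pass (of_real ep) (A k) (B (m - k)) zq) = (\<Sum>k\<le>m. S k - P k)"
  unfolding S_def P_def by (intro sum.cong J_up) auto
 have down: "(\<Sum>k<m. pass (1 - of_real ep) (A k) (B (m - Suc k)) (zq + 1)) = (\<Sum>k<m. R k - Q (Suc k))"
  unfolding R_def Q_def by (intro sum.cong J_down) auto
 have all: "pass (of_real ep) L M z = S m - P 0"
 proof -
  have "pass (of_real ep) L M z = J (of_real ep) (z - of_real ep)" by (simp add: pass_def conv_segment_def)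
  also have "\<dots> = Pz (z - of_real ep) - Pz (of_real ep)"
   by (rule J_piece) (use eps nat_offset_notin_Nats[of ep 0] in \<open>auto simp: Im_z\<close>)
  finally show ?thesis by (simp add: S_def P_def z)
 qed
 have ray: "ray_part (of_real ep) (A' 0) (B' m) zq = ray_part (of_real ep) L' M' z"
  if A': "!!x. [|0 < x; x < 1|] ==> A' 0 (of_real x) = L' (of_real x)"
  and B': "!!s. [|ep <= Re s; Re s <= 1 - ep; \<bar>Im s\<bar> < rh|] ==> B' m s = M' (of_nat m + s)" for A' B' :: "nat => complex => complex" and L' M'
  unfolding ray_part_def contour_integral_integral vector_derivative_linepath_at
 proof (rule integral_spike[of "{0}"])
  fix t :: real assume t: "t : {0..1} - {0}"
  obtain x where x: "x = t * ep" "0 < x" "x <= ep" using t eps mult_right_mono[of t 1 ep] by auto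
  have lp: "linepath 0 (of_real ep) t = (of_real x :: complex)" by (simp add: linepath_def scaleR_conv_of_real x(1))
  have "A' 0 (of_real x) = L' (of_real x)" using A'[of x] x eps by simp
  moreover have "B' m (zq - of_real x) = M' (of_nat m + (zq - of_real x))"
   by (rule B') (use x(2,3) eps y abs_e[of y] in \<open>simp_all add: Im_z\<close>)
  moreover have "of_nat m + (zq - of_real x) = z - of_real x" by (simp add: z)
  ultimately show "L' (linepath 0 (of_real ep) t) * M' (z - linepath 0 (of_real ep) t) * (of_real ep - 0) =
    A' 0 (linepath 0 (of_real ep) t) * B' m (zq - linepath 0 (of_real ep) t) * (of_real ep - 0)"
   by (simp only: lp)
 qed auto
 have rays: "ray_part (of_real ep) (A 0) (B m) zq = ray_part (of_real ep) L M z"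
  "ray_part (of_real ep) (B 0) (A m) zq = ray_part (of_real ep) M L z"
  using F.glue[of _ 0] G.glue[of _ 0] AL[of m] BM[of m] by (auto intro!: ray)
 have conv: "ray_convolution L M z = ray_part (of_real ep) L M z + pass (of_real ep) L M z + ray_part (of_real ep) M L z"
  unfolding ray_convolution_def
 proof (rule contour_integral_unique, rule has_contour_integral_convolution[OF m.convex_base m.base_star])
  show "L holomorphic_on m.base" "M holomorphic_on m.base"
   using F.L G.L m.base_subset_sheet analytic_on_subset analytic_imp_holomorphic by metis+
  have "z : half V (-e)" using half_memI[of z] eps y by (simp add: Im_z)
  then show "z : m.base" using m.half_subset_base by blast
  have "z - of_real ep : half V (-e)" using half_memI[of "z - of_real ep"] eps y by (simp add: Im_z)
  then show "z - of_real ep : m.base" using m.half_subset_base by blast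
  show "of_real ep : m.base" using m.of_real_base eps by simp
 qed (use F.radL G.radL in auto)
 show ?thesis
  unfolding zigzag_def bottom top up down rays conv all
  unfolding telescoping_zigzag[of P Q m R S, symmetric] by simp
qed

end

lemma zigzag_below_half:
 assumes ep: "admissible ep"
 obtains rh where "rh > 0" "!!y. [|0 < y; y < rh|] ==>
  zigzag e ep L A M B m (Complex (1/2) (- e * y)) = ray_convolution L M (of_nat m + Complex (1/2) (- e * y))"
proof -
 have eps: "0 < ep" "ep < 1/4" using ep by (auto simp: admissible_def)
 have b: "1 - ep < 1" using eps by simp
 obtain rh1 where 1: "rh1 > 0" "!!k. k <= m ==> A k holomorphic_on {s. ep <= Re s & Re s <= 1 - ep & \<bar>Im s\<bar> < rh1}"
  "!!k s. [|k <= m; ep <= Re s; Re s <= 1 - ep; \<bar>Im s\<bar> < rh1|] ==> A k s = L (of_nat k + s)"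
  using F.strips_agree[OF eps(1) b] by blast
 obtain rh2 where 2: "rh2 > 0" "!!k. k <= m ==> B k holomorphic_on {s. ep <= Re s & Re s <= 1 - ep & \<bar>Im s\<bar> < rh2}"
  "!!k s. [|k <= m; ep <= Re s; Re s <= 1 - ep; \<bar>Im s\<bar> < rh2|] ==> B k s = M (of_nat k + s)"
  using G.strips_agree[OF eps(1) b] by blast
 obtain d where d: "d > 0" "!!y. [|0 < y; y < d|] ==> Complex ep y : V & Complex ep (- y) : V"
  using real_ball_V[OF eps(1)] by blast
 define rh where "rh = min (min rh1 rh2) (min d ep)"
 have rh: "rh > 0" "rh <= rh1" "rh <= rh2" "rh <= d" "rh <= ep" using 1 2 d eps by (auto simp: rh_def)
 show ?thesis
 proof (rule that[OF rh(1)])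
  fix y assume y: "0 < y" "y < rh"
  show "zigzag e ep L A M B m (Complex (1/2) (- e * y)) = ray_convolution L M (of_nat m + Complex (1/2) (- e * y))"
  proof (rule zigzag_eq_ray_convolution[OF ep y])
   show "y < ep" "Complex ep y : V" "Complex ep (- y) : V" using y rh d(2)[of y] by auto
   fix k assume k: "k <= m"
   show "A k holomorphic_on {s. ep <= Re s & Re s <= 1 - ep & \<bar>Im s\<bar> < rh}"
    using rh by (intro holomorphic_on_subset[OF 1(2)[OF k]]) auto
   show "B k holomorphic_on {s. ep <= Re s & Re s <= 1 - ep & \<bar>Im s\<bar> < rh}"
    using rh by (intro holomorphic_on_subset[OF 2(2)[OF k]]) auto
  qed (use rh 1(3) 2(3) in auto)
 qed
qed

end

section \<open>Sheets of the convolution: boundary extension and gluing\<close>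

lemma between_Nats:
 assumes "0 < p" "p ~: \<nat>" obtains n where "real n < p" "p < real n + 1"
proof -
 have "p ~= real (nat \<lfloor>p\<rfloor>)" using assms(2) by (metis of_nat_in_Nats)
 moreover have "real (nat \<lfloor>p\<rfloor>) <= p" "p < real (nat \<lfloor>p\<rfloor>) + 1" using assms(1) by auto
 ultimately show ?thesis using that[of "nat \<lfloor>p\<rfloor>"] by auto
qed

text \<open>Extension to p from the side e alone; values of f on the axis or beyond it are not
  constrained.\<close>

definition extends_at :: "real => (complex => complex) => complex => bool" where
 "extends_at e f p \<longleftrightarrow> (\<exists>r>0. \<exists>ph. ph holomorphic_on ball p r & (\<forall>z\<in>ball p r. 0 < e * Im z --> ph z = f z))"

lemma extends_at_analytic: "f analytic_on {p} ==> extends_at e f p"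
 unfolding extends_at_def analytic_on_def by blast

lemma extends_at_binop:
 assumes "extends_at e f p" "extends_at e g p"
  and op: "!!ph pz S. [|ph holomorphic_on S; pz holomorphic_on S|] ==> (%z. q (ph z) (pz z)) holomorphic_on S"
 shows "extends_at e (%z. q (f z) (g z)) p"
proof -
 from assms obtain r ph s pz where r: "r > 0" "ph holomorphic_on ball p r" "\<forall>z\<in>ball p r. 0 < e * Im z --> ph z = f z"
  and s: "s > 0" "pz holomorphic_on ball p s" "\<forall>z\<in>ball p s. 0 < e * Im z --> pz z = g z"
  unfolding extends_at_def by blast
 have "ph holomorphic_on ball p (min r s)" "pz holomorphic_on ball p (min r s)"
  using r(2) s(2) by (auto elim: holomorphic_on_subset)
 then have "(%z. q (ph z) (pz z)) holomorphic_on ball p (min r s)" by (rule op)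
 moreover have "\<forall>z\<in>ball p (min r s). 0 < e * Im z --> q (ph z) (pz z) = q (f z) (g z)" using r(3) s(3) by auto
 moreover have "min r s > 0" using r s by simp
 ultimately show ?thesis unfolding extends_at_def by blast
qed

lemma extends_at_add: "[|extends_at e f p; extends_at e g p|] ==> extends_at e (%z. f z + g z) p"
 by (rule extends_at_binop) (auto intro: holomorphic_intros)

lemma extends_at_diff: "[|extends_at e f p; extends_at e g p|] ==> extends_at e (%z. f z - g z) p"
 by (rule extends_at_binop) (auto intro: holomorphic_intros)

lemma extends_at_sum:
 "finite K ==> (!!k. k : K ==> extends_at e (f k) p) ==> extends_at e (%z. \<Sum>k\<in>K. f k z) p"
proof (induction K rule: finite_induct)
 case empty
 then show ?case by (auto intro!: extends_at_analytic analytic_intros)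
next
 case (insert k K)
 then show ?case by (auto intro!: extends_at_add)
qed

lemma extends_at_shift:
 assumes "extends_at e f (p + of_real c)" shows "extends_at e (%z. f (z + of_real c)) p"
proof -
 from assms obtain r ph where r: "r > 0" "ph holomorphic_on ball (p + of_real c) r"
  "\<forall>z\<in>ball (p + of_real c) r. 0 < e * Im z --> ph z = f z" unfolding extends_at_def by blast
 have b: "z + of_real c : ball (p + of_real c) r" if "z : ball p r" for z using that by (simp add: dist_norm)
 have "(ph \<circ> (%z. z + of_real c)) holomorphic_on ball p r"
  by (rule holomorphic_on_compose_gen[OF _ r(2)]) (use b in \<open>auto intro!: holomorphic_intros\<close>)
 then have "(%z. ph (z + of_real c)) holomorphic_on ball p r" by (simp add: o_def)
 moreover have "\<forall>z\<in>ball p r. 0 < e * Im z --> ph (z + of_real c) = f (z + of_real c)" using r(3) b by simp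
 ultimately show ?thesis unfolding extends_at_def using r(1) by blast
qed

context sheet_pair
begin

lemma pass_extends_at:
 assumes "A' analytic_on sheet V e" "B' analytic_on sheet V e" "0 < a" "a ~: \<nat>" "p ~: \<nat>" "p - a ~: \<nat>" "a < p"
 shows "extends_at e (pass (of_real a) A' B') (of_real p)"
proof -
 obtain r ph where "r > 0" "ph holomorphic_on ball (of_real p) r"
  "!!z. [|z : ball (of_real p) r; 0 < e * Im z|] ==> ph z = pass (of_real a) A' B' z"
  by (rule pass_extension[OF assms]) blast
 then show ?thesis unfolding extends_at_def by blast
qed

text \<open>For m = 0 there are neither arcs nor returning legs, and what remains is the straight
  integral split near its two ends.\<close>

lemma zigzag_0:
 assumes z: "z : half V e" "z - of_real ep : V" and ep: "0 < ep" "ep < 1"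
 shows "zigzag e ep L A M B 0 z = ray_convolution (A 0) (B 0) z"
proof -
 have "((%s. A 0 s * B 0 (z - s)) has_contour_integral
   (ray_part (of_real ep) (A 0) (B 0) z + pass (of_real ep) (A 0) (B 0) z + ray_part (of_real ep) (B 0) (A 0) z)) (linepath 0 z)"
 proof (rule has_contour_integral_convolution[OF convex_base base_star])
  show "A 0 holomorphic_on base" "B 0 holomorphic_on base"
   using F.A G.A base_subset_sheet analytic_on_subset analytic_imp_holomorphic by metis+
  show "z : base" using z half_subset_base by blast
  have "z - of_real ep : half V e" using z by (simp add: half_def)
  then show "z - of_real ep : base" using half_subset_base by blast
 qed (use F.radA G.radA of_real_base ep in auto)
 then show ?thesis unfolding ray_convolution_def zigzag_def by (simp add: contour_integral_unique)
qed

text \<open>Keeps p - s on the sheet for s on an arc or an end ray, so that at p only the legs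
  require a bent contour.\<close>

definition small_for :: "real => real => bool" where
 "small_for p ep \<longleftrightarrow> admissible ep & ep < p / 2 & (\<forall>x. \<bar>x\<bar> <= ep --> p + x ~: \<nat>) &
   (\<forall>z. p - ep <= Re z & \<bar>Im z\<bar> <= ep --> z : V)"

lemma small_for_exists:
 assumes p: "0 < p" "p ~: \<nat>"
 obtains d where "d > 0" "!!ep. [|0 < ep; ep < d|] ==> small_for p ep"
proof -
 obtain n where n: "real n < p" "p < real n + 1" using between_Nats[OF p] .
 obtain d1 where d1: "d1 > 0" "!!ep. [|0 < ep; ep < d1|] ==> admissible ep" using admissible_small by blast
 have p2: "0 < p / 2" using p by simp
 obtain d2 where d2: "d2 > 0" "!!ep. [|0 < ep; ep < d2|] ==> Complex (p / 2) ep : V & Complex (p / 2) (- ep) : V"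
  using real_ball_V[OF p2] by blast
 define d where "d = min (min d1 d2) (min (p / 2) (min (p - real n) (real n + 1 - p)))"
 have "small_for p ep" if "0 < ep" "ep < d" for ep
 proof -
  have ep: "0 < ep" "ep < d1" "ep < d2" "ep < p / 2" "real n < p - ep" "p + ep < real n + 1" using that by (auto simp: d_def)
  have "z : V" if "p - ep <= Re z" "\<bar>Im z\<bar> <= ep" for z
   using Complex_mem_V[of "p / 2" ep z] d2(2)[of ep] that ep by simp
  moreover have "p + x ~: \<nat>" if "\<bar>x\<bar> <= ep" for x
   using not_Nats_between[of n "p + x"] that ep by auto
  ultimately show ?thesis using d1 ep by (auto simp: small_for_def)
 qed
 moreover have "d > 0" using d1 d2 p n by (auto simp: d_def)
 ultimately show ?thesis using that by blast
qed

lemma small_for_notin_Nats: "[|small_for p ep; \<bar>x\<bar> <= ep|] ==> p + x ~: \<nat>"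
 by (simp add: small_for_def)

lemma small_for_arc:
 assumes ep: "small_for p ep"
  and s: "s : closed_segment (- of_real ep) (- \<i> * of_real (e * ep)) \<union> closed_segment (- \<i> * of_real (e * ep)) (of_real ep)"
 shows "of_real p - s : sheet V e"
proof -
 have "0 < ep" using ep by (simp add: small_for_def admissible_def)
 note d = diamond_side[OF s less_imp_le[OF this] e]
 have "of_real p - s : V" using d ep by (auto simp: small_for_def)
 moreover have "of_real p - s ~: \<nat>"
 proof
  assume N: "of_real p - s : \<nat>"
  then have "Im s = 0" using Nats_Im_0[OF N] by simp
  then have "of_real p - s = of_real (p + - Re s)" by (simp add: complex_eq_iff)
  moreover have "p + - Re s ~: \<nat>" by (rule small_for_notin_Nats[OF ep]) (use d in auto)
  ultimately show False using N by (simp only: of_real_in_Nats_iff)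
 qed
 ultimately show ?thesis using d by (simp add: sheet_def)
qed

lemma small_for_ray:
 assumes ep: "small_for p ep" and t: "t : {0..1}"
 shows "of_real p - of_real t * of_real ep : sheet V e"
proof -
 have eps: "0 < ep" using ep by (simp add: small_for_def admissible_def)
 obtain x where x: "x = t * ep" "0 <= x" "x <= ep" using t eps mult_right_mono[of t 1 ep] by auto
 have "p + - x ~: \<nat>" by (rule small_for_notin_Nats[OF ep]) (use x in auto)
 moreover have "0 < p + - x" using ep x(2,3) eps by (auto simp: small_for_def)
 ultimately have "of_real (p + - x) : sheet V e" by (intro of_real_sheet)
 then show ?thesis by (simp add: x(1))
qed

text \<open>Arcs and end rays are analytic at p as they stand. The legs would run along the axis
  through integers; \<open>pass_extension\<close> continues them, the returning ones at p +
  1.\<close>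

lemma zigzag_extends_at:
 assumes p: "0 < p" "p ~: \<nat>"
 obtains ep where "admissible ep" "of_real p - of_real ep : V" "of_real p + \<i> * of_real (e * ep) : V"
  "extends_at e (zigzag e ep L A M B m) (of_real p)"
proof -
 obtain d where d: "d > 0" "!!ep. [|0 < ep; ep < d|] ==> small_for p ep" using small_for_exists[OF p] by blast
 define ep where "ep = d / 2"
 have small: "small_for p ep" using d by (simp add: ep_def)
 have adm: "admissible ep" and ep: "ep < p / 2" and nn: "!!x. \<bar>x\<bar> <= ep ==> p + x ~: \<nat>"
  and inV: "!!z. [|p - ep <= Re z; \<bar>Im z\<bar> <= ep|] ==> z : V" using small by (auto simp: small_for_def)
 have eps: "0 < ep" "ep < 1/4" using adm by (auto simp: admissible_def)
 obtain n where n: "real n < p" "p < real n + 1" using between_Nats[OF p] .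
 note parts = zigzag_parts_analytic[OF adm small_for_arc[OF small] small_for_ray[OF small]]
 have pass1: "extends_at e (pass (of_real ep) (A k) (B j)) (of_real p)" for k j
 proof (rule pass_extends_at[OF F.A G.A])
  show "ep ~: \<nat>" using not_Nats_between[of 0 ep] eps by simp
  show "p - ep ~: \<nat>" using nn[of "- ep"] eps by simp
  show "ep < p" using ep eps p by simp
 qed (use ep eps p in auto)
 have pass2': "extends_at e (pass (of_real (1 - ep)) (A k) (B j)) (of_real (p + 1))" for k j
 proof (rule pass_extends_at[OF F.A G.A])
  show "1 - ep ~: \<nat>" using not_Nats_between[of 0 "1 - ep"] ep eps by simp
  show "p + 1 ~: \<nat>" using not_Nats_between[of "Suc n" "p + 1"] n by simp
  show "p + 1 - (1 - ep) ~: \<nat>" using nn[of ep] eps by simp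
 qed (use ep eps p in auto)
 have pass2: "extends_at e (%z. pass (1 - of_real ep) (A k) (B j) (z + 1)) (of_real p)" for k j
  using extends_at_shift[of e "pass (1 - of_real ep) (A k) (B j)" "of_real p" 1] pass2'[of k j] by simp
 have "extends_at e (zigzag e ep L A M B m) (of_real p)"
  unfolding zigzag_def[abs_def]
  by (intro extends_at_diff extends_at_add extends_at_sum pass1 pass2 extends_at_analytic[OF parts(1)]
    extends_at_analytic[OF parts(2)] extends_at_analytic[OF parts(3)] extends_at_analytic[OF parts(4)]) auto
 moreover have "of_real p - of_real ep : V" "of_real p + \<i> * of_real (e * ep) : V"
  using eps(1) by (auto intro!: inV simp: abs_mult)
 ultimately show ?thesis using that adm by blast
qed

lemma region_eq:
 assumes "admissible ep"
 shows "region ep = insert (1/2) {z : {z : V. z - of_real ep : V & z + \<i> * of_real (e * ep) : V}. 0 < e * Im z}"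
 by (auto simp: region_def half_def)

lemma convex_region:
 assumes ep: "admissible ep" shows "convex (region ep)"
proof -
 have eps: "0 < ep" "ep < 1/4" using ep by (auto simp: admissible_def)
 define K where "K = {z : V. z - of_real ep : V & z + \<i> * of_real (e * ep) : V}"
 have K: "convex K"
 proof (rule convexI)
  fix x y and u v :: real assume x: "x : K" and y: "y : K" and uv: "0 <= u" "0 <= v" "u + v = 1"
  have c: "u *\<^sub>R (x + c) + v *\<^sub>R (y + c) = u *\<^sub>R x + v *\<^sub>R y + (u + v) *\<^sub>R c" for c
   by (simp add: algebra_simps)
  have "u *\<^sub>R x + v *\<^sub>R y : V" "u *\<^sub>R (x + - of_real ep) + v *\<^sub>R (y + - of_real ep) : V"
   "u *\<^sub>R (x + \<i> * of_real (e * ep)) + v *\<^sub>R (y + \<i> * of_real (e * ep)) : V"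
   using x y uv by (auto intro!: convexD[OF convex_V] simp: K_def)
  then show "u *\<^sub>R x + v *\<^sub>R y : K" unfolding c using uv by (simp add: K_def)
 qed
 have "1/2 : K"
  using eps by (auto simp: K_def abs_mult intro!: admissible_mem_V[OF ep])
 then show ?thesis
  unfolding region_eq[OF ep] K_def[symmetric] by (intro convex_insert_upper[OF K]) auto
qed

lemma half_islimpt:
 assumes "0 < rh" and c: "c = 1 \<or> c = -1"
 shows "(1/2 :: complex) islimpt {Complex (1/2) (c * e * y) |y. 0 < y & y < rh}"
 unfolding islimpt_approachable
proof (intro allI impI)
 fix d :: real assume "d > 0"
 then obtain y where y: "0 < y" "y < rh" "y < d" using dense[of 0 "min rh d"] assms by auto
 have "1/2 = Complex (1/2) 0" by (simp add: complex_eq_iff)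
 then have "dist (Complex (1/2) (c * e * y)) (1/2) = \<bar>c * e * y\<bar>"
  by (simp add: dist_norm cmod_def)
 moreover have "\<bar>c * e * y\<bar> = y" using c e y by (auto simp: abs_mult)
 ultimately have "dist (Complex (1/2) (c * e * y)) (1/2) = y" by simp
 then have "Complex (1/2) (c * e * y) ~= 1/2" "dist (Complex (1/2) (c * e * y)) (1/2) < d"
  using y by (metis dist_self less_irrefl, simp)
 then show "\<exists>x'\<in>{Complex (1/2) (c * e * y) |y. 0 < y & y < rh}. x' ~= 1/2 & dist x' (1/2) < d"
  using y(1,2) by blast
qed

text \<open>Slightly to the side -e of 1/2 both sides equal the straight convolution, whatever the
  size of the detours. The intersection of the two regions is convex and contains 1/2, so the
  identity theorem carries the equality to z.\<close>

lemma zigzag_indep: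
 assumes ep: "admissible ep" and ep': "admissible ep'" and z: "z : region ep" "z : region ep'"
 shows "zigzag e ep L A M B m z = zigzag e ep' L A M B m z"
proof -
 obtain rh1 where 1: "rh1 > 0" "!!y. [|0 < y; y < rh1|] ==>
  zigzag e ep L A M B m (Complex (1/2) (- e * y)) = ray_convolution L M (of_nat m + Complex (1/2) (- e * y))"
  using zigzag_below_half[OF ep, of m] by blast
 obtain rh2 where 2: "rh2 > 0" "!!y. [|0 < y; y < rh2|] ==>
  zigzag e ep' L A M B m (Complex (1/2) (- e * y)) = ray_convolution L M (of_nat m + Complex (1/2) (- e * y))"
  using zigzag_below_half[OF ep', of m] by blast
 show ?thesis
 proof (rule analytic_eq_on_connected[where f = "zigzag e ep L A M B m" and g = "zigzag e ep' L A M B m"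
    and T = "region ep \<inter> region ep'" and a = "1/2" and w = z
    and Z = "{Complex (1/2) (-1 * e * y) |y. 0 < y & y < min rh1 rh2}"])
  show "zigzag e ep L A M B m analytic_on (region ep \<inter> region ep')"
   "zigzag e ep' L A M B m analytic_on (region ep \<inter> region ep')"
   using zigzag_analytic[OF ep] zigzag_analytic[OF ep'] analytic_on_analytic_at by blast+
  show "connected (region ep \<inter> region ep')"
   by (intro convex_connected convex_Int convex_region ep ep')
  show "1/2 : region ep \<inter> region ep'" by (simp add: region_def)
  show "(1/2 :: complex) islimpt {Complex (1/2) (-1 * e * y) |y. 0 < y & y < min rh1 rh2}"
   using 1(1) 2(1) by (intro half_islimpt) auto
  show "z : region ep \<inter> region ep'" using z by blast
 qed (use 1(2) 2(2) in auto)
qed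

lemma region_exists:
 assumes "z : half V e" obtains ep where "admissible ep" "z : region ep"
proof -
 have zV: "z : V" using assms by (simp add: half_def)
 then obtain d where d: "d > 0" "ball z d <= V" using open_V openE by blast
 obtain d1 where d1: "d1 > 0" "!!ep. [|0 < ep; ep < d1|] ==> admissible ep" using admissible_small by blast
 obtain ep where ep: "0 < ep" "ep < d" "ep < d1" using dense[of 0 "min d d1"] d d1 by auto
 have "z - of_real ep : ball z d" "z + \<i> * of_real (e * ep) : ball z d"
  using ep by (auto simp: dist_norm norm_mult abs_mult)
 then have "z - of_real ep : V" "z + \<i> * of_real (e * ep) : V" using d(2) by blast+
 then have "z : region ep" using assms unfolding region_def by blast
 then show ?thesis using that d1(2) ep by blast
qed

lemma open_region_half: "open {z : half V e. z - of_real ep : V & z + \<i> * of_real (e * ep) : V}"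
proof -
 have "{z : half V e. z - of_real ep : V & z + \<i> * of_real (e * ep) : V} =
   half V e \<inter> (%z. z - of_real ep) -` V \<inter> (%z. z + \<i> * of_real (e * ep)) -` V" by auto
 then show ?thesis
  by (simp only:) (intro open_Int open_half open_vimage open_V continuous_intros)
qed

text \<open>Every point of the open half lies in the region of some \<open>ep\<close>, and
  independence of \<open>ep\<close> makes the local zigzags one holomorphic function; the extensions
  at real points complete the sheet.\<close>

lemma sheet_convolution_exists:
 obtains C where "C analytic_on sheet V e"
  "!!ep z. [|admissible ep; z : region ep; z ~= 1/2|] ==> C z = zigzag e ep L A M B m z"
proof -
 define ep where "ep z = (SOME ep. admissible ep & z : region ep)" for z
 have ep: "admissible (ep z) & z : region (ep z)" if "z : half V e" for z
  unfolding ep_def by (rule someI_ex) (use region_exists[OF that] in blast)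
 define C0 where "C0 z = zigzag e (ep z) L A M B m z" for z
 have C0: "C0 z = zigzag e ep' L A M B m z" if "admissible ep'" "z : region ep'" "z : half V e" for z ep'
  unfolding C0_def using zigzag_indep[of "ep z" ep' z] ep[of z] that by blast
 have half_ne: "z ~= 1/2" if "z : half V e" for z
 proof
  assume eq: "z = 1/2"
  have "Im z = 0" unfolding eq by simp
  then show False using that by (simp add: half_def)
 qed
 have "C0 analytic_on {z0}" if z0: "z0 : half V e" for z0
 proof -
  define U where "U = {z : half V e. z - of_real (ep z0) : V & z + \<i> * of_real (e * ep z0) : V}"
  have "z0 : U" using ep[OF z0] half_ne[OF z0] by (auto simp: U_def region_def)
  then have "\<forall>\<^sub>F z in nhds z0. z : U"
   using open_region_half by (intro eventually_nhds_in_open) (auto simp: U_def)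
  then have "\<forall>\<^sub>F z in nhds z0. C0 z = zigzag e (ep z0) L A M B m z"
   by (rule eventually_mono) (use C0 ep[OF z0] in \<open>auto simp: U_def region_def\<close>)
  from analytic_at_cong[OF this] show ?thesis using zigzag_analytic ep[OF z0] by blast
 qed
 then have hol: "C0 holomorphic_on half V e"
  using analytic_on_analytic_at analytic_imp_holomorphic by blast
 obtain C where C: "C analytic_on (half V e \<union> of_real ` {x. 0 < x & x ~: \<nat>})" "!!z. z : half V e ==> C z = C0 z"
 proof (rule analytic_extension_across_real[OF e hol open_half])
  fix p :: complex assume "p : of_real ` {x. 0 < x & x ~: \<nat>}"
  then obtain x where x: "p = of_real x" "0 < x" "x ~: \<nat>" by auto
  obtain de where de: "admissible de" "p - of_real de : V" "p + \<i> * of_real (e * de) : V"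
   "extends_at e (zigzag e de L A M B m) p"
   using zigzag_extends_at[OF x(2,3)] unfolding x(1) by metis
  from de(4) obtain r ph where r: "r > 0" "ph holomorphic_on ball p r"
   "\<forall>z\<in>ball p r. 0 < e * Im z --> ph z = zigzag e de L A M B m z" unfolding extends_at_def by blast
  define W where "W = V \<inter> (%z. z - of_real de) -` V \<inter> (%z. z + \<i> * of_real (e * de)) -` V"
  have "open W" unfolding W_def by (intro open_Int open_vimage open_V continuous_intros)
  moreover have "p : W" using de x of_real_V by (auto simp: W_def)
  ultimately obtain s where s: "s > 0" "ball p s <= W" using openE by blast
  have "ph holomorphic_on ball p (min r s)" using r(2) by (rule holomorphic_on_subset) auto
  moreover have "z : half V e & ph z = C0 z" if z: "z : ball p (min r s)" "0 < e * Im z" for z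
  proof -
   have "z : W" using z s by auto
   then have "z : half V e" "z : region de" using z by (auto simp: W_def half_def region_def)
   then show ?thesis using C0[OF de(1)] r(3) z by simp
  qed
  moreover have "min r s > 0" using r s by simp
  ultimately show "Im p = 0 & (\<exists>r>0. \<exists>ph. ph holomorphic_on ball p r &
       (\<forall>z\<in>ball p r. 0 < e * Im z --> z : half V e & ph z = C0 z))"
   using x(1) by (metis Im_complex_of_real)
 qed (auto simp: half_def)
 show ?thesis
 proof
  show "C analytic_on sheet V e" using C(1) by (simp add: sheet_eq)
  fix ep' z assume "admissible ep'" "z : region ep'" "z ~= 1/2"
  then show "C z = zigzag e ep' L A M B m z" using C(2) C0 by (auto simp: region_def)
 qed
qed

text \<open>Near 1/2 the function C is a zigzag, which on the side -e equals the straight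
  convolution, that is H (m + w). The identity theorem carries this along the interval (0,
  1).\<close>

lemma sheet_convolution_glue:
 assumes C: "C analytic_on sheet V e"
  "!!ep z. [|admissible ep; z : region ep; z ~= 1/2|] ==> C z = zigzag e ep L A M B m z"
  and H: "H analytic_on sheet V (-e)" "!!z. z : half V (-e) ==> H z = ray_convolution L M z"
  and x: "0 < x" "x < 1"
 shows "C (of_real x) = H (of_nat m + of_real x)"
proof -
 interpret m: wedge V "-e" by (rule wedge_uminus)
 obtain d where d: "d > 0" "!!ep. [|0 < ep; ep < d|] ==> admissible ep" using admissible_small by blast
 define ep where "ep = d / 2"
 have ep: "admissible ep" using d by (simp add: ep_def)
 have eps: "0 < ep" "ep < 1/4" using ep by (auto simp: admissible_def)
 obtain rh where rh: "rh > 0" "!!y. [|0 < y; y < rh|] ==>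
  zigzag e ep L A M B m (Complex (1/2) (- e * y)) = ray_convolution L M (of_nat m + Complex (1/2) (- e * y))"
  using zigzag_below_half[OF ep, of m] by blast
 have half_real: "(1/2 :: complex) = of_real (1/2)" by simp
 have halfs: "(1/2 :: complex) : sheet V e"
  unfolding half_real using not_Nats_between[of 0 "1/2"] by (intro of_real_sheet) auto
 obtain r1 where r1: "r1 > 0" "C holomorphic_on ball (1/2) r1" using C(1) halfs unfolding analytic_on_def by blast
 have "zigzag e ep L A M B m analytic_on {1/2}" by (rule zigzag_analytic[OF ep]) (simp add: region_def)
 then obtain r2 where r2: "r2 > 0" "zigzag e ep L A M B m holomorphic_on ball (1/2) r2"
  unfolding analytic_on_def by blast
 define r where "r = min r1 r2"
 have r: "r > 0" "r <= r1" "r <= r2" using r1 r2 by (auto simp: r_def)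
 have an: "C analytic_on ball (1/2) r" "zigzag e ep L A M B m analytic_on ball (1/2) r"
  unfolding analytic_on_open[OF open_ball]
  by (rule holomorphic_on_subset[OF r1(2)], use r in force) (rule holomorphic_on_subset[OF r2(2)], use r in force)
 have near: "C z = zigzag e ep L A M B m z" if "z : ball (1/2) r" for z
 proof (rule analytic_eq_on_connected[OF an connected_ball])
  show "1/2 : ball (1/2 :: complex) r" using r by simp
  show "(1/2 :: complex) islimpt {Complex (1/2) (1 * e * y) |y. 0 < y & y < ep / 2}"
   using eps by (intro half_islimpt) auto
  fix w assume "w : {Complex (1/2) (1 * e * y) |y. 0 < y & y < ep / 2}"
  then obtain y where y: "w = Complex (1/2) (e * y)" "0 < y" "y < ep / 2" by auto
  have "w : V" using y eps by (intro admissible_mem_V[OF ep]) (auto simp: abs_mult)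
  have "0 < e * Im w" using y by simp
  then have "w ~= 1/2" by (metis half_real Im_complex_of_real less_irrefl mult_zero_right)
  have "w : region ep"
  proof -
   have "w - of_real ep : V" using y eps by (intro admissible_mem_V[OF ep]) (auto simp: abs_mult)
   moreover have "w + \<i> * of_real (e * ep) : V"
   proof -
    \<comment> \<open>Doubling the two admissible points, V being a cone, gives room for the height
      y + ep above 1/2.\<close>
    have "Complex (1/2) (2 * ep) = of_real 2 * Complex (1/4) ep" "Complex (1/2) (- (2 * ep)) = of_real 2 * Complex (1/4) (- ep)"
     by (simp_all add: complex_eq_iff)
    then have c: "Complex (1/2) (2 * ep) : V" "Complex (1/2) (- (2 * ep)) : V"
     using ep cone[of _ 2] by (auto simp: admissible_def simp del: of_real_numeral)
    have "\<bar>Im (w + \<i> * of_real (e * ep))\<bar> = y + ep"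
    proof -
     have "Im (w + \<i> * of_real (e * ep)) = e * (y + ep)" using y by (simp add: distrib_left)
     then show ?thesis using y eps by (simp add: abs_mult)
    qed
    then show ?thesis using y eps by (intro Complex_mem_V[OF c]) auto
   qed
   ultimately show ?thesis using \<open>w : V\<close> \<open>0 < e * Im w\<close> by (simp add: region_def half_def)
  qed
  then show "C w = zigzag e ep L A M B m w" using C(2)[OF ep] \<open>w ~= 1/2\<close> by blast
 qed (rule that)
 define T where "T = (of_real ` {0<..<1} :: complex set)"
 have Ts: "T <= sheet V e" using of_real_sheet not_Nats_between[of 0] by (auto simp: T_def)
 have Tm: "of_nat m + z : sheet V (-e)" if zT: "z : T" for z
 proof -
  obtain u where u: "z = of_real u" "0 < u" "u < 1" using zT by (auto simp: T_def)
  then show ?thesis using m.of_real_sheet[of "real m + u"] not_Nats_between[of m "real m + u"] by simp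
 qed
 show ?thesis
 proof (rule analytic_eq_on_connected[where T = T and f = C and g = "%z. H (of_nat m + z)" and w = "of_real x" and a = "1/2"
    and Z = "{Complex (1/2) (-1 * e * y) |y. 0 < y & y < min rh (min r ep)}"])
  show "C analytic_on T" using C(1) Ts by (rule analytic_on_subset)
  have "(%z. of_nat m + z) analytic_on T" by (intro analytic_intros)
  moreover have "H analytic_on (%z. of_nat m + z) ` T" using Tm by (intro analytic_on_subset[OF H(1)]) auto
  ultimately show "(%z. H (of_nat m + z)) analytic_on T"
   using analytic_on_compose[of "%z. of_nat m + z" T H] by (simp add: o_def)
  show "connected T" unfolding T_def by (intro connected_continuous_image continuous_intros) simp
  show "1/2 : T" unfolding T_def half_real by (rule imageI) simp
  show "(1/2 :: complex) islimpt {Complex (1/2) (-1 * e * y) |y. 0 < y & y < min rh (min r ep)}"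
   using rh(1) r(1) eps by (intro half_islimpt) auto
  show "of_real x : T" using x by (auto simp: T_def)
  fix w assume "w : {Complex (1/2) (-1 * e * y) |y. 0 < y & y < min rh (min r ep)}"
  then obtain y where y: "w = Complex (1/2) (- e * y)" "0 < y" "y < rh" "y < r" "y < ep" by auto
  have "(1/2 :: complex) - w = Complex 0 (e * y)" unfolding y(1) by (simp add: complex_eq_iff)
  then have "dist (1/2) w = \<bar>e * y\<bar>" by (simp add: dist_norm cmod_def)
  then have "w : ball (1/2) r" using y by (simp add: abs_mult)
  then have "C w = ray_convolution L M (of_nat m + w)" using near rh(2)[OF y(2,3)] y(1) by simp
  moreover have "of_nat m + w : half V (-e)"
  proof -
   have "of_nat m + w : V" using y eps by (intro admissible_mem_V[OF ep]) (auto simp: abs_mult)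
   then show ?thesis using y by (simp add: half_def)
  qed
  ultimately show "C w = H (of_nat m + w)" using H(2) by simp
 qed
qed

end

section \<open>Integrable majorants at the integers and limits at the axis\<close>

text \<open>The majorant depends on the abscissa alone and holds at all small heights on the side e;
  this is the form in which \<open>integrable_at_integers\<close> reaches single sheets.\<close>

definition dominated_at :: "real => (complex => complex) => real => bool" where
 "dominated_at e F n \<longleftrightarrow> (\<exists>de>0. \<exists>H. set_integrable lborel {n - de..n + de} H &
   (\<forall>x y. x ~= n & \<bar>x - n\<bar> < de & 0 < y & y < de --> norm (F (Complex x (e * y))) <= H x))"

text \<open>The abscissas where one of the factors F x, G (P - x) may be singular; a countable set,
  hence negligible.\<close>

definition integers_from_ends :: "real => real set" where
 "integers_from_ends P = {x. x : \<nat> \<or> P - x : \<nat>}"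

lemma countable_integers_from_ends: "countable (integers_from_ends P)"
proof -
 have "integers_from_ends P <= \<nat> \<union> (%x. P - x) ` \<nat>"
 proof
  fix x assume "x : integers_from_ends P"
  then consider "x : \<nat>" | "P - x : \<nat>" by (auto simp: integers_from_ends_def)
  then show "x : \<nat> \<union> (%x. P - x) ` \<nat>"
  proof cases
   case 2
   then have "P - (P - x) : (%x. P - x) ` \<nat>" by (rule imageI)
   then show ?thesis by simp
  qed simp
 qed
 moreover have "countable (\<nat> \<union> (%x. P - x) ` \<nat>)" by (simp add: Nats_def)
 ultimately show ?thesis by (rule countable_subset)
qed

lemma negligible_integers_from_ends: "negligible (integers_from_ends P)"
proof -
 have "negligible (\<Union>((%x. {x}) ` integers_from_ends P))"
  using countable_integers_from_ends by (intro negligible_countable_Union) auto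
 then show ?thesis by simp
qed

lemma absolutely_integrable_on_diff_negligible:
 fixes f :: "'a::euclidean_space => 'b::euclidean_space"
 assumes "negligible N"
 shows "f absolutely_integrable_on S - N \<longleftrightarrow> f absolutely_integrable_on S"
 by (rule absolutely_integrable_spike_set_eq; rule negligible_subset[OF assms]; blast)

lemma integrable_on_diff_negligible:
 fixes f :: "'a::euclidean_space => 'b::banach"
 assumes "negligible N"
 shows "f integrable_on S - N \<longleftrightarrow> f integrable_on S"
 by (rule integrable_spike_set_eq; rule negligible_subset[OF assms]; blast)

lemma integral_diff_negligible:
 fixes f :: "'a::euclidean_space => 'b::banach"
 assumes "negligible N"
 shows "integral (S - N) f = integral S f"
 by (rule integral_spike_set; rule negligible_subset[OF assms]; blast)

lemma integrable_on_reflect_shift: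
 fixes f :: "real => 'a::euclidean_space"
 assumes "f integrable_on {c - b..c - a}"
 shows "(%x. f (c - x)) integrable_on {a..b}"
proof -
 have "(%x. f ((-1) *\<^sub>R x + c)) integrable_on (%x. (1 / (-1)) *\<^sub>R x + - ((1 / (-1)) *\<^sub>R c)) ` cbox (c - b) (c - a)"
  using assms by (intro integrable_affinity) auto
 moreover have "(%x. (1 / (-1)) *\<^sub>R x + - ((1 / (-1)) *\<^sub>R c)) ` cbox (c - b) (c - a) = {a..b}"
 proof (intro equalityI subsetI)
  fix x assume "x : {a..b}"
  then have "c - x : cbox (c - b) (c - a)" "x = (1 / (-1)) *\<^sub>R (c - x) + - ((1 / (-1)) *\<^sub>R c)" by auto
  then show "x : (%x. (1 / (-1)) *\<^sub>R x + - ((1 / (-1)) *\<^sub>R c)) ` cbox (c - b) (c - a)" by blast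
 qed auto
 ultimately show ?thesis by simp
qed

lemma integrable_on_affine_unit:
 fixes f :: "real => 'a::euclidean_space"
 assumes "f integrable_on {min a b..max a b}" "a ~= b"
 shows "(%t. f (a + t * (b - a))) integrable_on {0..1}"
proof -
 have "(%x. f ((b - a) *\<^sub>R x + a)) integrable_on (%x. (1 / (b - a)) *\<^sub>R x + - ((1 / (b - a)) *\<^sub>R a)) ` cbox (min a b) (max a b)"
  using assms by (intro integrable_affinity) auto
 moreover have "(%x. (1 / (b - a)) *\<^sub>R x + - ((1 / (b - a)) *\<^sub>R a)) ` cbox (min a b) (max a b) = {0..1}"
 proof (intro equalityI subsetI)
  fix t assume "t : (%x. (1 / (b - a)) *\<^sub>R x + - ((1 / (b - a)) *\<^sub>R a)) ` cbox (min a b) (max a b)"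
  then obtain x where x: "min a b <= x" "x <= max a b" and "t = (1 / (b - a)) *\<^sub>R x + - ((1 / (b - a)) *\<^sub>R a)" by auto
  then have "t = (x - a) / (b - a)" using assms(2) by (simp add: diff_divide_distrib)
  show "t : {0..1}" unfolding \<open>t = (x - a) / (b - a)\<close> using x assms(2)
   by (cases "a < b") (auto simp: zero_le_divide_iff divide_le_eq_1)
 next
  fix t :: real assume t: "t : {0..1}"
  have "t = (1 / (b - a)) *\<^sub>R (a + t * (b - a)) + - ((1 / (b - a)) *\<^sub>R a)"
  proof -
   have "(1 / (b - a)) *\<^sub>R (a + t * (b - a)) + - ((1 / (b - a)) *\<^sub>R a) = (1 / (b - a)) * (t * (b - a))"
    unfolding real_scaleR_def distrib_left by simp
   then show ?thesis using assms(2) by simp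
  qed
  moreover have "a + t * (b - a) : cbox (min a b) (max a b)"
   using t convex_bound_le[of a "max a b" b "1 - t" t] convex_bound_le[of "- a" "- min a b" "- b" "1 - t" t]
   by (simp add: algebra_simps)
  ultimately show "t : (%x. (1 / (b - a)) *\<^sub>R x + - ((1 / (b - a)) *\<^sub>R a)) ` cbox (min a b) (max a b)" by blast
 qed
 ultimately show ?thesis by (simp add: mult.commute add.commute)
qed

context wedge
begin

lemma boundary_bounded:
 assumes F: "F analytic_on sheet V e" and x: "0 < x0" "x0 ~: \<nat>"
 obtains de M where "de > 0" "!!x y. [|\<bar>x - x0\<bar> <= de; 0 <= y; y <= de|] ==> norm (F (Complex x (e * y))) <= M"
proof -
 have "F analytic_on {of_real x0}" using F of_real_sheet[OF x] analytic_on_subset by blast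
 then have "isCont F (of_real x0)" by (rule analytic_at_imp_isCont)
 then obtain r where r: "r > 0" "!!z. dist z (of_real x0) < r ==> dist (F z) (F (of_real x0)) < 1"
  unfolding continuous_at_eps_delta using zero_less_one by blast
 have "norm (F (Complex x (e * y))) <= norm (F (of_real x0)) + 1" if "\<bar>x - x0\<bar> <= r / 3" "0 <= y" "y <= r / 3" for x y
 proof -
  have "norm (Complex x (e * y) - of_real x0) <= \<bar>x - x0\<bar> + \<bar>e * y\<bar>"
   using cmod_le[of "Complex x (e * y) - of_real x0"] by simp
  also have "\<dots> < r" using that r(1) by (simp add: abs_mult)
  finally have "dist (F (Complex x (e * y))) (F (of_real x0)) < 1" using r(2) by (simp add: dist_norm)
  then show ?thesis using norm_triangle_sub[of "F (Complex x (e * y))" "F (of_real x0)"] by (simp add: dist_norm)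
 qed
 then show ?thesis using that[of "r / 3" "norm (F (of_real x0)) + 1"] r(1) by auto
qed

lemma boundary_tendsto:
 assumes F: "F analytic_on sheet V e" and x: "0 < x" "x ~: \<nat>" and y: "(y \<longlongrightarrow> 0) net"
 shows "((%k. F (Complex x (e * y k))) \<longlongrightarrow> F (of_real x)) net"
proof -
 have "F analytic_on {of_real x}" using F of_real_sheet[OF x] analytic_on_subset by blast
 then have c: "isCont F (of_real x)" by (rule analytic_at_imp_isCont)
 have "((%k. of_real x + \<i> * of_real (e * y k)) \<longlongrightarrow> of_real x + \<i> * of_real (e * 0)) net"
  by (intro tendsto_intros y)
 then have "((%k. Complex x (e * y k)) \<longlongrightarrow> of_real x) net" by (simp add: Complex_eq)
 then show ?thesis by (rule isCont_tendsto_compose[OF c])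
qed

text \<open>At a point that is not an integer the function is bounded. At an integer the majorant
  passes to height 0 by continuity of the boundary values at neighbouring abscissas.\<close>

lemma boundary_dominated:
 assumes F: "F analytic_on sheet V e" and dom: "!!n. 1 <= n ==> dominated_at e F (real n)" and x0: "0 < x0"
 obtains de H where "de > 0" "de < x0" "H integrable_on {x0 - de..x0 + de}"
  "!!x y. [|\<bar>x - x0\<bar> <= de; x ~: \<nat>; 0 <= y; y <= de|] ==> norm (F (Complex x (e * y))) <= H x"
proof (cases "x0 : \<nat>")
 case False
 obtain de M where de: "de > 0" "!!x y. [|\<bar>x - x0\<bar> <= de; 0 <= y; y <= de|] ==> norm (F (Complex x (e * y))) <= M"
  using boundary_bounded[OF F x0 False] by blast
 show ?thesis
 proof (rule that[of "min de (x0 / 2)" "%_. M"])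
  show "norm (F (Complex x (e * y))) <= M" if "\<bar>x - x0\<bar> <= min de (x0 / 2)" "0 <= y" "y <= min de (x0 / 2)" for x y
   using that by (intro de(2)) auto
 qed (use de x0 in auto)
next
 case True
 then obtain n :: nat where n: "x0 = real n" "1 <= n" using x0 by (auto simp: Nats_def)
 obtain de H where de: "de > 0" "set_integrable lborel {x0 - de..x0 + de} H"
  "!!x y. [|x ~= x0; \<bar>x - x0\<bar> < de; 0 < y; y < de|] ==> norm (F (Complex x (e * y))) <= H x"
  using dom[OF n(2)] unfolding dominated_at_def n(1) by blast
 define d where "d = min (de / 2) (x0 / 2)"
 have d: "0 < d" "d < de" "d < x0" using de x0 by (auto simp: d_def)
 have "H absolutely_integrable_on {x0 - de..x0 + de}" by (rule set_integrable_lborel_imp_absolutely_integrable[OF de(2)])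
 then have "H absolutely_integrable_on {x0 - d..x0 + d}" by (rule set_integrable_subset) (use d in auto)
 then have int: "H integrable_on {x0 - d..x0 + d}" by (simp add: absolutely_integrable_on_def)
 have le: "norm (F (Complex x (e * y))) <= H x" if "\<bar>x - x0\<bar> <= d" "x ~: \<nat>" "0 <= y" "y <= d" for x y
 proof (cases "y = 0")
  case False
  then show ?thesis using that d True by (intro de(3)) auto
 next
  case y: True
  have x: "0 < x" using that d by auto
  have ident: "((%y::real. y) \<longlongrightarrow> 0) (at_right 0)" by (rule tendsto_ident_at)
  have "((%y. norm (F (Complex x (e * y)))) \<longlongrightarrow> norm (F (of_real x))) (at_right 0)"
   by (intro tendsto_norm boundary_tendsto[OF F x that(2)] ident)
  moreover have "\<forall>\<^sub>F y in at_right 0. norm (F (Complex x (e * y))) <= H x"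
   unfolding eventually_at_right_field
  proof (intro exI[of _ d] conjI d(1) allI impI)
   fix y :: real assume "0 < y" "y < d"
   then show "norm (F (Complex x (e * y))) <= H x" using that(1,2) d True by (intro de(3)) auto
  qed
  ultimately have "norm (F (of_real x)) <= H x" by (rule tendsto_upperbound) simp
  then show ?thesis using y by (simp add: complex_of_real_def)
 qed
 show ?thesis by (rule that[of d H]) (use d int le in auto)
qed

text \<open>As P is not an integer, x and P - x are never integers together: near each x one factor
  is bounded and the other has an integrable majorant. \<open>Bolzano\<close> joins the local
  majorants over [u, v].\<close>

lemma product_dominated:
 assumes F: "F analytic_on sheet V e" "!!n. 1 <= n ==> dominated_at e F (real n)"
  and G: "G analytic_on sheet V e" "!!n. 1 <= n ==> dominated_at e G (real n)"
  and P: "P ~: \<nat>" and uv: "0 < u" "u <= v" "v < P"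
 obtains y0 H where "y0 > 0" "H integrable_on {u..v}"
  "!!x y1 y2. [|x : {u..v}; x ~: integers_from_ends P; 0 <= y1; y1 <= y0; 0 <= y2; y2 <= y0|] ==>
    norm (F (Complex x (e * y1)) * G (Complex (P - x) (e * y2))) <= H x"
proof -
 define Q where "Q a b \<longleftrightarrow> (\<exists>y0>0. \<exists>H. H integrable_on {a..b} &
   (\<forall>x y1 y2. x : {a..b} & x ~: integers_from_ends P & 0 <= y1 & y1 <= y0 & 0 <= y2 & y2 <= y0 -->
    norm (F (Complex x (e * y1)) * G (Complex (P - x) (e * y2))) <= H x))" for a b
 have "Q u v" using uv(2)
 proof (rule Bolzano)
  fix a b c assume ab: "Q a b" "Q b c" "a <= b" "b <= c"
  obtain y1 H1 where 1: "y1 > 0" "H1 integrable_on {a..b}"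
   "!!x t1 t2. [|x : {a..b}; x ~: integers_from_ends P; 0 <= t1; t1 <= y1; 0 <= t2; t2 <= y1|] ==>
    norm (F (Complex x (e * t1)) * G (Complex (P - x) (e * t2))) <= H1 x" using ab(1) unfolding Q_def by blast
  obtain y2 H2 where 2: "y2 > 0" "H2 integrable_on {b..c}"
   "!!x t1 t2. [|x : {b..c}; x ~: integers_from_ends P; 0 <= t1; t1 <= y2; 0 <= t2; t2 <= y2|] ==>
    norm (F (Complex x (e * t1)) * G (Complex (P - x) (e * t2))) <= H2 x" using ab(2) unfolding Q_def by blast
  define H where "H x = (if x <= b then H1 x else H2 x)" for x
  have "H integrable_on {a..b}" using 1(2) by (rule integrable_eq) (auto simp: H_def)
  moreover have "H integrable_on {b..c}"
  proof (rule integrable_spike[OF 2(2)])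
   show "negligible {b}" by simp
   show "H x = H2 x" if "x : {b..c} - {b}" for x using that by (simp add: H_def)
  qed
  ultimately have "H integrable_on {a..c}" by (rule Henstock_Kurzweil_Integration.integrable_combine[OF ab(3,4)])
  moreover have "norm (F (Complex x (e * t1)) * G (Complex (P - x) (e * t2))) <= H x"
   if "x : {a..c}" "x ~: integers_from_ends P" "0 <= t1" "t1 <= min y1 y2" "0 <= t2" "t2 <= min y1 y2" for x t1 t2
  proof (cases "x <= b")
   case True
   then have "H x = H1 x" by (simp add: H_def)
   show ?thesis unfolding \<open>H x = H1 x\<close> by (rule 1(3)) (use that True in auto)
  next
   case False
   then have "H x = H2 x" by (simp add: H_def)
   show ?thesis unfolding \<open>H x = H2 x\<close> by (rule 2(3)) (use that False in auto)
  qed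
  moreover have "min y1 y2 > 0" using 1 2 by simp
  ultimately show "Q a c" unfolding Q_def by (intro exI[of _ "min y1 y2"] exI[of _ H] conjI allI impI) (blast | auto)+
 next
  fix x0 assume x0: "u <= x0" "x0 <= v"
  have pos: "0 < x0" "0 < P - x0" using x0 uv by auto
  obtain d1 H1 where 1: "d1 > 0" "d1 < x0" "H1 integrable_on {x0 - d1..x0 + d1}"
   "!!x y. [|\<bar>x - x0\<bar> <= d1; x ~: \<nat>; 0 <= y; y <= d1|] ==> norm (F (Complex x (e * y))) <= H1 x"
   using boundary_dominated[OF F pos(1)] by blast
  obtain d2 H2 where 2: "d2 > 0" "d2 < P - x0" "H2 integrable_on {P - x0 - d2..P - x0 + d2}"
   "!!x y. [|\<bar>x - (P - x0)\<bar> <= d2; x ~: \<nat>; 0 <= y; y <= d2|] ==> norm (G (Complex x (e * y))) <= H2 x"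
   using boundary_dominated[OF G pos(2)] by blast
  have int2: "(%x. H2 (P - x)) integrable_on {x0 - d2..x0 + d2}"
   by (rule integrable_on_reflect_shift) (use 2(3) in \<open>simp add: algebra_simps\<close>)
  have "x0 ~: \<nat> \<or> P - x0 ~: \<nat>" using P Nats_add[of x0 "P - x0"] by auto
  then obtain d H where d: "d > 0" "H integrable_on {x0 - d..x0 + d}"
   "!!x y1 y2. [|\<bar>x - x0\<bar> <= d; x ~: integers_from_ends P; 0 <= y1; y1 <= d; 0 <= y2; y2 <= d|] ==>
     norm (F (Complex x (e * y1)) * G (Complex (P - x) (e * y2))) <= H x"
  proof
   assume x0N: "x0 ~: \<nat>"
   obtain d3 M where 3: "d3 > 0" "!!x y. [|\<bar>x - x0\<bar> <= d3; 0 <= y; y <= d3|] ==> norm (F (Complex x (e * y))) <= M"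
    using boundary_bounded[OF F(1) pos(1) x0N] by blast
   have int: "(%x. M * H2 (P - x)) integrable_on {x0 - min d2 d3..x0 + min d2 d3}"
    using integrable_subinterval_real[OF integrable_on_mult_right[OF int2, of M]] by auto
   show thesis
   proof (rule that[OF _ int])
    show "min d2 d3 > 0" using 2 3 by simp
    fix x y1 y2 assume x: "\<bar>x - x0\<bar> <= min d2 d3" "x ~: integers_from_ends P" "0 <= y1" "y1 <= min d2 d3" "0 <= y2" "y2 <= min d2 d3"
    have "norm (F (Complex x (e * y1))) <= M" using x by (intro 3(2)) auto
    moreover have "norm (G (Complex (P - x) (e * y2))) <= H2 (P - x)"
     using x by (intro 2(4)) (auto simp: integers_from_ends_def)
    moreover have "0 <= norm (F (Complex x (e * y1)))" by simp
    ultimately show "norm (F (Complex x (e * y1)) * G (Complex (P - x) (e * y2))) <= M * H2 (P - x)"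
     unfolding norm_mult by (intro mult_mono') auto
   qed
  next
   assume x0N: "P - x0 ~: \<nat>"
   obtain d3 M where 3: "d3 > 0" "!!x y. [|\<bar>x - (P - x0)\<bar> <= d3; 0 <= y; y <= d3|] ==> norm (G (Complex x (e * y))) <= M"
    using boundary_bounded[OF G(1) pos(2) x0N] by blast
   have int: "(%x. H1 x * M) integrable_on {x0 - min d1 d3..x0 + min d1 d3}"
    using integrable_subinterval_real[OF integrable_on_mult_left[OF 1(3), of M]] by auto
   show thesis
   proof (rule that[OF _ int])
    show "min d1 d3 > 0" using 1 3 by simp
    fix x y1 y2 assume x: "\<bar>x - x0\<bar> <= min d1 d3" "x ~: integers_from_ends P" "0 <= y1" "y1 <= min d1 d3" "0 <= y2" "y2 <= min d1 d3"
    have "norm (G (Complex (P - x) (e * y2))) <= M" using x by (intro 3(2)) auto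
    moreover have "norm (F (Complex x (e * y1))) <= H1 x"
     using x by (intro 1(4)) (auto simp: integers_from_ends_def)
    moreover have "0 <= norm (F (Complex x (e * y1)))" by simp
    ultimately show "norm (F (Complex x (e * y1)) * G (Complex (P - x) (e * y2))) <= H1 x * M"
     unfolding norm_mult by (intro mult_mono') auto
   qed
  qed
  have "Q a b" if "a <= x0" "x0 <= b" "b - a < d" for a b
  proof -
   have "H integrable_on {a..b}" by (rule integrable_subinterval_real[OF d(2)]) (use that in auto)
   moreover have "norm (F (Complex x (e * y1)) * G (Complex (P - x) (e * y2))) <= H x"
    if "x : {a..b}" "x ~: integers_from_ends P" "0 <= y1" "y1 <= d" "0 <= y2" "y2 <= d" for x y1 y2
    using that \<open>a <= x0\<close> \<open>x0 <= b\<close> \<open>b - a < d\<close> by (intro d(3)) auto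
   ultimately show ?thesis unfolding Q_def using d(1) by blast
  qed
  then show "\<exists>d>0. \<forall>a b. a <= x0 & x0 <= b & b - a < d --> Q a b" using d(1) by blast
 qed
 then show ?thesis unfolding Q_def using that by blast
qed

lemma boundary_product_continuous:
 assumes F: "F analytic_on sheet V e" and G: "G analytic_on sheet V e"
 shows "continuous_on {x. 0 < x & x < P & x ~: integers_from_ends P} (%x. F (of_real x) * G (of_real (P - x)))"
proof (intro continuous_intros)
 show "continuous_on {x. 0 < x & x < P & x ~: integers_from_ends P} (%x. F (of_real x))"
  by (rule continuous_on_compose2[OF holomorphic_on_imp_continuous_on[OF analytic_imp_holomorphic[OF F]]])
   (auto intro!: continuous_intros of_real_sheet simp: integers_from_ends_def)
 show "continuous_on {x. 0 < x & x < P & x ~: integers_from_ends P} (%x. G (of_real (P - x)))"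
 proof (rule continuous_on_compose2[OF holomorphic_on_imp_continuous_on[OF analytic_imp_holomorphic[OF G]]])
  show "(%x. of_real (P - x)) ` {x. 0 < x & x < P & x ~: integers_from_ends P} <= sheet V e"
   by (safe intro!: of_real_sheet) (auto simp: integers_from_ends_def)
 qed (intro continuous_intros)
qed

lemma boundary_product_integrable:
 assumes F: "F analytic_on sheet V e" "!!n. 1 <= n ==> dominated_at e F (real n)"
  and G: "G analytic_on sheet V e" "!!n. 1 <= n ==> dominated_at e G (real n)"
  and P: "P ~: \<nat>" and uv: "0 < u" "u <= v" "v < P"
 shows "(%x. F (of_real x) * G (of_real (P - x))) absolutely_integrable_on {u..v}"
proof -
 obtain y0 H where H: "y0 > 0" "H integrable_on {u..v}"
  "!!x y1 y2. [|x : {u..v}; x ~: integers_from_ends P; 0 <= y1; y1 <= y0; 0 <= y2; y2 <= y0|] ==>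
    norm (F (Complex x (e * y1)) * G (Complex (P - x) (e * y2))) <= H x"
  using product_dominated[OF F G P uv] by blast
 let ?S = "{u..v} - integers_from_ends P"
 have N: "integers_from_ends P : sets lebesgue"
  using negligible_imp_sets[OF negligible_integers_from_ends] .
 have "(%x. F (of_real x) * G (of_real (P - x))) absolutely_integrable_on ?S"
 proof (rule measurable_bounded_by_integrable_imp_absolutely_integrable)
  show S: "?S : sets lebesgue" using N by auto
  show "(%x. F (of_real x) * G (of_real (P - x))) : borel_measurable (lebesgue_on ?S)"
   by (rule continuous_imp_measurable_on_sets_lebesgue[OF continuous_on_subset[OF boundary_product_continuous[OF F(1) G(1), of P]] S])
    (use uv in auto)
  show "H integrable_on ?S"
   using H(2) by (simp only: integrable_on_diff_negligible[OF negligible_integers_from_ends])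
  have real: "Complex x (e * 0) = of_real x" for x by (simp add: complex_eq_iff)
  show "norm (F (of_real x) * G (of_real (P - x))) <= H x" if "x : ?S" for x
   using H(3)[of x 0 0, unfolded real] H(1) that by fastforce
 qed
 then show ?thesis by (simp only: absolutely_integrable_on_diff_negligible[OF negligible_integers_from_ends])
qed

end

lemma integrable_on_affine_pos:
 fixes f :: "real => 'a::euclidean_space"
 assumes "f integrable_on {m * a + c..m * b + c}" "0 < m"
 shows "(%x. f (m * x + c)) integrable_on {a..b}"
proof -
 obtain i where "(f has_integral i) (cbox (m * a + c) (m * b + c))" using assms(1) by auto
 from has_integral_affinity'[OF this assms(2), of c] have
  "((%x. f (m *\<^sub>R x + c)) has_integral (i /\<^sub>R m ^ DIM(real))) (cbox ((m * a + c - c) /\<^sub>R m) ((m * b + c - c) /\<^sub>R m))" .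
 then show ?thesis using assms(2) by (auto simp: field_simps)
qed

lemma absolutely_integrable_on_reflect_shift:
 fixes f :: "real => 'a::euclidean_space"
 assumes "f absolutely_integrable_on {c - b..c - a}"
 shows "(%x. f (c - x)) absolutely_integrable_on {a..b}"
 using assms integrable_on_reflect_shift[of f c b a] integrable_on_reflect_shift[of "%x. norm (f x)" c b a]
 unfolding absolutely_integrable_on_def by blast

lemma absolutely_integrable_combine:
 fixes f :: "real => 'a::euclidean_space"
 assumes "a <= c" "c <= b" "f absolutely_integrable_on {a..c}" "f absolutely_integrable_on {c..b}"
 shows "f absolutely_integrable_on {a..b}"
 using assms unfolding absolutely_integrable_on_def
 by (blast intro: Henstock_Kurzweil_Integration.integrable_combine)

lemma negligible_affine_vimage_integers_from_ends:
 assumes "m ~= 0"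
 shows "negligible {t. a + t * m : integers_from_ends P}"
proof -
 have "{t. a + t * m : integers_from_ends P} <= (%x. (x - a) / m) ` integers_from_ends P"
 proof
  fix t assume t: "t : {t. a + t * m : integers_from_ends P}"
  have "t = ((a + t * m) - a) / m" using assms by simp
  then show "t : (%x. (x - a) / m) ` integers_from_ends P" using t by blast
 qed
 then have "countable {t. a + t * m : integers_from_ends P}"
  by (rule countable_subset) (intro countable_image countable_integers_from_ends)
 then have "negligible (\<Union>((%x. {x}) ` {t. a + t * m : integers_from_ends P}))"
  by (intro negligible_countable_Union) auto
 then show ?thesis by simp
qed

lemma segment_weights:
 fixes a P t :: real
 assumes "t : {0..1}"
 shows "a + t * ((P - a) - a) : {min a (P - a)..max a (P - a)}"
 using assms convex_bound_le[of a "max a (P - a)" "P - a" "1 - t" t]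
  convex_bound_le[of "- a" "- min a (P - a)" "- (P - a)" "1 - t" t]
 by (simp add: algebra_simps)

context wedge
begin

text \<open>On the leg belonging to height y the arguments of F and G lie at heights t y and (1 - t)
  y over real points independent of y, so \<open>product_dominated\<close> bounds the integrands
  uniformly and dominated convergence applies. P \<noteq> 2 * a makes the abscissa a nondegenerate
  affine function of t, through which the majorant is pulled back.\<close>

lemma pass_tendsto_boundary:
 fixes a P :: real
 assumes F: "F analytic_on sheet V e" "!!n. 1 <= n ==> dominated_at e F (real n)"
  and G: "G analytic_on sheet V e" "!!n. 1 <= n ==> dominated_at e G (real n)"
  and P: "P ~: \<nat>" and a: "0 < a" "a < P" "a ~: \<nat>" "P - a ~: \<nat>" "P ~= 2 * a"
 shows "((%y. pass (of_real a) F G (Complex P (e * y))) \<longlongrightarrow> pass (of_real a) F G (of_real P)) (at_right 0)"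
proof -
 define u where "u = min a (P - a)"
 define v where "v = max a (P - a)"
 have uv: "0 < u" "u <= v" "v < P" using a by (auto simp: u_def v_def)
 obtain y1 H where H: "y1 > 0" "H integrable_on {u..v}"
  "!!x t1 t2. [|x : {u..v}; x ~: integers_from_ends P; 0 <= t1; t1 <= y1; 0 <= t2; t2 <= y1|] ==>
    norm (F (Complex x (e * t1)) * G (Complex (P - x) (e * t2))) <= H x"
  using product_dominated[OF F G P uv] by blast
 obtain d where d: "d > 0" "!!ep. [|0 < ep; ep < d|] ==> Complex u ep : V & Complex u (- ep) : V"
  using real_ball_V[OF uv(1)] by blast
 define y0 where "y0 = min y1 (d / 2)"
 have y0: "0 < y0" "y0 <= y1" "y0 < d" using H(1) d(1) by (auto simp: y0_def)
 define x where "x t = a + t * ((P - a) - a)" for t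
 have xuv: "x t : {u..v}" "P - x t : {u..v}" if "t : {0..1}" for t
  using segment_weights[OF that, of a P] by (auto simp: x_def u_def v_def)
 define ph where "ph y t = F (Complex (x t) (e * (t * y))) * G (Complex (P - x t) (e * ((1 - t) * y))) *
   (Complex P (e * y) - 2 * of_real a)" for y t
 have pass_eq: "pass (of_real a) F G (Complex P (e * y)) = integral {0..1} (ph y)" for y
 proof -
  have 1: "of_real t * Complex P (e * y) + of_real a * (1 - 2 * of_real t) = Complex (x t) (e * (t * y))" for t
   by (simp add: complex_eq_iff x_def algebra_simps)
  have 2: "Complex P (e * y) - Complex (x t) (e * (t * y)) = Complex (P - x t) (e * ((1 - t) * y))" for t
   by (simp add: complex_eq_iff algebra_simps)
  show ?thesis unfolding pass_eq_integral 1 2 ph_def by simp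
 qed
 define N where "N = {t. a + t * ((P - a) - a) : integers_from_ends P}"
 have m: "(P - a) - a ~= 0" using a(5) by linarith
 have N: "negligible N" unfolding N_def by (rule negligible_affine_vimage_integers_from_ends[OF m])
 define K where "K = \<bar>P - 2 * a\<bar> + y0"
 have int_ph: "ph y integrable_on {0..1}" if y: "0 < y" "y < y0" for y
 proof -
  have "y < d" using y y0 by linarith
  then have dV: "Complex u y : V" "Complex u (- y) : V" using d(2)[OF y(1)] by simp_all
  have V: "Complex r (e * w) : V" if "u <= r" "0 <= w" "w <= y" for r w
   by (rule Complex_mem_V[OF dV]) (use y that in \<open>simp_all add: abs_mult\<close>)
  have sh: "Complex r (e * w) : sheet V e" if "u <= r" "0 <= w" "w <= y" "w = 0 ==> r ~: \<nat>" for r w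
  proof (cases "w = 0")
   case True
   then have "Complex r (e * w) = of_real r" by (simp add: complex_eq_iff)
   then show ?thesis using that uv True by (simp add: of_real_sheet)
  next
   case False
   then have "Complex r (e * w) : half V e" using V[OF that(1-3)] that by (simp add: half_def)
   then show ?thesis using half_subset_sheet by blast
  qed
  have c1: "continuous_on {0..1} (%t. F (Complex (x t) (e * (t * y))))"
  proof (rule continuous_on_compose2[OF holomorphic_on_imp_continuous_on[OF analytic_imp_holomorphic[OF F(1)]]])
   show "continuous_on {0..1} (%t. Complex (x t) (e * (t * y)))"
    unfolding Complex_eq x_def by (intro continuous_intros)
   show "(%t. Complex (x t) (e * (t * y))) ` {0..1} <= sheet V e"
   proof (rule image_subsetI)
    fix t :: real assume t: "t : {0..1}"
    show "Complex (x t) (e * (t * y)) : sheet V e"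
    proof (rule sh)
     show "t * y = 0 ==> x t ~: \<nat>" using y a by (simp add: x_def)
    qed (use xuv(1)[OF t] t y mult_left_le_one_le[of y t] in auto)
   qed
  qed
  have c2: "continuous_on {0..1} (%t. G (Complex (P - x t) (e * ((1 - t) * y))))"
  proof (rule continuous_on_compose2[OF holomorphic_on_imp_continuous_on[OF analytic_imp_holomorphic[OF G(1)]]])
   show "continuous_on {0..1} (%t. Complex (P - x t) (e * ((1 - t) * y)))"
    unfolding Complex_eq x_def by (intro continuous_intros)
   show "(%t. Complex (P - x t) (e * ((1 - t) * y))) ` {0..1} <= sheet V e"
   proof (rule image_subsetI)
    fix t :: real assume t: "t : {0..1}"
    show "Complex (P - x t) (e * ((1 - t) * y)) : sheet V e"
    proof (rule sh)
     assume "(1 - t) * y = 0"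
     then have "t = 1" using y by simp
     then show "P - x t ~: \<nat>" using a by (simp add: x_def)
    qed (use xuv(2)[OF t] t y mult_left_le_one_le[of y "1 - t"] in auto)
   qed
  qed
  show ?thesis unfolding ph_def
   by (intro integrable_continuous_real continuous_intros c1 c2)
 qed
 have le_ph: "norm (ph y t) <= H (x t) * K" if y: "0 < y" "y < y0" and t: "t : {0..1} - N" for y t
 proof -
  have t01: "t : {0..1}" "0 <= t" "t <= 1" using t by auto
  have "t * y <= y" "(1 - t) * y <= y" using t01 y by (auto intro!: mult_left_le_one_le)
  then have ty: "t * y <= y1" "(1 - t) * y <= y1" using y y0 by linarith+
  have "norm (F (Complex (x t) (e * (t * y))) * G (Complex (P - x t) (e * ((1 - t) * y)))) <= H (x t)"
  proof (rule H(3)[OF xuv(1)[OF t01(1)] _ _ ty(1) _ ty(2)])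
   show "x t ~: integers_from_ends P" using t by (simp add: N_def x_def)
  qed (use t01 y in auto)
  moreover have "norm (Complex P (e * y) - 2 * of_real a) <= K"
  proof -
   have "norm (Complex P (e * y) - 2 * of_real a) <= \<bar>P - 2 * a\<bar> + \<bar>e * y\<bar>"
    using cmod_le[of "Complex P (e * y) - 2 * of_real a"] by simp
   then show ?thesis using y by (simp add: K_def abs_mult)
  qed
  ultimately show ?thesis unfolding ph_def norm_mult by (intro mult_mono') auto
 qed
 have int_H: "(%t. H (x t) * K) integrable_on {0..1}"
  unfolding x_def using H(2) a(5) by (intro integrable_on_mult_left integrable_on_affine_unit) (auto simp: u_def v_def)
 have real_eq: "Complex r (e * 0) = of_real r" for r by (simp add: complex_eq_iff)
 have lim: "((%y. integral {0..1} (ph y)) \<longlongrightarrow> integral {0..1} (ph 0)) (at_right 0)"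
 proof (rule tendsto_at_right_sequentially[OF y0(1)])
  fix S :: "nat => real"
  assume S: "!!n. 0 < S n" "!!n. S n < y0" "decseq S" "S \<longlonglongrightarrow> 0"
  have "(%n. integral ({0..1} - N) (ph (S n))) \<longlonglongrightarrow> integral ({0..1} - N) (ph 0)"
  proof (rule dominated_convergence(2))
   show "ph (S n) integrable_on {0..1} - N" for n
    unfolding integrable_on_diff_negligible[OF N] by (rule int_ph[OF S(1,2)])
   show "(%t. H (x t) * K) integrable_on {0..1} - N"
    unfolding integrable_on_diff_negligible[OF N] by (rule int_H)
   show "norm (ph (S n) t) <= H (x t) * K" if "t : {0..1} - N" for n t by (rule le_ph[OF S(1,2) that])
   fix t assume t: "t : {0..1} - N"
   have xt: "0 < x t" "x t ~: \<nat>" "0 < P - x t" "P - x t ~: \<nat>"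
    using t xuv[of t] uv by (auto simp: N_def x_def integers_from_ends_def)
   have 0: "(%n. t * S n) \<longlonglongrightarrow> 0" "(%n. (1 - t) * S n) \<longlonglongrightarrow> 0" by (rule tendsto_mult_right_zero[OF S(4)])+
   have "(%n. of_real P + \<i> * of_real (e * S n)) \<longlonglongrightarrow> of_real P + \<i> * of_real (e * 0)"
    by (intro tendsto_intros S(4))
   then have 1: "(%n. Complex P (e * S n)) \<longlonglongrightarrow> of_real P" by (simp add: Complex_eq)
   show "(%n. ph (S n) t) \<longlonglongrightarrow> ph 0 t"
    unfolding ph_def mult_zero_right real_eq[unfolded mult_zero_right]
    using boundary_tendsto[OF F(1) xt(1,2) 0(1)] boundary_tendsto[OF G(1) xt(3,4) 0(2)] 1
    by (intro tendsto_intros) auto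
  qed
  then show "(%n. integral {0..1} (ph (S n))) \<longlonglongrightarrow> integral {0..1} (ph 0)"
   unfolding integral_diff_negligible[OF N] .
 qed
 then show ?thesis using pass_eq[of 0] unfolding real_eq pass_eq by simp
qed

text \<open>Written as a difference of integrals from 0, the formula covers both orientations of the
  segment.\<close>

lemma pass_real:
 fixes a P :: real
 assumes int: "(%x. F (of_real x) * G (of_real (P - x))) integrable_on {0..P}" and a: "0 < a" "a < P"
 shows "pass (of_real a) F G (of_real P) =
  integral {0..P - a} (%x. F (of_real x) * G (of_real (P - x))) - integral {0..a} (%x. F (of_real x) * G (of_real (P - x)))"
proof -
 let ?f = "%x. F (of_real x) * G (of_real (P - x))"
 have seg: "contour_integral (linepath (of_real u) (of_real v)) (%s. F s * G (of_real P - s)) = integral {0..v} ?f - integral {0..u} ?f"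
  if "0 < u" "u < v" "v < P" for u v
 proof -
  have "integral {0..u} ?f + integral {u..v} ?f = integral {0..v} ?f"
   by (rule Henstock_Kurzweil_Integration.integral_combine) (use that integrable_subinterval_real[OF int, of 0 v] in auto)
  then have "integral {u..v} ?f = integral {0..v} ?f - integral {0..u} ?f" by (simp only: eq_diff_eq add.commute)
  then show ?thesis using that by (subst contour_integral_linepath_Reals_eq) auto
 qed
 have eq: "of_real P - of_real a = (of_real (P - a) :: complex)" by simp
 consider "a < P - a" | "a = P - a" | "P - a < a" by linarith
 then show ?thesis
 proof cases
  case 1 then show ?thesis unfolding pass_def eq using a by (intro seg) auto
 next
  case 2
  then show ?thesis unfolding pass_def eq 2[symmetric] contour_integral_trivial by (simp only: diff_self)
 next
  case 3
  then show ?thesis unfolding pass_def eq using a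
   by (subst contour_integral_linepath_neg, subst seg) auto
 qed
qed

end

definition dominated_at_0 :: "(complex => complex) => bool" where
 "dominated_at_0 F \<longleftrightarrow> (\<exists>r>0. \<exists>H. H integrable_on {0..r} & (\<forall>x. 0 < x & x <= r --> norm (F (of_real x)) <= H x))"

context wedge
begin

lemma boundary_product_integrable_at_0:
 assumes F: "F analytic_on sheet V e" "dominated_at_0 F" and G: "G analytic_on sheet V e"
  and P: "0 < P" "P ~: \<nat>"
 obtains r where "0 < r" "r < P / 2" "(%x. F (of_real x) * G (of_real (P - x))) absolutely_integrable_on {0..r}"
proof -
 obtain r1 H where H: "r1 > 0" "H integrable_on {0..r1}" "!!x. [|0 < x; x <= r1|] ==> norm (F (of_real x)) <= H x"
  using F(2) unfolding dominated_at_0_def by blast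
 obtain d M where d: "d > 0" "!!x y. [|\<bar>x - P\<bar> <= d; 0 <= y; y <= d|] ==> norm (G (Complex x (e * y))) <= M"
  using boundary_bounded[OF G P] by blast
 define r where "r = min (min r1 d) (P / 3)"
 have r: "0 < r" "r <= r1" "r <= d" "r < P / 2" using H(1) d(1) P(1) by (auto simp: r_def)
 let ?S = "{0..r} - integers_from_ends P"
 have S: "?S : sets lebesgue" using negligible_imp_sets[OF negligible_integers_from_ends[of P]] by auto
 have "(%x. F (of_real x) * G (of_real (P - x))) absolutely_integrable_on ?S"
 proof (rule measurable_bounded_by_integrable_imp_absolutely_integrable[OF _ S])
  have "0 : integers_from_ends P" by (simp add: integers_from_ends_def)
  then have pos: "0 < x" if "x : ?S" for x using that by (cases "x = 0") auto
  show "(%x. F (of_real x) * G (of_real (P - x))) : borel_measurable (lebesgue_on ?S)"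
   by (rule continuous_imp_measurable_on_sets_lebesgue[OF continuous_on_subset[OF boundary_product_continuous[OF F(1) G(1), of P]] S])
    (use r P pos in force)
  have "(%x. H x * M) integrable_on {0..r}"
   by (intro integrable_on_mult_left integrable_subinterval_real[OF H(2)]) (use r in auto)
  then show "(%x. H x * M) integrable_on ?S"
   by (simp only: integrable_on_diff_negligible[OF negligible_integers_from_ends])
  fix x assume x: "x : ?S"
  have "norm (F (of_real x)) <= H x" using pos[OF x] x r by (intro H(3)) auto
  moreover have "norm (G (Complex (P - x) (e * 0))) <= M" using pos[OF x] x r d(1) by (intro d(2)) auto
  moreover have "Complex (P - x) (e * 0) = of_real (P - x)" by (simp add: complex_eq_iff)
  ultimately show "norm (F (of_real x) * G (of_real (P - x))) <= H x * M"
   unfolding norm_mult by (intro mult_mono') auto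
 qed
 then have "(%x. F (of_real x) * G (of_real (P - x))) absolutely_integrable_on {0..r}"
  by (simp only: absolutely_integrable_on_diff_negligible[OF negligible_integers_from_ends])
 with r show ?thesis using that by blast
qed

text \<open>Near 0 the first factor is dominated and the second is bounded, being near P; the
  reflection x -> P - x treats the other end, and \<open>boundary_product_integrable\<close> the
  middle.\<close>

lemma boundary_convolution_integrable:
 assumes F: "F analytic_on sheet V e" "!!n. 1 <= n ==> dominated_at e F (real n)" "dominated_at_0 F"
  and G: "G analytic_on sheet V e" "!!n. 1 <= n ==> dominated_at e G (real n)" "dominated_at_0 G"
  and P: "0 < P" "P ~: \<nat>"
 shows "(%x. F (of_real x) * G (of_real (P - x))) absolutely_integrable_on {0..P}"
proof -
 obtain r where r: "0 < r" "r < P / 2" "(%x. F (of_real x) * G (of_real (P - x))) absolutely_integrable_on {0..r}"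
  using boundary_product_integrable_at_0[OF F(1,3) G(1) P] by blast
 obtain q where q: "0 < q" "q < P / 2" "(%x. G (of_real x) * F (of_real (P - x))) absolutely_integrable_on {0..q}"
  using boundary_product_integrable_at_0[OF G(1,3) F(1) P] by blast
 have "(%x. G (of_real (P - x)) * F (of_real (P - (P - x)))) absolutely_integrable_on {P - q..P}"
  by (rule absolutely_integrable_on_reflect_shift) (use q in simp)
 then have right: "(%x. F (of_real x) * G (of_real (P - x))) absolutely_integrable_on {P - q..P}"
  by (simp add: mult.commute)
 have "(%x. F (of_real x) * G (of_real (P - x))) absolutely_integrable_on {r..P - q}"
  by (rule boundary_product_integrable[OF F(1,2) G(1,2) P(2)]) (use r q in auto)
 then have "(%x. F (of_real x) * G (of_real (P - x))) absolutely_integrable_on {r..P}"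
  using right r q by (intro absolutely_integrable_combine[of r "P - q" P]) auto
 then show ?thesis using r by (intro absolutely_integrable_combine[of 0 r P]) auto
qed

end

text \<open>The segment is parametrised so that the abscissa runs through an interval of length
  \<open>ep\<close>, while its own length is at most 2 * ep; this accounts for the factor 2.\<close>

lemma norm_contour_integral_segment_le:
 fixes c ep K :: real
 assumes H: "H integrable_on {c..c + ep}" and ep: "0 < ep" and K: "0 <= K" and uv: "norm (v - u) <= 2 * ep"
  and le: "!!t. [|0 < t; t < 1|] ==> norm (f (linepath u v t)) <= K * H (c + ep * t)"
 shows "norm (contour_integral (linepath u v) f) <= 2 * K * integral {c..c + ep} H"
proof -
 have N: "negligible {0, 1 :: real}" by simp
 have "(H has_integral integral {c..c + ep} H) (cbox c (c + ep))" using H by (simp add: has_integral_integral)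
 from has_integral_affinity'[OF this ep, of c]
 have "((%t. H (ep * t + c)) has_integral integral {c..c + ep} H / ep) {0..1}"
  using ep by (simp add: divide_inverse mult.commute)
 then have "((%t. (2 * K * ep) * H (ep * t + c)) has_integral (2 * K * ep) * (integral {c..c + ep} H / ep)) {0..1}"
  by (rule has_integral_mult_right)
 then have G: "((%t. (2 * K * ep) * H (ep * t + c)) has_integral 2 * K * integral {c..c + ep} H) {0..1}" using ep by (simp add: mult.assoc)
 let ?g = "%t. (2 * K * ep) * H (ep * t + c)" and ?f = "%t. f (linepath u v t) * (v - u)"
 have le': "norm (?f t) <= ?g t" if "t : {0..1} - {0, 1}" for t
 proof -
  have "norm (?f t) <= (K * H (c + ep * t)) * (2 * ep)"
   unfolding norm_mult using that by (intro mult_mono' le uv) auto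
  then show ?thesis by (simp add: algebra_simps)
 qed
 have int_g: "?g integrable_on {0..1} - {0, 1}" unfolding integrable_on_diff_negligible[OF N] using G by blast
 have "norm (integral ({0..1} - {0, 1}) ?f) <= integral ({0..1} - {0, 1}) ?g"
 proof (cases "?f integrable_on {0..1} - {0, 1}")
  case True
  then show ?thesis by (rule Henstock_Kurzweil_Integration.integral_norm_bound_integral[OF _ int_g le'])
 next
  \<comment> \<open>A non-integrable integrand has integral 0 by convention, so nonnegativity of the
    bound is enough.\<close>
  case False
  have "0 <= integral ({0..1} - {0, 1}) ?g"
   by (rule Henstock_Kurzweil_Integration.integral_nonneg[OF int_g]) (rule order_trans[OF norm_ge_zero le'])
  then show ?thesis unfolding not_integrable_integral[OF False] norm_zero .
 qed
 then show ?thesis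
  unfolding integral_diff_negligible[OF N] contour_integral_integral vector_derivative_linepath_at integral_unique[OF G] .
qed

lemma integral_shrinking_interval:
 fixes H :: "real => 'a::euclidean_space"
 assumes H: "H integrable_on {k - de..k + de}" and de: "0 < de"
 shows "((%ep. integral {k - ep..k} H) \<longlongrightarrow> 0) (at_right 0)"
  and "((%ep. integral {k..k + ep} H) \<longlongrightarrow> 0) (at_right 0)"
proof -
 have ev: "\<forall>\<^sub>F ep in at_right 0. 0 < ep & ep < de"
  using de by (auto simp: eventually_at_right_field)
 have id: "((%ep. ep) \<longlongrightarrow> 0) (at_right (0::real))" by (rule tendsto_ident_at)
 have H1: "H integrable_on {k - de..k}" and H2: "H integrable_on {k..k + de}"
  using de by (auto intro!: integrable_subinterval_real[OF H])
 have "((%ep. k - ep) \<longlongrightarrow> k - 0) (at_right 0)" by (intro tendsto_intros id)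
 then have t1: "((%ep. k - ep) \<longlongrightarrow> k) (at_right 0)" by simp
 have "((%ep. integral {k - de..k - ep} H) \<longlongrightarrow> integral {k - de..k} H) (at_right 0)"
  by (rule continuous_on_tendsto_compose[OF indefinite_integral_continuous_1[OF H1] t1])
   (use de in \<open>auto intro: eventually_mono[OF ev]\<close>)
 then have "((%ep. integral {k - de..k} H - integral {k - de..k - ep} H) \<longlongrightarrow> integral {k - de..k} H - integral {k - de..k} H) (at_right 0)"
  by (intro tendsto_intros)
 then have lim: "((%ep. integral {k - de..k} H - integral {k - de..k - ep} H) \<longlongrightarrow> 0) (at_right 0)" by simp
 have eq: "\<forall>\<^sub>F ep in at_right 0. integral {k - de..k} H - integral {k - de..k - ep} H = integral {k - ep..k} H"
  using ev
 proof eventually_elim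
  fix ep :: real assume ep: "0 < ep & ep < de"
  have "integral {k - de..k - ep} H + integral {k - ep..k} H = integral {k - de..k} H"
   by (rule Henstock_Kurzweil_Integration.integral_combine[OF _ _ H1]) (use ep in auto)
  then show "integral {k - de..k} H - integral {k - de..k - ep} H = integral {k - ep..k} H"
   by (simp add: diff_eq_eq add.commute)
 qed
 show "((%ep. integral {k - ep..k} H) \<longlongrightarrow> 0) (at_right 0)" by (rule Lim_transform_eventually[OF lim eq])
 have "((%ep. k + ep) \<longlongrightarrow> k + 0) (at_right 0)" by (intro tendsto_intros id)
 then have t2: "((%ep. k + ep) \<longlongrightarrow> k) (at_right 0)" by simp
 have "((%ep. integral {k..k + ep} H) \<longlongrightarrow> integral {k..k} H) (at_right 0)"
  by (rule continuous_on_tendsto_compose[OF indefinite_integral_continuous_1[OF H2] t2])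
   (use de in \<open>auto intro: eventually_mono[OF ev]\<close>)
 then show "((%ep. integral {k..k + ep} H) \<longlongrightarrow> 0) (at_right 0)" by simp
qed

context wedge
begin

text \<open>Inside each side of the diamond the height is nonzero and the abscissa differs from k,
  so the majorant of L applies and G is bounded near p. The arc is thus bounded by integrals of the
  majorant over intervals shrinking to k.\<close>

lemma arc_part_tendsto_0:
 assumes L: "dominated_at (-e) L k" and G: "G analytic_on sheet V e" and p: "0 < p" "p ~: \<nat>"
 shows "((%ep. arc_part e ep (%s. L (of_real k + s)) G (of_real p)) \<longlongrightarrow> 0) (at_right 0)"
proof -
 obtain de H where de: "de > 0" "set_integrable lborel {k - de..k + de} H"
  "!!x y. [|x ~= k; \<bar>x - k\<bar> < de; 0 < y; y < de|] ==> norm (L (Complex x (-e * y))) <= H x"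
  using L unfolding dominated_at_def by blast
 obtain d M where d: "d > 0" "!!x y. [|\<bar>x - p\<bar> <= d; 0 <= y; y <= d|] ==> norm (G (Complex x (e * y))) <= M"
  using boundary_bounded[OF G p] by blast
 have M: "0 <= M" using d(2)[of p 0] d(1) norm_ge_zero order_trans by (metis abs_zero diff_self less_eq_real_def order_refl)
 have H: "H integrable_on {k - de..k + de}"
  using set_integrable_lborel_imp_absolutely_integrable[OF de(2)] by (simp add: absolutely_integrable_on_def)
 define r where "r = min de d"
 have r: "0 < r" "r <= de" "r <= d" using de d by (auto simp: r_def)
 have prod: "norm (L (of_real k + s) * G (of_real p - s)) <= M * H (k + x)"
  if s: "s = Complex x (- e * y)" and x: "x ~= 0" "\<bar>x\<bar> < r" and y: "0 < y" "y < r" for s x y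
 proof -
  have 1: "of_real k + s = Complex (k + x) (- e * y)" "of_real p - s = Complex (p - x) (e * y)"
   by (simp_all add: s complex_eq_iff)
  have "norm (L (of_real k + s)) <= H (k + x)" unfolding 1 using x y r by (intro de(3)) auto
  moreover have "norm (G (of_real p - s)) <= M" unfolding 1 using x y r by (intro d(2)) auto
  ultimately have "norm (L (of_real k + s)) * norm (G (of_real p - s)) <= H (k + x) * M" by (intro mult_mono') auto
  then show ?thesis by (simp add: norm_mult mult.commute)
 qed
 have bound: "norm (arc_part e ep (%s. L (of_real k + s)) G (of_real p)) <= 2 * M * (integral {k - ep..k} H + integral {k..k + ep} H)"
  if ep: "0 < ep" "ep < r" for ep
 proof -
  have H1: "H integrable_on {k - ep..k - ep + ep}" and H2: "H integrable_on {k..k + ep}"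
   using ep r by (auto intro!: integrable_subinterval_real[OF H])
  have scaled: "0 < t * ep" "t * ep < r" if "0 < t" "t < 1" for t
  proof -
   have "t * ep < 1 * ep" using that ep by (intro mult_strict_right_mono) auto
   then show "t * ep < r" using ep by linarith
  qed (use that ep in simp)
  have n: "norm (\<i> * of_real (e * ep) :: complex) = ep" using ep by (simp add: norm_mult)
  have 1: "norm (contour_integral (linepath (- of_real ep) (- \<i> * of_real (e * ep))) (%s. L (of_real k + s) * G (of_real p - s)))
    <= 2 * M * integral {k - ep..k - ep + ep} H"
  proof (rule norm_contour_integral_segment_le[OF H1 ep(1) M])
   show "norm (- \<i> * of_real (e * ep) - (- of_real ep) :: complex) <= 2 * ep"
    using norm_triangle_ineq4[of "of_real ep :: complex" "\<i> * of_real (e * ep)"] ep n by simp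
   fix t :: real assume t: "0 < t" "t < 1"
   have "0 < (1 - t) * ep" "(1 - t) * ep < r" "0 < t * ep" "t * ep < r"
    using scaled[of t] scaled[of "1 - t"] t by simp_all
   then have 0: "norm (L (of_real k + linepath (- of_real ep) (- \<i> * of_real (e * ep)) t) *
     G (of_real p - linepath (- of_real ep) (- \<i> * of_real (e * ep)) t)) <= M * H (k + (- ((1 - t) * ep)))"
    by (intro prod[of _ _ "t * ep"]) (auto simp: complex_eq_iff linepath_def)
   have eq: "k + (- ((1 - t) * ep)) = k - ep + ep * t" by (simp add: algebra_simps)
   show "norm (L (of_real k + linepath (- of_real ep) (- \<i> * of_real (e * ep)) t) *
     G (of_real p - linepath (- of_real ep) (- \<i> * of_real (e * ep)) t)) <= M * H (k - ep + ep * t)" using 0 unfolding eq .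
  qed
  have 2: "norm (contour_integral (linepath (- \<i> * of_real (e * ep)) (of_real ep)) (%s. L (of_real k + s) * G (of_real p - s)))
    <= 2 * M * integral {k..k + ep} H"
  proof (rule norm_contour_integral_segment_le[OF H2 ep(1) M])
   show "norm (of_real ep - (- \<i> * of_real (e * ep)) :: complex) <= 2 * ep"
    using norm_triangle_ineq[of "of_real ep :: complex" "\<i> * of_real (e * ep)"] ep n by simp
   fix t :: real assume t: "0 < t" "t < 1"
   have "0 < (1 - t) * ep" "(1 - t) * ep < r" "0 < ep * t" "ep * t < r"
    using scaled[of t] scaled[of "1 - t"] t by (simp_all add: mult.commute)
   then show "norm (L (of_real k + linepath (- \<i> * of_real (e * ep)) (of_real ep) t) *
     G (of_real p - linepath (- \<i> * of_real (e * ep)) (of_real ep) t)) <= M * H (k + ep * t)"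
    by (intro prod[of _ _ "(1 - t) * ep"]) (auto simp: complex_eq_iff linepath_def)
  qed
  show ?thesis unfolding arc_part_def
   using norm_triangle_le[OF add_mono[OF 1 2]] by (simp add: distrib_left)
 qed
 have "((%ep. 2 * M * (integral {k - ep..k} H + integral {k..k + ep} H)) \<longlongrightarrow> 2 * M * (0 + 0)) (at_right 0)"
  by (intro tendsto_intros integral_shrinking_interval[OF H de(1)])
 then have lim: "((%ep. 2 * M * (integral {k - ep..k} H + integral {k..k + ep} H)) \<longlongrightarrow> 0) (at_right 0)" by simp
 have "\<forall>\<^sub>F ep in at_right 0. 0 < ep & ep < r"
  using r by (auto simp: eventually_at_right_field)
 then have "\<forall>\<^sub>F ep in at_right 0. norm (arc_part e ep (%s. L (of_real k + s)) G (of_real p)) <= 2 * M * (integral {k - ep..k} H + integral {k..k + ep} H)"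
  by eventually_elim (blast intro: bound)
 then show ?thesis by (rule Lim_null_comparison) (rule lim)
qed

end

context sheet_family
begin

lemma dominated_at_0_first: "dominated_at_0 (A 0)"
proof -
 have K: "compact {1/2 :: complex} & {1/2 :: complex} <= base" using of_real_base[of "1/2"] by simp
 obtain H where H: "set_integrable lborel {0..1} H"
  "!!t. t : {0<..1} ==> norm (A 0 (of_real t * (1/2))) <= H t"
  using radA[unfolded radially_integrable_def, rule_format, OF K] by auto
 have "H integrable_on {0..1}"
  using set_integrable_lborel_imp_absolutely_integrable[OF H(1)] by (simp add: absolutely_integrable_on_def)
 then have int: "(%x. H (2 * x + 0)) integrable_on {0..1/2}" by (intro integrable_on_affine_pos) auto
 show ?thesis unfolding dominated_at_0_def
 proof (intro exI[of _ "1/2"] exI[of _ "%x. H (2 * x + 0)"] conjI allI impI int)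
  fix x :: real assume x: "0 < x & x <= 1/2"
  have "of_real x = of_real (2 * x + 0) * (1/2 :: complex)" by simp
  then show "norm (A 0 (of_real x)) <= H (2 * x + 0)" using H(2)[of "2 * x + 0"] x by auto
 qed simp
qed

text \<open>The origin of the sheet k \<ge> 1 is the integer k of the surface; just to its right A k
  equals the boundary values of L, which are dominated at k.\<close>

lemma dominated_at_0_succ:
 assumes k: "1 <= k" and dom: "!!n. 1 <= n ==> dominated_at (-e) L (real n)"
 shows "dominated_at_0 (A k)"
proof -
 have pos: "0 < real k" using k by simp
 interpret flip: wedge V "-e" by (rule wedge_uminus)
 obtain de H where de: "de > 0" "de < real k" "H integrable_on {real k - de..real k + de}"
  "!!x y. [|\<bar>x - real k\<bar> <= de; x ~: \<nat>; 0 <= y; y <= de|] ==> norm (L (Complex x (- e * y))) <= H x"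
  using flip.boundary_dominated[OF L dom pos] by blast
 define r where "r = min de (1/2)"
 have r: "0 < r" "r <= de" "r < 1" using de by (auto simp: r_def)
 have int: "(%x. H (1 * x + real k)) integrable_on {0..r}"
  by (rule integrable_on_affine_pos) (use r in \<open>auto intro!: integrable_subinterval_real[OF de(3)]\<close>)
 show ?thesis unfolding dominated_at_0_def
 proof (intro exI[of _ r] exI[of _ "%x. H (1 * x + real k)"] conjI allI impI int r)
  fix x :: real assume x: "0 < x & x <= r"
  have "x + real k ~: \<nat>" using x r not_Nats_between[of k "x + real k"] by auto
  then have "norm (L (Complex (x + real k) (- e * 0))) <= H (x + real k)" using x r de(1) by (intro de(4)) auto
  moreover have "Complex (x + real k) (- e * 0) = of_nat k + of_real x" by (simp add: complex_eq_iff)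
  ultimately show "norm (A k (of_real x)) <= H (1 * x + real k)" using glue[of x k] x r by simp
 qed
qed

lemma dominated_at_0:
 assumes "!!n. 1 <= n ==> dominated_at (-e) L (real n)" shows "dominated_at_0 (A k)"
 using dominated_at_0_first dominated_at_0_succ[OF _ assms, of k] by (cases "k = 0") auto

end

section \<open>Sheets of the convolution at real points\<close>

locale integrable_sheet_pair = sheet_pair +
 assumes domA: "1 <= n ==> dominated_at e (A k) (real n)" and domL: "1 <= n ==> dominated_at (-e) L (real n)"
  and domB: "1 <= n ==> dominated_at e (B k) (real n)" and domM: "1 <= n ==> dominated_at (-e) M (real n)"
begin

lemma sheet_product_integrable:
 assumes "0 < P" "P ~: \<nat>"
 shows "(%x. A k (of_real x) * B j (of_real (P - x))) absolutely_integrable_on {0..P}"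
  and "(%x. B k (of_real x) * A j (of_real (P - x))) absolutely_integrable_on {0..P}"
 by (rule boundary_convolution_integrable[OF F.A domA F.dominated_at_0[OF domL] G.A domB G.dominated_at_0[OF domM] assms]; assumption)
  (rule boundary_convolution_integrable[OF G.A domB G.dominated_at_0[OF domM] F.A domA F.dominated_at_0[OF domL] assms]; assumption)

definition boundary_integral :: "(complex => complex) => (complex => complex) => real => real => complex" where
 "boundary_integral F G P u = integral {0..u} (%x. F (of_real x) * G (of_real (P - x)))"

lemma boundary_integral_tendsto:
 assumes int: "(%x. F (of_real x) * G (of_real (P - x))) absolutely_integrable_on {0..P}"
  and g: "(g \<longlongrightarrow> l) net" and l: "0 <= l" "l <= P" and ev: "\<forall>\<^sub>F x in net. 0 <= g x & g x <= P"
 shows "((%x. boundary_integral F G P (g x)) \<longlongrightarrow> boundary_integral F G P l) net"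
proof -
 have "(%x. F (of_real x) * G (of_real (P - x))) integrable_on {0..P}"
  using int by (simp add: absolutely_integrable_on_def)
 then have "continuous_on {0..P} (boundary_integral F G P)"
  unfolding boundary_integral_def by (rule indefinite_integral_continuous_1)
 then show ?thesis
  by (rule continuous_on_tendsto_compose[OF _ g]) (use l ev in \<open>auto elim: eventually_mono\<close>)
qed

text \<open>Both sides are limits of the same values when the axis is approached from the side e: C
  because it is analytic on the sheet, the zigzag piece by piece through
  \<open>pass_tendsto_boundary\<close>.\<close>

lemma sheet_convolution_at_real_eq_zigzag:
 assumes C: "C analytic_on sheet V e"
  "!!ep z. [|admissible ep; z : region ep; z ~= 1/2|] ==> C z = zigzag e ep L A M B m z"
  and p: "0 < p" "p ~: \<nat>" "p + 1 ~: \<nat>" and ep: "small_for p ep" "p + 1 ~= 2 * (1 - ep)"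
 shows "C (of_real p) = zigzag e ep L A M B m (of_real p)"
proof -
 have adm: "admissible ep" and eps: "0 < ep" "ep < 1/4" "ep < p / 2"
  using ep(1) by (auto simp: small_for_def admissible_def)
 have id: "((%y. y) \<longlongrightarrow> 0) (at_right (0::real))" by (rule tendsto_ident_at)
 have "((%y. of_real p + \<i> * of_real (e * y)) \<longlongrightarrow> of_real p + \<i> * of_real (e * 0)) (at_right 0)"
  by (intro tendsto_intros id)
 then have zlim: "((%y. Complex p (e * y)) \<longlongrightarrow> of_real p) (at_right 0)" by (simp add: Complex_eq)
 have an: "((%y. f (Complex p (e * y))) \<longlongrightarrow> f (of_real p)) (at_right 0)" if "f analytic_on {of_real p}" for f
  by (rule isCont_tendsto_compose[OF analytic_at_imp_isCont[OF that] zlim])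
 note parts = zigzag_parts_analytic[OF adm small_for_arc[OF ep(1)] small_for_ray[OF ep(1)]]
 have nN: "ep ~: \<nat>" "1 - ep ~: \<nat>" using eps not_Nats_between[of 0 ep] not_Nats_between[of 0 "1 - ep"] by auto
 have pN: "p - ep ~: \<nat>" "p + ep ~: \<nat>"
  using small_for_notin_Nats[OF ep(1), of "- ep"] small_for_notin_Nats[OF ep(1), of ep] eps by auto
 have pass1: "((%y. pass (of_real ep) (A k) (B j) (Complex p (e * y))) \<longlongrightarrow> pass (of_real ep) (A k) (B j) (of_real p)) (at_right 0)" for k j
  by (rule pass_tendsto_boundary[OF F.A domA G.A domB p(2)]) (use eps nN pN in auto)
 have pass2: "((%y. pass (1 - of_real ep) (A k) (B j) (Complex p (e * y) + 1)) \<longlongrightarrow> pass (1 - of_real ep) (A k) (B j) (of_real p + 1)) (at_right 0)" for k j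
 proof -
  have "((%y. pass (of_real (1 - ep)) (A k) (B j) (Complex (p + 1) (e * y))) \<longlongrightarrow> pass (of_real (1 - ep)) (A k) (B j) (of_real (p + 1))) (at_right 0)"
   by (rule pass_tendsto_boundary[OF F.A domA G.A domB p(3)]) (use p eps nN pN ep(2) in auto)
  moreover have "Complex (p + 1) (e * y) = Complex p (e * y) + 1" for y by (simp add: complex_eq_iff)
  ultimately show ?thesis by simp
 qed
 have lim: "((%y. zigzag e ep L A M B m (Complex p (e * y))) \<longlongrightarrow> zigzag e ep L A M B m (of_real p)) (at_right 0)"
  unfolding zigzag_def
  by (intro tendsto_intros an parts pass1 pass2) auto
 have V: "z : V" if "p - ep <= Re z" "\<bar>Im z\<bar> <= ep" for z using ep(1) that by (auto simp: small_for_def)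
 have ev1: "\<forall>\<^sub>F y in at_right 0. 0 < y & y < ep / 2"
  unfolding eventually_at_right_field by (rule exI[of _ "ep / 2"]) (use eps in auto)
 have "of_real p + \<i> * of_real (e * ep) : V" by (rule V) (use eps in \<open>simp_all add: abs_mult\<close>)
 then have ev2: "\<forall>\<^sub>F y in at_right 0. Complex p (e * y) + \<i> * of_real (e * ep) : V"
  by (rule topological_tendstoD[OF tendsto_add[OF zlim tendsto_const] open_V])
 have ev: "\<forall>\<^sub>F y in at_right 0. zigzag e ep L A M B m (Complex p (e * y)) = C (Complex p (e * y))"
  using ev1 ev2
 proof eventually_elim
  fix y :: real assume y: "0 < y & y < ep / 2" and y2: "Complex p (e * y) + \<i> * of_real (e * ep) : V"
  have im: "\<bar>e * y\<bar> <= ep" using y by (simp add: abs_mult)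
  have ey: "e * y ~= 0" using y e by auto
  have "p - ep <= p" using eps by simp
  then have "Complex p (e * y) : V" using V[of "Complex p (e * y)"] im by simp
  then have "Complex p (e * y) : half V e" using y by (simp add: half_def)
  moreover have "Complex p (e * y) - of_real ep : V" using V[of "Complex p (e * y) - of_real ep"] im by simp
  moreover note y2
  ultimately have "Complex p (e * y) : region ep" by (simp add: region_def)
  moreover have "Complex p (e * y) ~= 1 / 2" using ey by (auto simp: complex_eq_iff)
  ultimately show "zigzag e ep L A M B m (Complex p (e * y)) = C (Complex p (e * y))" using C(2)[OF adm] by simp
 qed
 have "((%y. C (Complex p (e * y))) \<longlongrightarrow> zigzag e ep L A M B m (of_real p)) (at_right 0)"
  by (rule Lim_transform_eventually[OF lim ev])
 moreover have "((%y. C (Complex p (e * y))) \<longlongrightarrow> C (of_real p)) (at_right 0)"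
  by (rule boundary_tendsto[OF C(1) p(1,2) id])
 ultimately show ?thesis using tendsto_unique[of "at_right (0::real)"] by (metis trivial_limit_at_right_real)
qed

text \<open>Let \<open>ep\<close> tend to 0 in the zigzag at p. End rays and arcs vanish, the
  outward legs become integrals over [0, p], and the returning legs become oriented integrals from 1
  to p of products whose arguments add up to p + 1.\<close>

lemma sheet_convolution_at_real:
 assumes C: "C analytic_on sheet V e"
  "!!ep z. [|admissible ep; z : region ep; z ~= 1/2|] ==> C z = zigzag e ep L A M B m z"
  and p: "0 < p" "p ~: \<nat>"
 shows "C (of_real p) = (\<Sum>k\<le>m. boundary_integral (A k) (B (m - k)) p p) -
  (\<Sum>k<m. boundary_integral (A k) (B (m - Suc k)) (p + 1) p - boundary_integral (A k) (B (m - Suc k)) (p + 1) 1)"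
proof -
 obtain n where n: "real n < p" "p < real n + 1" using between_Nats[OF p] .
 have p1: "p + 1 ~: \<nat>" using not_Nats_between[of "Suc n" "p + 1"] n by simp
 have "p ~= 1" using p(2) by auto
 define E where "E ep = boundary_integral (A 0) (B m) p ep + boundary_integral (B 0) (A m) p ep +
   (\<Sum>k=1..m. arc_part e ep (%s. L (of_nat k + s)) (B (m - k)) (of_real p)) +
   (\<Sum>k=1..m. arc_part e ep (%s. M (of_nat k + s)) (A (m - k)) (of_real p)) +
   (\<Sum>k\<le>m. boundary_integral (A k) (B (m - k)) p (p - ep) - boundary_integral (A k) (B (m - k)) p ep) -
   (\<Sum>k<m. boundary_integral (A k) (B (m - Suc k)) (p + 1) (p + ep) - boundary_integral (A k) (B (m - Suc k)) (p + 1) (1 - ep))" for ep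
 obtain d where d: "d > 0" "!!ep. [|0 < ep; ep < d|] ==> small_for p ep" using small_for_exists[OF p] by blast
 \<comment> \<open>The last bound excludes p + 1 = 2 * (1 - ep), the degenerate position of the
   returning legs.\<close>
 define d' where "d' = min d (min (1/4) (min (p / 2) \<bar>(1 - p) / 2\<bar>))"
 have d': "0 < d'" using d(1) p \<open>p ~= 1\<close> by (auto simp: d'_def)
 have ev0: "\<forall>\<^sub>F ep in at_right 0. 0 < ep & ep < d'"
  unfolding eventually_at_right_field by (rule exI[of _ d']) (use d' in auto)
 note int = sheet_product_integrable(1)
 have int': "(%x. A k (of_real x) * B j (of_real (P - x))) integrable_on {0..P}" if "0 < P" "P ~: \<nat>" for P k j
  using int[OF that] by (simp add: absolutely_integrable_on_def)
 have CE: "C (of_real p) = E ep" if ep: "0 < ep" "ep < d'" for ep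
 proof -
  have ep': "ep < d" "ep < 1/4" "ep < p / 2" "ep < \<bar>(1 - p) / 2\<bar>" using ep by (auto simp: d'_def)
  have "p + 1 ~= 2 * (1 - ep)"
  proof
   assume "p + 1 = 2 * (1 - ep)"
   then have "ep = (1 - p) / 2" by simp
   then show False using ep'(4) ep(1) by simp
  qed
  then have "C (of_real p) = zigzag e ep L A M B m (of_real p)"
   by (intro sheet_convolution_at_real_eq_zigzag[OF C(1) _ p p1 d(2)[OF ep(1) ep'(1)]] C(2))
  moreover have "ray_part (of_real ep) F' G' (of_real p) = boundary_integral F' G' p ep" for F' G'
   unfolding ray_part_def boundary_integral_def using ep(1)
   by (subst contour_integral_linepath_Reals_eq) auto
  moreover have "pass (of_real ep) (A k) (B j) (of_real p) =
    boundary_integral (A k) (B j) p (p - ep) - boundary_integral (A k) (B j) p ep" for k j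
   unfolding boundary_integral_def by (rule pass_real[OF int'[OF p]]) (use ep ep' in auto)
  moreover have "pass (1 - of_real ep) (A k) (B j) (of_real p + 1) =
    boundary_integral (A k) (B j) (p + 1) (p + ep) - boundary_integral (A k) (B j) (p + 1) (1 - ep)" for k j
  proof -
   have "pass (of_real (1 - ep)) (A k) (B j) (of_real (p + 1)) =
     boundary_integral (A k) (B j) (p + 1) (p + 1 - (1 - ep)) - boundary_integral (A k) (B j) (p + 1) (1 - ep)"
    unfolding boundary_integral_def by (rule pass_real[OF int'[OF _ p1]]) (use p ep ep' in auto)
   moreover have "p + 1 - (1 - ep) = p + ep" by simp
   ultimately show ?thesis by simp
  qed
  ultimately show ?thesis by (simp only: zigzag_def E_def)
 qed
 have id: "((%ep. ep) \<longlongrightarrow> 0) (at_right (0::real))" by (rule tendsto_ident_at)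
 have g0: "((%ep. ep) \<longlongrightarrow> 0) (at_right (0::real))" "((%ep. p - ep) \<longlongrightarrow> p) (at_right 0)"
  "((%ep. p + ep) \<longlongrightarrow> p) (at_right 0)" "((%ep. 1 - ep) \<longlongrightarrow> 1) (at_right (0::real))"
  using tendsto_diff[OF tendsto_const[of p] id] tendsto_add[OF tendsto_const[of p] id] tendsto_diff[OF tendsto_const[of 1] id] id
  by simp_all
 have ev: "\<forall>\<^sub>F ep in at_right 0. 0 <= ep & ep <= p" "\<forall>\<^sub>F ep in at_right 0. 0 <= p - ep & p - ep <= p"
  "\<forall>\<^sub>F ep in at_right 0. 0 <= p + ep & p + ep <= p + 1" "\<forall>\<^sub>F ep in at_right 0. 0 <= 1 - ep & 1 - ep <= p + 1"
  using p by (auto intro!: eventually_mono[OF ev0] simp: d'_def)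
 have z: "boundary_integral F' G' P 0 = 0" for F' G' P by (simp add: boundary_integral_def)
 have bi0: "((%ep. boundary_integral (A k) (B j) p ep) \<longlongrightarrow> 0) (at_right 0)" for k j
  using boundary_integral_tendsto[OF int[OF p] g0(1) _ _ ev(1)] p unfolding z by auto
 have bi0': "((%ep. boundary_integral (B k) (A j) p ep) \<longlongrightarrow> 0) (at_right 0)" for k j
  using boundary_integral_tendsto[OF sheet_product_integrable(2)[OF p] g0(1) _ _ ev(1)] p unfolding z by auto
 have bip: "((%ep. boundary_integral (A k) (B j) p (p - ep)) \<longlongrightarrow> boundary_integral (A k) (B j) p p) (at_right 0)" for k j
  by (rule boundary_integral_tendsto[OF int[OF p] g0(2) _ _ ev(2)]) (use p in auto)
 have pos1: "0 < p + 1" using p by simp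
 have bip1: "((%ep. boundary_integral (A k) (B j) (p + 1) (p + ep)) \<longlongrightarrow> boundary_integral (A k) (B j) (p + 1) p) (at_right 0)" for k j
  by (rule boundary_integral_tendsto[OF int[OF pos1 p1] g0(3) _ _ ev(3)]) (use p in auto)
 have bi1: "((%ep. boundary_integral (A k) (B j) (p + 1) (1 - ep)) \<longlongrightarrow> boundary_integral (A k) (B j) (p + 1) 1) (at_right 0)" for k j
  by (rule boundary_integral_tendsto[OF int[OF pos1 p1] g0(4) _ _ ev(4)]) (use p in auto)
 have arcs: "((%ep. arc_part e ep (%s. L (of_nat k + s)) (B j) (of_real p)) \<longlongrightarrow> 0) (at_right 0)"
  "((%ep. arc_part e ep (%s. M (of_nat k + s)) (A j) (of_real p)) \<longlongrightarrow> 0) (at_right 0)" if "k : {1..m}" for k j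
  using arc_part_tendsto_0[OF domL[of k] G.A p] arc_part_tendsto_0[OF domM[of k] F.A p] that by simp_all
 have "(E \<longlongrightarrow> 0 + 0 + (\<Sum>k=1..m. 0) + (\<Sum>k=1..m. 0) + (\<Sum>k\<le>m. boundary_integral (A k) (B (m - k)) p p - 0) -
   (\<Sum>k<m. boundary_integral (A k) (B (m - Suc k)) (p + 1) p - boundary_integral (A k) (B (m - Suc k)) (p + 1) 1)) (at_right 0)"
  unfolding E_def by (intro tendsto_add tendsto_diff tendsto_sum bi0 bi0' bip bip1 bi1 arcs)
 moreover have "(E \<longlongrightarrow> C (of_real p)) (at_right 0)"
  by (rule Lim_transform_eventually[OF tendsto_const]) (rule eventually_mono[OF ev0], simp add: CE)
 ultimately show ?thesis using tendsto_unique[OF trivial_limit_at_right_real] by fastforce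
qed

end

section \<open>Sectors described by slopes, and kinds of curves\<close>

text \<open>For Re z > 0 membership in a cone depends on this number alone, and the curves of the
  surface run in the right half-plane.\<close>

definition slope :: "complex => real" where "slope z = Im z / Re z"

lemma slope_of_real_mult: "0 < t ==> slope (of_real t * z) = slope z"
 by (simp add: slope_def)

lemma Re_combination_pos: "[|0 < Re z; 0 < Re w; 0 <= u; 0 <= v; u + v = 1|] ==> 0 < u * Re z + v * Re w"
 by (cases "u = 0") (auto intro: add_pos_nonneg)

text \<open>The slope of a convex combination is a convex combination of the slopes, with weights
  proportional to the real parts.\<close>

lemma slope_combination:
 assumes J: "convex J" and z: "0 < Re z" "slope z : J" and w: "0 < Re w" "slope w : J" and uv: "0 <= u" "0 <= v" "u + v = 1"
 shows "0 < Re (u *\<^sub>R z + v *\<^sub>R w) & slope (u *\<^sub>R z + v *\<^sub>R w) : J"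
proof -
 define R where "R = u * Re z + v * Re w"
 have R: "0 < R" unfolding R_def by (rule Re_combination_pos) (use z w uv in auto)
 have "(u * Re z / R) *\<^sub>R slope z + (v * Re w / R) *\<^sub>R slope w : J"
  using z w uv R by (intro convexD[OF J]) (auto simp: R_def simp flip: add_divide_distrib)
 moreover have "(u * Re z / R) *\<^sub>R slope z + (v * Re w / R) *\<^sub>R slope w = slope (u *\<^sub>R z + v *\<^sub>R w)"
 proof -
  have "Re z * slope z = Im z" "Re w * slope w = Im w" using z w by (simp_all add: slope_def)
  then have "(u * Re z / R) *\<^sub>R slope z + (v * Re w / R) *\<^sub>R slope w = (u * Im z + v * Im w) / R"
   by (simp add: add_divide_distrib mult.assoc)
  then show ?thesis by (simp add: slope_def R_def)
 qed
 ultimately show ?thesis using R by (simp add: R_def)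
qed

lemma open_slope_cone: "open J ==> open {z. 0 < Re z & slope z : J}"
proof -
 assume J: "open J"
 have o: "open {z. 0 < Re z}" by (intro open_Collect_less continuous_intros)
 have "continuous_on {z. 0 < Re z} slope" unfolding slope_def by (intro continuous_intros) auto
 then have "open ({z. 0 < Re z} \<inter> slope -` J)" using continuous_open_preimage[OF _ o J] by blast
 moreover have "{z. 0 < Re z} \<inter> slope -` J = {z. 0 < Re z & slope z : J}" by auto
 ultimately show ?thesis by simp
qed

lemma sign_constant:
 fixes g :: "real => real"
 assumes g: "continuous_on {a<..<b} g" and nz: "!!t. t : {a<..<b} ==> g t ~= 0"
 obtains e where "e = 1 \<or> e = -1" "!!t. t : {a<..<b} ==> 0 < e * g t"
proof (cases "\<exists>t\<in>{a<..<b}. 0 < g t")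
 case True
 then obtain s where s: "s : {a<..<b}" "0 < g s" by blast
 have "0 < g t" if t: "t : {a<..<b}" for t
 proof (rule ccontr)
  assume "\<not> 0 < g t"
  then have "{g t..g s} <= g ` {a<..<b}" "0 : {g t..g s}"
   using connected_contains_Icc[OF connected_continuous_image[OF g connected_Ioo], of "g t" "g s"] s t by auto
  then have "0 : g ` {a<..<b}" by blast
  then show False using nz by fastforce
 qed
 then show ?thesis using that[of 1] by simp
next
 case False
 then have "0 < -1 * g t" if "t : {a<..<b}" for t using nz[OF that] that by force
 then show ?thesis using that[of "-1"] by blast
qed

text \<open>The curve ends on the side e after crossing at time c, in (m, m+1), from the side -e; c
  = 0 with m = 0 encodes that it does not cross. The weak inequality after c admits a curve that
  touches the axis without changing sides.\<close>

definition kind :: "(real => complex) => real => nat => real => bool" where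
 "kind ga e m c \<longleftrightarrow> 0 <= c & c < 1 & (\<forall>t\<in>{0<..<c}. e * Im (ga t) < 0) & Im (ga c) = 0 &
   (\<forall>t\<in>{c<..<1}. 0 <= e * Im (ga t)) &
   (if c = 0 then m = 0 else real m < Re (ga c)) & Re (ga c) < real m + 1"

text \<open>Only the right half-plane matters, and there W is the cone over an open set S of slopes
  without the integers. S may be disconnected, since angles are taken modulo 2 pi. I is the
  component of slope 0 and V the cone over it; curves that cross the axis stay in V, the others only
  in D.\<close>

locale sector =
 fixes W :: "complex set" and S :: "real set"
 assumes open_S: "open S" and zero_S: "0 : S"
  and W: "0 < Re z ==> z : W \<longleftrightarrow> z ~: \<nat> & slope z : S"
begin

definition D :: "complex set" where "D = {z. 0 < Re z & slope z : S}"
definition I :: "real set" where "I = connected_component_set S 0"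
definition V :: "complex set" where "V = {z. 0 < Re z & slope z : I}"

lemma zero_I: "0 : I" and I_subset: "I <= S" and open_I: "open I" and convex_I: "convex I"
 using zero_S connected_component_subset open_connected_component[OF open_S] is_interval_connected_1 is_interval_convex_1
 by (auto simp: I_def)

lemma V_subset: "V <= D" using I_subset by (auto simp: V_def D_def)

lemma open_D: "open D" and open_V: "open V"
 unfolding D_def V_def by (intro open_slope_cone open_S open_I)+

lemma of_real_in_V: "0 < x ==> of_real x : V" using zero_I by (simp add: V_def slope_def)

lemma cone_D: "[|z : D; 0 < t|] ==> of_real t * z : D" and cone_V: "[|z : V; 0 < t|] ==> of_real t * z : V"
 by (simp_all add: D_def V_def slope_of_real_mult)

lemma convex_V: "convex V"
 by (rule convexI) (use slope_combination[OF convex_I] in \<open>auto simp: V_def\<close>)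

lemma wedge_V: "e = 1 \<or> e = -1 ==> wedge V e"
 using open_V convex_V cone_V of_real_in_V[of 1] by unfold_locales (auto simp: V_def)

lemma W_iff: "0 < Re z ==> z : W \<longleftrightarrow> z : D & z ~: \<nat>"
 using W by (auto simp: D_def)

lemma component_subset_I: "[|connected T; T <= S; T \<inter> I ~= {}|] ==> T <= I"
 using connected_component_maximal[of _ T S] connected_component_eq[of _ S 0] unfolding I_def by blast

abbreviation "curve \<equiv> R1_curve W"

lemma curveD:
 assumes "curve ga"
 shows "continuous_on {0..1} ga" "ga 0 = 0" "!!t. [|0 < t; t <= 1|] ==> ga t : W"
  and "!!s t. [|0 <= s; s < t; t <= 1|] ==> Re (ga s) < Re (ga t)"
  and "!!s t. [|0 < s; s < 1; Im (ga s) = 0; 0 < t; t < 1; Im (ga t) = 0|] ==> s = t"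
  and "!!t. [|0 < t; t <= 1|] ==> 0 < Re (ga t)"
  and "!!t. [|0 < t; t <= 1|] ==> ga t : D"
  and "!!t. [|0 < t; t <= 1|] ==> ga t ~: \<nat>"
proof -
 show 1: "continuous_on {0..1} ga" "ga 0 = 0" "!!t. [|0 < t; t <= 1|] ==> ga t : W"
  using assms unfolding R1_curve_def path_def by auto
 show 2: "Re (ga s) < Re (ga t)" if "0 <= s" "s < t" "t <= 1" for s t
  using assms that unfolding R1_curve_def by (intro strict_mono_onD[of "{0..1}" "%t. Re (ga t)"]) auto
 show "s = t" if "0 < s" "s < 1" "Im (ga s) = 0" "0 < t" "t < 1" "Im (ga t) = 0" for s t
  using assms that unfolding R1_curve_def by (meson greaterThanLessThan_iff)
 show 3: "0 < Re (ga t)" if "0 < t" "t <= 1" for t using 2[of 0 t] 1 that by simp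
 show "ga t : D" "ga t ~: \<nat>" if "0 < t" "t <= 1" for t using W_iff[OF 3[OF that]] 1(3)[OF that] by auto
qed

lemma curveI:
 assumes "continuous_on {0..1} ga" "ga 0 = 0"
  and "!!s t. [|0 <= s; s < t; t <= 1|] ==> Re (ga s) < Re (ga t)"
  and D: "!!t. [|0 < t; t <= 1|] ==> slope (ga t) : S" "!!t. [|0 < t; t <= 1; Im (ga t) = 0|] ==> ga t ~: \<nat>"
  and "!!t. [|0 < t; t < 1; Im (ga t) = 0|] ==> t = c"
 shows "curve ga"
proof -
 have "ga t : W" if "0 < t" "t <= 1" for t
 proof -
  have "0 < Re (ga t)" using assms(3)[of 0 t] assms(2) that by simp
  then show ?thesis using D[OF that] Nats_Im_0[of "ga t"] by (auto simp: W_iff D_def)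
 qed
 moreover have "strict_mono_on {0..1} (%t. Re (ga t))" by (rule strict_mono_onI) (use assms(3) in auto)
 moreover have "t1 = t2" if "t1 : {0<..<1}" "t2 : {0<..<1}" "Im (ga t1) = 0 & Im (ga t2) = 0" for t1 t2
  using assms(6)[of t1] assms(6)[of t2] that by simp
 ultimately show ?thesis unfolding R1_curve_def path_def using assms(1,2) by simp
qed

lemma curve_nonzero_between:
 assumes "curve ga" "0 <= a" "a < b" "b <= 1"
 obtains t where "a < t" "t < b" "Im (ga t) ~= 0"
proof -
 define s where "s = (2 * a + b) / 3"
 define t where "t = (a + 2 * b) / 3"
 have st: "a < s" "s < t" "t < b" using assms by (auto simp: s_def t_def)
 then have "\<not> (Im (ga s) = 0 & Im (ga t) = 0)" using curveD(5)[OF assms(1), of s t] assms by auto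
 then show ?thesis using that[of s] that[of t] st by auto
qed

text \<open>On either side of the at most one zero the imaginary part has constant sign; equal signs
  mean a touch, opposite signs a crossing.\<close>

lemma kind_exists:
 assumes ga: "curve ga"
 obtains e m c where "e = 1 \<or> e = -1" "kind ga e m c"
proof -
 have cont: "continuous_on {a<..<b} (%t. Im (ga t))" if "0 <= a" "b <= 1" for a b
  by (intro continuous_intros continuous_on_subset[OF curveD(1)[OF ga]]) (use that in auto)
 show ?thesis
 proof (cases "\<exists>c\<in>{0<..<1}. Im (ga c) = 0")
  case False
  then have nz: "!!t. t : {0<..<1} ==> Im (ga t) ~= 0" by blast
  obtain e where e: "e = 1 \<or> e = -1" "!!t. t : {0<..<1} ==> 0 < e * Im (ga t)"
   using sign_constant[OF cont[OF order_refl order_refl] nz] by blast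
  have "kind ga e 0 0" using e(2) curveD(2)[OF ga] by (auto simp: kind_def intro: less_imp_le)
  then show ?thesis using that e(1) by blast
 next
  case True
  then obtain c where c: "0 < c" "c < 1" "Im (ga c) = 0" by auto
  have nz: "Im (ga t) ~= 0" if "t : {0<..<c} \<union> {c<..<1}" for t using curveD(5)[OF ga, of t c] c that by auto
  obtain a where a: "a = 1 \<or> a = -1" "!!t. t : {0<..<c} ==> 0 < a * Im (ga t)"
   using sign_constant[OF cont[OF order_refl less_imp_le[OF c(2)]] nz[OF UnI1]] by blast
  obtain b where b: "b = 1 \<or> b = -1" "!!t. t : {c<..<1} ==> 0 < b * Im (ga t)"
   using sign_constant[OF cont[OF less_imp_le[OF c(1)] order_refl] nz[OF UnI2]] by blast
  show ?thesis
  proof (cases "a = b")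
   case True
   have "0 <= b * Im (ga t)" if "t : {0<..<1}" for t
    using a(2)[of t] b(2)[of t] c True that by (cases t c rule: linorder_cases) (auto intro: less_imp_le)
   then have "kind ga b 0 0" using curveD(2)[OF ga] by (auto simp: kind_def)
   then show ?thesis using that b(1) by blast
  next
   case False
   then have ab: "a = - b" using a(1) b(1) by auto
   have real: "ga c = of_real (Re (ga c))" using c by (simp add: complex_eq_iff)
   have "Re (ga c) ~: \<nat>" using curveD(8)[OF ga, of c] c real of_real_in_Nats_iff[of "Re (ga c)"] by simp
   then obtain m where m: "real m < Re (ga c)" "Re (ga c) < real m + 1"
    using between_Nats[of "Re (ga c)"] curveD(6)[OF ga, of c] c by auto
   have "kind ga b m c" unfolding kind_def using c m a(2) b(2) ab by (auto intro: less_imp_le)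
   then show ?thesis using that b(1) by blast
  qed
 qed
qed

lemma kind_after:
 assumes "curve ga" "kind ga e m c"
 shows "0 <= e * Im (ga 1)" "real m < Re (ga 1)" "ga 1 ~: \<nat>" "ga 1 : D" "0 < Re (ga 1)"
proof -
 have c: "0 <= c" "c < 1" using assms(2) by (auto simp: kind_def)
 show "ga 1 ~: \<nat>" "ga 1 : D" "0 < Re (ga 1)" using curveD[OF assms(1)] by auto
 show "real m < Re (ga 1)"
  using assms(2) curveD(4)[OF assms(1) c(1,2)] \<open>0 < Re (ga 1)\<close> by (auto simp: kind_def split: if_splits)
 have "((%t. e * Im (ga t)) \<longlongrightarrow> e * Im (ga 1)) (at 1 within {0..1})"
  using curveD(1)[OF assms(1)] unfolding continuous_on_def by (intro tendsto_intros) auto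
 then have "((%t. e * Im (ga t)) \<longlongrightarrow> e * Im (ga 1)) (at_left 1)"
  by (simp add: at_within_Icc_at_left)
 moreover have "\<forall>\<^sub>F t in at_left 1. 0 <= e * Im (ga t)"
  unfolding eventually_at_left_field by (rule exI[of _ c]) (use assms(2) c in \<open>auto simp: kind_def\<close>)
 ultimately show "0 <= e * Im (ga 1)" by (rule tendsto_lowerbound) simp
qed

text \<open>The slopes along the curve form a connected subset of S, and the slope at the crossing
  is 0.\<close>

lemma kind_crossing_V:
 assumes ga: "curve ga" and k: "kind ga e m c" "0 < c" and t: "0 < t" "t <= 1"
 shows "ga t : V"
proof -
 define T where "T = (%t. slope (ga t)) ` {0<..1}"
 have "continuous_on {0<..1} (%t. slope (ga t))" unfolding slope_def
  by (intro continuous_intros continuous_on_subset[OF curveD(1)[OF ga]]) (use curveD(6)[OF ga] in force)+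
 then have "connected T" unfolding T_def by (rule connected_continuous_image) simp
 moreover have "T <= S" using curveD(7)[OF ga] by (auto simp: T_def D_def)
 moreover have "slope (ga c) = 0" "c <= 1" using k by (auto simp: kind_def slope_def)
 then have "0 : T" using k(2) unfolding T_def by (metis greaterThanAtMost_iff imageI)
 ultimately have "T <= I" using component_subset_I[of T] zero_I by blast
 then show ?thesis using t curveD(6)[OF ga] by (auto simp: V_def T_def)
qed

lemma kind_unique:
 assumes ga: "curve ga" and k: "kind ga e m c" "kind ga e' m' c'" and e: "e = 1 \<or> e = -1" "e' = 1 \<or> e' = -1"
 shows "e = e' & m = m' & c = c'"
proof -
 have c: "0 <= c" "c < 1" "0 <= c'" "c' < 1" using k by (auto simp: kind_def)
 have mx: "0 <= max c c'" "max c c' < 1" using c by simp_all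
 obtain t where t: "max c c' < t" "t < 1" "Im (ga t) ~= 0"
  using curve_nonzero_between[OF ga mx order_refl] .
 have "0 <= e * Im (ga t)" "0 <= e' * Im (ga t)" using k t c by (auto simp: kind_def)
 then have ee: "e = e'" using t e by auto
 have "c = c'"
 proof (rule ccontr)
  assume "c ~= c'"
  then have "min c c' < max c c'" by auto
  moreover have "0 <= min c c'" "max c c' <= 1" using c by simp_all
  ultimately obtain s where s: "min c c' < s" "s < max c c'" "Im (ga s) ~= 0"
   using curve_nonzero_between[OF ga] by blast
  then have "0 <= e * Im (ga s) & e * Im (ga s) < 0"
   using k c ee by (cases "c < c'") (auto simp: kind_def)
  then show False by linarith
 qed
 moreover have "m = m'"
  using k \<open>c = c'\<close> by (auto simp: kind_def split: if_splits)
 ultimately show ?thesis using ee by simp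
qed

text \<open>A crossing is pinned down by a time strictly before it and one strictly after it, and
  small perturbations keep the signs at both. The exception is a curve that does not cross and ends
  on the axis: a nearby curve may cross shortly before its end, in the interval (N, N+1) that
  contains the end point.\<close>

lemma kind_stable:
 assumes ga: "curve ga" and k: "kind ga e m c" and e: "e = 1 \<or> e = -1"
 obtains de where "de > 0" "!!ga'. [|curve ga'; !!t. t : {0..1} ==> dist (ga' t) (ga t) < de|] ==>
  (\<exists>c'. kind ga' e m c') \<or>
  (m = 0 & Im (ga 1) = 0 & (\<exists>N c'. real N < Re (ga 1) & Re (ga 1) < real N + 1 & kind ga' (-e) N c'))"
proof -
 have c: "0 <= c" "c < 1" using k by (auto simp: kind_def)
 note pos = kind_after[OF ga k]
 have contRe: "continuous_on {0..1} (%t. Re (ga t))" and contIm: "continuous_on {0..1} (%t. e * Im (ga t))"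
  by (intro continuous_intros curveD(1)[OF ga])+
 \<comment> \<open>A time soon after c at which the curve is strictly on the side e while its real
   part is still below m + 1.\<close>
 obtain t1 where t1: "c < t1" "t1 < 1" "Im (ga t1) ~= 0" "Re (ga t1) < real m + 1"
 proof -
  have "Re (ga c) < real m + 1" using k by (simp add: kind_def)
  then obtain d where d: "d > 0" "!!t. [|t : {0..1}; dist t c < d|] ==> dist (Re (ga t)) (Re (ga c)) < real m + 1 - Re (ga c)"
   using contRe c unfolding continuous_on_iff by (metis atLeastAtMost_iff diff_gt_0_iff_gt less_imp_le)
  have mn: "c < min 1 (c + d)" "min 1 (c + d) <= 1" using c d(1) by simp_all
  obtain t where t: "c < t" "t < min 1 (c + d)" "Im (ga t) ~= 0"
   using curve_nonzero_between[OF ga c(1) mn] .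
  have "t : {0..1}" "dist t c < d" using t c by (auto simp: dist_real_def)
  from d(2)[OF this] have "Re (ga t) < real m + 1" by (simp add: dist_real_def)
  then show ?thesis using that[of t] t by simp
 qed
 have t1e: "0 < e * Im (ga t1)"
 proof -
  have "0 <= e * Im (ga t1)" using k t1 by (auto simp: kind_def)
  then show ?thesis using t1(3) e by auto
 qed
 have near: "\<bar>Re (ga' t) - Re (ga t)\<bar> < de & \<bar>e * Im (ga' t) - e * Im (ga t)\<bar> < de"
  if "dist (ga' t) (ga t) < de" for ga' t de
  using that abs_Re_le_cmod[of "ga' t - ga t"] abs_Im_le_cmod[of "ga' t - ga t"] e by (auto simp: dist_norm)
 show ?thesis
 proof (cases "c = 0")
  case False
  then have c0: "0 < c" using c by simp
  then have cm: "real m < Re (ga c)" using k by (simp add: kind_def)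
  obtain d where d: "d > 0" "!!t. [|t : {0..1}; dist t c < d|] ==> dist (Re (ga t)) (Re (ga c)) < Re (ga c) - real m"
   using contRe c cm unfolding continuous_on_iff by (metis atLeastAtMost_iff diff_gt_0_iff_gt less_imp_le)
  \<comment> \<open>Just before the crossing, close enough to c for the real part to exceed
    m.\<close>
  define t0 where "t0 = max (c / 2) (c - d / 2)"
  have t0: "0 < t0" "t0 < c" "real m < Re (ga t0)"
  proof -
   show "0 < t0" "t0 < c" using c0 d(1) by (auto simp: t0_def)
   moreover have "dist t0 c < d" using d(1) c0 by (auto simp: t0_def dist_real_def)
   ultimately show "real m < Re (ga t0)" using d(2)[of t0] c by (auto simp: dist_real_def)
  qed
  have t0e: "e * Im (ga t0) < 0" using k t0 by (auto simp: kind_def)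
  \<comment> \<open>Preserves the signs at t0 and t1 and the bounds m and m + 1 there, so the
    crossing of a nearby curve is caught between t0 and t1.\<close>
  define de where "de = min (min (e * Im (ga t1)) (- (e * Im (ga t0)))) (min (Re (ga t0) - real m) (real m + 1 - Re (ga t1)))"
  have de: "de > 0" using t1e t0e t0 t1 by (auto simp: de_def)
  show ?thesis
  proof (rule that[OF de])
   fix ga' assume ga': "curve ga'" and cl: "!!t. t : {0..1} ==> dist (ga' t) (ga t) < de"
   have nr: "\<bar>Re (ga' t) - Re (ga t)\<bar> < de & \<bar>e * Im (ga' t) - e * Im (ga t)\<bar> < de" if "t : {0..1}" for t
    by (rule near) (rule cl[OF that])
   have n0: "e * Im (ga' t0) < 0" "real m < Re (ga' t0)" using nr[of t0] t0 c by (auto simp: de_def)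
   have n1: "0 < e * Im (ga' t1)" "Re (ga' t1) < real m + 1" using nr[of t1] t1 c by (auto simp: de_def)
   obtain e' m' c' where k': "e' = 1 \<or> e' = -1" "kind ga' e' m' c'" using kind_exists[OF ga'] .
   have c': "0 <= c'" "c' < 1" and Im0: "Im (ga' c') = 0"
    and after: "!!t. [|c' < t; t < 1|] ==> 0 <= e' * Im (ga' t)" and before: "!!t. [|0 < t; t < c'|] ==> e' * Im (ga' t) < 0"
    using k'(2) by (auto simp: kind_def)
   have "e' = e"
   proof (rule ccontr)
    assume "e' ~= e"
    then have e': "e' = - e" using e k'(1) by auto
    have "t1 < c'" using after[of t1] n1(1) Im0 t1 e' by (cases t1 c' rule: linorder_cases) auto
    then show False using before[of t0] n0(1) t0 t1 e' by auto
   qed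
   moreover have t0c': "t0 < c'" using after[of t0] n0(1) Im0 t0 c \<open>e' = e\<close> by (cases t0 c' rule: linorder_cases) auto
   moreover have c't1: "c' < t1" using before[of t1] n1(1) Im0 t0 t1 c \<open>e' = e\<close> by (cases t1 c' rule: linorder_cases) auto
   moreover have "m' = m"
   proof -
    have "Re (ga' t0) < Re (ga' c')" "Re (ga' c') < Re (ga' t1)"
     using curveD(4)[OF ga'] t0c' c't1 t0 t1 c by auto
    then have "real m < Re (ga' c')" "Re (ga' c') < real m + 1" using n0 n1 by auto
    moreover have "real m' < Re (ga' c')" "Re (ga' c') < real m' + 1" using k'(2) t0c' t0 by (auto simp: kind_def split: if_splits)
    ultimately show ?thesis by linarith
   qed
   ultimately show "(\<exists>c'. kind ga' e m c') \<or>
    (m = 0 & Im (ga 1) = 0 & (\<exists>N c'. real N < Re (ga 1) & Re (ga 1) < real N + 1 & kind ga' (-e) N c'))"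
    using k'(2) by blast
  qed
 next
  case True
  then have m: "m = 0" using k by (simp add: kind_def)
  \<comment> \<open>Meaningful for a real end point; 0 is a default value otherwise.\<close>
  define N where "N = (if Im (ga 1) = 0 then nat \<lfloor>Re (ga 1)\<rfloor> else 0)"
  have N: "real N < Re (ga 1) & Re (ga 1) < real N + 1" if im: "Im (ga 1) = 0"
  proof -
   have "Re (ga 1) ~: \<nat>"
    using pos(3) of_real_in_Nats_iff[of "Re (ga 1)"] im by (simp add: complex_eq_iff complex_is_Real_iff of_real_Re)
   then obtain k where k: "real k < Re (ga 1)" "Re (ga 1) < real k + 1" using between_Nats[OF pos(5)] by blast
   then have "\<lfloor>Re (ga 1)\<rfloor> = int k" by linarith
   then show ?thesis using k im by (simp add: N_def)
  qed
  obtain d where d: "d > 0" "!!t. [|t : {0..1}; dist t 1 < d|] ==>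
    (if Im (ga 1) = 0 then real N < Re (ga t) else e * Im (ga 1) / 2 < e * Im (ga t))"
  proof (cases "Im (ga 1) = 0")
   case True
   then have p: "0 < Re (ga 1) - real N" using N by simp
   obtain d where d1: "d > 0" and d2: "!!t. [|t : {0..1}; dist t 1 < d|] ==> dist (Re (ga t)) (Re (ga 1)) < Re (ga 1) - real N"
    using contRe p unfolding continuous_on_iff by (metis atLeastAtMost_iff order_refl zero_le_one)
   have "real N < Re (ga t)" if "t : {0..1}" "dist t 1 < d" for t
    using d2[OF that] unfolding dist_real_def by linarith
   then show ?thesis using that[OF d1] True by simp
  next
   case False
   then have p: "0 < e * Im (ga 1) / 2" using pos(1) e by auto
   obtain d where d1: "d > 0" and d2: "!!t. [|t : {0..1}; dist t 1 < d|] ==> dist (e * Im (ga t)) (e * Im (ga 1)) < e * Im (ga 1) / 2"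
    using contIm p unfolding continuous_on_iff by (metis atLeastAtMost_iff order_refl zero_le_one)
   have "e * Im (ga 1) / 2 < e * Im (ga t)" if "t : {0..1}" "dist t 1 < d" for t
    using d2[OF that] unfolding dist_real_def by linarith
   then show ?thesis using that[OF d1] False by simp
  qed
  have mx: "0 <= max t1 (1 - d)" "max t1 (1 - d) < 1" using t1 c d(1) by simp_all
  \<comment> \<open>A time close to the end with the sign of e. A nearby curve that ends up on the
    other side has to cross after it, that is, near the end point.\<close>
  obtain t2 where t2: "max t1 (1 - d) < t2" "t2 < 1" "Im (ga t2) ~= 0"
   using curve_nonzero_between[OF ga mx order_refl] .
  have t2e: "0 < e * Im (ga t2)"
  proof -
   have "0 <= e * Im (ga t2)" using k t1 t2 by (auto simp: kind_def)
   then show ?thesis using t2(3) e by auto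
  qed
  define et where "et = (if Im (ga 1) = 0 then min (Re (ga t2) - real N) (real N + 1 - Re (ga 1)) else e * Im (ga 1) / 2)"
  have d2: "dist t2 1 < d" using t2 d(1) by (auto simp: dist_real_def)
  have et: "et > 0" using N d(2)[of t2] d2 t1 t2 c pos(1) e by (auto simp: et_def)
  define de where "de = min (min (e * Im (ga t1)) (e * Im (ga t2))) (min et (1 - Re (ga t1)))"
  have de: "de > 0" using t1e t2e et t1(4) m by (auto simp: de_def)
  show ?thesis
  proof (rule that[OF de])
   fix ga' assume ga': "curve ga'" and cl: "!!t. t : {0..1} ==> dist (ga' t) (ga t) < de"
   have nr: "\<bar>Re (ga' t) - Re (ga t)\<bar> < de & \<bar>e * Im (ga' t) - e * Im (ga t)\<bar> < de" if "t : {0..1}" for t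
    by (rule near) (rule cl[OF that])
   have n1: "0 < e * Im (ga' t1)" "Re (ga' t1) < 1" using nr[of t1] t1 c m by (auto simp: de_def)
   have n2: "0 < e * Im (ga' t2)" using nr[of t2] t2 t1 c by (auto simp: de_def)
   obtain e' m' c' where k': "e' = 1 \<or> e' = -1" "kind ga' e' m' c'" using kind_exists[OF ga'] .
   have c': "0 <= c'" "c' < 1" and Im0: "Im (ga' c') = 0"
    and after: "!!t. [|c' < t; t < 1|] ==> 0 <= e' * Im (ga' t)" and before: "!!t. [|0 < t; t < c'|] ==> e' * Im (ga' t) < 0"
    and m': "if c' = 0 then m' = 0 else real m' < Re (ga' c')" "Re (ga' c') < real m' + 1"
    using k'(2) by (auto simp: kind_def)
   show "(\<exists>c'. kind ga' e m c') \<or>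
    (m = 0 & Im (ga 1) = 0 & (\<exists>N c'. real N < Re (ga 1) & Re (ga 1) < real N + 1 & kind ga' (-e) N c'))"
   proof (cases "e' = e")
    case True
    have "c' < t1" using before[of t1] n1(1) Im0 t1 c True by (cases t1 c' rule: linorder_cases) auto
    then have "Re (ga' c') < 1" using curveD(4)[OF ga', of c' t1] n1 t1 c' by auto
    then have "m' = m" using m m' by (auto split: if_splits)
    then show ?thesis using k'(2) True by blast
   next
    case False
    then have e': "e' = - e" using e k'(1) by auto
    have t2c': "t2 < c'" using after[of t2] n2 Im0 t2 e' by (cases t2 c' rule: linorder_cases) auto
    have c'd: "dist c' 1 < d" "c' : {0..1}" using t2c' t2 c' by (auto simp: dist_real_def)
    have im: "Im (ga 1) = 0"
    proof (rule ccontr)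
     assume nz: "Im (ga 1) ~= 0"
     then have "e * Im (ga 1) / 2 < e * Im (ga c')" using d(2)[OF c'd(2,1)] by simp
     moreover have "\<bar>e * Im (ga' c') - e * Im (ga c')\<bar> < e * Im (ga 1) / 2"
      using nr[OF c'd(2)] nz by (auto simp: de_def et_def)
     ultimately show False using Im0 by simp
    qed
    have "\<bar>Re (ga' t2) - Re (ga t2)\<bar> < Re (ga t2) - real N" "\<bar>Re (ga' 1) - Re (ga 1)\<bar> < real N + 1 - Re (ga 1)"
     using nr[of t2] nr[of 1] t2 t1 c im by (auto simp: de_def et_def)
    then have "real N < Re (ga' t2)" "Re (ga' 1) < real N + 1" by linarith+
    moreover have "Re (ga' t2) < Re (ga' c')" "Re (ga' c') < Re (ga' 1)"
     using curveD(4)[OF ga'] t2c' c' t2 t1 c by auto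
    moreover have "0 < c'" using t2c' t2 t1 c by auto
    ultimately have "real m' < real N + 1" "real N < real m' + 1" using m' by auto
    then have "m' = N" by linarith
    then show ?thesis using k'(2) e' m im N by blast
   qed
  qed
 qed
qed

end

section \<open>Homotopy classes of curves and explicit representatives\<close>

context sector
begin

lemma R1_class_eqI:
 assumes h: "homotopic_with_canon (%sg. curve sg & sg 1 = ga 1) {0..1} UNIV ga ga'"
 shows "R1_class W ga = R1_class W ga'"
proof -
 have e: "ga' 1 = ga 1" using homotopic_with_imp_property[OF h] by simp
 show ?thesis unfolding R1_class_def e
  using homotopic_with_trans[OF h] homotopic_with_trans[OF homotopic_with_symD[OF h]] by blast
qed

lemma R1_class_linear:
 assumes ga: "curve ga" "curve ga'" "ga' 1 = ga 1"
  and comb: "!!s. [|0 < s; s < 1|] ==> curve (%t. (1 - s) *\<^sub>R ga t + s *\<^sub>R ga' t)"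
 shows "R1_class W ga = R1_class W ga'"
proof (rule R1_class_eqI)
 define h where "h y = (1 - fst y) *\<^sub>R ga (snd y) + fst y *\<^sub>R ga' (snd y)" for y :: "real \<times> real"
 have c: "continuous_on ({0..1} \<times> {0..1}) (%y::real\<times>real. g (snd y))" if "curve g" for g
  by (rule continuous_on_compose2[OF curveD(1)[OF that]]) (auto intro!: continuous_intros)
 have "continuous_on ({0..1} \<times> {0..1}) h"
  unfolding h_def by (intro continuous_intros c ga)
 moreover have "curve (%t. h (s, t)) & h (s, 1) = ga 1" if s: "s : {0..1}" for s
 proof -
  have "h (s, 1) = ga 1" using ga(3) by (simp add: h_def scaleR_conv_of_real algebra_simps)
  moreover consider "s = 0" | "s = 1" | "0 < s" "s < 1" using s by fastforce
  then have "curve (%t. h (s, t))" using ga comb[of s] by cases (simp_all add: h_def)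
  ultimately show ?thesis by simp
 qed
 ultimately show "homotopic_with_canon (%sg. curve sg & sg 1 = ga 1) {0..1} UNIV ga ga'"
  unfolding homotopic_with_def by (intro exI[of _ h]) (simp add: h_def)
qed

lemma curve_combination:
 assumes ga: "curve ga" "curve ga'" and J: "convex J" "J <= S"
  and sl: "!!t. [|0 < t; t <= 1|] ==> slope (ga t) : J" "!!t. [|0 < t; t <= 1|] ==> slope (ga' t) : J"
  and s: "0 < s" "s < 1"
  and nN: "!!t. [|0 < t; t <= 1; Im ((1 - s) *\<^sub>R ga t + s *\<^sub>R ga' t) = 0|] ==> (1 - s) *\<^sub>R ga t + s *\<^sub>R ga' t ~: \<nat>"
  and one: "!!t. [|0 < t; t < 1; Im ((1 - s) *\<^sub>R ga t + s *\<^sub>R ga' t) = 0|] ==> t = c"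
 shows "curve (%t. (1 - s) *\<^sub>R ga t + s *\<^sub>R ga' t)"
proof (rule curveI[OF _ _ _ _ nN one])
 show "continuous_on {0..1} (%t. (1 - s) *\<^sub>R ga t + s *\<^sub>R ga' t)"
  by (intro continuous_intros curveD(1) ga)
 show "(1 - s) *\<^sub>R ga 0 + s *\<^sub>R ga' 0 = 0" using curveD(2)[OF ga(1)] curveD(2)[OF ga(2)] by simp
 show "Re ((1 - s) *\<^sub>R ga a + s *\<^sub>R ga' a) < Re ((1 - s) *\<^sub>R ga b + s *\<^sub>R ga' b)" if "0 <= a" "a < b" "b <= 1" for a b
  using curveD(4)[OF ga(1) that] curveD(4)[OF ga(2) that] s by (simp add: add_strict_mono)
 show "slope ((1 - s) *\<^sub>R ga t + s *\<^sub>R ga' t) : S" if "0 < t" "t <= 1" for t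
  using slope_combination[OF J(1) curveD(6)[OF ga(1) that] sl(1)[OF that] curveD(6)[OF ga(2) that] sl(2)[OF that], of "1 - s" s] s J(2) by auto
qed auto

lemma explicit_curve:
 assumes x: "0 < x" and w: "continuous_on {0..1} w" and S: "!!t. [|0 < t; t <= 1|] ==> w t / x : S"
  and nN: "!!t. [|0 < t; t <= 1; w t = 0|] ==> t * x ~: \<nat>" and one: "!!t. [|0 < t; t < 1; w t = 0|] ==> t = c"
 shows "curve (%t. Complex (t * x) (t * w t))"
proof (rule curveI)
 show "continuous_on {0..1} (%t. Complex (t * x) (t * w t))" unfolding Complex_eq by (intro continuous_intros w)
 show "Complex (t * x) (t * w t) ~: \<nat>" if "0 < t" "t <= 1" "Im (Complex (t * x) (t * w t)) = 0" for t
 proof -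
  have "w t = 0" using that by simp
  moreover then have "Complex (t * x) (t * w t) = of_real (t * x)" by (simp add: complex_eq_iff)
  ultimately show ?thesis using nN[OF that(1,2)] of_real_in_Nats_iff[of "t * x"] by metis
 qed
 show "Re (Complex (a * x) (a * w a)) < Re (Complex (b * x) (b * w b))" if "a < b" for a b
  using that x by simp
 show "Complex (0 * x) (0 * w 0) = 0" by (simp add: complex_eq_iff)
 show "slope (Complex (t * x) (t * w t)) : S" if "0 < t" "t <= 1" for t
 proof -
  have "slope (Complex (t * x) (t * w t)) = w t / x" using that by (simp add: slope_def)
  then show ?thesis using S[OF that] by simp
 qed
 show "t = c" if "0 < t" "t < 1" "Im (Complex (t * x) (t * w t)) = 0" for t
  using one[OF that(1,2)] that by simp
qed

text \<open>The ray to z, bent by e * ka * t * (1 - t) so that interior points lie strictly on the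
  side e even when z is real.\<close>

definition strict_curve :: "real => real => complex => real => complex" where
 "strict_curve e ka z = (%t. Complex (t * Re z) (t * (Im z + e * ka * (1 - t))))"

lemma strict_curve:
 assumes e: "e = 1 \<or> e = -1" and z: "0 < Re z" "z ~: \<nat>" "0 <= e * Im z" and ka: "0 <= ka" "0 < e * Im z \<or> 0 < ka"
  and S: "!!de. [|0 <= de; de <= ka|] ==> (Im z + e * de) / Re z : S"
 shows "curve (strict_curve e ka z)" "strict_curve e ka z 1 = z"
  and "!!t. [|0 < t; t < 1|] ==> 0 < e * Im (strict_curve e ka z t)" "kind (strict_curve e ka z) e 0 0"
proof -
 have pos: "0 < e * (Im z + e * ka * (1 - t))" if "0 < t" "t < 1" for t
 proof -
  have "0 <= ka * (1 - t)" "0 < ka ==> 0 < ka * (1 - t)" using that ka(1) by auto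
  moreover have "e * (Im z + e * ka * (1 - t)) = e * Im z + ka * (1 - t)" using e by (auto simp: algebra_simps)
  ultimately show ?thesis using z(3) ka(2) by linarith
 qed
 show 3: "0 < e * Im (strict_curve e ka z t)" if "0 < t" "t < 1" for t
 proof -
  have "e * Im (strict_curve e ka z t) = t * (e * (Im z + e * ka * (1 - t)))" by (simp add: strict_curve_def)
  moreover have "0 < t * (e * (Im z + e * ka * (1 - t)))" by (rule mult_pos_pos[OF that(1) pos[OF that]])
  ultimately show ?thesis by (simp only:)
 qed
 show 2: "strict_curve e ka z 1 = z" by (simp add: strict_curve_def)
 show "kind (strict_curve e ka z) e 0 0"
  using 3 by (auto simp: kind_def strict_curve_def[of e ka z] intro: less_imp_le)
 show "curve (strict_curve e ka z)" unfolding strict_curve_def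
 proof (rule explicit_curve[OF z(1)])
  show "continuous_on {0..1} (%t. Im z + e * ka * (1 - t))" by (intro continuous_intros)
  fix t :: real assume t: "0 < t" "t <= 1"
  have "(Im z + e * (ka * (1 - t))) / Re z : S"
   by (rule S) (use t ka(1) mult_left_le[of "1 - t" ka] in auto)
  then show "(Im z + e * ka * (1 - t)) / Re z : S" by (simp add: mult.assoc)
  assume w: "Im z + e * ka * (1 - t) = 0"
  have "t = 1" using pos[OF t(1)] w t(2) by (cases "t < 1") auto
  then have "z = of_real (t * Re z)" using w by (simp add: complex_eq_iff)
  then show "t * Re z ~: \<nat>" using z(2) of_real_in_Nats_iff[of "t * Re z"] by metis
 next
  fix t :: real assume t: "0 < t" "t < 1" and w: "Im z + e * ka * (1 - t) = 0"
  then show "t = 0" using pos[OF t] by simp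
 qed
qed

lemma half_strict_curve:
 assumes e: "e = 1 \<or> e = -1" and z: "z : D" "0 < e * Im z"
 shows "curve (strict_curve e 0 z)" "strict_curve e 0 z 1 = z"
  "!!t. [|0 < t; t < 1|] ==> 0 < e * Im (strict_curve e 0 z t)" "kind (strict_curve e 0 z) e 0 0"
proof -
 have z': "0 < Re z" "z ~: \<nat>" "0 <= e * Im z" "0 < e * Im z \<or> 0 < (0::real)" using z Nats_Im_0[of z] by (auto simp: D_def)
 have "(Im z + e * de) / Re z : S" if "0 <= de" "de <= 0" for de using z that by (auto simp: D_def slope_def)
 note strict_curve[OF e z'(1-3) order_refl z'(4) this]
 then show "curve (strict_curve e 0 z)" "strict_curve e 0 z 1 = z"
  "!!t. [|0 < t; t < 1|] ==> 0 < e * Im (strict_curve e 0 z t)" "kind (strict_curve e 0 z) e 0 0" by auto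
qed

text \<open>Compactness of the segment from Re z0 to z0, which lies in V. Scaling the height by l
  and shifting it by de stays in V for all z near z0 at once; this is the room in which the explicit
  curves are drawn.\<close>

lemma tube:
 assumes z0: "z0 : V"
 obtains ka where "ka > 0" "!!z l de. [|dist z z0 <= ka; 0 <= l; l <= 1; \<bar>de\<bar> <= ka|] ==> 0 < Re z & (l * Im z + de) / Re z : I"
proof -
 have R: "of_real (Re z0) : V" using of_real_in_V z0 by (simp add: V_def)
 have "closed_segment (of_real (Re z0)) z0 <= V" using closed_segment_subset[OF R z0 convex_V] .
 then obtain et where et: "et > 0" "(\<Union>x\<in>closed_segment (of_real (Re z0)) z0. ball x et) <= V"
  using compact_subset_open_imp_ball_epsilon_subset[OF compact_segment open_V] by blast
 have "0 < Re z & (l * Im z + de) / Re z : I" if z: "dist z z0 <= et / 4" and l: "0 <= l" "l <= 1" and de: "\<bar>de\<bar> <= et / 4" for z l de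
 proof -
  define w where "w = Complex (Re z0) (l * Im z0)"
  have "w = (1 - l) *\<^sub>R of_real (Re z0) + l *\<^sub>R z0" by (simp add: w_def complex_eq_iff algebra_simps)
  then have w: "w : closed_segment (of_real (Re z0)) z0" using l by (auto simp: closed_segment_def)
  have "norm (w - Complex (Re z) (l * Im z + de)) <= \<bar>Re z0 - Re z\<bar> + \<bar>l * (Im z0 - Im z) - de\<bar>"
   using cmod_le[of "w - Complex (Re z) (l * Im z + de)"] by (simp add: w_def algebra_simps)
  also have "\<dots> <= \<bar>Re z0 - Re z\<bar> + (\<bar>Im z0 - Im z\<bar> + \<bar>de\<bar>)"
  proof -
   have "\<bar>l * (Im z0 - Im z)\<bar> <= \<bar>Im z0 - Im z\<bar>" using l mult_left_le_one_le[of "\<bar>Im z0 - Im z\<bar>" l] by (simp add: abs_mult)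
   then show ?thesis by linarith
  qed
  also have "\<dots> <= et / 4 + (et / 4 + et / 4)"
   using abs_Re_le_cmod[of "z0 - z"] abs_Im_le_cmod[of "z0 - z"] z de by (simp add: dist_norm norm_minus_commute)
  also have "\<dots> < et" using et(1) by simp
  finally have "Complex (Re z) (l * Im z + de) : ball w et" by (simp add: dist_norm)
  then have "Complex (Re z) (l * Im z + de) : V" using et(2) w by blast
  then show ?thesis by (simp add: V_def slope_def)
 qed
 then show ?thesis using that[of "et / 4"] et(1) by simp
qed

lemma V_strict_curve:
 assumes e: "e = 1 \<or> e = -1" and z: "0 < Re z" "z ~: \<nat>" "0 <= e * Im z" and ka: "0 < ka"
  and S: "!!l de. [|0 <= l; l <= 1; \<bar>de\<bar> <= ka|] ==> (l * Im z + de) / Re z : I"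
 shows "curve (strict_curve e ka z)" "strict_curve e ka z 1 = z"
  "!!t. [|0 < t; t < 1|] ==> 0 < e * Im (strict_curve e ka z t)" "kind (strict_curve e ka z) e 0 0"
proof -
 have 1: "(Im z + e * de) / Re z : S" if "0 <= de" "de <= ka" for de
  using S[of 1 "e * de"] that e I_subset by (auto simp: abs_mult)
 have 2: "0 <= ka" "0 < e * Im z \<or> 0 < ka" using ka by auto
 note strict_curve[OF e z 2 1]
 then show "curve (strict_curve e ka z)" "strict_curve e ka z 1 = z"
  "!!t. [|0 < t; t < 1|] ==> 0 < e * Im (strict_curve e ka z t)" "kind (strict_curve e ka z) e 0 0" by auto
qed

lemma strict_curve_exists:
 assumes e: "e = 1 \<or> e = -1" and z: "z : D" "z ~: \<nat>" "0 <= e * Im z" and et: "0 < et"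
 obtains sg where "curve sg" "sg 1 = z" "!!t. [|0 < t; t < 1|] ==> 0 < e * Im (sg t)" "kind sg e 0 0"
  "!!t. [|0 <= t; t <= 1|] ==> norm (sg t) < norm z + et"
proof -
 have Re: "0 < Re z" using z by (simp add: D_def)
 have nrm: "norm (strict_curve e ka z t) < norm z + et" if ka: "0 <= ka" "ka < et" and t: "0 <= t" "t <= 1" for ka t
 proof -
  have eq: "strict_curve e ka z t = of_real t * z + \<i> * of_real (e * (t * (ka * (1 - t))))"
   by (simp add: strict_curve_def complex_eq_iff algebra_simps)
  have "norm (strict_curve e ka z t) <= norm (of_real t * z) + norm (\<i> * of_real (e * (t * (ka * (1 - t)))) :: complex)"
   unfolding eq by (rule norm_triangle_ineq)
  also have "norm (of_real t * z) <= norm z" using t mult_left_le_one_le[of "norm z" t] by (simp add: norm_mult)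
  also have "norm (\<i> * of_real (e * (t * (ka * (1 - t)))) :: complex) <= ka"
  proof -
   have "ka * (1 - t) <= ka" "0 <= ka * (1 - t)" using ka t mult_left_le[of "1 - t" ka] by auto
   moreover then have "t * (ka * (1 - t)) <= ka * (1 - t)" "0 <= t * (ka * (1 - t))" using t mult_left_le_one_le[of "ka * (1 - t)" t] by auto
   moreover have "norm (\<i> * of_real (e * x) :: complex) = \<bar>x\<bar>" for x
    using e by (auto simp: norm_mult)
   then have "norm (\<i> * of_real (e * (t * (ka * (1 - t)))) :: complex) = \<bar>t * (ka * (1 - t))\<bar>" .
   ultimately show ?thesis by linarith
  qed
  finally show ?thesis using ka by simp
 qed
 show ?thesis
 proof (cases "Im z = 0")
  case False
  then have pos: "0 < e * Im z" using z(3) e by auto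
  show ?thesis
   by (rule that[OF half_strict_curve(1-4)[OF e z(1) pos]]) (use nrm[of 0] et in auto)
 next
  case True
  then have "z = of_real (Re z)" by (simp add: complex_eq_iff)
  then have "z : V" using of_real_in_V[OF Re] by simp
  then obtain ka0 where ka0: "ka0 > 0" "!!w l de. [|dist w z <= ka0; 0 <= l; l <= 1; \<bar>de\<bar> <= ka0|] ==> 0 < Re w & (l * Im w + de) / Re w : I"
   using tube by blast
  define ka where "ka = min ka0 (et / 2)"
  have ka: "0 < ka" "ka <= ka0" "ka < et" using ka0(1) et by (auto simp: ka_def)
  have "(l * Im z + de) / Re z : I" if "0 <= l" "l <= 1" "\<bar>de\<bar> <= ka" for l de
   using ka0(2)[of z l de] that ka ka0(1) by simp
  note sc = V_strict_curve[OF e Re z(2,3) ka(1) this]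
  show ?thesis by (rule that[OF sc(1-4)]) (use nrm ka in auto)
 qed
qed

text \<open>The factor t - c changes the side at time c, and the ramp
  \<open>max 0 ((t - c) / (1 - c))\<close> afterwards leads to z. The real part is t * Re z, so the
  crossing takes place at c * Re z.\<close>

definition cross_curve :: "real => real => real => complex => real => complex" where
 "cross_curve e ka c z = (%t. Complex (t * Re z) (t * (Im z * max 0 ((t - c) / (1 - c)) + e * ka * (t - c) * (1 - t))))"

lemma cross_curve:
 assumes e: "e = 1 \<or> e = -1" and z: "0 < Re z" "z ~: \<nat>" "0 <= e * Im z" and ka: "0 < ka"
  and S: "!!l de. [|0 <= l; l <= 1; \<bar>de\<bar> <= ka|] ==> (l * Im z + de) / Re z : I"
  and c: "0 < c" "c < 1" "real m < c * Re z" "c * Re z < real m + 1"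
 shows "curve (cross_curve e ka c z)" "cross_curve e ka c z 1 = z" "kind (cross_curve e ka c z) e m c"
proof -
 define w where "w t = Im z * max 0 ((t - c) / (1 - c)) + e * ka * (t - c) * (1 - t)" for t
 have ew: "e * w t = e * Im z * max 0 ((t - c) / (1 - c)) + ka * (t - c) * (1 - t)" for t
  using e by (auto simp: w_def algebra_simps)
 have neg: "e * w t < 0" if "0 < t" "t < c" for t
 proof -
  have m0: "max 0 ((t - c) / (1 - c)) = 0" using divide_nonpos_pos[of "t - c" "1 - c"] that c by (simp add: max_def)
  have "ka * (t - c) * (1 - t) < 0" using that c ka by (simp add: mult_less_0_iff mult_pos_neg)
  then show ?thesis unfolding ew m0 by simp
 qed
 have pos: "0 < e * w t" if "c < t" "t < 1" for t
 proof -
  have "0 < ka * (t - c) * (1 - t)" using that ka by simp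
  moreover have "0 <= e * Im z * max 0 ((t - c) / (1 - c))" by (rule mult_nonneg_nonneg[OF z(3)]) simp
  ultimately show ?thesis unfolding ew by linarith
 qed
 have wc: "w c = 0" and w1: "w 1 = Im z" using c by (simp_all add: w_def)
 have eq: "cross_curve e ka c z = (%t. Complex (t * Re z) (t * w t))" by (simp add: cross_curve_def w_def)
 show "cross_curve e ka c z 1 = z" unfolding eq by (simp add: w1)
 have zero: "t = c" if "0 < t" "t < 1" "w t = 0" for t
  using neg[of t] pos[of t] that by (cases t c rule: linorder_cases) auto
 show "kind (cross_curve e ka c z) e m c"
  unfolding kind_def eq using c neg pos wc
  by (auto simp: mult.left_commute[of e] intro: mult_pos_neg less_imp_le)
 show "curve (cross_curve e ka c z)" unfolding eq
 proof (rule explicit_curve[OF z(1) _ _ _ zero])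
  show "continuous_on {0..1} w" unfolding w_def using c by (intro continuous_intros) auto
  fix t :: real assume t: "0 < t" "t <= 1"
  have "(max 0 ((t - c) / (1 - c)) * Im z + e * ka * (t - c) * (1 - t)) / Re z : I"
  proof (rule S)
   show "max 0 ((t - c) / (1 - c)) <= 1" using t c by (simp add: divide_le_eq_1)
   have "\<bar>t - c\<bar> * \<bar>1 - t\<bar> <= 1" using t c by (intro mult_le_one) auto
   then have "ka * (\<bar>t - c\<bar> * \<bar>1 - t\<bar>) <= ka" using ka by simp
   then show "\<bar>e * ka * (t - c) * (1 - t)\<bar> <= ka" using e ka by (auto simp: abs_mult mult.assoc)
  qed simp
  then show "w t / Re z : S" using I_subset by (auto simp: w_def mult.commute)
  assume wt: "w t = 0"
  show "t * Re z ~: \<nat>"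
  proof (cases "t = 1")
   case True
   then have "z = of_real (t * Re z)" using wt w1 by (simp add: complex_eq_iff)
   then show ?thesis using z(2) of_real_in_Nats_iff[of "t * Re z"] by metis
  next
   case False
   then have "t = c" using zero t wt by simp
   then show ?thesis using not_Nats_between c by simp
  qed
 qed auto
qed

end

section \<open>Homotopy invariants: side and crossing interval\<close>

context sector
begin

text \<open>Both curves are deformed linearly into one strict curve to z: at interior times a
  combination with it is strictly on the side e, so it can meet the axis only at its end. All slopes
  lie in the component of S containing the slope of z, which is convex.\<close>

lemma R1_class_kind0:
 assumes ga: "curve ga" "curve ga'" "ga' 1 = ga 1" and k: "kind ga e 0 0" "kind ga' e 0 0" and e: "e = 1 \<or> e = -1"
 shows "R1_class W ga = R1_class W ga'"
proof -
 define z where "z = ga 1"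
 note end_z = kind_after[OF ga(1) k(1)]
 obtain sg where sg: "curve sg" "sg 1 = z" "!!t. [|0 < t; t < 1|] ==> 0 < e * Im (sg t)"
 proof -
  have "\<exists>sg. curve sg & sg 1 = z & (\<forall>t. 0 < t & t < 1 --> 0 < e * Im (sg t))"
   unfolding z_def by (rule strict_curve_exists[OF e end_z(4,3,1) zero_less_one]) blast
  then show ?thesis using that by blast
 qed
 define J where "J = connected_component_set S (slope z)"
 have zS: "slope z : S" using end_z(4) by (simp add: D_def z_def)
 have J: "convex J" "J <= S"
  using connected_component_subset is_interval_connected_1 is_interval_convex_1 by (auto simp: J_def)
 have slJ: "slope (g t) : J" if g: "curve g" "g 1 = z" and t: "0 < t" "t <= 1" for g t
 proof -
  have "continuous_on {0<..1} (%t. slope (g t))" unfolding slope_def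
   by (intro continuous_intros continuous_on_subset[OF curveD(1)[OF g(1)]]) (use curveD(6)[OF g(1)] in force)+
  then have "connected ((%t. slope (g t)) ` {0<..1})" by (rule connected_continuous_image) simp
  moreover have "(%t. slope (g t)) ` {0<..1} <= S" using curveD(7)[OF g(1)] by (auto simp: D_def)
  moreover have "slope z : (%t. slope (g t)) ` {0<..1}" using g(2) by (intro image_eqI[of _ _ 1]) auto
  ultimately have "(%t. slope (g t)) ` {0<..1} <= J" unfolding J_def by (intro connected_component_maximal)
  then show ?thesis using t by auto
 qed
 have to_sg: "R1_class W g = R1_class W sg" if g: "curve g" "g 1 = z" "kind g e 0 0" for g
 proof (rule R1_class_linear[OF g(1) sg(1)])
  show "sg 1 = g 1" using sg(2) g(2) by simp
  fix s :: real assume s: "0 < s" "s < 1"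
  have pos: "0 < e * Im ((1 - s) *\<^sub>R g t + s *\<^sub>R sg t)" if t: "0 < t" "t < 1" for t
  proof -
   have "0 <= e * Im (g t)" using g(3) t by (auto simp: kind_def)
   then have "0 <= (1 - s) * (e * Im (g t))" by (rule mult_nonneg_nonneg[rotated]) (use s in simp)
   moreover have "0 < s * (e * Im (sg t))" using sg(3)[OF t] s by simp
   moreover have "e * Im ((1 - s) *\<^sub>R g t + s *\<^sub>R sg t) = (1 - s) * (e * Im (g t)) + s * (e * Im (sg t))"
    by (simp add: algebra_simps)
   ultimately show ?thesis by linarith
  qed
  show "curve (%t. (1 - s) *\<^sub>R g t + s *\<^sub>R sg t)"
  proof (rule curve_combination[OF g(1) sg(1) J slJ[OF g(1,2)] slJ[OF sg(1,2)] s])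
   fix t :: real assume t: "0 < t" "t <= 1" and im: "Im ((1 - s) *\<^sub>R g t + s *\<^sub>R sg t) = 0"
   have "t = 1" using pos[OF t(1)] im t(2) by (cases "t < 1") auto
   then have "(1 - s) *\<^sub>R g t + s *\<^sub>R sg t = z" using g(2) sg(2) by (simp add: scaleR_conv_of_real algebra_simps)
   then show "(1 - s) *\<^sub>R g t + s *\<^sub>R sg t ~: \<nat>" using end_z(3) z_def by simp
  next
   fix t :: real assume "0 < t" "t < 1" "Im ((1 - s) *\<^sub>R g t + s *\<^sub>R sg t) = 0"
   then show "t = 0" using pos[of t] by simp
  qed auto
 qed
 show ?thesis using to_sg[OF ga(1) _ k(1)] to_sg[OF ga(2) _ k(2)] ga(3) z_def by simp
qed

lemma curve_reparametrize:
 assumes ga: "curve ga" and ta: "continuous_on {0..1} ta" "ta 0 = 0" "ta 1 = 1"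
  and mono: "!!s t. [|0 <= s; s < t; t <= 1|] ==> ta s < ta t"
 shows "curve (%t. ga (ta t))"
proof -
 have r: "0 < ta t & ta t <= 1" if "0 < t" "t <= 1" for t
  using mono[of 0 t] mono[of t 1] ta that by (cases "t = 1") auto
 have r0: "0 <= ta t & ta t <= 1" if "0 <= t" "t <= 1" for t
  using r[of t] ta(2) that by (cases "t = 0") auto
 have r1: "ta t < 1" if "0 < t" "t < 1" for t using mono[of t 1] ta(3) that by auto
 show ?thesis unfolding R1_curve_def path_def
 proof (intro conjI ballI impI)
  show "continuous_on {0..1} (%t. ga (ta t))"
  proof (rule continuous_on_compose2[OF curveD(1)[OF ga] ta(1)], rule image_subsetI)
   fix t :: real assume "t : {0..1}"
   then show "ta t : {0..1}" using r0[of t] by simp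
  qed
  show "ga (ta 0) = 0" using curveD(2)[OF ga] ta(2) by simp
  show "ga (ta t) : W" if "t : {0<..1}" for t using curveD(3)[OF ga, of "ta t"] r[of t] that by simp
  show "strict_mono_on {0..1} (%t. Re (ga (ta t)))"
  proof (rule strict_mono_onI)
   fix s t :: real assume st: "s : {0..1}" "t : {0..1}" "s < t"
   show "Re (ga (ta s)) < Re (ga (ta t))"
    by (rule curveD(4)[OF ga]) (use st r0[of s] r0[of t] mono[of s t] in auto)
  qed
  fix s t :: real assume st: "s : {0<..<1}" "t : {0<..<1}" "Im (ga (ta s)) = 0 & Im (ga (ta t)) = 0"
  have "ta s = ta t" by (rule curveD(5)[OF ga]) (use st r[of s] r[of t] r1[of s] r1[of t] in auto)
  then show "s = t" using mono[of s t] mono[of t s] st by (cases s t rule: linorder_cases) auto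
 qed
qed

lemma R1_class_reparametrize:
 assumes ga: "curve ga" and ta: "continuous_on {0..1} ta" "ta 0 = 0" "ta 1 = 1"
  and mono: "!!s t. [|0 <= s; s < t; t <= 1|] ==> ta s < ta t"
 shows "R1_class W ga = R1_class W (%t. ga (ta t))"
proof (rule R1_class_eqI)
 define T where "T u t = (1 - u) * t + u * ta t" for u t
 have T01: "T u 0 = 0" "T u 1 = 1" for u using ta by (simp_all add: T_def)
 have Tmono: "T u s < T u t" if u: "0 <= u" "u <= 1" and st: "0 <= s" "s < t" "t <= 1" for u s t
 proof (cases "u = 0")
  case True then show ?thesis using st by (simp add: T_def)
 next
  case False
  have "u * ta s < u * ta t" using mono[OF st] u False by simp
  moreover have "(1 - u) * s <= (1 - u) * t" using u st by (intro mult_left_mono) auto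
  ultimately show ?thesis by (simp add: T_def)
 qed
 have Tr: "T u t : {0..1}" if "0 <= u" "u <= 1" "0 <= t" "t <= 1" for u t
  using Tmono[of u 0 t] Tmono[of u t 1] that T01[of u] by (cases "t = 0"; cases "t = 1") auto
 define h where "h y = ga (T (fst y) (snd y))" for y :: "real \<times> real"
 have c: "continuous_on ({0..1} \<times> {0..1}) (%y::real\<times>real. ta (snd y))"
  by (rule continuous_on_compose2[OF ta(1)]) (auto intro!: continuous_intros)
 have "continuous_on ({0..1} \<times> {0..1}) h" unfolding h_def
 proof (rule continuous_on_compose2[OF curveD(1)[OF ga]])
  show "continuous_on ({0..1} \<times> {0..1}) (%y::real\<times>real. T (fst y) (snd y))"
   unfolding T_def by (intro continuous_intros c)
  show "(%y. T (fst y) (snd y)) ` ({0..1} \<times> {0..1}) <= {0..1}" using Tr by fastforce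
 qed
 moreover have "curve (%t. h (u, t)) & h (u, 1) = ga 1" if u: "u : {0..1}" for u
 proof
  show "curve (%t. h (u, t))" unfolding h_def fst_conv snd_conv
   by (rule curve_reparametrize[OF ga]) (use u T01 Tmono in \<open>auto simp: T_def intro!: continuous_intros ta\<close>)
  show "h (u, 1) = ga 1" by (simp add: h_def T01)
 qed
 ultimately show "homotopic_with_canon (%sg. curve sg & sg 1 = ga 1) {0..1} UNIV ga (%t. ga (ta t))"
  unfolding homotopic_with_def by (intro exI[of _ h]) (simp add: h_def T_def)
qed

text \<open>The time change t powr al with al = ln c / ln (1/2) sends 1/2 to c.\<close>

lemma crossing_time_half:
 assumes ga: "curve ga" and k: "kind ga e m c" "0 < c"
 obtains ga' where "curve ga'" "ga' 1 = ga 1" "R1_class W ga = R1_class W ga'" "kind ga' e m (1/2)"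
proof -
 have c: "0 < c" "c < 1" using k by (auto simp: kind_def)
 define al where "al = ln c / ln (1/2)"
 have al: "0 < al" unfolding al_def using c by (intro divide_neg_neg) auto
 define ta where "ta t = t powr al" for t
 have "ln (1/2 :: real) ~= 0" using ln_eq_zero_iff[of "1/2::real"] by auto
 then have half: "ta (1/2) = c" using c by (simp add: ta_def al_def powr_def)
 have ta01: "ta 0 = 0" "ta 1 = 1" by (simp_all add: ta_def)
 have cont: "continuous_on {0..1} ta" unfolding ta_def using al by (intro continuous_on_powr' continuous_intros) auto
 have mono: "ta s < ta t" if "0 <= s" "s < t" "t <= 1" for s t
  unfolding ta_def using that al by (intro powr_less_mono2) auto
 have k': "kind (%t. ga (ta t)) e m (1/2)"
 proof -
  have "e * Im (ga (ta t)) < 0" if "0 < t" "t < 1/2" for t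
  proof -
   have "0 < ta t" "ta t < c" using mono[of 0 t] mono[of t "1/2"] that ta01 half by auto
   then show ?thesis using k by (auto simp: kind_def)
  qed
  moreover have "0 <= e * Im (ga (ta t))" if "1/2 < t" "t < 1" for t
  proof -
   have "c < ta t" "ta t < 1" using mono[of "1/2" t] mono[of t 1] that ta01 half by auto
   then show ?thesis using k by (auto simp: kind_def)
  qed
  ultimately show ?thesis using k half by (auto simp: kind_def)
 qed
 show ?thesis
  by (rule that[OF curve_reparametrize[OF ga cont ta01 mono] _ R1_class_reparametrize[OF ga cont ta01 mono] k'])
   (use ta01 in auto)
qed

text \<open>Once both curves cross at the same time, their convex combinations cross at that time
  and at no other interior time, and the crossing point stays in the convex interval (m,
  m+1).\<close>

lemma R1_class_crossing:
 assumes ga: "curve ga" "curve ga'" "ga' 1 = ga 1" and k: "kind ga e m c" "kind ga' e m c'" "0 < c" "0 < c'" and e: "e = 1 \<or> e = -1"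
 shows "R1_class W ga = R1_class W ga'"
proof -
 obtain g where g: "curve g" "g 1 = ga 1" "R1_class W ga = R1_class W g" "kind g e m (1/2)"
  using crossing_time_half[OF ga(1) k(1,3)] by blast
 obtain g' where g': "curve g'" "g' 1 = ga' 1" "R1_class W ga' = R1_class W g'" "kind g' e m (1/2)"
  using crossing_time_half[OF ga(2) k(2,4)] by blast
 have "R1_class W g = R1_class W g'"
 proof (rule R1_class_linear[OF g(1) g'(1)])
  show "g' 1 = g 1" using g g' ga by simp
  fix s :: real assume s: "0 < s" "s < 1"
  let ?c = "%t. (1 - s) *\<^sub>R g t + s *\<^sub>R g' t"
  have im: "e * Im (?c t) = (1 - s) * (e * Im (g t)) + s * (e * Im (g' t))" for t by (simp add: algebra_simps)
  have zero: "t = 1/2" if t: "0 < t" "t < 1" "Im (?c t) = 0" for t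
  proof (cases t "1/2 :: real" rule: linorder_cases)
   case less
   then have "e * Im (g t) < 0" "e * Im (g' t) < 0" using g(4) g'(4) t by (auto simp: kind_def)
   then have "(1 - s) * (e * Im (g t)) < 0" "s * (e * Im (g' t)) < 0" using s by (auto simp: mult_pos_neg)
   then have "e * Im (?c t) < 0" unfolding im by linarith
   then show ?thesis using t(3) by simp
  next
   case greater
   have "Im (g t) ~= 0" "Im (g' t) ~= 0"
    using curveD(5)[OF g(1), of t "1/2"] curveD(5)[OF g'(1), of t "1/2"] g(4) g'(4) t greater by (auto simp: kind_def)
   moreover have "0 <= e * Im (g t)" "0 <= e * Im (g' t)" using g(4) g'(4) t greater by (auto simp: kind_def)
   ultimately have "0 < e * Im (g t)" "0 < e * Im (g' t)" using e by auto
   then have "0 < (1 - s) * (e * Im (g t))" "0 < s * (e * Im (g' t))" using s by auto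
   then have "0 < e * Im (?c t)" unfolding im by linarith
   then show ?thesis using t(3) by simp
  qed simp
  show "curve ?c"
  proof (rule curve_combination[OF g(1) g'(1) convex_I I_subset _ _ s _ zero])
   show "slope (g t) : I" "slope (g' t) : I" if "0 < t" "t <= 1" for t
    using kind_crossing_V[OF g(1) g(4) _ that] kind_crossing_V[OF g'(1) g'(4) _ that] by (auto simp: V_def)
   fix t :: real assume t: "0 < t" "t <= 1" "Im (?c t) = 0"
   show "?c t ~: \<nat>"
   proof (cases "t = 1")
    case True
    have "g' 1 = g 1" using g g' ga by simp
    then have "?c t = g 1" using True by (simp add: scaleR_conv_of_real algebra_simps)
    then show ?thesis using curveD(8)[OF g(1), of 1] by simp
   next
    case False
    then have th: "t = 1/2" using zero t by simp
    have r: "real m < Re (g t)" "Re (g t) < real m + 1" "real m < Re (g' t)" "Re (g' t) < real m + 1"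
     using g(4) g'(4) by (auto simp: kind_def th)
    have "real m < Re (?c t) & Re (?c t) < real m + 1"
     using convex_bound_lt[of "Re (g t)" "real m + 1" "Re (g' t)" "1 - s" s] convex_bound_lt[of "- Re (g t)" "- real m" "- Re (g' t)" "1 - s" s] r s
     by (simp add: algebra_simps)
    then have "Re (?c t) ~: \<nat>" using not_Nats_between by blast
    moreover have "?c t = of_real (Re (?c t))" using t(3) by (simp add: complex_eq_iff)
    ultimately show ?thesis using of_real_in_Nats_iff by metis
   qed
  qed auto
 qed
 then show ?thesis using g(3) g'(3) by simp
qed

text \<open>By uniform continuity the curves of a homotopy move uniformly little for nearby
  parameters, so a quantity insensitive to small perturbations with fixed end is locally constant
  along [0, 1].\<close>

lemma R1_class_invariant:
 assumes loc: "!!ga. curve ga ==> ga 1 = z ==> \<exists>de>0. \<forall>ga'. curve ga' & ga' 1 = z & (\<forall>t\<in>{0..1}. dist (ga' t) (ga t) < de) --> Ph ga' = Ph ga"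
  and ga: "ga : R1_class W ga0" "ga0 1 = z"
 shows "Ph ga = Ph ga0"
proof -
 have "\<exists>h. continuous_on ({0..1} \<times> {0..1}) h & (\<forall>x. h (0, x) = ga0 x) & (\<forall>x. h (1, x) = ga x) &
  (\<forall>t\<in>{0..1::real}. curve (%x. h (t, x)) & h (t, 1) = z)"
  using ga unfolding R1_class_def homotopic_with_def by simp
 then obtain h where h: "continuous_on ({0..1} \<times> {0..1}) h" "!!x. h (0, x) = ga0 x" "!!x. h (1, x) = ga x"
  "!!t. t : {0..1::real} ==> curve (%x. h (t, x)) & h (t, 1) = z"
  by (elim exE conjE) blast
 have uc: "uniformly_continuous_on ({0..1} \<times> {0..1}) h"
  by (rule compact_uniformly_continuous[OF h(1)]) (intro compact_Times compact_Icc)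
 have "(%s. Ph (%x. h (s, x))) constant_on {0..1::real}"
 proof (rule locally_constant_imp_constant)
  fix a :: real assume a: "a : {0..1}"
  have ca: "curve (%x. h (a, x))" "h (a, 1) = z" using h(4)[OF a] by simp_all
  obtain de where de: "de > 0" "\<forall>ga'. curve ga' & ga' 1 = z & (\<forall>t\<in>{0..1}. dist (ga' t) (h (a, t)) < de) --> Ph ga' = Ph (%x. h (a, x))"
   using loc[of "%x. h (a, x)", OF ca] by (elim exE conjE) (rule that; assumption)
  obtain d where d: "d > 0" "\<forall>x\<in>{0..1} \<times> {0..1}. \<forall>y\<in>{0..1} \<times> {0..1}. dist y x < d --> dist (h y) (h x) < de"
   using uc[unfolded uniformly_continuous_on_def, THEN spec, THEN mp, OF de(1)] by blast
  have eqs: "Ph (%x. h (s, x)) = Ph (%x. h (a, x))" if s: "s : {0..1} \<inter> ball a d" for s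
  proof (rule de(2)[rule_format], intro conjI ballI)
   have "s : {0..1}" using s by simp
   from h(4)[OF this] show "curve (%x. h (s, x))" "h (s, 1) = z" by blast+
   fix t :: real assume t: "t : {0..1}"
   have m: "(a, t) : {0..1} \<times> {0..1}" "(s, t) : {0..1} \<times> {0..1}" using a t s by auto
   have "dist (s, t) (a, t) = dist s a" by (simp add: dist_Pair_Pair)
   also have "\<dots> < d" using s by (simp add: dist_commute)
   finally show "dist (h (s, t)) (h (a, t)) < de" by (rule d(2)[THEN bspec, OF m(1), THEN bspec, OF m(2), THEN mp])
  qed
  have op: "openin (top_of_set {0..1}) ({0..1} \<inter> ball a d)" by (intro openin_open_Int) simp
  have am: "a : {0..1} \<inter> ball a d" using a d(1) by simp
  show "\<exists>T. openin (top_of_set {0..1}) T & a : T & (\<forall>x\<in>T. Ph (%y. h (x, y)) = Ph (%y. h (a, y)))"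
   by (intro exI[of _ "{0..1} \<inter> ball a d"] conjI ballI op am eqs)
 qed simp
 then obtain y where y: "!!s. s : {0..1} ==> Ph (%x. h (s, x)) = y" unfolding constant_on_def by blast
 have "(%x. h (0, x)) = ga0" "(%x. h (1, x)) = ga" using h(2,3) by auto
 then show ?thesis using y[of 0] y[of 1] by simp
qed

lemma R1_class_self: "curve ga ==> ga : R1_class W ga"
 unfolding R1_class_def using curveD(1)[of ga] by simp

lemma R1_class_curve: "ga : R1_class W ga0 ==> curve ga & ga 1 = ga0 1 & R1_class W ga = R1_class W ga0"
 using R1_class_eqI[of ga0 ga] homotopic_with_imp_property[of _ _ _ ga0 ga] unfolding R1_class_def by auto

end

section \<open>Values of a surface function along the branches\<close>

context sector
begin

lemma R1_value_eqI:
 assumes ga: "curve ga" "P ga" "ga 1 = z" and eq: "!!ga'. [|curve ga'; ga' 1 = z; P ga'|] ==> f (R1_class W ga') = v"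
 shows "R1_value W P f z = v"
 unfolding R1_value_def using someI[of "%ga. curve ga & ga 1 = z & P ga" ga] ga by (intro eq) auto

definition direct_value :: "R1_fun => real => complex => complex" where
 "direct_value f e = R1_value W (%ga. kind ga e 0 0) f"

definition crossing_value :: "R1_fun => real => nat => complex => complex" where
 "crossing_value f e m = R1_value W (%ga. \<exists>c>0. kind ga e m c) f"

lemma direct_value_eq:
 assumes "curve ga" "kind ga e 0 0" "ga 1 = z" "e = 1 \<or> e = -1"
 shows "direct_value f e z = f (R1_class W ga)"
 unfolding direct_value_def
proof (rule R1_value_eqI[where P = "%ga. kind ga e 0 0", OF assms(1,2,3)])
 fix ga' assume "curve ga'" "ga' 1 = z" "kind ga' e 0 0"
 then show "f (R1_class W ga') = f (R1_class W ga)" using R1_class_kind0[of ga ga' e] assms by simp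
qed

lemma crossing_value_eq:
 assumes "curve ga" "kind ga e m c" "0 < c" "ga 1 = z" "e = 1 \<or> e = -1"
 shows "crossing_value f e m z = f (R1_class W ga)"
 unfolding crossing_value_def
proof (rule R1_value_eqI[where P = "%ga. \<exists>c>0. kind ga e m c", OF assms(1) _ assms(4)])
 show "\<exists>c>0. kind ga e m c" using assms by blast
 fix ga' assume g: "curve ga'" "ga' 1 = z" "\<exists>c>0. kind ga' e m c"
 then obtain c' where "0 < c'" "kind ga' e m c'" by blast
 then show "f (R1_class W ga') = f (R1_class W ga)" using R1_class_crossing[of ga ga' e m c c'] g assms by simp
qed

text \<open>The limit of the crossing curves as the crossing time tends to 0: it stays on the side e
  throughout.\<close>

lemma cross_curve_0:
 assumes e: "e = 1 \<or> e = -1" and z: "0 < Re z" "z ~: \<nat>" "0 <= e * Im z" and ka: "0 < ka"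
  and S: "!!l de. [|0 <= l; l <= 1; \<bar>de\<bar> <= ka|] ==> (l * Im z + de) / Re z : I"
 shows "curve (cross_curve e ka 0 z)" "cross_curve e ka 0 z 1 = z" "kind (cross_curve e ka 0 z) e 0 0"
proof -
 define w where "w t = Im z * max 0 t + e * ka * t * (1 - t)" for t
 have eq: "cross_curve e ka 0 z = (%t. Complex (t * Re z) (t * w t))" by (simp add: cross_curve_def w_def)
 have ew: "e * w t = e * Im z * max 0 t + ka * t * (1 - t)" for t using e by (auto simp: w_def algebra_simps)
 have pos: "0 < e * w t" if "0 < t" "t < 1" for t
 proof -
  have "0 < ka * t * (1 - t)" using that ka by simp
  moreover have "0 <= e * Im z * max 0 t" by (rule mult_nonneg_nonneg[OF z(3)]) simp
  ultimately show ?thesis unfolding ew by linarith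
 qed
 show "cross_curve e ka 0 z 1 = z" unfolding eq by (simp add: w_def)
 show "kind (cross_curve e ka 0 z) e 0 0"
  unfolding kind_def eq using pos by (auto simp: mult.left_commute[of e] intro: less_imp_le)
 show "curve (cross_curve e ka 0 z)" unfolding eq
 proof (rule explicit_curve[OF z(1)])
  show "continuous_on {0..1} w" unfolding w_def by (intro continuous_intros)
  fix t :: real assume t: "0 < t" "t <= 1"
  have "(t * Im z + e * ka * t * (1 - t)) / Re z : I"
  proof (rule S)
   have "\<bar>t\<bar> * \<bar>1 - t\<bar> <= 1" using t by (intro mult_le_one) auto
   then have "ka * (\<bar>t\<bar> * \<bar>1 - t\<bar>) <= ka" using ka by simp
   then show "\<bar>e * ka * t * (1 - t)\<bar> <= ka" using e ka by (auto simp: abs_mult mult.assoc)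
  qed (use t in auto)
  moreover have "max 0 t = t" using t by simp
  ultimately show "w t / Re z : S" using I_subset by (auto simp: w_def mult.commute)
  assume wt: "w t = 0"
  have "t = 1" using pos[OF t(1)] wt t(2) by (cases "t < 1") auto
  then have "z = of_real (t * Re z)" using wt by (simp add: w_def complex_eq_iff)
  then show "t * Re z ~: \<nat>" using z(2) of_real_in_Nats_iff[of "t * Re z"] by metis
 next
  fix t :: real assume t: "0 < t" "t < 1" "w t = 0"
  then show "t = 0" using pos[of t] by simp
 qed
qed

text \<open>The limit as the crossing time tends to 1, for a real end point: it stays on the side
  -e.\<close>

lemma cross_curve_1:
 assumes e: "e = 1 \<or> e = -1" and x: "0 < x" "x ~: \<nat>" and ka: "0 < ka"
  and S: "!!de. \<bar>de\<bar> <= ka ==> de / x : I"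
 shows "curve (cross_curve e ka 1 (of_real x))" "cross_curve e ka 1 (of_real x) 1 = of_real x" "kind (cross_curve e ka 1 (of_real x)) (-e) 0 0"
proof -
 define w where "w t = e * ka * (t - 1) * (1 - t)" for t
 have eq: "cross_curve e ka 1 (of_real x) = (%t. Complex (t * x) (t * w t))" by (simp add: cross_curve_def w_def)
 have pos: "0 < - e * w t" if "0 < t" "t < 1" for t
 proof -
  have "- e * w t = ka * ((1 - t) * (1 - t))" using e by (auto simp: w_def algebra_simps)
  then show ?thesis using ka that by simp
 qed
 show "cross_curve e ka 1 (of_real x) 1 = of_real x" unfolding eq by (simp add: w_def complex_eq_iff)
 have kpos: "0 < - e * (t * w t)" if "0 < t" "t < 1" for t
 proof -
  have "- e * (t * w t) = t * (- e * w t)" by simp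
  then show ?thesis using mult_pos_pos[OF that(1) pos[OF that]] by (simp only:)
 qed
 show "kind (cross_curve e ka 1 (of_real x)) (-e) 0 0"
  unfolding kind_def eq using kpos by (auto intro: less_imp_le)
 show "curve (cross_curve e ka 1 (of_real x))" unfolding eq
 proof (rule explicit_curve[OF x(1)])
  show "continuous_on {0..1} w" unfolding w_def by (intro continuous_intros)
  fix t :: real assume t: "0 < t" "t <= 1"
  have "\<bar>t - 1\<bar> * \<bar>1 - t\<bar> <= 1" using t by (intro mult_le_one) auto
  then have "ka * (\<bar>t - 1\<bar> * \<bar>1 - t\<bar>) <= ka" using ka by simp
  then have "\<bar>w t\<bar> <= ka" using e ka by (auto simp: w_def abs_mult mult.assoc)
  then show "w t / x : S" using S I_subset by blast
  assume "w t = 0"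
  then have "t = 1" using pos[OF t(1)] t(2) by (cases "t < 1") auto
  then show "t * x ~: \<nat>" using x by simp
 next
  fix t :: real assume t: "0 < t" "t < 1" "w t = 0"
  then show "t = 0" using pos[of t] by simp
 qed
qed

lemma dist_strict_curve:
 assumes "0 <= t" "t <= 1" shows "dist (strict_curve e ka z t) (strict_curve e ka w t) <= dist z w"
proof -
 have "strict_curve e ka z t - strict_curve e ka w t = of_real t * (z - w)"
  by (simp add: strict_curve_def complex_eq_iff algebra_simps)
 then show ?thesis using assms mult_left_le_one_le[of "norm (z - w)" t] by (simp add: dist_norm norm_mult)
qed

lemma dist_cross_curve:
 assumes "0 <= t" "t <= 1" "0 < c" "c < 1" shows "dist (cross_curve e ka c z t) (cross_curve e ka c w t) <= 2 * dist z w"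
proof -
 define g where "g = max 0 ((t - c) / (1 - c))"
 have g: "0 <= g" "g <= 1" using assms by (auto simp: g_def divide_le_eq_1)
 have eq: "cross_curve e ka c z t - cross_curve e ka c w t = Complex (t * Re (z - w)) (t * g * Im (z - w))"
  by (simp add: cross_curve_def g_def[symmetric] complex_eq_iff algebra_simps)
 have "norm (cross_curve e ka c z t - cross_curve e ka c w t) <= \<bar>t * Re (z - w)\<bar> + \<bar>t * g * Im (z - w)\<bar>"
  unfolding eq using cmod_le[of "Complex (t * Re (z - w)) (t * g * Im (z - w))"] by simp
 also have "\<bar>t * Re (z - w)\<bar> <= \<bar>Re (z - w)\<bar>" using assms mult_left_le_one_le[of "\<bar>Re (z - w)\<bar>" t] by (simp only: abs_mult abs_of_nonneg abs_ge_zero)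
 also have "\<bar>t * g * Im (z - w)\<bar> <= \<bar>Im (z - w)\<bar>"
  using assms g mult_le_one[of t g] mult_left_le_one_le[of "\<bar>Im (z - w)\<bar>" "t * g"] by (simp only: abs_mult abs_of_nonneg abs_ge_zero mult_nonneg_nonneg)
 finally show ?thesis using abs_Re_le_cmod[of "z - w"] abs_Im_le_cmod[of "z - w"] unfolding dist_norm by linarith
qed

lemma dist_cross_curve_0:
 assumes t: "0 <= t" "t <= 1" and c: "0 < c" "c <= 1/2" and e: "e = 1 \<or> e = -1" and ka: "0 < ka"
 shows "dist (cross_curve e ka c z t) (cross_curve e ka 0 z t) <= c * (2 * \<bar>Im z\<bar> + ka)"
proof -
 define g where "g = max 0 ((t - c) / (1 - c)) - t"
 have g: "\<bar>g\<bar> <= 2 * c"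
 proof (cases "t <= c")
  case True
  then have "max 0 ((t - c) / (1 - c)) = 0" using c divide_nonpos_pos[of "t - c" "1 - c"] by (simp add: max_def)
  then show ?thesis using t True by (simp add: g_def)
 next
  case False
  have "(t - c) / (1 - c) - t = - (c * (1 - t) / (1 - c))" using c by (simp add: field_simps)
  moreover have "0 <= (t - c) / (1 - c)" using False c by simp
  ultimately have "g = - (c * (1 - t) / (1 - c))" by (simp add: g_def)
  moreover have "c * (1 - t) / (1 - c) <= 2 * c"
  proof -
   have "c * (1 - t) <= c * (2 * (1 - c))" using c t by (intro mult_left_mono) auto
   then show ?thesis using c by (simp add: divide_le_eq algebra_simps)
  qed
  moreover have "0 <= c * (1 - t) / (1 - c)" using c t by simp
  ultimately show ?thesis by linarith
 qed
 define D' where "D' = t * (Im z * g - e * ka * c * (1 - t))"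
 have "cross_curve e ka c z t - cross_curve e ka 0 z t = \<i> * of_real D'"
  using t by (simp add: cross_curve_def g_def D'_def complex_eq_iff algebra_simps)
 then have "dist (cross_curve e ka c z t) (cross_curve e ka 0 z t) = \<bar>D'\<bar>" by (simp add: dist_norm norm_mult)
 also have "\<dots> <= \<bar>Im z * g - e * ka * c * (1 - t)\<bar>"
  unfolding D'_def abs_mult using t mult_left_le_one_le[of "\<bar>Im z * g - e * ka * c * (1 - t)\<bar>" t] by simp
 also have "\<dots> <= \<bar>Im z * g\<bar> + \<bar>e * ka * c * (1 - t)\<bar>" by (rule abs_triangle_ineq4)
 also have "\<bar>Im z * g\<bar> <= \<bar>Im z\<bar> * (2 * c)" unfolding abs_mult by (rule mult_left_mono[OF g]) simp
 also have "\<bar>e * ka * c * (1 - t)\<bar> <= ka * c" using e ka c t mult_left_le[of "1 - t" "ka * c"] by (auto simp: abs_mult)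
 finally show ?thesis by (simp add: algebra_simps)
qed

context
 fixes f :: R1_fun
 assumes f: "R1_analytic_on W (R1 W) f"
begin

lemma germ:
 assumes ga: "curve ga"
 obtains ep ph where "ep > 0" "ph holomorphic_on ball (ga 1) ep"
  "!!ga'. [|curve ga'; !!t. [|0 <= t; t <= 1|] ==> dist (ga' t) (ga t) < ep|] ==> f (R1_class W ga') = ph (ga' 1)"
proof -
 have "R1_class W ga : R1 W" unfolding R1_def using ga by blast
 from f[unfolded R1_analytic_on_def, rule_format, OF this R1_class_self[OF ga]]
 obtain ep ph where "ep > 0" "ph holomorphic_on ball (ga 1) ep"
  and *: "\<forall>ga'. curve ga' & (\<forall>t\<in>{0..1}. dist (ga' t) (ga t) < ep) --> f (R1_class W ga') = ph (ga' 1)" by blast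
 show ?thesis by (rule that[OF \<open>ep > 0\<close> \<open>ph holomorphic_on ball (ga 1) ep\<close>]) (use * in auto)
qed

text \<open>The explicit curves to nearby end points are uniformly close to the one ending at z0, so
  a single germ of f gives the values at all of them.\<close>

lemma direct_value_local:
 assumes e: "e = 1 \<or> e = -1" and z0: "z0 : sheet D e"
 shows "\<exists>r>0. \<exists>ph. ph holomorphic_on ball z0 r & (\<forall>z\<in>ball z0 r. z : sheet D e --> direct_value f e z = ph z)"
proof -
 have z0': "z0 : D" "0 <= e * Im z0" "z0 ~: \<nat>" using z0 by (auto simp: sheet_def)
 have "\<exists>ka r. 0 < r & (\<forall>z\<in>ball z0 r. z : sheet D e -->
   curve (strict_curve e ka z) & strict_curve e ka z 1 = z & kind (strict_curve e ka z) e 0 0)"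
 proof (cases "Im z0 = 0")
  case False
  then have "z0 : D \<inter> {z. 0 < e * Im z}" using z0' e by auto
  moreover have "open (D \<inter> {z. 0 < e * Im z})" by (intro open_Int open_D open_Collect_less continuous_intros)
  ultimately obtain r where r: "r > 0" "ball z0 r <= D \<inter> {z. 0 < e * Im z}" using open_contains_ball by blast
  have "curve (strict_curve e 0 z) & strict_curve e 0 z 1 = z & kind (strict_curve e 0 z) e 0 0" if "z : ball z0 r" for z
   using half_strict_curve(1,2,4)[OF e, of z] r(2) that by blast
  then show ?thesis using r(1) by blast
 next
  case True
  then have "z0 = of_real (Re z0)" "0 < Re z0" using z0' by (simp_all add: complex_eq_iff D_def)
  then have "z0 : V" using of_real_in_V by metis
  then obtain ka where ka: "ka > 0" "!!w l de. [|dist w z0 <= ka; 0 <= l; l <= 1; \<bar>de\<bar> <= ka|] ==> 0 < Re w & (l * Im w + de) / Re w : I"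
   using tube by blast
  have "curve (strict_curve e ka z) & strict_curve e ka z 1 = z & kind (strict_curve e ka z) e 0 0"
   if z: "z : ball z0 ka" "z : sheet D e" for z
  proof -
   have d: "dist z z0 <= ka" using z(1) by (simp add: dist_commute)
   have R: "0 < Re z" "z ~: \<nat>" "0 <= e * Im z" using z(2) by (auto simp: sheet_def D_def)
   have tb: "(l * Im z + de) / Re z : I" if "0 <= l" "l <= 1" "\<bar>de\<bar> <= ka" for l de using ka(2)[OF d that] by simp
   show ?thesis using V_strict_curve(1,2,4)[OF e R ka(1) tb] by simp
  qed
  then show ?thesis using ka(1) by blast
 qed
 then obtain ka r where r: "0 < r" "!!z. [|z : ball z0 r; z : sheet D e|] ==>
   curve (strict_curve e ka z) & strict_curve e ka z 1 = z & kind (strict_curve e ka z) e 0 0" by blast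
 have c0: "curve (strict_curve e ka z0)" "strict_curve e ka z0 1 = z0" using r(2)[of z0] r(1) z0 by auto
 obtain ep ph where ep: "ep > 0" "ph holomorphic_on ball z0 ep"
  "!!ga'. [|curve ga'; !!t. [|0 <= t; t <= 1|] ==> dist (ga' t) (strict_curve e ka z0 t) < ep|] ==> f (R1_class W ga') = ph (ga' 1)"
  using germ[OF c0(1)] unfolding c0(2) by blast
 have "direct_value f e z = ph z" if z: "z : ball z0 (min r ep)" "z : sheet D e" for z
 proof -
  have c: "curve (strict_curve e ka z)" "strict_curve e ka z 1 = z" "kind (strict_curve e ka z) e 0 0" using r(2)[of z] z by auto
  have "f (R1_class W (strict_curve e ka z)) = ph (strict_curve e ka z 1)"
  proof (rule ep(3)[OF c(1)])
   fix t :: real assume "0 <= t" "t <= 1"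
   from dist_strict_curve[OF this, of e ka z z0] show "dist (strict_curve e ka z t) (strict_curve e ka z0 t) < ep"
    using z(1) by (simp add: dist_commute)
  qed
  then show ?thesis using direct_value_eq[OF c(1,3,2) e] c(2) by simp
 qed
 then show ?thesis using r(1) ep(1,2) holomorphic_on_subset[OF ep(2), of "ball z0 (min r ep)"]
  by (intro exI[of _ "min r ep"] conjI exI[of _ ph]) auto
qed

lemma crossing_value_local:
 assumes e: "e = 1 \<or> e = -1" and z0: "z0 : sheet V e" "real m < Re z0"
 shows "\<exists>r>0. \<exists>ph. ph holomorphic_on ball z0 r & (\<forall>z\<in>ball z0 r. z : sheet V e --> crossing_value f e m z = ph z)"
proof -
 have z0': "z0 : V" "0 < Re z0" using z0 by (auto simp: sheet_def V_def)
 \<comment> \<open>Places the crossing halfway between m and the smaller of Re z0 and m + 1.\<close>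
 define c where "c = (real m + min (Re z0) (real m + 1)) / 2 / Re z0"
 have cR: "c * Re z0 = (real m + min (Re z0) (real m + 1)) / 2" using z0'(2) by (simp add: c_def)
 have c: "real m < c * Re z0" "c * Re z0 < real m + 1" "c * Re z0 < 1 * Re z0" "0 * Re z0 < c * Re z0"
  unfolding cR using z0(2) z0'(2) by auto
 have c01: "0 < c" "c < 1" using mult_right_less_imp_less[OF c(3)] mult_right_less_imp_less[OF c(4)] z0'(2) by auto
 obtain ka where ka: "ka > 0" "!!w l de. [|dist w z0 <= ka; 0 <= l; l <= 1; \<bar>de\<bar> <= ka|] ==> 0 < Re w & (l * Im w + de) / Re w : I"
  using tube[OF z0'(1)] by blast
 define r where "r = min ka (min (c * Re z0 - real m) (real m + 1 - c * Re z0))"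
 have r: "0 < r" "r <= ka" using ka(1) c by (auto simp: r_def)
 have cc: "curve (cross_curve e ka c z)" "cross_curve e ka c z 1 = z" "kind (cross_curve e ka c z) e m c"
  if z: "z : ball z0 r" "z : sheet V e" for z
 proof -
  have d: "dist z z0 <= ka" using z(1) r by (simp add: dist_commute)
  have R: "0 < Re z" "z ~: \<nat>" "0 <= e * Im z" using z(2) by (auto simp: sheet_def V_def)
  have tb: "(l * Im z + de) / Re z : I" if "0 <= l" "l <= 1" "\<bar>de\<bar> <= ka" for l de using ka(2)[OF d that] by simp
  have "\<bar>c * (Re z - Re z0)\<bar> <= \<bar>Re z - Re z0\<bar>" using c01 mult_left_le_one_le[of "\<bar>Re z - Re z0\<bar>" c] by (simp add: abs_mult)
  also have "\<dots> <= dist z z0" using abs_Re_le_cmod[of "z - z0"] by (simp add: dist_norm)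
  also have "\<dots> < r" using z(1) by (simp add: dist_commute)
  finally have "\<bar>c * Re z - c * Re z0\<bar> < r" by (simp add: right_diff_distrib)
  then have "real m < c * Re z" "c * Re z < real m + 1" unfolding r_def by linarith+
  from cross_curve[OF e R ka(1) tb c01 this]
  show "curve (cross_curve e ka c z)" "cross_curve e ka c z 1 = z" "kind (cross_curve e ka c z) e m c" by auto
 qed
 have z0b: "z0 : ball z0 r" using r by simp
 note c0 = cc[OF z0b z0(1)]
 obtain ep ph where ep: "ep > 0" "ph holomorphic_on ball z0 ep"
  "!!ga'. [|curve ga'; !!t. [|0 <= t; t <= 1|] ==> dist (ga' t) (cross_curve e ka c z0 t) < ep|] ==> f (R1_class W ga') = ph (ga' 1)"
  using germ[OF c0(1)] unfolding c0(2) by blast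
 have "crossing_value f e m z = ph z" if z: "z : ball z0 (min r (ep / 2))" "z : sheet V e" for z
 proof -
  have zb: "z : ball z0 r" using z(1) by simp
  note c = cc[OF zb z(2)]
  have "f (R1_class W (cross_curve e ka c z)) = ph (cross_curve e ka c z 1)"
  proof (rule ep(3)[OF c(1)])
   fix t :: real assume "0 <= t" "t <= 1"
   from dist_cross_curve[OF this c01, of e ka z z0] show "dist (cross_curve e ka c z t) (cross_curve e ka c z0 t) < ep"
    using z(1) by (simp add: dist_commute)
  qed
  then show ?thesis using crossing_value_eq[OF c(1,3) c01(1) c(2) e] c(2) by simp
 qed
 moreover have "ph holomorphic_on ball z0 (min r (ep / 2))"
  by (rule holomorphic_on_subset[OF ep(2) subset_ball]) (use ep(1) in auto)
 ultimately show ?thesis using r(1) ep(1)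
  by (intro exI[of _ "min r (ep / 2)"] conjI exI[of _ ph]) auto
qed

text \<open>With a crossing time near 0 the crossing curve is uniformly close to one without
  crossing, so the same germ of f gives both values.\<close>

lemma crossing_value_0:
 assumes e: "e = 1 \<or> e = -1" and z: "z : sheet V e"
 shows "crossing_value f e 0 z = direct_value f e z"
proof -
 have z': "z : V" "0 < Re z" "z ~: \<nat>" "0 <= e * Im z" using z by (auto simp: sheet_def V_def)
 obtain ka where ka: "ka > 0" "!!w l de. [|dist w z <= ka; 0 <= l; l <= 1; \<bar>de\<bar> <= ka|] ==> 0 < Re w & (l * Im w + de) / Re w : I"
  using tube[OF z'(1)] by blast
 have tb: "(l * Im z + de) / Re z : I" if "0 <= l" "l <= 1" "\<bar>de\<bar> <= ka" for l de using ka(2)[of z, OF _ that] ka(1) by simp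
 note c0 = cross_curve_0[OF e z'(2-4) ka(1) tb]
 obtain ep ph where ep: "ep > 0" "ph holomorphic_on ball (cross_curve e ka 0 z 1) ep"
  "!!ga'. [|curve ga'; !!t. [|0 <= t; t <= 1|] ==> dist (ga' t) (cross_curve e ka 0 z t) < ep|] ==> f (R1_class W ga') = ph (ga' 1)"
  using germ[OF c0(1)] by blast
 define q where "q = 2 * \<bar>Im z\<bar> + ka"
 have q: "0 < q" using ka(1) by (simp add: q_def add_nonneg_pos)
 \<comment> \<open>Small enough for the crossing to lie left of 1 and for the two curves to differ
   by less than ep.\<close>
 define c where "c = min (1/2) (min (1 / (2 * Re z)) (ep / (2 * q)))"
 have c: "0 < c" "c <= 1/2" "c <= 1 / (2 * Re z)" "c <= ep / (2 * q)" using z'(2) q ep(1) by (auto simp: c_def)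
 have "c * Re z <= 1 / (2 * Re z) * Re z" "c * q <= ep / (2 * q) * q" using c z'(2) q by (intro mult_right_mono; simp)+
 then have cR: "c * Re z < real 0 + 1" "c * q < ep" "real 0 < c * Re z" using z'(2) q ep(1) c(1) by auto
 have c1: "c < 1" using c(2) by simp
 note cc = cross_curve[OF e z'(2-4) ka(1) tb c(1) c1 cR(3,1)]
 have "f (R1_class W (cross_curve e ka c z)) = ph (cross_curve e ka c z 1)"
 proof (rule ep(3)[OF cc(1)])
  fix t :: real assume t: "0 <= t" "t <= 1"
  from dist_cross_curve_0[OF t c(1,2) e ka(1), of z] show "dist (cross_curve e ka c z t) (cross_curve e ka 0 z t) < ep"
   using cR(2) by (simp add: q_def)
 qed
 moreover have "f (R1_class W (cross_curve e ka 0 z)) = ph (cross_curve e ka 0 z 1)"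
 proof (rule ep(3)[OF c0(1)])
  show "dist (cross_curve e ka 0 z t) (cross_curve e ka 0 z t) < ep" for t unfolding dist_self by (rule ep(1))
 qed
 ultimately show ?thesis
  using crossing_value_eq[OF cc(1,3) c(1) cc(2) e, of f] direct_value_eq[OF c0(1,3,2) e, of f] cc(2) c0(2) by simp
qed

text \<open>With a crossing time near 1 the crossing curve is uniformly close to one that never
  leaves the side -e. This is the source of the gluing condition \<open>glue\<close> for sheet
  families.\<close>

lemma crossing_value_real:
 assumes e: "e = 1 \<or> e = -1" and x: "real m < x" "x < real m + 1"
 shows "crossing_value f e m (of_real x) = direct_value f (-e) (of_real x)"
proof -
 have xp: "0 < x" "x ~: \<nat>" using x not_Nats_between by (auto intro: le_less_trans)
 have e': "-e = 1 \<or> -e = -1" using e by auto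
 have z': "0 < Re (of_real x :: complex)" "(of_real x :: complex) ~: \<nat>" "0 <= e * Im (of_real x)" using xp by (simp_all add: of_real_in_Nats_iff)
 obtain ka where ka: "ka > 0" "!!w l de. [|dist w (of_real x) <= ka; 0 <= l; l <= 1; \<bar>de\<bar> <= ka|] ==> 0 < Re w & (l * Im w + de) / Re w : I"
  using tube[OF of_real_in_V[OF xp(1)]] by blast
 have tb: "(l * Im (of_real x) + de) / Re (of_real x) : I" if "0 <= l" "l <= 1" "\<bar>de\<bar> <= ka" for l de
  using ka(2)[of "of_real x", OF _ that] ka(1) by simp
 have tb1: "de / x : I" if "\<bar>de\<bar> <= ka" for de using tb[OF _ _ that, of 1] by simp
 note c0 = cross_curve_1[OF e xp ka(1) tb1]
 obtain ep ph where ep: "ep > 0" "ph holomorphic_on ball (cross_curve e ka 1 (of_real x) 1) ep"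
  "!!ga'. [|curve ga'; !!t. [|0 <= t; t <= 1|] ==> dist (ga' t) (cross_curve e ka 1 (of_real x) t) < ep|] ==> f (R1_class W ga') = ph (ga' 1)"
  using germ[OF c0(1)] by blast
 \<comment> \<open>1 - h is the crossing time: late enough for the crossing to lie right of m and
   for the two curves to differ by less than ep.\<close>
 define h where "h = min (1/2) (min ((x - real m) / (2 * x)) (ep / (2 * ka)))"
 have h: "0 < h" "h <= 1/2" "h <= (x - real m) / (2 * x)" "h <= ep / (2 * ka)" using x xp ep(1) ka(1) by (auto simp: h_def)
 have "h * x <= (x - real m) / (2 * x) * x" "h * ka <= ep / (2 * ka) * ka" using h xp ka(1) by (intro mult_right_mono; simp)+
 then have hx: "h * x <= (x - real m) / 2" "h * ka < ep" using xp ka(1) ep(1) by auto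
 define c where "c = 1 - h"
 have c: "0 < c" "c < 1" using h by (auto simp: c_def)
 have "c * x = x - h * x" by (simp add: c_def algebra_simps)
 moreover have "0 < h * x" using h xp by simp
 ultimately have cx: "real m < c * Re (of_real x)" "c * Re (of_real x) < real m + 1" using hx x by (auto simp: field_simps)
 note cc = cross_curve[OF e z' ka(1) tb c cx]
 have "f (R1_class W (cross_curve e ka c (of_real x))) = ph (cross_curve e ka c (of_real x) 1)"
 proof (rule ep(3)[OF cc(1)])
  fix t :: real assume t: "0 <= t" "t <= 1"
  have "cross_curve e ka c (of_real x) t - cross_curve e ka 1 (of_real x) t = \<i> * of_real (e * (t * (1 - t) * (h * ka)))"
   by (simp add: cross_curve_def c_def complex_eq_iff algebra_simps)
  then have "dist (cross_curve e ka c (of_real x) t) (cross_curve e ka 1 (of_real x) t) = \<bar>e * (t * (1 - t) * (h * ka))\<bar>"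
   unfolding dist_norm by (simp only: norm_mult norm_of_real norm_ii mult_1)
  also have "\<dots> = t * (1 - t) * (h * ka)" using e t h ka(1) by (auto simp: abs_mult)
  also have "\<dots> <= h * ka" using t h ka(1) mult_le_one[of t "1 - t"] mult_left_le_one_le[of "h * ka" "t * (1 - t)"] by simp
  finally show "dist (cross_curve e ka c (of_real x) t) (cross_curve e ka 1 (of_real x) t) < ep" using hx(2) by simp
 qed
 moreover have "f (R1_class W (cross_curve e ka 1 (of_real x))) = ph (cross_curve e ka 1 (of_real x) 1)"
 proof (rule ep(3)[OF c0(1)])
  show "dist (cross_curve e ka 1 (of_real x) t) (cross_curve e ka 1 (of_real x) t) < ep" for t unfolding dist_self by (rule ep(1))
 qed
 ultimately show ?thesis
  using crossing_value_eq[OF cc(1,3) c(1) cc(2) e, of f] direct_value_eq[OF c0(1,3,2) e', of f] cc(2) c0(2) by simp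
qed

lemma direct_value_unit:
 assumes "e = 1 \<or> e = -1" "0 < x" "x < 1"
 shows "direct_value f e (of_real x) = direct_value f (-e) (of_real x)"
proof -
 have "(of_real x :: complex) : sheet V e"
  using assms of_real_in_V[of x] not_Nats_between[of 0 x] by (auto simp: sheet_def of_real_in_Nats_iff)
 then show ?thesis using crossing_value_0[of e "of_real x"] crossing_value_real[of e 0 x] assms by simp
qed

end

end

section \<open>Sheet functions attached to a surface function\<close>

text \<open>The local extensions at real points are patched by
  \<open>analytic_extension_across_real\<close>; at a real point A and Y agree because both values
  are limits from the side e.\<close>

lemma sheet_extension:
 assumes U: "open U" and e: "e = 1 \<or> e = -1"
  and loc: "!!z0. z0 : sheet U e ==> \<exists>r>0. \<exists>ph. ph holomorphic_on ball z0 r & (\<forall>z\<in>ball z0 r. z : sheet U e --> Y z = ph z)"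
 obtains A where "A analytic_on sheet U e" "!!z. z : sheet U e ==> A z = Y z"
proof -
 define P where "P = {p : U. Im p = 0 & p ~: \<nat>}"
 have sheet_eq: "sheet U e = half U e \<union> P" using e Nats_Im_0 by (force simp: sheet_def half_def P_def)
 have "half U e = U \<inter> {z. 0 < e * Im z}" by (auto simp: half_def)
 then have open_half: "open (half U e)" using U by (auto intro!: open_Int open_Collect_less continuous_intros)
 have hol: "Y holomorphic_on half U e"
 proof (rule analytic_imp_holomorphic, unfold analytic_on_def, rule ballI)
  fix z0 assume z0: "z0 : half U e"
  then have "z0 : sheet U e" using sheet_eq by blast
  then obtain r ph where r: "r > 0" "ph holomorphic_on ball z0 r" "!!z. [|z : ball z0 r; z : sheet U e|] ==> Y z = ph z" using loc by blast
  obtain r' where r': "r' > 0" "ball z0 r' <= half U e" using open_half z0 open_contains_ball by blast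
  have "Y holomorphic_on ball z0 (min r r')"
  proof (rule holomorphic_transform)
   show "ph holomorphic_on ball z0 (min r r')" by (rule holomorphic_on_subset[OF r(2) subset_ball]) simp
   show "ph z = Y z" if "z : ball z0 (min r r')" for z
   proof -
    have "z : ball z0 r" "z : ball z0 r'" using that by auto
    then show ?thesis using r(3)[of z] r'(2) sheet_eq by auto
   qed
  qed
  then show "\<exists>ep>0. Y holomorphic_on ball z0 ep" using r(1) r'(1) by (intro exI[of _ "min r r'"]) simp
 qed
 have loc': "\<exists>r>0. \<exists>ph. ph holomorphic_on ball p r & Y p = ph p & (\<forall>z\<in>ball p r. 0 < e * Im z --> z : half U e & ph z = Y z)" if p: "p : P" for p
 proof -
  have ps: "p : sheet U e" "p : U" using p sheet_eq by (auto simp: P_def)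
  obtain r ph where r: "r > 0" "ph holomorphic_on ball p r" "!!z. [|z : ball p r; z : sheet U e|] ==> Y z = ph z" using loc[OF ps(1)] by blast
  obtain r' where r': "r' > 0" "ball p r' <= U" using U ps(2) open_contains_ball by blast
  have "ph holomorphic_on ball p (min r r')" by (rule holomorphic_on_subset[OF r(2) subset_ball]) simp
  moreover have "z : half U e & ph z = Y z" if "z : ball p (min r r')" "0 < e * Im z" for z
  proof -
   have "z : ball p r" "z : ball p r'" using that by auto
   then have "z : half U e" using r'(2) that(2) by (auto simp: half_def)
   then show ?thesis using r(3)[OF \<open>z : ball p r\<close>] sheet_eq by auto
  qed
  moreover have "Y p = ph p" using r(3)[of p] r(1) ps(1) by simp
  ultimately show ?thesis using r(1) r'(1) by (intro exI[of _ "min r r'"] conjI exI[of _ ph]) auto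
 qed
 obtain A where A: "A analytic_on (half U e \<union> P)" "!!z. z : half U e ==> A z = Y z"
 proof (rule analytic_extension_across_real[OF e hol open_half])
  show "0 < e * Im z" if "z : half U e" for z using that by (simp add: half_def)
  show "Im p = 0 & (\<exists>r>0. \<exists>ph. ph holomorphic_on ball p r & (\<forall>z\<in>ball p r. 0 < e * Im z --> z : half U e & ph z = Y z))" if "p : P" for p
   using loc'[OF that] that by (auto simp: P_def)
 qed blast
 have "A p = Y p" if p: "p : P" for p
 proof -
  obtain r ph where r: "r > 0" "ph holomorphic_on ball p r" "Y p = ph p"
   "!!z. [|z : ball p r; 0 < e * Im z|] ==> z : half U e & ph z = Y z" using loc'[OF p] by blast
  have "((%y. p + \<i> * of_real (e * y)) \<longlongrightarrow> p + \<i> * of_real (e * 0)) (at_right 0)"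
   by (intro tendsto_intros tendsto_ident_at)
  then have lim: "((%y. p + \<i> * of_real (e * y)) \<longlongrightarrow> p) (at_right 0)" by simp
  have "A analytic_on {p}" using A(1) p analytic_on_subset by blast
  then have 1: "((%y. A (p + \<i> * of_real (e * y))) \<longlongrightarrow> A p) (at_right 0)"
   by (rule isCont_tendsto_compose[OF analytic_at_imp_isCont lim])
  have "isCont ph p" using holomorphic_on_imp_continuous_on[OF r(2)] r(1) by (simp add: continuous_on_eq_continuous_at)
  then have 2: "((%y. ph (p + \<i> * of_real (e * y))) \<longlongrightarrow> ph p) (at_right 0)"
   by (rule isCont_tendsto_compose[OF _ lim])
  have "\<forall>\<^sub>F y in at_right 0. ph (p + \<i> * of_real (e * y)) = A (p + \<i> * of_real (e * y))"
   unfolding eventually_at_right_field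
  proof (intro exI[of _ r] conjI r(1) allI impI)
   fix y :: real assume y: "0 < y" "y < r"
   have "norm (\<i> * of_real (e * y) :: complex) = y" using y e by (auto simp: norm_mult)
   then have b: "p + \<i> * of_real (e * y) : ball p r" using y by (simp add: dist_norm)
   have "0 < e * Im (p + \<i> * of_real (e * y))" using p e y by (auto simp: P_def)
   then show "ph (p + \<i> * of_real (e * y)) = A (p + \<i> * of_real (e * y))" using r(4)[OF b] A(2) by auto
  qed
  then have "((%y. A (p + \<i> * of_real (e * y))) \<longlongrightarrow> ph p) (at_right 0)" by (rule Lim_transform_eventually[OF 2])
  then show ?thesis using tendsto_unique[OF trivial_limit_at_right_real 1] r(3) by simp
 qed
 then show ?thesis using that[of A] A sheet_eq by auto
qed

text \<open>Only small t is critical. For t \<le> l the ray to p is a ray to l p, which lies in the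
  unit disc; for t \<ge> l the points t p fill a compact set, on which F is bounded.\<close>

lemma radially_integrable_scale:
 assumes star: "!!z t. [|z : C; 0 < t; t <= 1|] ==> of_real t * z : C"
  and cont: "continuous_on C F" and rad: "radially_integrable {z : C. norm z < 1} F"
 shows "radially_integrable C F"
 unfolding radially_integrable_def
proof (intro allI impI)
 fix K assume K: "compact K & K <= C"
 obtain b where b: "b > 0" "!!x. x : K ==> norm x <= b" using K compact_imp_bounded bounded_pos by metis
 \<comment> \<open>Makes l * b < 1, so that K scaled by l lies in the unit disc.\<close>
 define l where "l = 1 / (b + 1)"
 have l: "0 < l" "l < 1" "l * b < 1" using b(1) by (auto simp: l_def)
 define K' where "K' = (%z. of_real l * z) ` K"
 have "compact K'" unfolding K'_def using K by (intro compact_continuous_image continuous_intros) auto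
 moreover have "K' <= {z : C. norm z < 1}"
 proof
  fix w assume "w : K'"
  then obtain z where z: "z : K" "w = of_real l * z" by (auto simp: K'_def)
  have "norm w = l * norm z" using z l by (simp add: norm_mult)
  also have "\<dots> <= l * b" using b(2)[OF z(1)] l by simp
  finally show "w : {z : C. norm z < 1}" using l star[of z l] z K by auto
 qed
 ultimately have K': "compact K' & K' <= {z : C. norm z < 1}" by simp
 obtain H0 where H0: "set_integrable lborel {0..1} H0" "\<forall>p\<in>K'. \<forall>t\<in>{0<..1}. norm (F (of_real t * p)) <= H0 t"
  using rad[unfolded radially_integrable_def, THEN spec, THEN mp, OF K'] by blast
 define K2 where "K2 = (%(t, z). of_real t * z) ` ({l..1} \<times> K)"
 have "compact K2" unfolding K2_def case_prod_unfold using K by (intro compact_continuous_image continuous_intros compact_Times) auto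
 moreover have "K2 <= C"
 proof
  fix w assume "w : K2"
  then obtain t z where tz: "t : {l..1}" "z : K" "w = of_real t * z" unfolding K2_def by auto
  have "z : C" "0 < t" "t <= 1" using tz K l(1) by auto
  then show "w : C" using star tz(3) by simp
 qed
 ultimately have "compact (F ` K2)" using cont by (intro compact_continuous_image) (auto intro: continuous_on_subset)
 then obtain M where M: "M > 0" "!!x. x : F ` K2 ==> norm x <= M" using compact_imp_bounded bounded_pos by metis
 define H where "H t = norm (indicator {0..1} (t / l) * H0 (t / l)) + M" for t
 have "integrable lborel (%x. indicator {0..1} x * H0 x)" using H0(1) by (simp add: set_integrable_def)
 from lborel_integrable_real_affine[OF this, of "1 / l" 0] have "integrable lborel (%x. norm (indicator {0..1} (x / l) * H0 (x / l)))"
  using l(1) by simp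
 then have "set_integrable lborel {0..1} (%x. norm (indicator {0..1} (x / l) * H0 (x / l)))"
  unfolding set_integrable_def by (intro integrable_mult_indicator) auto
 moreover have "set_integrable lborel {0..1} (%x::real. M)" unfolding set_integrable_def by (intro integrable_scaleR_left integrable_real_indicator) auto
 ultimately have "set_integrable lborel {0..1} H" unfolding H_def by (rule set_integral_add(1))
 moreover have "norm (F (of_real t * p)) <= H t" if p: "p : K" and t: "t : {0<..1}" for p t
 proof (cases "t <= l")
  case True
  have "of_real l * p : K'" using p by (auto simp: K'_def)
  moreover have "t / l : {0<..1}" using t True l by simp
  ultimately have "norm (F (of_real (t / l) * (of_real l * p))) <= H0 (t / l)" using H0(2) by blast
  moreover have "of_real (t / l) * (of_real l * p) = of_real t * p" using l(1) by simp
  moreover have "indicator {0..1} (t / l) = (1 :: real)" using t True l by (auto simp: indicator_def)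
  ultimately show ?thesis using M(1) by (simp add: H_def)
 next
  case False
  then have "(t, p) : {l..1} \<times> K" using p t by simp
  then have "of_real t * p : K2" unfolding K2_def by force
  then have "norm (F (of_real t * p)) <= M" using M(2) by blast
  then show ?thesis by (simp add: H_def add_increasing)
 qed
 ultimately show "\<exists>H. set_integrable lborel {0..1} H & (\<forall>p\<in>K. \<forall>t\<in>{0<..1}. norm (F (of_real t * p)) <= H t)" by blast
qed

lemma ray_convolution_cong:
 assumes "!!t. [|0 < t; t < 1|] ==> A (of_real t * z) = A' (of_real t * z) & B (of_real t * z) = B' (of_real t * z)"
 shows "ray_convolution A B z = ray_convolution A' B' z"
 unfolding ray_convolution_def contour_integral_integral vector_derivative_linepath_at
proof (rule integral_spike[of "{0, 1}"])
 fix t :: real assume t: "t : {0..1} - {0, 1}"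
 have l: "linepath 0 z t = of_real t * z" by (simp add: linepath_def scaleR_conv_of_real)
 have r: "z - of_real t * z = of_real (1 - t) * z" by (simp add: algebra_simps)
 show "A' (linepath 0 z t) * B' (z - linepath 0 z t) * (z - 0) = A (linepath 0 z t) * B (z - linepath 0 z t) * (z - 0)"
  unfolding l r using assms[of t] assms[of "1 - t"] t by simp
qed simp

lemma of_real_islimpt:
 assumes "0 < r" shows "(of_real x :: complex) islimpt (of_real ` {x<..<x + r})"
 unfolding islimpt_approachable
proof (intro allI impI)
 fix d :: real assume d: "0 < d"
 define y where "y = x + min d r / 2"
 have "y : {x<..<x + r}" "\<bar>y - x\<bar> < d" "y ~= x" using d assms by (auto simp: y_def min_def)
 then show "\<exists>w\<in>of_real ` {x<..<x + r}. w ~= (of_real x :: complex) & dist w (of_real x) < d"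
  by (intro bexI[of _ "of_real y"]) (auto simp: dist_of_real dist_real_def)
qed

context sector
begin

lemma near0_domain_eq: "near0_domain W = {z : D. norm z < 1}"
proof -
 have "z ~: \<nat>" if z: "0 < Re z" "norm z < 1" for z
 proof
  assume "z : \<nat>"
  then obtain n :: nat where n: "z = of_nat n" by (auto simp: Nats_def)
  then show False using z by simp
 qed
 then show ?thesis by (auto simp: near0_domain_def W_iff D_def)
qed

lemma sheet_V_D: "z : sheet V e ==> z : sheet D e" using V_subset by (auto simp: sheet_def)

lemma of_nat_add_sheet_V:
 assumes z: "z : sheet V e" shows "of_nat m + z : sheet V e"
proof -
 interpret wedge V 1 by (rule wedge_V) simp
 have "z + of_real (real m) : V" using z by (intro add_real_V) (auto simp: sheet_def)
 then have v: "of_nat m + z : V" by (simp add: add.commute)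
 have "of_nat m + z ~: \<nat>"
 proof
  assume "of_nat m + z : \<nat>"
  then obtain n :: nat where n: "of_nat m + z = of_nat n" by (auto simp: Nats_def)
  have "0 < Re z" using z by (auto simp: sheet_def V_def)
  then have "real m < real n" using arg_cong[OF n, of Re] by simp
  then have "z = of_nat (n - m)" using n by (simp add: of_nat_diff algebra_simps)
  then show False using z by (simp add: sheet_def)
 qed
 then show ?thesis using v z by (simp add: sheet_def)
qed

lemma crossing_curve_exists:
 assumes e: "e = 1 \<or> e = -1" and z: "z : sheet V e" "real m < Re z"
 obtains ga c where "curve ga" "ga 1 = z" "kind ga e m c" "0 < c"
proof -
 have z': "z : V" "0 < Re z" "z ~: \<nat>" "0 <= e * Im z" using z by (auto simp: sheet_def V_def)
 obtain ka where ka: "ka > 0" "!!w l de. [|dist w z <= ka; 0 <= l; l <= 1; \<bar>de\<bar> <= ka|] ==> 0 < Re w & (l * Im w + de) / Re w : I"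
  using tube[OF z'(1)] by blast
 have tb: "(l * Im z + de) / Re z : I" if "0 <= l" "l <= 1" "\<bar>de\<bar> <= ka" for l de using ka(2)[of z, OF _ that] ka(1) by simp
 define c where "c = (real m + min (Re z) (real m + 1)) / 2 / Re z"
 have cR: "c * Re z = (real m + min (Re z) (real m + 1)) / 2" using z'(2) by (simp add: c_def)
 have c: "real m < c * Re z" "c * Re z < real m + 1" "c * Re z < 1 * Re z" "0 * Re z < c * Re z"
  unfolding cR using z(2) z'(2) by auto
 have c01: "0 < c" "c < 1" using mult_right_less_imp_less[OF c(3)] mult_right_less_imp_less[OF c(4)] z'(2) by auto
 from cross_curve[OF e z'(2-4) ka(1) tb c01 c(1,2)] show ?thesis using that c01(1) by blast
qed

lemma R1_value_strict:
 assumes e: "e = 1 \<or> e = -1" and z: "z : sheet D e"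
  and F: "!!ga. [|curve ga; ga 1 = z; kind ga e 0 0|] ==> F (R1_class W ga) = v"
 shows "R1_value W (%ga. \<forall>t\<in>{0<..<1}. 0 < e * Im (ga t)) F z = v"
proof -
 have z': "z : D" "z ~: \<nat>" "0 <= e * Im z" using z by (auto simp: sheet_def)
 have "\<exists>sg. curve sg & sg 1 = z & (\<forall>t. 0 < t & t < 1 --> 0 < e * Im (sg t))"
  by (rule strict_curve_exists[OF e z' zero_less_one]) blast
 then obtain sg where sg: "curve sg" "sg 1 = z" "\<forall>t\<in>{0<..<1}. 0 < e * Im (sg t)" by auto
 show ?thesis
 proof (rule R1_value_eqI[where P = "%ga. \<forall>t\<in>{0<..<1}. 0 < e * Im (ga t)", OF sg(1,3,2)])
  fix ga assume ga: "curve ga" "ga 1 = z" "\<forall>t\<in>{0<..<1}. 0 < e * Im (ga t)"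
  have "kind ga e 0 0" unfolding kind_def using ga(3) curveD(2)[OF ga(1)] by (auto intro: less_imp_le)
  then show "F (R1_class W ga) = v" using F ga by blast
 qed
qed

lemma R1_value_crossing:
 assumes z: "z : sheet V 1" "real m < Re z"
  and F: "!!ga c. [|curve ga; ga 1 = z; kind ga 1 m c; 0 < c|] ==> F (R1_class W ga) = v"
 shows "R1_value W (%ga. \<exists>c\<in>{0<..<1}. (\<forall>t\<in>{0<..<c}. Im (ga t) < 0) & Im (ga c) = 0 & real m < Re (ga c) & Re (ga c) < real m + 1 & (\<forall>t\<in>{c<..<1}. Im (ga t) > 0)) F z = v"
  (is "R1_value W ?P F z = v")
proof -
 obtain ga c where ga: "curve ga" "ga 1 = z" and k: "kind ga 1 m c" "0 < c" using crossing_curve_exists[OF _ z] by auto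
 have "0 < Im (ga t)" if "c < t" "t < 1" for t
 proof -
  have "0 <= Im (ga t)" using k that by (auto simp: kind_def)
  moreover have "Im (ga t) ~= 0" using curveD(5)[OF ga(1), of t c] k that by (auto simp: kind_def)
  ultimately show ?thesis by simp
 qed
 then have P: "?P ga" using k by (intro bexI[of _ c]) (auto simp: kind_def)
 show ?thesis
 proof (rule R1_value_eqI[where P = ?P, OF ga(1) P ga(2)])
  fix g assume g: "curve g" "g 1 = z" "?P g"
  then obtain c' where c': "0 < c'" "c' < 1" "\<forall>t\<in>{0<..<c'}. Im (g t) < 0" "Im (g c') = 0"
   "real m < Re (g c')" "Re (g c') < real m + 1" "\<forall>t\<in>{c'<..<1}. Im (g t) > 0" by auto
  then have "kind g 1 m c'" by (auto simp: kind_def intro: less_imp_le)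
  then show "F (R1_class W g) = v" using F g c'(1) by blast
 qed
qed

context
 fixes f :: R1_fun
 assumes f: "R1_analytic_on W (R1 W) f"
begin

text \<open>A curve inside the unit disc can cross only in (0, 1), and such a crossing does not
  change the value; on the axis the values from both sides agree.\<close>

lemma near0_eq_direct_value:
 assumes e: "e = 1 \<or> e = -1" and z: "z : sheet D e" "norm z < 1"
 shows "near0 W f z = direct_value f e z"
proof -
 have z': "z : D" "z ~: \<nat>" "0 <= e * Im z" using z by (auto simp: sheet_def)
 have et: "0 < 1 - norm z" using z by simp
 have "\<exists>sg. curve sg & sg 1 = z & (\<forall>t. 0 <= t & t <= 1 --> norm (sg t) < norm z + (1 - norm z))"
  by (rule strict_curve_exists[OF e z' et]) blast
 then obtain sg where sg: "curve sg" "sg 1 = z" "\<forall>t\<in>{0..1}. norm (sg t) < 1" by auto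
 show ?thesis unfolding near0_def
 proof (rule R1_value_eqI[where P = "%ga. \<forall>t\<in>{0..1}. norm (ga t) < 1", OF sg(1,3,2)])
  fix ga assume ga: "curve ga" "ga 1 = z" and n: "\<forall>t\<in>{0..1}. norm (ga t) < 1"
  obtain e' m c where k: "e' = 1 \<or> e' = -1" "kind ga e' m c" using kind_exists[OF ga(1)] .
  have "c : {0..1}" using k by (auto simp: kind_def)
  then have "Re (ga c) < 1" using n complex_Re_le_cmod[of "ga c"] by force
  then have m: "m = 0" using k by (auto simp: kind_def split: if_splits)
  have v: "f (R1_class W ga) = direct_value f e' z"
  proof (cases "c = 0")
   case True
   then show ?thesis using direct_value_eq[OF ga(1) _ ga(2) k(1), of f] k(2) m by simp
  next
   case False
   then have c: "0 < c" using k by (auto simp: kind_def)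
   have "z : sheet V e'" using kind_crossing_V[OF ga(1) k(2) c, of 1] kind_after[OF ga(1) k(2)] ga(2) by (auto simp: sheet_def)
   then show ?thesis using crossing_value_eq[OF ga(1) k(2) c ga(2) k(1), of f] crossing_value_0[OF f k(1)] m by simp
  qed
  show "f (R1_class W ga) = direct_value f e z"
  proof (cases "e' = e")
   case True then show ?thesis using v by simp
  next
   case False
   then have e': "e' = - e" using e k(1) by auto
   have "0 <= e' * Im z" using kind_after(1)[OF ga(1) k(2)] ga(2) by simp
   then have "Im z = 0" using z'(3) e e' by auto
   then have zr: "z = of_real (Re z)" by (simp add: complex_eq_iff)
   have "0 < Re z" "Re z < 1" using z' z(2) complex_Re_le_cmod[of z] by (auto simp: D_def)
   then show ?thesis using v direct_value_unit[OF f e, of "Re z"] zr e' by simp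
  qed
 qed
qed

lemma direct_value_extension:
 assumes e: "e = 1 \<or> e = -1"
 obtains A where "A analytic_on sheet D e" "!!z. z : sheet D e ==> A z = direct_value f e z"
 using sheet_extension[OF open_D e direct_value_local[OF f e]] by blast

text \<open>Off the axis this is one of the two direct branches. At a real point their extensions
  from both sides coincide on a real interval, hence on a ball.\<close>

lemma near0_holomorphic: "near0 W f holomorphic_on near0_domain W"
proof (rule analytic_imp_holomorphic, unfold analytic_on_def, rule ballI)
 fix z0 assume z0: "z0 : near0_domain W"
 have z0': "z0 : D" "norm z0 < 1" "z0 ~: \<nat>" using z0 W_iff by (auto simp: near0_domain_eq near0_domain_def)
 obtain A1 where A1: "A1 analytic_on sheet D 1" "!!z. z : sheet D 1 ==> A1 z = direct_value f 1 z"
  using direct_value_extension[of 1] by blast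
 obtain A2 where A2: "A2 analytic_on sheet D (-1)" "!!z. z : sheet D (-1) ==> A2 z = direct_value f (-1) z"
  using direct_value_extension[of "-1"] by blast
 have op: "open (near0_domain W)" unfolding near0_domain_eq
  using open_Int[OF open_D open_ball[of 0 1]] by (simp add: Int_def dist_norm)
 obtain r0 where r0: "r0 > 0" "ball z0 r0 <= near0_domain W" using op z0 open_contains_ball by blast
 have dom: "z : sheet D 1 & near0 W f z = A1 z" if "z : near0_domain W" "0 <= Im z" for z
 proof -
  have "z : sheet D 1" "norm z < 1" using that W_iff[of z] by (auto simp: sheet_def near0_domain_def)
  then show ?thesis using near0_eq_direct_value[of 1 z] A1(2)[of z] by simp
 qed
 have dom2: "z : sheet D (-1) & near0 W f z = A2 z" if "z : near0_domain W" "Im z <= 0" for z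
 proof -
  have "z : sheet D (-1)" "norm z < 1" using that W_iff[of z] by (auto simp: sheet_def near0_domain_def)
  then show ?thesis using near0_eq_direct_value[of "-1" z] A2(2)[of z] by simp
 qed
 consider "0 < Im z0" | "Im z0 < 0" | "Im z0 = 0" by linarith
 then show "\<exists>ep>0. near0 W f holomorphic_on ball z0 ep"
 proof cases
  case 1
  obtain r1 where r1: "r1 > 0" "A1 holomorphic_on ball z0 r1" using A1(1) dom[OF z0] 1 unfolding analytic_on_def by auto
  define r where "r = min (min r0 r1) (Im z0)"
  have "near0 W f holomorphic_on ball z0 r"
  proof (rule holomorphic_transform)
   show "A1 holomorphic_on ball z0 r" by (rule holomorphic_on_subset[OF r1(2) subset_ball]) (simp add: r_def)
   fix z assume z: "z : ball z0 r"
   have "\<bar>Im z0 - Im z\<bar> < Im z0" using z abs_Im_le_cmod[of "z0 - z"] by (simp add: r_def dist_norm)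
   then have "0 <= Im z" by linarith
   moreover have "z : near0_domain W" using z r0(2) by (auto simp: r_def)
   ultimately show "A1 z = near0 W f z" using dom by simp
  qed
  then show ?thesis using r0(1) r1(1) 1 by (intro exI[of _ r]) (simp add: r_def)
 next
  case 2
  obtain r1 where r1: "r1 > 0" "A2 holomorphic_on ball z0 r1" using A2(1) dom2[OF z0] 2 unfolding analytic_on_def by auto
  define r where "r = min (min r0 r1) (- Im z0)"
  have "near0 W f holomorphic_on ball z0 r"
  proof (rule holomorphic_transform)
   show "A2 holomorphic_on ball z0 r" by (rule holomorphic_on_subset[OF r1(2) subset_ball]) (simp add: r_def)
   fix z assume z: "z : ball z0 r"
   have "\<bar>Im z0 - Im z\<bar> < - Im z0" using z abs_Im_le_cmod[of "z0 - z"] by (simp add: r_def dist_norm)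
   then have "Im z <= 0" by linarith
   moreover have "z : near0_domain W" using z r0(2) by (auto simp: r_def)
   ultimately show "A2 z = near0 W f z" using dom2 by simp
  qed
  then show ?thesis using r0(1) r1(1) 2 by (intro exI[of _ r]) (simp add: r_def)
 next
  case 3
  obtain r1 where r1: "r1 > 0" "A1 holomorphic_on ball z0 r1" using A1(1) dom[OF z0] 3 unfolding analytic_on_def by auto
  obtain r2 where r2: "r2 > 0" "A2 holomorphic_on ball z0 r2" using A2(1) dom2[OF z0] 3 unfolding analytic_on_def by auto
  define r where "r = min r0 (min r1 r2)"
  have r: "0 < r" using r0 r1 r2 by (simp add: r_def)
  have h1: "A1 holomorphic_on ball z0 r" by (rule holomorphic_on_subset[OF r1(2) subset_ball]) (simp add: r_def)
  have h2: "A2 holomorphic_on ball z0 r" by (rule holomorphic_on_subset[OF r2(2) subset_ball]) (simp add: r_def)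
  have zr: "z0 = of_real (Re z0)" using 3 by (simp add: complex_eq_iff)
  have eq: "A1 z = A2 z" if z: "z : ball z0 r" for z
  proof (rule analytic_eq_on_connected[where f = A1 and g = A2 and T = "ball z0 r" and a = z0 and Z = "of_real ` {Re z0<..<Re z0 + r}" and w = z])
   show "A1 analytic_on ball z0 r" "A2 analytic_on ball z0 r" using h1 h2 by (simp_all add: analytic_on_open)
   show "z0 islimpt of_real ` {Re z0<..<Re z0 + r}" using of_real_islimpt[OF r, of "Re z0"] zr by simp
   show "A1 w = A2 w" if wZ: "w : of_real ` {Re z0<..<Re z0 + r}" for w
   proof -
    obtain x where x: "w = of_real x" "Re z0 < x" "x < Re z0 + r" using wZ by auto
    have "dist z0 w = \<bar>Re z0 - x\<bar>" unfolding x(1) by (subst zr) (simp only: dist_of_real dist_real_def)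
    then have "w : ball z0 r0" using x by (simp add: r_def)
    then have "w : near0_domain W" using r0(2) by blast
    then show ?thesis using dom[of w] dom2[of w] x(1) by simp
   qed
  qed (use r z in auto)
  have "near0 W f holomorphic_on ball z0 r"
  proof (rule holomorphic_transform[OF h1])
   fix z assume z: "z : ball z0 r"
   then have zd: "z : near0_domain W" using r0(2) by (auto simp: r_def)
   show "A1 z = near0 W f z"
    using dom[OF zd] dom2[OF zd] eq[OF z] by (cases "0 <= Im z") auto
  qed
  then show ?thesis using r by blast
 qed
qed

text \<open>The argument is shifted by m to give all sheets the same domain. An analytic extension
  is chosen, because \<open>crossing_value\<close> carries information only on the closed
  side.\<close>

definition sheet_function :: "real => nat => complex => complex" where
 "sheet_function e m = (SOME A. A analytic_on sheet V e & (\<forall>sg\<in>sheet V e. A sg = crossing_value f e m (of_nat m + sg)))"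

lemma sheet_function:
 assumes e: "e = 1 \<or> e = -1"
 shows "sheet_function e m analytic_on sheet V e"
  and "!!sg. sg : sheet V e ==> sheet_function e m sg = crossing_value f e m (of_nat m + sg)"
proof -
 have "\<exists>r>0. \<exists>ph. ph holomorphic_on ball s0 r & (\<forall>s\<in>ball s0 r. s : sheet V e --> crossing_value f e m (of_nat m + s) = ph s)"
  if s0: "s0 : sheet V e" for s0
 proof -
  have "real m < Re (of_nat m + s0)" using s0 by (simp add: sheet_def V_def)
  from crossing_value_local[OF f e of_nat_add_sheet_V[OF s0] this]
  obtain r ph where r: "r > 0" "ph holomorphic_on ball (of_nat m + s0) r"
   "!!z. [|z : ball (of_nat m + s0) r; z : sheet V e|] ==> crossing_value f e m z = ph z" by blast
  have b: "of_nat m + s : ball (of_nat m + s0) r \<longleftrightarrow> s : ball s0 r" for s by (simp add: dist_norm)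
  have "(ph \<circ> (%s. of_nat m + s)) holomorphic_on ball s0 r"
  proof (rule holomorphic_on_compose_gen[OF _ r(2)])
   show "(%s. of_nat m + s) holomorphic_on ball s0 r" by (intro holomorphic_intros)
   show "(%s. of_nat m + s) ` ball s0 r <= ball (of_nat m + s0) r" using b by blast
  qed
  moreover have "crossing_value f e m (of_nat m + s) = (ph \<circ> (%s. of_nat m + s)) s" if "s : ball s0 r" "s : sheet V e" for s
   using r(3)[of "of_nat m + s"] b that of_nat_add_sheet_V by simp
  ultimately show ?thesis using r(1) by blast
 qed
 from sheet_extension[OF open_V e this]
 obtain A where "A analytic_on sheet V e" "!!sg. sg : sheet V e ==> A sg = crossing_value f e m (of_nat m + sg)" by blast
 then have "\<exists>A. A analytic_on sheet V e & (\<forall>sg\<in>sheet V e. A sg = crossing_value f e m (of_nat m + sg))" by blast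
 from someI_ex[OF this] show "sheet_function e m analytic_on sheet V e"
  "!!sg. sg : sheet V e ==> sheet_function e m sg = crossing_value f e m (of_nat m + sg)"
  unfolding sheet_function_def by blast+
qed

lemma sheet_function_0:
 assumes e: "e = 1 \<or> e = -1" and z: "z : sheet V e"
 shows "sheet_function e 0 z = direct_value f e z"
 using sheet_function(2)[OF e z, of 0] crossing_value_0[OF f e z] by simp

context
 assumes f0: "integrable_at_0 W f"
begin

lemma radially_integrable_near0: "radially_integrable (near0_domain W) (near0 W f)"
 using f0 unfolding radially_integrable_def integrable_at_0_def .

text \<open>Inside the unit disc the direct branch is \<open>near0\<close>, for which the majorant
  is given; scaling extends the property to all of C.\<close>

lemma radially_integrable_direct_value:
 assumes e: "e = 1 \<or> e = -1" and C: "C <= sheet D e"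
  and star: "!!z t. [|z : C; 0 < t; t <= 1|] ==> of_real t * z : C"
  and F: "continuous_on C F" "!!z. z : C ==> F z = direct_value f e z"
 shows "radially_integrable C F"
proof (rule radially_integrable_scale[OF star F(1)])
 show "radially_integrable {z : C. norm z < 1} F"
  unfolding radially_integrable_def
 proof (intro allI impI)
  fix K assume K: "compact K & K <= {z : C. norm z < 1}"
  have "K <= near0_domain W" using K C by (auto simp: near0_domain_eq sheet_def)
  then have KK: "compact K & K <= near0_domain W" using K by simp
  obtain H where H: "set_integrable lborel {0..1} H" "\<forall>p\<in>K. \<forall>t\<in>{0<..1}. norm (near0 W f (of_real t * p)) <= H t"
   using radially_integrable_near0[unfolded radially_integrable_def, rule_format, OF KK] by blast
  have "near0 W f (of_real t * p) = F (of_real t * p)" if "p : K" "t : {0<..1}" for p t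
  proof -
   have c: "of_real t * p : C" using that K star by auto
   have "norm p < 1" using that K by auto
   then have "norm (of_real t * p) < 1" using that mult_left_le_one_le[of "norm p" t] by (simp add: norm_mult)
   then show ?thesis using near0_eq_direct_value[OF e, of "of_real t * p"] F(2)[OF c] C c by auto
  qed
  then show "\<exists>H. set_integrable lborel {0..1} H & (\<forall>p\<in>K. \<forall>t\<in>{0<..1}. norm (F (of_real t * p)) <= H t)"
   using H by (intro exI[of _ H]) auto
 qed
qed

lemma radially_integrable_base:
 assumes e: "e = 1 \<or> e = -1"
 shows "radially_integrable (wedge.base V e) (sheet_function e 0)"
proof -
 interpret wedge V e by (rule wedge_V[OF e])
 show ?thesis
 proof (rule radially_integrable_direct_value[OF e])
  show "base <= sheet D e" using base_subset_sheet sheet_V_D by blast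
  show "continuous_on base (sheet_function e 0)"
   by (rule continuous_on_subset[OF holomorphic_on_imp_continuous_on[OF analytic_imp_holomorphic[OF sheet_function(1)[OF e]]] base_subset_sheet])
  show "sheet_function e 0 z = direct_value f e z" if "z : base" for z
   using sheet_function_0[OF e] base_subset_sheet that by blast
 qed (rule base_star)
qed

lemma sheet_family_function:
 assumes e: "e = 1 \<or> e = -1"
 shows "sheet_family V e (sheet_function (-e) 0) (sheet_function e)"
proof (intro sheet_family.intro sheet_family_axioms.intro wedge_V[OF e])
 have e': "-e = 1 \<or> -e = -1" using e by auto
 show "sheet_function e k analytic_on sheet V e" for k by (rule sheet_function(1)[OF e])
 show "sheet_function (-e) 0 analytic_on sheet V (-e)" by (rule sheet_function(1)[OF e'])
 show "radially_integrable (wedge.base V e) (sheet_function e 0)" by (rule radially_integrable_base[OF e])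
 show "radially_integrable (wedge.base V (-e)) (sheet_function (-e) 0)" by (rule radially_integrable_base[OF e'])
 fix x :: real and k :: nat assume x: "0 < x" "x < 1"
 have s: "(of_real x :: complex) : sheet V e"
  using x of_real_in_V[of x] not_Nats_between[of 0 x] by (auto simp: sheet_def of_real_in_Nats_iff)
 have kx: "real k < real k + x" "real k + x < real k + 1" "0 < real k + x" using x by auto
 have s': "(of_real (real k + x) :: complex) : sheet V (-e)"
  using kx of_real_in_V[of "real k + x"] not_Nats_between[OF kx(1,2)] by (auto simp: sheet_def of_real_in_Nats_iff simp del: of_real_add)
 have "sheet_function e k (of_real x) = crossing_value f e k (of_real (real k + x))" using sheet_function(2)[OF e s, of k] by simp
 also have "\<dots> = direct_value f (-e) (of_real (real k + x))" by (rule crossing_value_real[OF f e kx(1,2)])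
 also have "\<dots> = sheet_function (-e) 0 (of_real (real k + x))" using sheet_function_0[OF e' s'] by simp
 finally show "sheet_function e k (of_real x) = sheet_function (-e) 0 (of_nat k + of_real x)" by simp
qed

end

end

end

section \<open>Balanced weights and the convolution of balanced sums\<close>

text \<open>Summation by parts turns the balanced average on (n, n+1) into a combination of branches
  with these weights: 1/2, 1/4, ..., with the last one repeated, so that they add up to 1.\<close>

definition balanced_weight :: "nat => nat => complex" where
 "balanced_weight n j = (if j < n then (1/2) ^ Suc j else (1/2) ^ n)"

text \<open>
 The weights \<open>balanced_weight n\<close> are multiplicative: the terms with \<open>m - Suc k\<close> are the corrections
 coming from the overlaps, and at \<open>s\<close> in \<open>(n, n + 1)\<close>, \<open>p - s\<close> in \<open>(l, l + 1)\<close> and \<open>p\<close> in \<open>(N, N + 1)\<close>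
 only \<open>n + l = N\<close> and \<open>n + l = N - 1\<close> occur.
\<close>

lemma balanced_weight_convolution:
 assumes N: "n + l = N \<or> Suc (n + l) = N"
 shows "(\<Sum>m\<le>N. balanced_weight N m * ((\<Sum>k\<le>m. if k <= n & m - k <= l then P k (m - k) else 0) -
   (\<Sum>k<m. (if Suc k <= n & Suc (m - Suc k) <= l then P k (m - Suc k) else 0) -
        (if n <= k & l <= m - Suc k then P k (m - Suc k) else 0)))) =
  (\<Sum>j\<le>n. \<Sum>i\<le>l. balanced_weight n j * balanced_weight l i * P j i)" (is "?lhs = ?rhs")
proof -
 let ?w = balanced_weight
 define T where "T = {(j, i). j + i <= N}"
 have finT: "finite T" by (rule finite_subset[of _ "{..N} \<times> {..N}"]) (auto simp: T_def)
 define a where "a j i = (if j <= n & i <= l then P j i else 0)" for j i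
 define b where "b j i = (if Suc j <= n & Suc i <= l then P j i else 0) - (if n <= j & l <= i then P j i else 0)" for j i
 have "?lhs = (\<Sum>m\<le>N. \<Sum>k\<le>m. ?w N (k + (m - k)) * a k (m - k)) - (\<Sum>m\<le>N. \<Sum>k<m. ?w N m * b k (m - Suc k))"
  unfolding sum_subtractf[symmetric] by (intro sum.cong refl) (simp add: right_diff_distrib sum_distrib_left a_def b_def)
 also have "(\<Sum>m\<le>N. \<Sum>k\<le>m. ?w N (k + (m - k)) * a k (m - k)) = (\<Sum>(j, i)\<in>T. ?w N (j + i) * a j i)"
  unfolding T_def by (subst sum.triangle_reindex_eq) simp
 also have "(\<Sum>m\<le>N. \<Sum>k<m. ?w N m * b k (m - Suc k)) = (\<Sum>m<N. \<Sum>k\<le>m. ?w N (Suc (k + (m - k))) * b k (m - k))"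
  by (subst sum.atMost_shift) (simp add: lessThan_Suc_atMost)
 also have "\<dots> = (\<Sum>(j, i)\<in>{(j, i). j + i < N}. ?w N (Suc (j + i)) * b j i)"
  by (subst sum.triangle_reindex) simp
 also have "\<dots> = (\<Sum>(j, i)\<in>T. if j + i < N then ?w N (Suc (j + i)) * b j i else 0)"
  by (rule sum.mono_neutral_cong_left[OF finT]) (auto simp: T_def split: if_splits)
 finally have "?lhs = (\<Sum>(j, i)\<in>T. ?w N (j + i) * a j i - (if j + i < N then ?w N (Suc (j + i)) * b j i else 0))"
  by (simp add: sum_subtractf case_prod_unfold)
 also have "\<dots> = (\<Sum>(j, i)\<in>T. if j <= n & i <= l then ?w n j * ?w l i * P j i else 0)"
 proof (intro sum.cong refl, safe)
  fix j i assume "(j, i) : T"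
  then have ji: "j + i <= N" by (simp add: T_def)
  consider "j < n" "i < l" | "j < n" "i = l" | "j = n" "i < l" | "j = n" "i = l" | "\<not> (j <= n & i <= l)" by linarith
  then show "?w N (j + i) * a j i - (if j + i < N then ?w N (Suc (j + i)) * b j i else 0) =
   (if j <= n & i <= l then ?w n j * ?w l i * P j i else 0)"
  proof cases
   \<comment> \<open>Here the correction applies, and 2^-(j+i+1) - 2^-(j+i+2) = 2^-(j+1) *
     2^-(i+1).\<close>
   case 1
   then have "j + i < N" "Suc (j + i) < N" using N by auto
   then show ?thesis using 1 by (simp add: balanced_weight_def a_def b_def power_add field_simps)
  next
   case 2
   then have "j + i < N" using N by auto
   then show ?thesis using 2 by (simp add: balanced_weight_def a_def b_def power_add)
  next
   case 3
   then have "j + i < N" using N by auto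
   then show ?thesis using 3 by (simp add: balanced_weight_def a_def b_def power_add)
  next
   case 4
   show ?thesis
   proof (cases "n + l = N")
    case True
    then show ?thesis using 4 by (simp add: balanced_weight_def a_def power_add[symmetric])
   next
    case False
    \<comment> \<open>The correction has the opposite sign here, and the last two weights for N
      coincide: 2^-N + 2^-N = 2^-n * 2^-l.\<close>
    then have "Suc (n + l) = N" using N by simp
    then have "N = Suc (n + l)" by simp
    then show ?thesis using 4 by (simp add: balanced_weight_def a_def b_def power_add)
   qed
  next
   case 5
   then have "\<not> (n <= j & l <= i & j + i < N)" using N by auto
   then show ?thesis using 5 by (auto simp: a_def b_def)
  qed
 qed
 also have "\<dots> = (\<Sum>(j, i)\<in>{..n} \<times> {..l}. ?w n j * ?w l i * P j i)"
  by (rule sum.mono_neutral_cong_right[OF finT]) (use N in \<open>auto simp: T_def split: if_splits\<close>)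
 also have "\<dots> = ?rhs" by (simp add: sum.cartesian_product)
 finally show ?thesis .
qed

lemma absolutely_integrable_restrict_interval:
 fixes f :: "real => 'a::euclidean_space"
 assumes f: "f absolutely_integrable_on {a..b}" and sub: "{a..b} <= {0..p}"
 shows "(%s. if a <= s & s <= b then f s else 0) absolutely_integrable_on {0..p}"
  and "((%s. if a <= s & s <= b then f s else 0) has_integral integral {a..b} f) {0..p}"
proof -
 have eq: "(%s. if a <= s & s <= b then g s else 0) = (%s. if s : {a..b} then g s else 0)" for g :: "real => 'b::zero"
  by auto
 have "(f has_integral integral {a..b} f) {a..b}" using f by (simp add: absolutely_integrable_on_def has_integral_integral)
 then show I: "((%s. if a <= s & s <= b then f s else 0) has_integral integral {a..b} f) {0..p}"
  unfolding eq by (simp only: has_integral_restrict[OF sub])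
 have "((%x. norm (f x)) has_integral integral {a..b} (%x. norm (f x))) {a..b}"
  using f by (simp add: absolutely_integrable_on_def has_integral_integral)
 then have "((%s. if s : {a..b} then norm (f s) else 0) has_integral integral {a..b} (%x. norm (f x))) {0..p}"
  by (simp only: has_integral_restrict[OF sub])
 moreover have "(%s. norm (if a <= s & s <= b then f s else 0)) = (%s. if s : {a..b} then norm (f s) else 0)" by auto
 ultimately show "(%s. if a <= s & s <= b then f s else 0) absolutely_integrable_on {0..p}"
  using I unfolding absolutely_integrable_on_def by (auto simp: integrable_on_def)
qed

lemma integral_shift_interval:
 fixes f :: "real => 'a::euclidean_space"
 assumes f: "f absolutely_integrable_on {a - c..b - c}"
 shows "(%s. f (s - c)) absolutely_integrable_on {a..b}" "integral {a..b} (%s. f (s - c)) = integral {a - c..b - c} f"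
proof -
 have sh: "((%s. g (s - c)) has_integral i) {a..b}" if "(g has_integral i) {a - c..b - c}" for g :: "real => 'b::euclidean_space" and i
 proof -
  have "(g has_integral i) (cbox (a - c) (b - c))" using that by simp
  from has_integral_affinity'[OF this, of 1 "- c"] show ?thesis by simp
 qed
 have 1: "((%s. f (s - c)) has_integral integral {a - c..b - c} f) {a..b}"
  using f by (intro sh) (simp add: absolutely_integrable_on_def has_integral_integral)
 have 2: "((%s. norm (f (s - c))) has_integral integral {a - c..b - c} (%x. norm (f x))) {a..b}"
  using f by (intro sh[of "%x. norm (f x)"]) (simp add: absolutely_integrable_on_def has_integral_integral)
 show "integral {a..b} (%s. f (s - c)) = integral {a - c..b - c} f" using 1 by (rule integral_unique)
 show "(%s. f (s - c)) absolutely_integrable_on {a..b}"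
  using 1 2 unfolding absolutely_integrable_on_def by (auto simp: integrable_on_def)
qed

context integrable_sheet_pair
begin

text \<open>Each sheet value at p - m is a sum of integrals of boundary values; shifted by k, all of
  them run over subintervals of [0, p]. At a fixed s the weighted sum of integrands is a combination
  of products A k (s - k) * B i (p - s - i), and \<open>balanced_weight_convolution\<close> turns it
  into Fb s * Gb (p - s) off a countable set.\<close>

lemma balanced_convolution:
 assumes p: "real N < p" "p < real N + 1"
  and F: "!!n s. [|real n < s; s < real n + 1|] ==> Fb s = (\<Sum>k\<le>n. balanced_weight n k * A k (of_real (s - real k)))"
  and G: "!!n s. [|real n < s; s < real n + 1|] ==> Gb s = (\<Sum>k\<le>n. balanced_weight n k * B k (of_real (s - real k)))"
  and C: "!!m. C m analytic_on sheet V e"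
   "!!m ep z. [|admissible ep; z : region ep; z ~= 1/2|] ==> C m z = zigzag e ep L A M B m z"
 shows "set_integrable lborel {0..p} (%s. Fb s * Gb (p - s))"
  and "(\<Sum>m\<le>N. balanced_weight N m * C m (of_real (p - real m))) = (LINT s:{0..p}|lborel. Fb s * Gb (p - s))"
proof -
 have nat_shift: "p - real j ~: \<nat>" "0 < p - real j" if "j <= N" for j
  using not_Nats_between[of "N - j" "p - real j"] p that by (auto simp: of_nat_diff)
 have pN: "p ~: \<nat>" using not_Nats_between p by blast
 define pz where "pz k i s = A k (of_real (s - real k)) * B i (of_real (p - s - real i))" for k i s
 define ph where "ph k i x = A k (of_real x) * B i (of_real (p - real (k + i) - x))" for k i x
 have phint: "ph k i absolutely_integrable_on {0..p - real (k + i)}" if "k + i <= N" for k i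
  unfolding ph_def by (rule sheet_product_integrable(1)) (use nat_shift[OF that] in auto)
 have pzph: "pz k i = (%s. ph k i (s - real k))" for k i
 proof
  fix s
  have "p - real (k + i) - (s - real k) = p - s - real i" by simp
  then show "pz k i s = ph k i (s - real k)" unfolding pz_def ph_def by (simp only:)
 qed
 have piece: "pz k i absolutely_integrable_on {a..b} & integral {a..b} (pz k i) = integral {a - real k..b - real k} (ph k i)"
  if ki: "k + i <= N" and ab: "real k <= a" "b <= p - real i" for k i a b
 proof -
  have "ph k i absolutely_integrable_on {a - real k..b - real k}"
   by (rule set_integrable_subset[OF phint[OF ki]]) (use ab in auto)
  from integral_shift_interval[OF this] show ?thesis by (simp add: pzph)
 qed
 have restr: "(%s. if a <= s & s <= b then pz k i s else 0) absolutely_integrable_on {0..p}"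
  "((%s. if a <= s & s <= b then pz k i s else 0) has_integral integral {a - real k..b - real k} (ph k i)) {0..p}"
  if ki: "k + i <= N" and ab: "real k <= a" "b <= p - real i" for k i a b
 proof -
  have sub: "{a..b} <= {0..p}" using ab by auto
  note pc = piece[OF ki ab]
  show "(%s. if a <= s & s <= b then pz k i s else 0) absolutely_integrable_on {0..p}"
   by (rule absolutely_integrable_restrict_interval(1)[OF conjunct1[OF pc] sub])
  show "((%s. if a <= s & s <= b then pz k i s else 0) has_integral integral {a - real k..b - real k} (ph k i)) {0..p}"
   using absolutely_integrable_restrict_interval(2)[OF conjunct1[OF pc] sub] pc by simp
 qed
 \<comment> \<open>E1 is the outward leg, from k to p - i. E2 - E3 is the oriented integral from k +
   1 to p - i - 1, where E3 takes over when these end points are in reverse order.\<close>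
 define E1 where "E1 k i s = (if real k <= s & s <= p - real i then pz k i s else 0)" for k i s
 define E2 where "E2 k i s = (if real k + 1 <= s & s <= p - real i - 1 then pz k i s else 0)" for k i s
 define E3 where "E3 k i s = (if p - real i - 1 <= s & s <= real k + 1 then pz k i s else 0)" for k i s
 have E1: "E1 k i absolutely_integrable_on {0..p}" "(E1 k i has_integral boundary_integral (A k) (B i) (p - real (k + i)) (p - real (k + i))) {0..p}"
  if "k + i <= N" for k i
  using restr[OF that, of "real k" "p - real i"] unfolding E1_def boundary_integral_def ph_def
  by (simp_all add: algebra_simps)
 have E2: "E2 k i absolutely_integrable_on {0..p}" "(E2 k i has_integral integral {1..p - real (Suc (k + i))} (ph k i)) {0..p}"
  if "Suc (k + i) <= N" for k i
  using restr[of k i "real k + 1" "p - real i - 1"] that unfolding E2_def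
  by (simp_all add: algebra_simps)
 have E3: "E3 k i absolutely_integrable_on {0..p}" "(E3 k i has_integral integral {p - real (Suc (k + i))..1} (ph k i)) {0..p}"
  if "Suc (k + i) <= N" for k i
  using restr[of k i "p - real i - 1" "real k + 1"] that p unfolding E3_def
  by (simp_all add: algebra_simps)
 have E23: "((%s. E2 k i s - E3 k i s) has_integral
   (boundary_integral (A k) (B i) (p - real (Suc (k + i)) + 1) (p - real (Suc (k + i))) -
    boundary_integral (A k) (B i) (p - real (Suc (k + i)) + 1) 1)) {0..p}" if ki: "Suc (k + i) <= N" for k i
 proof -
  define q where "q = p - real (Suc (k + i))"
  have q: "0 < q" "p - real (k + i) = q + 1" using nat_shift(2)[OF ki] by (auto simp: q_def)
  have ki': "k + i <= N" using ki by simp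
  have int: "ph k i integrable_on {0..q + 1}" using phint[OF ki'] unfolding q(2) by (simp add: absolutely_integrable_on_def)
  have bi: "boundary_integral (A k) (B i) (q + 1) u = integral {0..u} (ph k i)" for u
   unfolding boundary_integral_def ph_def q(2) ..
  have comb: "integral {0..u} (ph k i) + integral {u..v} (ph k i) = integral {0..v} (ph k i)" if "0 <= u" "u <= v" "v <= q + 1" for u v
   by (rule Henstock_Kurzweil_Integration.integral_combine) (use that integrable_subinterval_real[OF int, of 0 v] in auto)
  have "integral {1..q} (ph k i) - integral {q..1} (ph k i) = integral {0..q} (ph k i) - integral {0..1} (ph k i)"
  proof (cases "1 <= q")
   case True
   then have "integral {q..1} (ph k i) = 0" by (cases "q = 1") auto
   then show ?thesis using comb[of 1 q] True by (simp add: eq_diff_eq add.commute)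
  next
   case False
   then have "integral {1..q} (ph k i) = 0" by simp
   then show ?thesis using comb[of q 1] q(1) False by (simp add: eq_diff_eq diff_eq_eq algebra_simps)
  qed
  then show ?thesis using has_integral_diff[OF E2(2)[OF ki] E3(2)[OF ki]] unfolding q_def[symmetric] bi by simp
 qed
 define T where "T s = (\<Sum>m\<le>N. balanced_weight N m * ((\<Sum>k\<le>m. E1 k (m - k) s) - (\<Sum>k<m. E2 k (m - Suc k) s - E3 k (m - Suc k) s)))" for s
 have Tint: "T absolutely_integrable_on {0..p}" unfolding T_def
  by (intro absolutely_integrable_sum set_integrable_mult_right set_integral_diff(1) E1(1) E2(1) E3(1)) auto
 have hasT: "(T has_integral (\<Sum>m\<le>N. balanced_weight N m * C m (of_real (p - real m)))) {0..p}" unfolding T_def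
 proof (intro has_integral_sum has_integral_mult_right)
  fix m assume m: "m : {..N}"
  have Cm: "C m (of_real (p - real m)) = (\<Sum>k\<le>m. boundary_integral (A k) (B (m - k)) (p - real m) (p - real m)) -
    (\<Sum>k<m. boundary_integral (A k) (B (m - Suc k)) (p - real m + 1) (p - real m) - boundary_integral (A k) (B (m - Suc k)) (p - real m + 1) 1)"
   by (intro sheet_convolution_at_real C nat_shift) (use m in auto)
  show "((%s. (\<Sum>k\<le>m. E1 k (m - k) s) - (\<Sum>k<m. E2 k (m - Suc k) s - E3 k (m - Suc k) s)) has_integral C m (of_real (p - real m))) {0..p}"
   unfolding Cm
  proof (rule has_integral_diff; rule has_integral_sum)
   show "(E1 k (m - k) has_integral boundary_integral (A k) (B (m - k)) (p - real m) (p - real m)) {0..p}" if "k : {..m}" for k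
    using E1(2)[of k "m - k"] that m by simp
   show "((%s. E2 k (m - Suc k) s - E3 k (m - Suc k) s) has_integral boundary_integral (A k) (B (m - Suc k)) (p - real m + 1) (p - real m) -
     boundary_integral (A k) (B (m - Suc k)) (p - real m + 1) 1) {0..p}" if "k : {..<m}" for k
   proof -
    have eq: "Suc (k + (m - Suc k)) = m" using that by simp
    have "m <= N" using m by simp
    then show ?thesis by (rule E23[of k "m - Suc k", unfolded eq])
   qed
  qed auto
 qed simp
 have eqT: "T s = Fb s * Gb (p - s)" if s: "s : {0..p} - integers_from_ends p" for s
 proof -
  have sN: "s ~: \<nat>" "p - s ~: \<nat>" using s by (auto simp: integers_from_ends_def)
  have "0 < s" "0 < p - s" using s sN by (auto simp: less_le)
  then obtain n l where n: "real n < s" "s < real n + 1" and l: "real l < p - s" "p - s < real l + 1"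
   using between_Nats[of s] between_Nats[of "p - s"] sN by metis
  \<comment> \<open>The integer parts of s and p - s add up to N or to N - 1.\<close>
  have nl: "n + l = N \<or> Suc (n + l) = N" using n l p by linarith
  have e1: "E1 k i s = (if k <= n & i <= l then pz k i s else 0)" for k i
  proof -
   have "real k <= s \<longleftrightarrow> k <= n" "s <= p - real i \<longleftrightarrow> i <= l" using n l by linarith+
   then show ?thesis by (simp add: E1_def)
  qed
  have e2: "E2 k i s = (if Suc k <= n & Suc i <= l then pz k i s else 0)" for k i
  proof -
   have "real k + 1 <= s \<longleftrightarrow> Suc k <= n" "s <= p - real i - 1 \<longleftrightarrow> Suc i <= l" using n l by linarith+
   then show ?thesis by (simp add: E2_def)
  qed
  have e3: "E3 k i s = (if n <= k & l <= i then pz k i s else 0)" for k i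
  proof -
   have "s <= real k + 1 \<longleftrightarrow> n <= k" "p - real i - 1 <= s \<longleftrightarrow> l <= i" using n l sN by linarith+
   then show ?thesis by (auto simp: E3_def)
  qed
  have "T s = (\<Sum>j\<le>n. \<Sum>i\<le>l. balanced_weight n j * balanced_weight l i * pz j i s)"
   unfolding T_def e1 e2 e3 by (rule balanced_weight_convolution[OF nl, of "%k i. pz k i s"])
  also have "\<dots> = Fb s * Gb (p - s)"
   unfolding F[OF n] G[OF l] sum_product by (intro sum.cong refl) (simp add: pz_def algebra_simps)
  finally show ?thesis .
 qed
 note neg = negligible_integers_from_ends[of p]
 have "T absolutely_integrable_on {0..p} - integers_from_ends p"
  using Tint by (simp only: absolutely_integrable_on_diff_negligible[OF neg])
 then have "(%s. Fb s * Gb (p - s)) absolutely_integrable_on {0..p} - integers_from_ends p"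
  by (rule set_integrable_cong[THEN iffD1, rotated -1]) (use eqT in auto)
 then have abs: "(%s. Fb s * Gb (p - s)) absolutely_integrable_on {0..p}"
  by (simp only: absolutely_integrable_on_diff_negligible[OF neg])
 have hasF: "((%s. Fb s * Gb (p - s)) has_integral (\<Sum>m\<le>N. balanced_weight N m * C m (of_real (p - real m)))) {0..p}"
  by (rule has_integral_spike[OF neg _ hasT]) (use eqT in simp)
 define O' where "O' = {0<..<p} - integers_from_ends p"
 \<comment> \<open>Integrability with respect to \<open>lborel\<close> asks for Borel measurability:
   the product is continuous on the open set \<open>O'\<close>, and what is left of [0, p] is
   countable.\<close>
 have meas: "(%s. indicator {0..p} s *\<^sub>R (Fb s * Gb (p - s))) : borel_measurable borel"
 proof -
  have Nats_closed: "closed (\<nat> :: real set)" by (rule closed_Nats)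
  have "integers_from_ends p = \<nat> \<union> (%x. p - x) -` \<nat>" by (auto simp: integers_from_ends_def)
  moreover have "closed ((%x. p - x) -` (\<nat> :: real set))"
   by (rule continuous_closed_vimage[OF Nats_closed]) (intro continuous_intros)
  ultimately have "closed (integers_from_ends p)" using Nats_closed by (simp add: closed_Un)
  then have O': "open O'" unfolding O'_def by (intro open_Diff) auto
  have contT: "continuous_on O' (%s. Fb s * Gb (p - s))"
  proof (rule continuous_at_imp_continuous_on, rule ballI)
   fix s assume s: "s : O'"
   have sN: "s ~: \<nat>" "p - s ~: \<nat>" "0 < s" "0 < p - s" using s by (auto simp: O'_def integers_from_ends_def)
   obtain n where n: "real n < s" "s < real n + 1" using between_Nats[OF sN(3,1)] .
   obtain l where l: "real l < p - s" "p - s < real l + 1" using between_Nats[OF sN(4,2)] .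
   define U where "U = {real n<..<real n + 1} \<inter> {p - real l - 1<..<p - real l}"
   have "open U" "s : U" using n l by (auto simp: U_def)
   have contA: "isCont (%s. A' (of_real (c s) :: complex)) s" if "A' analytic_on sheet V e" "isCont c s" "0 < c s" "c s ~: \<nat>" for A' :: "complex => complex" and c
   proof -
    have "isCont A' (of_real (c s))" using that of_real_sheet[of "c s"] analytic_at_imp_isCont analytic_on_subset[of A' "sheet V e" "{of_real (c s)}"] by blast
    then show ?thesis using that(2) by (intro isCont_o2[of s "%s. of_real (c s)" A'] continuous_intros) auto
   qed
   have nN: "s - real k ~: \<nat>" "0 < s - real k" if "k <= n" for k
    using not_Nats_between[of "n - k" "s - real k"] n that by (auto simp: of_nat_diff)
   have lN: "p - s - real k ~: \<nat>" "0 < p - s - real k" if "k <= l" for k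
    using not_Nats_between[of "l - k" "p - s - real k"] l that by (auto simp: of_nat_diff)
   have "isCont (%s. (\<Sum>k\<le>n. balanced_weight n k * A k (of_real (s - real k))) * (\<Sum>k\<le>l. balanced_weight l k * B k (of_real (p - s - real k)))) s"
    by (intro continuous_mult continuous_sum continuous_const contA F.A G.A continuous_diff continuous_ident nN lN) auto
   moreover have "\<forall>\<^sub>F x in nhds s. Fb x * Gb (p - x) = (\<Sum>k\<le>n. balanced_weight n k * A k (of_real (x - real k))) * (\<Sum>k\<le>l. balanced_weight l k * B k (of_real (p - x - real k)))"
    unfolding eventually_nhds
   proof (intro exI[of _ U] conjI ballI \<open>open U\<close> \<open>s : U\<close>)
    fix x assume "x : U"
    then show "Fb x * Gb (p - x) = (\<Sum>k\<le>n. balanced_weight n k * A k (of_real (x - real k))) * (\<Sum>k\<le>l. balanced_weight l k * B k (of_real (p - x - real k)))"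
     using F[of n x] G[of l "p - x"] by (auto simp: U_def)
   qed
   ultimately show "isCont (%s. Fb s * Gb (p - s)) s" by (simp add: isCont_cong)
  qed
  have m: "(%s. indicator O' s *\<^sub>R (Fb s * Gb (p - s))) : borel_measurable borel"
   by (rule borel_measurable_continuous_on_indicator[OF _ contT]) (use O' in auto)
  have eq: "indicator O' s *\<^sub>R (Fb s * Gb (p - s)) = indicator {0..p} s *\<^sub>R (Fb s * Gb (p - s))" if "s ~: integers_from_ends p" for s
  proof -
   have "s ~= 0" "s ~= p" using that by (auto simp: integers_from_ends_def)
   then have "s : O' \<longleftrightarrow> s : {0..p}" using that by (auto simp: O'_def)
   then show ?thesis by (simp add: indicator_def)
  qed
  show ?thesis
   by (rule measurable_discrete_difference[OF m countable_integers_from_ends _ _ eq]) simp_all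
 qed
 show si: "set_integrable lborel {0..p} (%s. Fb s * Gb (p - s))"
  using abs meas unfolding set_integrable_def by (subst (asm) integrable_completion) auto
 show "(\<Sum>m\<le>N. balanced_weight N m * C m (of_real (p - real m))) = (LINT s:{0..p}|lborel. Fb s * Gb (p - s))"
  using set_borel_integral_eq_integral(2)[OF si] integral_unique[OF hasF] by simp
qed

end

section \<open>Balanced averages in terms of sheet functions\<close>

context sector
begin

text \<open>The pair is well determined by \<open>kind_unique\<close>; the crossing time is
  forgotten, since reparametrisation changes it.\<close>

definition kind_of :: "(real => complex) => real \<times> nat" where
 "kind_of ga = (SOME em. (fst em = 1 \<or> fst em = -1) & (\<exists>c. kind ga (fst em) (snd em) c))"

lemma kind_of_eq:
 assumes "curve ga" "kind ga e m c" "e = 1 \<or> e = -1"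
 shows "kind_of ga = (e, m)"
 unfolding kind_of_def
proof (rule some_equality)
 show "(fst (e, m) = 1 \<or> fst (e, m) = -1) & (\<exists>c. kind ga (fst (e, m)) (snd (e, m)) c)" using assms by auto
 fix em assume em: "(fst em = 1 \<or> fst em = -1) & (\<exists>c. kind ga (fst em) (snd em) c)"
 then obtain c' where "kind ga (fst em) (snd em) c'" by blast
 then show "em = (e, m)" using kind_unique[OF assms(1) assms(2), of "fst em" "snd em" c'] em assms(3) by (auto simp: prod_eq_iff)
qed

text \<open>Off the axis the exceptional alternative of \<open>kind_stable\<close> cannot occur, so
  the kind is locally constant along homotopies.\<close>

lemma kind_of_class:
 assumes "ga : R1_class W ga0" "Im (ga0 1) ~= 0"
 shows "kind_of ga = kind_of ga0"
proof (rule R1_class_invariant[OF _ assms(1) refl])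
 fix sg assume sg: "curve sg" "sg 1 = ga0 1"
 obtain e m c where k: "e = 1 \<or> e = -1" "kind sg e m c" using kind_exists[OF sg(1)] .
 obtain de where de: "de > 0" "!!ga'. [|curve ga'; !!t. t : {0..1} ==> dist (ga' t) (sg t) < de|] ==>
  (\<exists>c'. kind ga' e m c') \<or>
  (m = 0 & Im (sg 1) = 0 & (\<exists>N c'. real N < Re (sg 1) & Re (sg 1) < real N + 1 & kind ga' (-e) N c'))"
  using kind_stable[OF sg(1) k(2,1)] by blast
 show "\<exists>de>0. \<forall>ga'. curve ga' & ga' 1 = ga0 1 & (\<forall>t\<in>{0..1}. dist (ga' t) (sg t) < de) --> kind_of ga' = kind_of sg"
 proof (intro exI[of _ de] conjI de(1) allI impI)
  fix ga' assume h: "curve ga' & ga' 1 = ga0 1 & (\<forall>t\<in>{0..1}. dist (ga' t) (sg t) < de)"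
  then obtain c' where "kind ga' e m c'" using de(2)[of ga'] assms(2) sg(2) by auto
  then show "kind_of ga' = kind_of sg" using kind_of_eq[OF sg(1) k(2,1)] kind_of_eq[of ga' e m c'] h k(1) by simp
 qed
qed

lemma open_half_D: "open (half D e)"
proof -
 have "half D e = D \<inter> {z. 0 < e * Im z}" by (auto simp: half_def)
 then show ?thesis using open_D by (auto intro!: open_Int open_Collect_less continuous_intros)
qed

lemma half_D_star: "[|z : half D e; 0 < t|] ==> of_real t * z : half D e"
 using cone_D[of z t] by (auto simp: half_def mult.left_commute[of e])

lemma half_sheet_D: "half D e <= sheet D e"
 using Nats_Im_0 by (force simp: half_def sheet_def)

lemma of_real_sheet_V: "[|0 < x; x ~: \<nat>|] ==> of_real x : sheet V e"
 using of_real_in_V by (simp add: sheet_def of_real_in_Nats_iff)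

lemma balanced_sum:
 fixes c :: "nat => complex"
 shows "c 0 + (\<Sum>k<n. (1/2) ^ Suc k * (c (Suc k) - c k)) = (\<Sum>k\<le>n. balanced_weight n k * c k)"
proof -
 have "c 0 + (\<Sum>k<n. (1/2) ^ Suc k * (c (Suc k) - c k)) = (\<Sum>k<n. (1/2) ^ Suc k * c k) + (1/2) ^ n * c n"
 proof (induction n)
  case (Suc n)
  define X :: complex where "X = (1/2) ^ Suc n"
  have X: "(1/2) ^ n = X + X" by (simp add: X_def)
  have "c 0 + (\<Sum>k<Suc n. (1/2) ^ Suc k * (c (Suc k) - c k)) = (c 0 + (\<Sum>k<n. (1/2) ^ Suc k * (c (Suc k) - c k))) + X * (c (Suc n) - c n)"
   by (simp only: sum.lessThan_Suc add.assoc X_def)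
  also have "\<dots> = ((\<Sum>k<n. (1/2) ^ Suc k * c k) + X * c n) + X * c (Suc n)"
   unfolding Suc X by (simp only: ring_distribs) simp
  finally show ?case by (simp only: sum.lessThan_Suc X_def)
 qed simp
 also have "\<dots> = (\<Sum>k\<le>n. balanced_weight n k * c k)"
  unfolding lessThan_Suc_atMost[symmetric] sum.lessThan_Suc by (simp add: balanced_weight_def)
 finally show ?thesis .
qed

text \<open>On (n, n+1) the Heaviside factors cut the series after n terms. By the convention in
  \<open>crossing_cont\<close> its last branch, with k = n, is the lower continuation.\<close>

lemma balanced_average_branches:
 assumes p: "real n < p" "p < real n + 1"
  and upper: "!!ga. [|curve ga; ga 1 = of_real p; kind ga 1 0 0|] ==> F (R1_class W ga) = c 0"
  and cross: "!!k ga t. [|k < n; curve ga; ga 1 = of_real p; kind ga 1 k t; 0 < t|] ==> F (R1_class W ga) = c k"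
  and lower: "!!ga. [|curve ga; ga 1 = of_real p; kind ga (-1) 0 0|] ==> F (R1_class W ga) = c n"
 shows "balanced_average W F p = (\<Sum>k\<le>n. balanced_weight n k * c k)"
proof -
 have pp: "0 < p" "p ~: \<nat>" using p not_Nats_between by (auto intro: le_less_trans)
 note sV = of_real_sheet_V[OF pp]
 have "R1_value W (%ga. \<forall>t\<in>{0<..<1}. 0 < 1 * Im (ga t)) F (of_real p) = c 0"
 proof (rule R1_value_strict)
  show "of_real p : sheet D 1" by (rule sheet_V_D[OF sV])
 qed (simp, rule upper)
 then have u: "upper_cont W F (of_real p) = c 0" unfolding upper_cont_def by (simp only: mult_1)
 have "R1_value W (%ga. \<forall>t\<in>{0<..<1}. 0 < -1 * Im (ga t)) F (of_real p) = c n"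
 proof (rule R1_value_strict)
  show "of_real p : sheet D (-1)" by (rule sheet_V_D[OF sV])
 qed (simp, rule lower)
 then have l: "lower_cont W F (of_real p) = c n" unfolding lower_cont_def by (simp only: mult_minus1 neg_0_less_iff_less)
 have cr: "crossing_cont W F k (of_real p) = c k" if k: "k <= n" for k
 proof (cases "k = n")
  case True
  then show ?thesis using l p by (simp add: crossing_cont_def)
 next
  case False
  then have kn: "k < n" using k by simp
  then have "real k + 1 <= p" "real k < Re (of_real p)" using p by auto
  then show ?thesis using R1_value_crossing[of "of_real p" k F "c k", OF sV] cross[OF kn] by (simp add: crossing_cont_def)
 qed
 have "(\<Sum>k. (1/2) ^ Suc k * (crossing_cont W F (Suc k) (of_real p) - crossing_cont W F k (of_real p)) * heaviside (p - real (Suc k))) =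
  (\<Sum>k<n. (1/2) ^ Suc k * (crossing_cont W F (Suc k) (of_real p) - crossing_cont W F k (of_real p)) * heaviside (p - real (Suc k)))"
 proof (rule suminf_finite)
  fix k assume "k ~: {..<n}"
  then have "p - real (Suc k) < 0" using p by auto
  then show "(1/2) ^ Suc k * (crossing_cont W F (Suc k) (of_real p) - crossing_cont W F k (of_real p)) * heaviside (p - real (Suc k)) = 0"
   by (simp add: heaviside_def)
 qed simp
 also have "\<dots> = (\<Sum>k<n. (1/2) ^ Suc k * (c (Suc k) - c k))"
 proof (rule sum.cong[OF refl])
  fix k assume "k : {..<n}"
  then have "Suc k <= n" "k <= n" "\<not> p - real (Suc k) < 0" using p by auto
  then show "(1/2) ^ Suc k * (crossing_cont W F (Suc k) (of_real p) - crossing_cont W F k (of_real p)) * heaviside (p - real (Suc k)) =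
    (1/2) ^ Suc k * (c (Suc k) - c k)" using cr by (simp add: heaviside_def)
 qed
 finally show ?thesis unfolding balanced_average_def u using balanced_sum[of c n] by simp
qed

context
 fixes f :: R1_fun
 assumes f: "R1_analytic_on W (R1 W) f"
begin

text \<open>The upper continuation is the sheet 0 by \<open>crossing_value_0\<close>, and on (n,
  n+1) the lower continuation is the sheet n by \<open>crossing_value_real\<close>.\<close>

lemma balanced_average_sheet_function:
 assumes p: "real n < p" "p < real n + 1"
 shows "balanced_average W f p = (\<Sum>k\<le>n. balanced_weight n k * sheet_function f 1 k (of_real (p - real k)))"
proof (rule balanced_average_branches[OF p])
 have pp: "0 < p" "p ~: \<nat>" using p not_Nats_between by (auto intro: le_less_trans)
 have sf: "sheet_function f 1 k (of_real (p - real k)) = crossing_value f 1 k (of_real p)" if k: "k <= n" for k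
 proof -
  have "0 < p - real k" "p - real k ~: \<nat>" using not_Nats_between[of "n - k" "p - real k"] k p by (auto simp: of_nat_diff)
  then have "sheet_function f 1 k (of_real (p - real k)) = crossing_value f 1 k (of_nat k + of_real (p - real k))"
   by (intro sheet_function(2)[OF f] of_real_sheet_V) auto
  then show ?thesis by simp
 qed
 fix ga assume ga: "curve ga" "ga 1 = of_real p"
 show "f (R1_class W ga) = sheet_function f 1 0 (of_real (p - real 0))" if "kind ga 1 0 0"
  using direct_value_eq[OF ga(1) that ga(2), of f] sf[of 0] crossing_value_0[OF f, of 1, OF _ of_real_sheet_V[OF pp]] by simp
 show "f (R1_class W ga) = sheet_function f 1 k (of_real (p - real k))" if "k < n" "kind ga 1 k t" "0 < t" for k t
  using crossing_value_eq[OF ga(1) that(2,3) ga(2), of f] sf[of k] that by simp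
 show "f (R1_class W ga) = sheet_function f 1 n (of_real (p - real n))" if "kind ga (-1) 0 0"
  using direct_value_eq[OF ga(1) that ga(2), of f] sf[of n] crossing_value_real[OF f, of 1, OF _ p] by simp
qed

lemma dominated_near_integer:
 assumes e: "e = 1 \<or> e = -1" and n: "1 <= (n::nat)" and de: "0 < de" and H: "set_integrable lborel {real (n + k) - de..real (n + k) + de} H"
  and le: "!!x y. [|x ~= real (n + k); \<bar>x - real (n + k)\<bar> < de; 0 < y; y < de; Complex (x - real k) (e * y) : sheet V e|] ==>
   norm (F (Complex (x - real k) (e * y))) <= H x"
 shows "dominated_at e F (real n)"
proof -
 have "of_real (real n) : V" using n by (intro of_real_in_V) simp
 then obtain r where r: "r > 0" "ball (of_real (real n)) r <= V" using open_V open_contains_ball by blast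
 define d where "d = min de (r / 2)"
 have d: "0 < d" "d <= de" "d <= r / 2" using de r by (auto simp: d_def)
 have "integrable lborel (%x. indicator {real (n + k) - de..real (n + k) + de} x *\<^sub>R H x)" using H by (simp add: set_integrable_def)
 from lborel_integrable_real_affine[OF this, of 1 "real k"]
 have "integrable lborel (%x. indicator {real (n + k) - de..real (n + k) + de} (real k + x) *\<^sub>R H (real k + x))" by simp
 moreover have "indicator {real (n + k) - de..real (n + k) + de} (real k + x) = (indicator {real n - de..real n + de} x :: real)" for x
  by (auto simp: indicator_def)
 ultimately have "set_integrable lborel {real n - de..real n + de} (%x. H (real k + x))" by (simp add: set_integrable_def)
 then have "set_integrable lborel {real n - d..real n + d} (%x. H (real k + x))"
  by (rule set_integrable_subset) (use d in auto)
 moreover have "norm (F (Complex x (e * y))) <= H (real k + x)" if h: "x ~= real n & \<bar>x - real n\<bar> < d & 0 < y & y < d" for x y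
 proof -
  have "norm (Complex x (e * y) - of_real (real n)) <= \<bar>x - real n\<bar> + \<bar>e * y\<bar>"
   using cmod_le[of "Complex x (e * y) - of_real (real n)"] by simp
  also have "\<bar>e * y\<bar> = y" using e h by auto
  finally have "norm (Complex x (e * y) - of_real (real n)) < r" using h d by simp
  then have "Complex x (e * y) : ball (of_real (real n)) r" by (simp add: dist_norm norm_minus_commute)
  then have "Complex x (e * y) : V" using r(2) by blast
  moreover have ey: "0 < e * (e * y)" using e h by auto
  moreover have "Complex x (e * y) ~: \<nat>" using Nats_Im_0[of "Complex x (e * y)"] ey by auto
  ultimately have s: "Complex ((real k + x) - real k) (e * y) : sheet V e" by (simp add: sheet_def)
  have "norm (F (Complex ((real k + x) - real k) (e * y))) <= H (real k + x)"
   by (rule le) (use h d s in auto)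
  then show ?thesis by simp
 qed
 ultimately show ?thesis unfolding dominated_at_def using d(1) by (intro exI[of _ d] conjI exI[of _ "%x. H (real k + x)"]) auto
qed

text \<open>The point n of the sheet k is the integer n + k of the surface, and k < n + k, so the
  bound on crossing branches at that integer applies.\<close>

lemma dominated_sheet_function:
 assumes fi: "integrable_at_integers W f" and n: "1 <= (n::nat)"
 shows "dominated_at 1 (sheet_function f 1 k) (real n)" "dominated_at (-1) (sheet_function f (-1) 0) (real n)"
proof -
 have nk: "1 <= n + k" using n by simp
 obtain de H where de: "de : {0<..<1}" "set_integrable lborel {real (n + k) - de..real (n + k) + de} H"
  "!!x y. [|x ~= real (n + k); \<bar>x - real (n + k)\<bar> < de; 0 < y; y < de|] ==> \<forall>m<n + k. norm (crossing_cont W f m (Complex x y)) <= H x"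
  using fi[unfolded integrable_at_integers_def, rule_format, OF nk] by blast
 show "dominated_at 1 (sheet_function f 1 k) (real n)"
 proof (rule dominated_near_integer[OF _ n _ de(2)])
  fix x y :: real assume x: "x ~= real (n + k)" "\<bar>x - real (n + k)\<bar> < de" "0 < y" "y < de" and s: "Complex (x - real k) (1 * y) : sheet V 1"
  have eq: "of_nat k + Complex (x - real k) (1 * y) = Complex x y" by (simp add: complex_eq_iff)
  have sx: "Complex x y : sheet V 1" using of_nat_add_sheet_V[OF s, of k] unfolding eq .
  have kx: "real k < Re (Complex x y)" using s by (simp add: sheet_def V_def)
  have cv: "crossing_cont W f k (Complex x y) = crossing_value f 1 k (Complex x y)"
   using R1_value_crossing[OF sx kx, of f "crossing_value f 1 k (Complex x y)"] crossing_value_eq[of _ 1 k _ "Complex x y" f] x(3)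
   by (simp add: crossing_cont_def)
  have "sheet_function f 1 k (Complex (x - real k) (1 * y)) = crossing_cont W f k (Complex x y)"
   using sheet_function(2)[OF f _ s, of k] unfolding eq cv by simp
  then show "norm (sheet_function f 1 k (Complex (x - real k) (1 * y))) <= H x" using de(3)[OF x] n by simp
 qed (use de(1) in auto)
next
 obtain de H where de: "de : {0<..<1}" "set_integrable lborel {real n - de..real n + de} H"
  "!!x y. [|x ~= real n; \<bar>x - real n\<bar> < de; 0 < y; y < de|] ==> norm (lower_cont W f (Complex x (- y))) <= H x"
  using fi[unfolded integrable_at_integers_def, rule_format, OF n] by blast
 show "dominated_at (-1) (sheet_function f (-1) 0) (real n)"
 proof (rule dominated_near_integer[of "-1" n de 0 H])
  fix x y :: real assume x: "x ~= real (n + 0)" "\<bar>x - real (n + 0)\<bar> < de" "0 < y" "y < de" and s: "Complex (x - real 0) (-1 * y) : sheet V (-1)"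
  have "lower_cont W f (Complex x (-1 * y)) = direct_value f (-1) (Complex x (-1 * y))"
   using R1_value_strict[of "-1" "Complex x (-1 * y)" f "direct_value f (-1) (Complex x (-1 * y))"] sheet_V_D[OF s] direct_value_eq[of _ "-1" "Complex x (-1 * y)" f]
   by (simp add: lower_cont_def)
  then have "sheet_function f (-1) 0 (Complex (x - real 0) (-1 * y)) = lower_cont W f (Complex x (- y))"
   using sheet_function_0[OF f _ s] by simp
  then show "norm (sheet_function f (-1) 0 (Complex (x - real 0) (-1 * y))) <= H x" using de(3)[of x y] x by simp
 qed (use de n in auto)
qed

end

section \<open>The convolution as a function on the surface\<close>

context
 fixes f g :: R1_fun
 assumes f: "R1_analytic_on W (R1 W) f" "integrable_at_0 W f" and g: "R1_analytic_on W (R1 W) g" "integrable_at_0 W g"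
begin

lemma sheet_pair_functions:
 assumes e: "e = 1 \<or> e = -1"
 shows "sheet_pair V e (sheet_function f (-e) 0) (sheet_function f e) (sheet_function g (-e) 0) (sheet_function g e)"
 by (intro sheet_pair.intro wedge_V[OF e] sheet_family_function[OF f e] sheet_family_function[OF g e])

definition sheet_convolution :: "real => nat => complex => complex" where
 "sheet_convolution e m = (SOME C. C analytic_on sheet V e &
   (\<forall>ep z. wedge.admissible V ep & z : sheet_pair.region V e ep & z ~= 1/2 -->
    C z = zigzag e ep (sheet_function f (-e) 0) (sheet_function f e) (sheet_function g (-e) 0) (sheet_function g e) m z))"

lemma sheet_convolution:
 assumes e: "e = 1 \<or> e = -1"
 shows "sheet_convolution e m analytic_on sheet V e"
  and "!!ep z. [|wedge.admissible V ep; z : sheet_pair.region V e ep; z ~= 1/2|] ==>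
   sheet_convolution e m z = zigzag e ep (sheet_function f (-e) 0) (sheet_function f e) (sheet_function g (-e) 0) (sheet_function g e) m z"
proof -
 interpret P: sheet_pair V e "sheet_function f (-e) 0" "sheet_function f e" "sheet_function g (-e) 0" "sheet_function g e"
  by (rule sheet_pair_functions[OF e])
 have "\<exists>C. C analytic_on sheet V e &
   (\<forall>ep z. wedge.admissible V ep & z : sheet_pair.region V e ep & z ~= 1/2 -->
    C z = zigzag e ep (sheet_function f (-e) 0) (sheet_function f e) (sheet_function g (-e) 0) (sheet_function g e) m z)"
  by (rule P.sheet_convolution_exists[of m]) blast
 from someI_ex[OF this] show "sheet_convolution e m analytic_on sheet V e"
  "!!ep z. [|wedge.admissible V ep; z : sheet_pair.region V e ep; z ~= 1/2|] ==>
   sheet_convolution e m z = zigzag e ep (sheet_function f (-e) 0) (sheet_function f e) (sheet_function g (-e) 0) (sheet_function g e) m z"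
  unfolding sheet_convolution_def by blast+
qed

lemma sheet_convolution_0:
 assumes e: "e = 1 \<or> e = -1" and z: "z : half V e"
 shows "sheet_convolution e 0 z = ray_convolution (sheet_function f e 0) (sheet_function g e 0) z"
  and "sheet_convolution e 0 z = ray_convolution (direct_value f e) (direct_value g e) z"
proof -
 interpret P: sheet_pair V e "sheet_function f (-e) 0" "sheet_function f e" "sheet_function g (-e) 0" "sheet_function g e"
  by (rule sheet_pair_functions[OF e])
 obtain ep where ep: "P.admissible ep" "z : P.region ep" using P.region_exists[OF z] .
 have z2: "z ~= 1/2"
 proof
  assume "z = 1/2"
  from arg_cong[OF this, of Im] have "Im z = 0" by simp
  then show False using z by (simp add: half_def)
 qed
 then have zV: "z - of_real ep : V" using ep(2) by (auto simp: P.region_def)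
 have eps: "0 < ep" "ep < 1" using ep(1) by (auto simp: P.admissible_def)
 show 1: "sheet_convolution e 0 z = ray_convolution (sheet_function f e 0) (sheet_function g e 0) z"
  using sheet_convolution(2)[OF e ep z2, of 0] P.zigzag_0[OF z zV eps] by simp
 also have "\<dots> = ray_convolution (direct_value f e) (direct_value g e) z"
 proof (rule ray_convolution_cong)
  fix t :: real assume t: "0 < t" "t < 1"
  have "of_real t * z : half V e" using z cone_V[of z t] t by (auto simp: half_def mult.left_commute[of e])
  then have "of_real t * z : sheet V e" using P.half_subset_sheet by blast
  then show "sheet_function f e 0 (of_real t * z) = direct_value f e (of_real t * z) &
    sheet_function g e 0 (of_real t * z) = direct_value g e (of_real t * z)"
   using sheet_function_0[OF f(1) e] sheet_function_0[OF g(1) e] by simp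
 qed
 finally show "sheet_convolution e 0 z = ray_convolution (direct_value f e) (direct_value g e) z" .
qed

lemma direct_value_half:
 assumes F: "R1_analytic_on W (R1 W) F" "integrable_at_0 W F" and e: "e = 1 \<or> e = -1"
 shows "direct_value F e holomorphic_on half D e" "radially_integrable (half D e) (direct_value F e)"
proof -
 obtain A where A: "A analytic_on sheet D e" "!!z. z : sheet D e ==> A z = direct_value F e z"
  using direct_value_extension[OF F(1) e] by blast
 show hol: "direct_value F e holomorphic_on half D e"
 proof (rule holomorphic_transform)
  show "A holomorphic_on half D e" by (rule holomorphic_on_subset[OF analytic_imp_holomorphic[OF A(1)] half_sheet_D])
  show "A z = direct_value F e z" if "z : half D e" for z using A(2) half_sheet_D that by blast
 qed
 show "radially_integrable (half D e) (direct_value F e)"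
  by (rule radially_integrable_direct_value[OF F e half_sheet_D half_D_star holomorphic_on_imp_continuous_on[OF hol] refl])
qed

text \<open>A curve without crossing may end in any component of D, where the straight convolution
  is used; real end points are covered by the sheet. After crossing beyond 1 the point z - m has to
  lie in V, and 0 is a default value elsewhere.\<close>

definition conv_value :: "real => nat => complex => complex" where
 "conv_value e m z =
   (if m = 0 then if z : half D e then ray_convolution (direct_value f e) (direct_value g e) z else sheet_convolution e 0 z
   else if z - of_nat m : V then sheet_convolution e m (z - of_nat m) else 0)"

lemma conv_value_local:
 assumes e: "e = 1 \<or> e = -1" and z0: "z0 : sheet D e" "m = 0 \<or> z0 - of_nat m : V"
 shows "\<exists>r>0. \<exists>ph. ph holomorphic_on ball z0 r & (\<forall>z\<in>ball z0 r. z : sheet D e --> conv_value e m z = ph z)"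
proof (cases "m = 0")
 case m: True
 show ?thesis
 proof (cases "z0 : half D e")
  case True
  then obtain r where r: "r > 0" "ball z0 r <= half D e" using open_half_D open_contains_ball by blast
  have "ray_convolution (direct_value f e) (direct_value g e) holomorphic_on half D e"
   by (rule ray_convolution_holomorphic(1)[OF open_half_D half_D_star direct_value_half[OF f e] direct_value_half[OF g e]])
  then have "ray_convolution (direct_value f e) (direct_value g e) holomorphic_on ball z0 r" by (rule holomorphic_on_subset[OF _ r(2)])
  moreover have "conv_value e m z = ray_convolution (direct_value f e) (direct_value g e) z" if "z : ball z0 r" for z
  proof -
   have "z : half D e" using that r(2) by blast
   then show ?thesis using m by (simp add: conv_value_def)
  qed
  ultimately show ?thesis using r(1) by blast
 next
  case False
  then have "\<not> 0 < e * Im z0" using z0(1) by (auto simp: half_def sheet_def)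
  then have "Im z0 = 0" using z0(1) e by (auto simp: sheet_def)
  then have zr: "z0 = of_real (Re z0)" by (simp add: complex_eq_iff)
  have R: "0 < Re z0" using z0(1) by (simp add: sheet_def D_def)
  have z0V: "z0 : V" using of_real_in_V[OF R] zr by simp
  then have "z0 : sheet V e" using z0(1) by (simp add: sheet_def)
  then obtain r1 where r1: "r1 > 0" "sheet_convolution e 0 holomorphic_on ball z0 r1"
   using sheet_convolution(1)[OF e, of 0] unfolding analytic_on_def by blast
  obtain r2 where r2: "r2 > 0" "ball z0 r2 <= V" using open_V z0V open_contains_ball by blast
  have "sheet_convolution e 0 holomorphic_on ball z0 (min r1 r2)" by (rule holomorphic_on_subset[OF r1(2) subset_ball]) simp
  moreover have "conv_value e m z = sheet_convolution e 0 z" if "z : ball z0 (min r1 r2)" for z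
  proof (cases "z : half D e")
   case True
   have "z : ball z0 r2" using that by simp
   then have "z : half V e" using r2(2) True by (auto simp: half_def)
   then show ?thesis using sheet_convolution_0(2)[OF e] True m by (simp add: conv_value_def)
  qed (simp add: conv_value_def m)
  ultimately show ?thesis using r1(1) r2(1) by (intro exI[of _ "min r1 r2"] conjI exI[of _ "sheet_convolution e 0"]) auto
 qed
next
 case False
 then have zV: "z0 - of_nat m : V" using z0 by simp
 have "z0 - of_nat m ~: \<nat>"
 proof
  assume "z0 - of_nat m : \<nat>"
  then have "(z0 - of_nat m) + of_nat m : \<nat>" by (intro Nats_add) auto
  then show False using z0(1) by (simp add: sheet_def)
 qed
 then have "z0 - of_nat m : sheet V e" using zV z0(1) by (simp add: sheet_def)
 then obtain r1 where r1: "r1 > 0" "sheet_convolution e m holomorphic_on ball (z0 - of_nat m) r1"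
  using sheet_convolution(1)[OF e, of m] unfolding analytic_on_def by blast
 obtain r2 where r2: "r2 > 0" "ball (z0 - of_nat m) r2 <= V" using open_V zV open_contains_ball by blast
 define r where "r = min r1 r2"
 have b: "z - of_nat m : ball (z0 - of_nat m) s \<longleftrightarrow> z : ball z0 s" for z s by (simp add: dist_norm)
 have "sheet_convolution e m holomorphic_on ball (z0 - of_nat m) r" by (rule holomorphic_on_subset[OF r1(2) subset_ball]) (simp add: r_def)
 then have "(sheet_convolution e m \<circ> (%z. z - of_nat m)) holomorphic_on ball z0 r"
 proof (rule holomorphic_on_compose_gen[rotated])
  show "(%z. z - of_nat m) holomorphic_on ball z0 r" by (intro holomorphic_intros)
  show "(%z. z - of_nat m) ` ball z0 r <= ball (z0 - of_nat m) r" using b by blast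
 qed
 moreover have "conv_value e m z = (sheet_convolution e m \<circ> (%z. z - of_nat m)) z" if "z : ball z0 r" for z
 proof -
  have "z : ball z0 r2" using that by (simp add: r_def)
  then have "z - of_nat m : V" using b[of z r2] r2(2) by blast
  then show ?thesis using False by (simp add: conv_value_def)
 qed
 moreover have "r > 0" using r1(1) r2(1) by (simp add: r_def)
 ultimately show ?thesis by blast
qed

text \<open>A curve that has just crossed in (N, N+1) and one that is about to cross there receive
  the same value; this is \<open>sheet_convolution_glue\<close>.\<close>

lemma conv_value_real:
 assumes e: "e = 1 \<or> e = -1" and x: "real N < x" "x < real N + 1"
 shows "conv_value e N (of_real x) = sheet_convolution e N (of_real (x - real N))"
  and "conv_value e N (of_real x) = conv_value (-e) 0 (of_real x)"
proof -
 interpret P: sheet_pair V e "sheet_function f (-e) 0" "sheet_function f e" "sheet_function g (-e) 0" "sheet_function g e"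
  by (rule sheet_pair_functions[OF e])
 have e': "-e = 1 \<or> -e = -1" using e by auto
 have x': "0 < x - real N" "x - real N < 1" using x by auto
 have eq: "of_real x - of_nat N = (of_real (x - real N) :: complex)" by simp
 show 1: "conv_value e N (of_real x) = sheet_convolution e N (of_real (x - real N))"
  using of_real_in_V[OF x'(1)] unfolding conv_value_def eq by (simp add: half_def)
 have "sheet_convolution e N (of_real (x - real N)) = sheet_convolution (-e) 0 (of_nat N + of_real (x - real N))"
  by (rule P.sheet_convolution_glue[OF sheet_convolution(1)[OF e] sheet_convolution(2)[OF e] sheet_convolution(1)[OF e'] sheet_convolution_0(1)[OF e'] x'])
 then show "conv_value e N (of_real x) = conv_value (-e) 0 (of_real x)"
  unfolding 1 by (simp add: conv_value_def half_def)
qed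

definition curve_value :: "(real => complex) => complex" where
 "curve_value ga = conv_value (fst (kind_of ga)) (snd (kind_of ga)) (ga 1)"

definition surface_convolution :: R1_fun where
 "surface_convolution q = curve_value (SOME ga. ga : q)"

lemma curve_value_eq: "[|curve ga; kind ga e m c; e = 1 \<or> e = -1|] ==> curve_value ga = conv_value e m (ga 1)"
 using kind_of_eq[of ga e m c] by (simp add: curve_value_def)

text \<open>\<open>curve_value\<close> is constant along homotopies: the kind is stable, and in the
  exceptional case of \<open>kind_stable\<close> both kinds give the same value by
  \<open>conv_value_real\<close>.\<close>

lemma surface_convolution_class:
 assumes ga: "curve ga"
 shows "surface_convolution (R1_class W ga) = curve_value ga"
proof -
 have mem: "(SOME ga'. ga' : R1_class W ga) : R1_class W ga" by (rule someI[of "%ga'. ga' : R1_class W ga", OF R1_class_self[OF ga]])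
 show ?thesis unfolding surface_convolution_def
 proof (rule R1_class_invariant[OF _ mem refl])
  fix sg assume sg: "curve sg" "sg 1 = ga 1"
  obtain e m c where k: "e = 1 \<or> e = -1" "kind sg e m c" using kind_exists[OF sg(1)] .
  have e': "-e = 1 \<or> -e = -1" using k(1) by auto
  obtain de where de: "de > 0" "!!ga'. [|curve ga'; !!t. t : {0..1} ==> dist (ga' t) (sg t) < de|] ==>
   (\<exists>c'. kind ga' e m c') \<or>
   (m = 0 & Im (sg 1) = 0 & (\<exists>N c'. real N < Re (sg 1) & Re (sg 1) < real N + 1 & kind ga' (-e) N c'))"
   using kind_stable[OF sg(1) k(2,1)] by blast
  show "\<exists>de>0. \<forall>ga'. curve ga' & ga' 1 = ga 1 & (\<forall>t\<in>{0..1}. dist (ga' t) (sg t) < de) --> curve_value ga' = curve_value sg"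
  proof (intro exI[of _ de] conjI de(1) allI impI)
   fix ga' assume h: "curve ga' & ga' 1 = ga 1 & (\<forall>t\<in>{0..1}. dist (ga' t) (sg t) < de)"
   then consider c' where "kind ga' e m c'" | N c' where "m = 0" "Im (sg 1) = 0" "real N < Re (sg 1)" "Re (sg 1) < real N + 1" "kind ga' (-e) N c'"
    using de(2)[of ga'] by blast
   then show "curve_value ga' = curve_value sg"
   proof cases
    case 1
    then show ?thesis using curve_value_eq[of ga' e m c'] curve_value_eq[OF sg(1) k(2,1)] h k(1) sg(2) by simp
   next
    case 2
    have zr: "sg 1 = of_real (Re (sg 1))" using 2(2) by (simp add: complex_eq_iff)
    have "curve_value ga' = conv_value (-e) N (sg 1)" using curve_value_eq[of ga' "-e" N c'] 2(5) h e' sg(2) by simp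
    also have "\<dots> = conv_value e 0 (sg 1)" using conv_value_real(2)[OF e' 2(3,4)] zr by simp
    finally show ?thesis using curve_value_eq[OF sg(1) k(2,1)] 2(1) by simp
   qed
  qed
 qed
qed

text \<open>Curves near ga have its kind or, when ga ends on the axis without crossing, the kind of
  a late crossing. The germs belonging to the two kinds agree on a real interval, hence on a ball,
  so one germ covers all nearby curves.\<close>

lemma surface_convolution_local:
 assumes ga: "curve ga" and good: "!!e m c. [|e = 1 \<or> e = -1; kind ga e m c|] ==> m = 0 \<or> ga 1 - of_nat m : V"
 shows "\<exists>ep>0. \<exists>ph. ph holomorphic_on ball (ga 1) ep &
  (\<forall>ga'. curve ga' & (\<forall>t\<in>{0..1}. dist (ga' t) (ga t) < ep) --> surface_convolution (R1_class W ga') = ph (ga' 1))"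
proof -
 obtain e m c where k: "e = 1 \<or> e = -1" "kind ga e m c" using kind_exists[OF ga] .
 have e': "-e = 1 \<or> -e = -1" using k(1) by auto
 define z0 where "z0 = ga 1"
 note a = kind_after[OF ga k(2), folded z0_def]
 have z0s: "z0 : sheet D e" using a by (simp add: sheet_def)
 obtain r ph where r: "r > 0" "ph holomorphic_on ball z0 r" "!!z. [|z : ball z0 r; z : sheet D e|] ==> conv_value e m z = ph z"
  using conv_value_local[OF k(1) z0s good[OF k, folded z0_def]] by blast
 obtain de where de: "de > 0" "!!ga'. [|curve ga'; !!t. t : {0..1} ==> dist (ga' t) (ga t) < de|] ==>
  (\<exists>c'. kind ga' e m c') \<or>
  (m = 0 & Im (ga 1) = 0 & (\<exists>N c'. real N < Re (ga 1) & Re (ga 1) < real N + 1 & kind ga' (-e) N c'))"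
  using kind_stable[OF ga k(2,1)] by blast
 have "\<exists>s>0. s <= r & (\<forall>N z. m = 0 & Im z0 = 0 & real N < Re z0 & Re z0 < real N + 1 & z : ball z0 s & z : sheet D (-e) --> conv_value (-e) N z = ph z)"
 proof (cases "m = 0 & Im z0 = 0")
  case False
  then show ?thesis using r(1) by (intro exI[of _ r]) auto
 next
  case True
  have zr: "z0 = of_real (Re z0)" using True by (simp add: complex_eq_iff)
  have "Re z0 ~: \<nat>" using a(3) of_real_in_Nats_iff[of "Re z0"] zr by simp
  then obtain N where N: "real N < Re z0" "Re z0 < real N + 1" using between_Nats[OF a(5)] by blast
  have s0: "z0 : sheet D (-e)" using a True by (simp add: sheet_def)
  have "z0 - of_nat N = of_real (Re z0 - real N)" by (subst zr) simp
  then have "z0 - of_nat N : V" using of_real_in_V[of "Re z0 - real N"] N by simp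
  then obtain r' pz where r': "r' > 0" "pz holomorphic_on ball z0 r'" "!!z. [|z : ball z0 r'; z : sheet D (-e)|] ==> conv_value (-e) N z = pz z"
   using conv_value_local[OF e' s0, of N] by blast
  define s where "s = min r r'"
  have s: "0 < s" "s <= r" using r(1) r'(1) by (auto simp: s_def)
  \<comment> \<open>Keeps the interval of comparison inside (N, N+1), where the two values are known
    to agree.\<close>
  define q where "q = min s (real N + 1 - Re z0)"
  have q: "0 < q" using s N by (simp add: q_def)
  have h1: "ph holomorphic_on ball z0 s" by (rule holomorphic_on_subset[OF r(2) subset_ball]) (simp add: s_def)
  have h2: "pz holomorphic_on ball z0 s" by (rule holomorphic_on_subset[OF r'(2) subset_ball]) (simp add: s_def)
  have eq: "pz z = ph z" if z: "z : ball z0 s" for z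
  proof (rule analytic_eq_on_connected[where f = pz and g = ph and T = "ball z0 s" and a = z0 and Z = "of_real ` {Re z0<..<Re z0 + q}" and w = z])
   show "pz analytic_on ball z0 s" "ph analytic_on ball z0 s" using h1 h2 by (simp_all add: analytic_on_open)
   show "z0 islimpt of_real ` {Re z0<..<Re z0 + q}" using of_real_islimpt[OF q, of "Re z0"] zr by simp
   show "pz w = ph w" if wZ: "w : of_real ` {Re z0<..<Re z0 + q}" for w
   proof -
    obtain x where x: "w = of_real x" "Re z0 < x" "x < Re z0 + q" using wZ by auto
    have xN: "real N < x" "x < real N + 1" using x N by (auto simp: q_def)
    have "dist z0 w = \<bar>Re z0 - x\<bar>" unfolding x(1) by (subst zr) (simp only: dist_of_real dist_real_def)
    then have wb: "w : ball z0 r" "w : ball z0 r'" using x by (auto simp: q_def s_def)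
    have "0 < x" "x ~: \<nat>" using xN not_Nats_between by (auto intro: le_less_trans)
    then have ws: "w : sheet D e" "w : sheet D (-e)" using of_real_sheet_V[of x] sheet_V_D x(1) by auto
    have "conv_value (-e) N w = conv_value e 0 w" using conv_value_real(2)[OF e' xN] x(1) by simp
    then show ?thesis using r(3)[OF wb(1) ws(1)] r'(3)[OF wb(2) ws(2)] True by simp
   qed
  qed (use s z in auto)
  have "conv_value (-e) M z = ph z" if M: "real M < Re z0" "Re z0 < real M + 1" and z: "z : ball z0 s" "z : sheet D (-e)" for M z
  proof -
   have "M = N" using M N by linarith
   moreover have "z : ball z0 r'" using z by (simp add: s_def)
   ultimately show ?thesis using r'(3) z eq by simp
  qed
  then show ?thesis using s by (intro exI[of _ s]) auto
 qed
 then obtain s where s: "s > 0" "s <= r" "!!N z. [|m = 0; Im z0 = 0; real N < Re z0; Re z0 < real N + 1; z : ball z0 s; z : sheet D (-e)|] ==> conv_value (-e) N z = ph z"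
  by blast
 define ep where "ep = min de s"
 have "ph holomorphic_on ball z0 ep" by (rule holomorphic_on_subset[OF r(2) subset_ball]) (use s in \<open>simp add: ep_def\<close>)
 moreover have "surface_convolution (R1_class W ga') = ph (ga' 1)" if h: "curve ga'" "\<forall>t\<in>{0..1}. dist (ga' t) (ga t) < ep" for ga'
 proof -
  have "dist (ga' 1) z0 < ep" using h(2) z0_def by simp
  then have zb: "ga' 1 : ball z0 s" "ga' 1 : ball z0 r" using s(2) by (auto simp: ep_def dist_commute)
  have cl: "dist (ga' t) (ga t) < de" if "t : {0..1}" for t using h(2) that by (simp add: ep_def)
  consider c' where "kind ga' e m c'" | N c' where "m = 0" "Im z0 = 0" "real N < Re z0" "Re z0 < real N + 1" "kind ga' (-e) N c'"
   using de(2)[OF h(1) cl] z0_def by blast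
  then show ?thesis
  proof cases
   case 1
   have "ga' 1 : sheet D e" using kind_after[OF h(1) 1] by (simp add: sheet_def)
   then show ?thesis using surface_convolution_class[OF h(1)] curve_value_eq[OF h(1) 1 k(1)] r(3)[OF zb(2)] by simp
  next
   case 2
   have "ga' 1 : sheet D (-e)" using kind_after[OF h(1) 2(5)] by (simp add: sheet_def)
   then show ?thesis using surface_convolution_class[OF h(1)] curve_value_eq[OF h(1) 2(5) e'] s(3)[OF 2(1-4) zb(1)] by simp
  qed
 qed
 moreover have "ep > 0" using de(1) s(1) by (simp add: ep_def)
 ultimately show ?thesis using z0_def by blast
qed

text \<open>From the crossing on, the defining condition of \<open>R1_conv\<close> keeps the slopes
  of sg t - m in S. They form a connected set containing 0, hence lie in I, and so the end point
  minus m is in V.\<close>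

lemma surface_convolution_analytic_conv: "R1_analytic_on W (R1_conv W) surface_convolution"
 unfolding R1_analytic_on_def
proof (intro ballI)
 fix q ga assume q: "q : R1_conv W" "ga : q"
 then obtain sg where sg: "q = R1_class W sg" "curve sg"
  and cond: "!!t0 t k. [|0 < t0; t0 <= t; t <= 1; Im (sg t0) = 0; real k < Re (sg t0)|] ==> sg t - of_nat k : W"
  unfolding R1_conv_def by auto
 have ga: "curve ga" "ga 1 = sg 1" using R1_class_curve[of ga sg] q(2) sg(1) by auto
 show "\<exists>ep>0. \<exists>ph. ph holomorphic_on ball (ga 1) ep &
  (\<forall>ga'. curve ga' & (\<forall>t\<in>{0..1}. dist (ga' t) (ga t) < ep) --> surface_convolution (R1_class W ga') = ph (ga' 1))"
 proof (rule surface_convolution_local[OF ga(1)])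
  fix e m c assume k: "e = 1 \<or> e = -1" "kind ga e m c"
  have Rm: "real m < Re (ga 1)" by (rule kind_after(2)[OF ga(1) k(2)])
  show "m = 0 \<or> ga 1 - of_nat m : V"
  proof (cases "m = 0 \<or> Im (ga 1) = 0")
   case True
   have "ga 1 - of_nat m = of_real (Re (ga 1) - real m)" if "Im (ga 1) = 0" using that by (simp add: complex_eq_iff)
   then show ?thesis using True of_real_in_V[of "Re (ga 1) - real m"] Rm by auto
  next
   case False
   \<comment> \<open>Off the axis all representatives of the class have the same kind, so the
     condition on sg can be used for ga.\<close>
   have kof: "kind_of sg = (e, m)" using kind_of_class[of ga sg] kind_of_eq[OF ga(1) k(2,1)] q(2) sg(1) ga(2) False by simp
   obtain e2 m2 c2 where k2: "e2 = 1 \<or> e2 = -1" "kind sg e2 m2 c2" using kind_exists[OF sg(2)] .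
   then have "e2 = e" "m2 = m" using kind_of_eq[OF sg(2) k2(2,1)] kof by auto
   then have c2: "0 < c2" "c2 < 1" "Im (sg c2) = 0" "real m < Re (sg c2)" using k2(2) False by (auto simp: kind_def split: if_splits)
   have Rpos: "0 < Re (sg t - of_nat m)" if "c2 <= t" "t <= 1" for t
    using curveD(4)[OF sg(2), of c2 t] c2 that by (cases "t = c2") auto
   define T where "T = (%t. slope (sg t - of_nat m)) ` {c2..1}"
   have "continuous_on {c2..1} (%t. slope (sg t - of_nat m))" unfolding slope_def
    by (intro continuous_intros continuous_on_subset[OF curveD(1)[OF sg(2)]]) (use c2 Rpos in force)+
   then have "connected T" unfolding T_def by (rule connected_continuous_image) simp
   moreover have "T <= S"
   proof
    fix y assume "y : T"
    then obtain t where t: "t : {c2..1}" "y = slope (sg t - of_nat m)" by (auto simp: T_def)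
    then have "sg t - of_nat m : W" using cond[of c2 t m] c2 by auto
    then show "y : S" using W_iff[OF Rpos[of t]] t by (auto simp: D_def)
   qed
   moreover have "0 : T" unfolding T_def using c2 by (intro image_eqI[of _ _ c2]) (auto simp: slope_def)
   ultimately have "T <= I" using component_subset_I[of T] zero_I by blast
   then have "slope (sg 1 - of_nat m) : I" using c2 by (auto simp: T_def)
   then show ?thesis using Rpos[of 1] c2 ga(2) by (simp add: V_def)
  qed
 qed
qed

text \<open>When all slopes are allowed, V is the whole right half-plane, and z - m belongs to it
  because the real part of the end point exceeds m.\<close>

lemma surface_convolution_analytic:
 assumes "S = UNIV"
 shows "R1_analytic_on W (R1 W) surface_convolution"
 unfolding R1_analytic_on_def
proof (intro ballI)
 fix q ga assume q: "q : R1 W" "ga : q"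
 then obtain sg where sg: "q = R1_class W sg" unfolding R1_def by auto
 have ga: "curve ga" using R1_class_curve[of ga sg] q(2) sg by auto
 have "UNIV <= I" by (rule component_subset_I) (use assms zero_I in auto)
 then have I: "I = UNIV" by blast
 show "\<exists>ep>0. \<exists>ph. ph holomorphic_on ball (ga 1) ep &
  (\<forall>ga'. curve ga' & (\<forall>t\<in>{0..1}. dist (ga' t) (ga t) < ep) --> surface_convolution (R1_class W ga') = ph (ga' 1))"
  by (rule surface_convolution_local[OF ga]) (use kind_after(2)[OF ga] I in \<open>auto simp: V_def\<close>)
qed

text \<open>Off the axis the direct branches of f and g coincide with \<open>near0\<close>, so the
  values are straight convolutions; at a real point the equality follows by a limit from one
  side.\<close>

lemma surface_convolution_near0: "convolution_near0 W f g surface_convolution"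
 unfolding convolution_near0_def
proof
 fix p assume p: "p : near0_domain W"
 have op: "open (near0_domain W)" unfolding near0_domain_eq
  using open_Int[OF open_D open_ball[of 0 1]] by (simp add: Int_def dist_norm)
 have star: "of_real t * z : near0_domain W" if "z : near0_domain W" "0 < t" "t <= 1" for z t
  using that cone_D[of z t] mult_left_le_one_le[of "norm z" t] by (auto simp: near0_domain_eq norm_mult)
 have rf: "radially_integrable (near0_domain W) (near0 W f)" "radially_integrable (near0_domain W) (near0 W g)"
  using f(2) g(2) unfolding radially_integrable_def integrable_at_0_def by auto
 note nf = near0_holomorphic[OF f(1)] and ng = near0_holomorphic[OF g(1)]
 have rc1: "ray_convolution (near0 W f) (near0 W g) holomorphic_on near0_domain W"
  by (rule ray_convolution_holomorphic(1)[OF op _ nf rf(1) ng rf(2)]) (rule star)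
 have rc2: "((%s. near0 W f s * near0 W g (p - s)) has_contour_integral ray_convolution (near0 W f) (near0 W g) p) (linepath 0 p)"
  by (rule ray_convolution_holomorphic(2)[OF op _ nf rf(1) ng rf(2) p]) (rule star)
 have half: "ray_convolution (direct_value f e) (direct_value g e) z = ray_convolution (near0 W f) (near0 W g) z"
  if e: "e = 1 \<or> e = -1" and z: "z : near0_domain W" "0 < e * Im z" for e z
 proof (rule ray_convolution_cong)
  fix t :: real assume t: "0 < t" "t < 1"
  have d: "of_real t * z : near0_domain W" using star[of z t] z t by simp
  then have n: "norm (of_real t * z) < 1" by (simp add: near0_domain_eq)
  have "of_real t * z : half D e" using d z t half_D_star[of z e t] by (auto simp: near0_domain_eq half_def)
  then have "of_real t * z : sheet D e" using half_sheet_D by blast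
  then show "direct_value f e (of_real t * z) = near0 W f (of_real t * z) & direct_value g e (of_real t * z) = near0 W g (of_real t * z)"
   using near0_eq_direct_value[OF f(1) e _ n] near0_eq_direct_value[OF g(1) e _ n] by simp
 qed
 have cv: "conv_value e 0 p = ray_convolution (near0 W f) (near0 W g) p" if e: "e = 1 \<or> e = -1" and s: "p : sheet D e" for e
 proof (cases "Im p = 0")
  case False
  then have pos: "0 < e * Im p" using s e by (auto simp: sheet_def)
  then have "p : half D e" using s by (simp add: half_def sheet_def)
  then show ?thesis using half[OF e p pos] by (simp add: conv_value_def)
 next
  case True
  obtain r ph where r: "r > 0" "ph holomorphic_on ball p r" "!!z. [|z : ball p r; z : sheet D e|] ==> conv_value e 0 z = ph z"
   using conv_value_local[OF e s, of 0] by blast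
  obtain r' where r': "r' > 0" "ball p r' <= near0_domain W" using op p open_contains_ball by blast
  have "((%y. p + \<i> * of_real (e * y)) \<longlongrightarrow> p + \<i> * of_real (e * 0)) (at_right 0)"
   by (intro tendsto_intros tendsto_ident_at)
  then have lim: "((%y. p + \<i> * of_real (e * y)) \<longlongrightarrow> p) (at_right 0)" by simp
  have "isCont ph p" using holomorphic_on_imp_continuous_on[OF r(2)] r(1) by (simp add: continuous_on_eq_continuous_at)
  then have 1: "((%y. ph (p + \<i> * of_real (e * y))) \<longlongrightarrow> ph p) (at_right 0)" by (rule isCont_tendsto_compose[OF _ lim])
  have "isCont (ray_convolution (near0 W f) (near0 W g)) p"
   using holomorphic_on_imp_continuous_on[OF rc1] p op by (simp add: continuous_on_eq_continuous_at)
  then have 2: "((%y. ray_convolution (near0 W f) (near0 W g) (p + \<i> * of_real (e * y))) \<longlongrightarrow> ray_convolution (near0 W f) (near0 W g) p) (at_right 0)"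
   by (rule isCont_tendsto_compose[OF _ lim])
  have "\<forall>\<^sub>F y in at_right 0. ph (p + \<i> * of_real (e * y)) = ray_convolution (near0 W f) (near0 W g) (p + \<i> * of_real (e * y))"
   unfolding eventually_at_right_field
  proof (intro exI[of _ "min r r'"] conjI allI impI)
   fix y :: real assume y: "0 < y" "y < min r r'"
   have "norm (\<i> * of_real (e * y) :: complex) = y" using y e by (auto simp: norm_mult)
   then have b: "p + \<i> * of_real (e * y) : ball p r" "p + \<i> * of_real (e * y) : ball p r'" using y by (simp_all add: dist_norm)
   have d: "p + \<i> * of_real (e * y) : near0_domain W" using b(2) r'(2) by blast
   have pos: "0 < e * Im (p + \<i> * of_real (e * y))" using True y e by auto
   have h: "p + \<i> * of_real (e * y) : half D e" using d pos by (simp add: half_def near0_domain_eq)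
   have "ph (p + \<i> * of_real (e * y)) = conv_value e 0 (p + \<i> * of_real (e * y))" using r(3)[OF b(1) subsetD[OF half_sheet_D h]] by simp
   also have "\<dots> = ray_convolution (near0 W f) (near0 W g) (p + \<i> * of_real (e * y))" using half[OF e d pos] h by (simp add: conv_value_def)
   finally show "ph (p + \<i> * of_real (e * y)) = ray_convolution (near0 W f) (near0 W g) (p + \<i> * of_real (e * y))" .
  qed (use r r' in simp)
  then have "((%y. ray_convolution (near0 W f) (near0 W g) (p + \<i> * of_real (e * y))) \<longlongrightarrow> ph p) (at_right 0)"
   by (rule Lim_transform_eventually[OF 1])
  then have "ph p = ray_convolution (near0 W f) (near0 W g) p" using tendsto_unique[OF trivial_limit_at_right_real _ 2] by blast
  then show ?thesis using r(3)[of p] r(1) s by simp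
 qed
 have pD: "p : D" "norm p < 1" "p ~: \<nat>" using p W_iff by (auto simp: near0_domain_eq near0_domain_def)
 define e where "e = (if 0 <= Im p then 1 else (-1) :: real)"
 have e: "e = 1 \<or> e = -1" "0 <= e * Im p" by (auto simp: e_def)
 have et: "0 < 1 - norm p" using pD by simp
 have "\<exists>sg. curve sg & sg 1 = p & (\<forall>t. 0 <= t & t <= 1 --> norm (sg t) < norm p + (1 - norm p))"
  by (rule strict_curve_exists[OF e(1) pD(1,3) e(2) et]) blast
 then obtain sg where sg: "curve sg" "sg 1 = p" "\<forall>t\<in>{0..1}. norm (sg t) < 1" by auto
 have nd: "near0 W surface_convolution p = R1_value W (%ga. \<forall>t\<in>{0..1}. norm (ga t) < 1) surface_convolution p" by (simp add: near0_def)
 have "near0 W surface_convolution p = ray_convolution (near0 W f) (near0 W g) p" unfolding nd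
 proof (rule R1_value_eqI[where P = "%ga. \<forall>t\<in>{0..1}. norm (ga t) < 1", OF sg(1,3,2)])
  fix ga assume ga: "curve ga" "ga 1 = p" and n: "\<forall>t\<in>{0..1}. norm (ga t) < 1"
  obtain e' m c where k: "e' = 1 \<or> e' = -1" "kind ga e' m c" using kind_exists[OF ga(1)] .
  have "c : {0..1}" using k by (auto simp: kind_def)
  then have "Re (ga c) < 1" using n complex_Re_le_cmod[of "ga c"] by force
  then have m: "m = 0" using k by (auto simp: kind_def split: if_splits)
  have "p : sheet D e'" using kind_after[OF ga(1) k(2)] ga(2) by (simp add: sheet_def)
  then show "surface_convolution (R1_class W ga) = ray_convolution (near0 W f) (near0 W g) p"
   using surface_convolution_class[OF ga(1)] curve_value_eq[OF ga(1) k(2,1)] cv[OF k(1)] m ga(2) by simp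
 qed
 then show "((%s. near0 W f s * near0 W g (p - s)) has_contour_integral near0 W surface_convolution p) (linepath 0 p)"
  using rc2 by simp
qed

text \<open>f, g and their convolution all average to sums over sheets with the same weights, which
  places the claim within \<open>balanced_convolution\<close>.\<close>

lemma balanced_surface_convolution:
 assumes fi: "integrable_at_integers W f" and gi: "integrable_at_integers W g" and p: "0 < p" "p ~: \<nat>"
 shows "set_integrable lborel {0..p} (%s. balanced_average W f s * balanced_average W g (p - s))"
  and "balanced_average W surface_convolution p = convolution (balanced_average W f) (balanced_average W g) p"
proof -
 obtain N where N: "real N < p" "p < real N + 1" using between_Nats[OF p] .
 interpret P: sheet_pair V 1 "sheet_function f (-1) 0" "sheet_function f 1" "sheet_function g (-1) 0" "sheet_function g 1"
  using sheet_pair_functions[of 1] by simp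
 interpret Q: integrable_sheet_pair V 1 "sheet_function f (-1) 0" "sheet_function f 1" "sheet_function g (-1) 0" "sheet_function g 1"
  by unfold_locales (use dominated_sheet_function[OF f(1) fi] dominated_sheet_function[OF g(1) gi] in auto)
 have one: "(1::real) = 1 \<or> (1::real) = -1" by simp
 note bc = Q.balanced_convolution[OF N balanced_average_sheet_function[OF f(1)] balanced_average_sheet_function[OF g(1)]
   sheet_convolution(1)[OF one] sheet_convolution(2)[OF one]]
 show "set_integrable lborel {0..p} (%s. balanced_average W f s * balanced_average W g (p - s))"
  by (rule bc(1)) auto
 have "balanced_average W surface_convolution p = (\<Sum>m\<le>N. balanced_weight N m * sheet_convolution 1 m (of_real (p - real m)))"
 proof (rule balanced_average_branches[OF N])
  have cvN: "conv_value 1 N (of_real p) = sheet_convolution 1 N (of_real (p - real N))" "conv_value 1 N (of_real p) = conv_value (-1) 0 (of_real p)"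
   using conv_value_real[OF one N] by simp_all
  have cvk: "conv_value 1 k (of_real p) = sheet_convolution 1 k (of_real (p - real k))" if k: "k <= N" for k
  proof -
   have "of_real p - of_nat k = (of_real (p - real k) :: complex)" by simp
   moreover have "0 < p - real k" using k N by simp
   ultimately show ?thesis using of_real_in_V[of "p - real k"] by (simp add: conv_value_def half_def)
  qed
  fix ga assume ga: "curve ga" "ga 1 = of_real p"
  note sc = surface_convolution_class[OF ga(1)]
  show "surface_convolution (R1_class W ga) = sheet_convolution 1 0 (of_real (p - real 0))" if "kind ga 1 0 0"
   using sc curve_value_eq[OF ga(1) that one] ga(2) cvk[of 0] by simp
  show "surface_convolution (R1_class W ga) = sheet_convolution 1 k (of_real (p - real k))" if "k < N" "kind ga 1 k t" "0 < t" for k t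
   using sc curve_value_eq[OF ga(1) that(2) one] ga(2) cvk[of k] that(1) by simp
  show "surface_convolution (R1_class W ga) = sheet_convolution 1 N (of_real (p - real N))" if "kind ga (-1) 0 0"
   using sc curve_value_eq[OF ga(1) that] ga(2) cvN by simp
 qed
 also have "\<dots> = convolution (balanced_average W f) (balanced_average W g) p"
  unfolding convolution_def by (rule bc(2)) auto
 finally show "balanced_average W surface_convolution p = convolution (balanced_average W f) (balanced_average W g) p" .
qed

end

end

section \<open>The given sector in terms of slopes, and the conclusion\<close>

text \<open>In the right half-plane arctan (slope z) is an argument of z, so any other argument has
  the same \<open>cis\<close>.\<close>

lemma eq_norm_cis_iff:
 assumes z: "0 < Re z" shows "z = of_real (norm z) * cis ta \<longleftrightarrow> cis ta = cis (arctan (slope z))"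
proof -
 have n: "norm z ~= 0" using z by auto
 have sq: "norm z = Re z * sqrt (1 + (slope z)\<^sup>2)"
 proof -
  have "(norm z)\<^sup>2 = (Re z)\<^sup>2 * (1 + (slope z)\<^sup>2)" using z by (simp add: cmod_power2 slope_def field_simps)
  then have "norm z = sqrt ((Re z)\<^sup>2 * (1 + (slope z)\<^sup>2))" by (metis norm_ge_zero real_sqrt_unique)
  then show ?thesis using z by (simp add: real_sqrt_mult)
 qed
 have s0: "sqrt (1 + (slope z)\<^sup>2) > 0" by (simp add: add_pos_nonneg)
 have "Re (of_real (norm z) * cis (arctan (slope z))) = Re z" using s0 by (simp add: sq cos_arctan)
 moreover have "Im (of_real (norm z) * cis (arctan (slope z))) = Im z" using s0 z by (simp add: sq sin_arctan slope_def)
 ultimately have z': "z = of_real (norm z) * cis (arctan (slope z))" by (simp add: complex_eq_iff)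
 show ?thesis
 proof
  assume "z = of_real (norm z) * cis ta"
  then have "of_real (norm z) * cis ta = of_real (norm z) * cis (arctan (slope z))" using z' by metis
  then show "cis ta = cis (arctan (slope z))" using n by simp
 next
  assume "cis ta = cis (arctan (slope z))"
  then show "z = of_real (norm z) * cis ta" using z' by metis
 qed
qed

text \<open>Angles are compared through \<open>cis\<close>, hence modulo 2 pi, so slopes whose angle
  enters the sector only after adding a multiple of 2 pi are included.\<close>

definition sector_slopes :: "nat => (nat => complex) => real set" where
 "sector_slopes n lam = (if n = 1 then UNIV else
   {x. \<exists>ta. - phi_minus n lam < ta & ta < phi_plus lam & cis ta = cis (arctan x)})"

lemma sector_W1:
 assumes n: "1 <= n" and lam: "lam 1 = 1" and arg: "!!i j. 1 <= i ==> i < j ==> j <= n ==> Arg2pi (lam i) < Arg2pi (lam j)"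
 shows "sector (W1 n lam) (sector_slopes n lam)"
proof
 show "open (sector_slopes n lam)"
 proof (cases "n = 1")
  case False
  define T where "T = {u. \<exists>ta. - phi_minus n lam < ta & ta < phi_plus lam & cis ta = cis u}"
  have "open T" unfolding open_dist
  proof
   fix u assume "u : T"
   then obtain ta where ta: "- phi_minus n lam < ta" "ta < phi_plus lam" "cis ta = cis u" by (auto simp: T_def)
   define d where "d = min (ta + phi_minus n lam) (phi_plus lam - ta)"
   have "y : T" if "dist y u < d" for y
   proof -
    have "cis (ta + (y - u)) = cis y" using ta(3) by (simp only: cis_mult[symmetric]) (simp add: cis_mult)
    moreover have "- phi_minus n lam < ta + (y - u)" "ta + (y - u) < phi_plus lam" using that by (auto simp: d_def dist_real_def)
    ultimately show ?thesis unfolding T_def by blast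
   qed
   moreover have "0 < d" using ta by (simp add: d_def)
   ultimately show "\<exists>d>0. \<forall>y. dist y u < d --> y : T" by blast
  qed
  then have "open (arctan -` T)" by (rule open_vimage) (intro continuous_intros)
  moreover have "arctan -` T = sector_slopes n lam" using False by (auto simp: T_def sector_slopes_def)
  ultimately show ?thesis by simp
 qed (simp add: sector_slopes_def)
 show "0 : sector_slopes n lam"
 proof (cases "n = 1")
  case False
  then have n2: "2 <= n" using n by simp
  have "Arg2pi (lam 1) < Arg2pi (lam 2)" using arg[of 1 2] n2 by simp
  then have "0 < phi_plus lam" using Arg2pi[of "lam 1"] by (simp add: phi_plus_def)
  moreover have "0 < phi_minus n lam" using Arg2pi[of "lam n"] by (simp add: phi_minus_def)
  ultimately show ?thesis using False by (auto simp: sector_slopes_def intro!: exI[of _ 0])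
 qed (simp add: sector_slopes_def)
 show "z : W1 n lam \<longleftrightarrow> z ~: \<nat> & slope z : sector_slopes n lam" if "0 < Re z" for z
  unfolding W1_def sector_slopes_def using eq_norm_cis_iff[OF that] by auto
qed

theorem theorem5:
  fixes n :: nat and lam :: "nat \<Rightarrow> complex" and f g :: R1_fun
  assumes "1 \<le> n"
    and "lam 1 = 1"
    and "\<And>i. 1 \<le> i \<Longrightarrow> i \<le> n \<Longrightarrow> lam i \<noteq> 0"
    and "\<And>i j. 1 \<le> i \<Longrightarrow> i < j \<Longrightarrow> j \<le> n \<Longrightarrow> Arg2pi (lam i) < Arg2pi (lam j)"
    and "R1_analytic_on (W1 n lam) (R1 (W1 n lam)) f"
    and "R1_analytic_on (W1 n lam) (R1 (W1 n lam)) g"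
    and "integrable_at_0 (W1 n lam) f"
    and "integrable_at_0 (W1 n lam) g"
  shows "\<exists>h :: R1_fun.
    convolution_near0 (W1 n lam) f g h \<and>
    R1_analytic_on (W1 n lam) (R1_conv (W1 n lam)) h \<and>
    (n = 1 \<or> (pi / 2 \<le> phi_plus lam \<and> pi / 2 \<le> phi_minus n lam) \<longrightarrow>
       R1_analytic_on (W1 n lam) (R1 (W1 n lam)) h) \<and>
    (integrable_at_integers (W1 n lam) f \<and> integrable_at_integers (W1 n lam) g \<longrightarrow>
       (\<forall>p::real. 0 < p \<and> p \<notin> \<nat> \<longrightarrow>
          set_integrable lborel {0..p}
            (\<lambda>s. balanced_average (W1 n lam) f s * balanced_average (W1 n lam) g (p - s)) \<and>
          balanced_average (W1 n lam) h p =
            convolution (balanced_average (W1 n lam) f) (balanced_average (W1 n lam) g) p))"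
proof -
 interpret sector "W1 n lam" "sector_slopes n lam" by (rule sector_W1[of n lam, OF assms(1,2)]) (rule assms(4))
 \<comment> \<open>arctan takes values strictly between - pi / 2 and pi / 2, so arctan x itself is
   an admissible angle.\<close>
 have full: "sector_slopes n lam = UNIV" if h: "n = 1 \<or> (pi / 2 <= phi_plus lam & pi / 2 <= phi_minus n lam)"
 proof -
  have "- phi_minus n lam < arctan x & arctan x < phi_plus lam" if "n ~= 1" for x
   using h that arctan_bounded[of x] by auto
  then show ?thesis by (auto simp: sector_slopes_def)
 qed
 let ?h = "surface_convolution f g"
 have "convolution_near0 (W1 n lam) f g ?h" by (rule surface_convolution_near0[OF assms(5,7,6,8)])
 moreover have "R1_analytic_on (W1 n lam) (R1_conv (W1 n lam)) ?h" by (rule surface_convolution_analytic_conv[OF assms(5,7,6,8)])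
 moreover have "R1_analytic_on (W1 n lam) (R1 (W1 n lam)) ?h" if "n = 1 \<or> (pi / 2 <= phi_plus lam & pi / 2 <= phi_minus n lam)"
  by (rule surface_convolution_analytic[OF assms(5,7,6,8) full[OF that]])
 moreover have "set_integrable lborel {0..p} (%s. balanced_average (W1 n lam) f s * balanced_average (W1 n lam) g (p - s)) &
   balanced_average (W1 n lam) ?h p = convolution (balanced_average (W1 n lam) f) (balanced_average (W1 n lam) g) p"
  if "integrable_at_integers (W1 n lam) f" "integrable_at_integers (W1 n lam) g" "0 < p" "p ~: \<nat>" for p
  using balanced_surface_convolution[OF assms(5,7,6,8) that] by simp
 ultimately show ?thesis by blast
qed

end
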